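(* Let $R$ be a noetherian regular integral domain with quotient field $K$, let $X = \operatorname{Spec} R$, and let $\alpha$ and $\beta$ be nonzero elements of $R$. (1) If $2$ is invertible in $R$ and $\alpha$ is a square modulo $\beta$, then the ramification divisor (on $X$) of the symbol algebra $(\alpha,\beta)_2$ over $K$ is a subset of the divisor of $\alpha$. (2) For any prime number $q$ that is invertible in $R$, if $R$ contains a primitive $q$th root of unity and $\alpha$ is a $q$th power modulo $\beta$, then the ramification divisor (on $X$) of the symbol algebra $(\alpha,\beta)_q$ over $K$ is a subset of the divisor of $\alpha$.
   Context: "$\alpha$ is a $q$th power modulo $\beta$" means there is $s\in R$ with $\alpha - s^q \in \beta R$. $X_1$ denotes the set of points of $X$ of codimension 1, i.e. the height one primes of $R$. For $x\in X_1$ the local ring $\mathcal{O}_{X,x}$ is a discrete valuation ring; $\nu$ denotes its discrete valuation on $K$ and $k(x)$ its residue field. The divisor of $\alpha\in K^*$ is the set of $x\in X_1$ at which $\nu(\alpha)\neq 0$. Symbol algebra: for $\alpha,\beta\in K^*$, $n$ a positive integer invertible in $K$ and $\zeta\in K$ a primitive $n$th root of unity, $(\alpha,\beta)_n$ is the associative $K$-algebra generated by $u,v$ subject to $u^n=\alpha$, $v^n=\beta$, $uv=\zeta vu$. It is central simple over $K$ and represents a class in the $n$-torsion of the Brauer group $\operatorname{B}(K)$. Ramification: let $D$ be a finite dimensional central $K$-division algebra and $x\in X_1$ such that $k(x)$ is perfect or $(D:K)$ is prime to the characteristic of $k(x)$. Let $K^\nu$ be the completion of $K$ at $\nu$, let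 $D^\nu$ be the division algebra component of $D\otimes_K K^\nu$, and let $A$ be a maximal order of $D^\nu$ over the complete local ring $\mathcal{O}^\nu_{X,x}$. The algebra of residue classes of $A$ (the quotient of $A$ by its radical) is a central simple algebra over some cyclic Galois extension $L$ of $k(x)$. The extension $L/k(x)$ is called the ramification of $D$ along $x$; it represents a class in $\operatorname{H}^1(k(x),\mathbb{Q}/\mathbb{Z})$ and depends only on the Brauer class of $D$. The ramification of a central simple algebra is that of a division algebra in its Brauer class. The ramification divisor of $D$ is the set of $x\in X_1$ for which $L/k(x)$ is nontrivial. *)

theory Defs
  imports "HOL-Algebra.Algebra" "HOL-Library.Extended_Nat"
begin

text \<open>
  Throughout, \<open>R\<close> is a subring (a subset of the carrier) of the field \<open>K\<close>, and as a ring of its own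
  it is \<open>K\<lparr>carrier := R\<rparr>\<close>. An algebra over \<open>K\<close> is a ring \<open>A\<close>, in general not commutative, together
  with a structure map from \<open>K\<close> to the centre of \<open>A\<close>.
\<close>


section \<open>Domains, their spectra and valuations\<close>

definition is_quotient_field :: "('a, 'm) ring_scheme \<Rightarrow> 'a set \<Rightarrow> bool" where
  "is_quotient_field K R \<longleftrightarrow> field K \<and> subring R K \<and>
     (\<forall>x\<in>carrier K. \<exists>a\<in>R. \<exists>b\<in>R - {\<zero>\<^bsub>K\<^esub>}. x = a \<otimes>\<^bsub>K\<^esub> inv\<^bsub>K\<^esub> b)"

definition height :: "('a, 'm) ring_scheme \<Rightarrow> 'a set \<Rightarrow> enat" where
  "height A P = Sup {enat n |n. \<exists>Q :: nat \<Rightarrow> 'a set.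
     (\<forall>i\<le>n. primeideal (Q i) A) \<and> (\<forall>i<n. Q i \<subset> Q (Suc i)) \<and> Q n = P}"

definition krull_dim :: "('a, 'm) ring_scheme \<Rightarrow> enat" where
  "krull_dim A = Sup {height A P |P. primeideal P A}"

text \<open>The maximal ideal can be generated by \<open>dim A\<close> elements; the bound on \<open>card G\<close> is an inequality
  because the generators need not be distinct.\<close>
definition regular_local_ring :: "('a, 'm) ring_scheme \<Rightarrow> bool" where
  "regular_local_ring A \<longleftrightarrow> cring A \<and> noetherian_ring A \<and>
     (\<exists>M. {I. maximalideal I A} = {M} \<and>
       (\<exists>G. finite G \<and> G \<subseteq> carrier A \<and> enat (card G) \<le> krull_dim A \<and> Idl\<^bsub>A\<^esub> G = M))"

definition stalk :: "('a, 'm) ring_scheme \<Rightarrow> 'a set \<Rightarrow> 'a set \<Rightarrow> 'a set" where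
  "stalk K R p = {a \<otimes>\<^bsub>K\<^esub> inv\<^bsub>K\<^esub> b |a b. a \<in> R \<and> b \<in> R - p}"

definition stalk_max :: "('a, 'm) ring_scheme \<Rightarrow> 'a set \<Rightarrow> 'a set \<Rightarrow> 'a set" where
  "stalk_max K R p = {a \<otimes>\<^bsub>K\<^esub> inv\<^bsub>K\<^esub> b |a b. a \<in> p \<and> b \<in> R - p}"

definition regular_domain :: "('a, 'm) ring_scheme \<Rightarrow> 'a set \<Rightarrow> bool" where
  "regular_domain K R \<longleftrightarrow>
     (\<forall>p. primeideal p (K\<lparr>carrier := R\<rparr>) \<longrightarrow> regular_local_ring (K\<lparr>carrier := stalk K R p\<rparr>))"

definition codim1_points :: "('a, 'm) ring_scheme \<Rightarrow> 'a set \<Rightarrow> 'a set set" where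
  "codim1_points K R =
     {p. primeideal p (K\<lparr>carrier := R\<rparr>) \<and> height (K\<lparr>carrier := R\<rparr>) p = 1}"

text \<open>
  The valuation of the discrete valuation ring \<open>stalk K R p\<close>: the exponent \<open>n\<close> in \<open>x = u \<pi>\<^sup>n\<close> with
  \<open>u\<close> a unit and \<open>\<pi>\<close> a generator of the maximal ideal. It is meaningful for \<open>x \<noteq> 0\<close> only.
\<close>
definition valuation :: "('a, 'm) ring_scheme \<Rightarrow> 'a set \<Rightarrow> 'a set \<Rightarrow> 'a \<Rightarrow> int" where
  "valuation K R p x = (THE n::int. \<exists>\<pi>\<in>stalk K R p. \<exists>u\<in>Units (K\<lparr>carrier := stalk K R p\<rparr>).
     PIdl\<^bsub>K\<lparr>carrier := stalk K R p\<rparr>\<^esub> \<pi> = stalk_max K R p \<and> x = u \<otimes>\<^bsub>K\<^esub> \<pi> [^]\<^bsub>K\<^esub> n)"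

definition divisor :: "('a, 'm) ring_scheme \<Rightarrow> 'a set \<Rightarrow> 'a \<Rightarrow> 'a set set" where
  "divisor K R x = {p \<in> codim1_points K R. valuation K R p x \<noteq> 0}"

definition residue_field :: "('a, 'm) ring_scheme \<Rightarrow> 'a set \<Rightarrow> 'a set \<Rightarrow> 'a set ring" where
  "residue_field K R p = K\<lparr>carrier := stalk K R p\<rparr> Quot stalk_max K R p"


section \<open>Completion\<close>

definition cauchy_seqs :: "('a, 'm) ring_scheme \<Rightarrow> ('a \<Rightarrow> int) \<Rightarrow> (nat \<Rightarrow> 'a) set" where
  "cauchy_seqs K v = {s. (\<forall>i. s i \<in> carrier K) \<and>
     (\<forall>N. \<exists>k. \<forall>i\<ge>k. \<forall>j\<ge>k. s i = s j \<or> N \<le> v (s i \<ominus>\<^bsub>K\<^esub> s j))}"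

definition null_seqs :: "('a, 'm) ring_scheme \<Rightarrow> ('a \<Rightarrow> int) \<Rightarrow> (nat \<Rightarrow> 'a) set" where
  "null_seqs K v = {s. (\<forall>i. s i \<in> carrier K) \<and>
     (\<forall>N. \<exists>k. \<forall>i\<ge>k. s i = \<zero>\<^bsub>K\<^esub> \<or> N \<le> v (s i))}"

definition cauchy_ring :: "('a, 'm) ring_scheme \<Rightarrow> ('a \<Rightarrow> int) \<Rightarrow> (nat \<Rightarrow> 'a) ring" where
  "cauchy_ring K v = \<lparr>carrier = cauchy_seqs K v,
     monoid.mult = (\<lambda>s t i. s i \<otimes>\<^bsub>K\<^esub> t i), one = (\<lambda>_. \<one>\<^bsub>K\<^esub>),
     ring.zero = (\<lambda>_. \<zero>\<^bsub>K\<^esub>), ring.add = (\<lambda>s t i. s i \<oplus>\<^bsub>K\<^esub> t i)\<rparr>"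

definition completion :: "('a, 'm) ring_scheme \<Rightarrow> ('a \<Rightarrow> int) \<Rightarrow> (nat \<Rightarrow> 'a) set ring" where
  "completion K v = cauchy_ring K v Quot null_seqs K v"

definition completion_class ::
    "('a, 'm) ring_scheme \<Rightarrow> ('a \<Rightarrow> int) \<Rightarrow> (nat \<Rightarrow> 'a) \<Rightarrow> (nat \<Rightarrow> 'a) set" where
  "completion_class K v s = null_seqs K v +>\<^bsub>cauchy_ring K v\<^esub> s"

definition completion_map ::
    "('a, 'm) ring_scheme \<Rightarrow> ('a \<Rightarrow> int) \<Rightarrow> 'a \<Rightarrow> (nat \<Rightarrow> 'a) set" where
  "completion_map K v c = completion_class K v (\<lambda>_. c)"

text \<open>The completion of a subring \<open>V\<close> of \<open>K\<close> (below, \<open>V\<close> is a stalk), as a subset of the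
  completion of \<open>K\<close>.\<close>
definition completed_subring ::
    "('a, 'm) ring_scheme \<Rightarrow> ('a \<Rightarrow> int) \<Rightarrow> 'a set \<Rightarrow> (nat \<Rightarrow> 'a) set set" where
  "completed_subring K v V = completion_class K v ` {s \<in> cauchy_seqs K v. \<forall>i. s i \<in> V}"


section \<open>Monoid rings, symbol algebras and tensor products\<close>

definition monoid_ring ::
    "('r, 'm) ring_scheme \<Rightarrow> ('g, 'n) monoid_scheme \<Rightarrow> ('g \<Rightarrow> 'r) ring" where
  "monoid_ring R M = \<lparr>
     carrier = {f. (\<forall>x. f x \<in> carrier R) \<and> finite {x. f x \<noteq> \<zero>\<^bsub>R\<^esub>} \<and> {x. f x \<noteq> \<zero>\<^bsub>R\<^esub>} \<subseteq> carrier M},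
     monoid.mult = (\<lambda>f g z. finsum R (\<lambda>(x, y). f x \<otimes>\<^bsub>R\<^esub> g y)
               {(x, y). f x \<noteq> \<zero>\<^bsub>R\<^esub> \<and> g y \<noteq> \<zero>\<^bsub>R\<^esub> \<and> x \<otimes>\<^bsub>M\<^esub> y = z}),
     one = (\<lambda>x. if x = \<one>\<^bsub>M\<^esub> then \<one>\<^bsub>R\<^esub> else \<zero>\<^bsub>R\<^esub>),
     ring.zero = (\<lambda>_. \<zero>\<^bsub>R\<^esub>),
     ring.add = (\<lambda>f g x. f x \<oplus>\<^bsub>R\<^esub> g x)\<rparr>"

definition monomial :: "('r, 'm) ring_scheme \<Rightarrow> 'r \<Rightarrow> 'g \<Rightarrow> 'g \<Rightarrow> 'r" where
  "monomial R c x = (\<lambda>y. if y = x then c else \<zero>\<^bsub>R\<^esub>)"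

datatype letter = Gen_u | Gen_v

definition words :: "letter list monoid" where
  "words = \<lparr>carrier = UNIV, monoid.mult = (@), one = []\<rparr>"

text \<open>The free associative algebra on \<open>u\<close> and \<open>v\<close> is the monoid ring of the monoid of words.\<close>
abbreviation free_algebra :: "('a, 'm) ring_scheme \<Rightarrow> (letter list \<Rightarrow> 'a) ring" where
  "free_algebra K \<equiv> monoid_ring K words"

definition symbol_ideal ::
    "('a, 'm) ring_scheme \<Rightarrow> nat \<Rightarrow> 'a \<Rightarrow> 'a \<Rightarrow> 'a \<Rightarrow> (letter list \<Rightarrow> 'a) set" where
  "symbol_ideal K n \<zeta> \<alpha> \<beta> =
    (let F = free_algebra K; u = monomial K \<one>\<^bsub>K\<^esub> [Gen_u]; v = monomial K \<one>\<^bsub>K\<^esub> [Gen_v]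
     in Idl\<^bsub>F\<^esub> {u [^]\<^bsub>F\<^esub> n \<ominus>\<^bsub>F\<^esub> monomial K \<alpha> [],
               v [^]\<^bsub>F\<^esub> n \<ominus>\<^bsub>F\<^esub> monomial K \<beta> [],
               u \<otimes>\<^bsub>F\<^esub> v \<ominus>\<^bsub>F\<^esub> monomial K \<zeta> [] \<otimes>\<^bsub>F\<^esub> (v \<otimes>\<^bsub>F\<^esub> u)})"

definition symbol_algebra ::
    "('a, 'm) ring_scheme \<Rightarrow> nat \<Rightarrow> 'a \<Rightarrow> 'a \<Rightarrow> 'a \<Rightarrow> (letter list \<Rightarrow> 'a) set ring" where
  "symbol_algebra K n \<zeta> \<alpha> \<beta> = free_algebra K Quot symbol_ideal K n \<zeta> \<alpha> \<beta>"

definition symbol_map ::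
    "('a, 'm) ring_scheme \<Rightarrow> nat \<Rightarrow> 'a \<Rightarrow> 'a \<Rightarrow> 'a \<Rightarrow> 'a \<Rightarrow> (letter list \<Rightarrow> 'a) set" where
  "symbol_map K n \<zeta> \<alpha> \<beta> c = symbol_ideal K n \<zeta> \<alpha> \<beta> +>\<^bsub>free_algebra K\<^esub> monomial K c []"

text \<open>
  The tensor product \<open>D \<otimes>\<^sub>K F\<close> of \<open>K\<close>-algebras with structure maps \<open>\<delta>\<close> and \<open>\<iota>\<close>: the free abelian
  group on the symbols \<open>d \<otimes> f\<close>, which is the ring \<open>\<Z>[D \<times> F]\<close> over the multiplicative monoid
  \<open>D \<times> F\<close>, modulo additivity in both arguments and \<open>\<delta> c d \<otimes> f = d \<otimes> \<iota> c f\<close>. Since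
  \<open>\<delta>\<close> and \<open>\<iota>\<close> have central images, the subgroup these relations generate is already an ideal.
\<close>
definition tensor_ideal :: "('a, 'm) ring_scheme \<Rightarrow> ('d, 'n) ring_scheme \<Rightarrow> ('a \<Rightarrow> 'd) \<Rightarrow>
    ('f, 'o) ring_scheme \<Rightarrow> ('a \<Rightarrow> 'f) \<Rightarrow> ('d \<times> 'f \<Rightarrow> int) set" where
  "tensor_ideal K D \<delta> F \<iota> =
    (let Z = monoid_ring \<Z> (D \<times>\<times> F); t = (\<lambda>d f. monomial \<Z> 1 (d, f))
     in Idl\<^bsub>Z\<^esub>
       ({t (d \<oplus>\<^bsub>D\<^esub> d') f \<ominus>\<^bsub>Z\<^esub> (t d f \<oplus>\<^bsub>Z\<^esub> t d' f) |d d' f.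
            d \<in> carrier D \<and> d' \<in> carrier D \<and> f \<in> carrier F} \<union>
        {t d (f \<oplus>\<^bsub>F\<^esub> f') \<ominus>\<^bsub>Z\<^esub> (t d f \<oplus>\<^bsub>Z\<^esub> t d f') |d f f'.
            d \<in> carrier D \<and> f \<in> carrier F \<and> f' \<in> carrier F} \<union>
        {t (\<delta> c \<otimes>\<^bsub>D\<^esub> d) f \<ominus>\<^bsub>Z\<^esub> t d (\<iota> c \<otimes>\<^bsub>F\<^esub> f) |c d f.
            c \<in> carrier K \<and> d \<in> carrier D \<and> f \<in> carrier F}))"

definition tensor_algebra :: "('a, 'm) ring_scheme \<Rightarrow> ('d, 'n) ring_scheme \<Rightarrow> ('a \<Rightarrow> 'd) \<Rightarrow>
    ('f, 'o) ring_scheme \<Rightarrow> ('a \<Rightarrow> 'f) \<Rightarrow> ('d \<times> 'f \<Rightarrow> int) set ring" where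
  "tensor_algebra K D \<delta> F \<iota> = monoid_ring \<Z> (D \<times>\<times> F) Quot tensor_ideal K D \<delta> F \<iota>"

definition tensor_map :: "('a, 'm) ring_scheme \<Rightarrow> ('d, 'n) ring_scheme \<Rightarrow> ('a \<Rightarrow> 'd) \<Rightarrow>
    ('f, 'o) ring_scheme \<Rightarrow> ('a \<Rightarrow> 'f) \<Rightarrow> 'f \<Rightarrow> ('d \<times> 'f \<Rightarrow> int) set" where
  "tensor_map K D \<delta> F \<iota> f =
     tensor_ideal K D \<delta> F \<iota> +>\<^bsub>monoid_ring \<Z> (D \<times>\<times> F)\<^esub> monomial \<Z> 1 (\<one>\<^bsub>D\<^esub>, f)"


section \<open>Division algebras and maximal orders\<close>

definition ring_center :: "('b, 'm) ring_scheme \<Rightarrow> 'b set" where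
  "ring_center B = {z \<in> carrier B. \<forall>b\<in>carrier B. z \<otimes>\<^bsub>B\<^esub> b = b \<otimes>\<^bsub>B\<^esub> z}"

definition central_division_algebra ::
    "('a, 'm) ring_scheme \<Rightarrow> ('d, 'n) ring_scheme \<Rightarrow> ('a \<Rightarrow> 'd) \<Rightarrow> bool" where
  "central_division_algebra K D \<delta> \<longleftrightarrow>
     ring D \<and> Units D = carrier D - {\<zero>\<^bsub>D\<^esub>} \<and>
     \<delta> \<in> ring_hom K D \<and> \<delta> ` carrier K = ring_center D \<and>
     ring.finite_dimension D (\<delta> ` carrier K) (carrier D)"

definition matrix_ring :: "nat \<Rightarrow> ('d, 'n) ring_scheme \<Rightarrow> (nat \<Rightarrow> nat \<Rightarrow> 'd) ring" where
  "matrix_ring m D = \<lparr>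
     carrier = {M. \<forall>i j. if i < m \<and> j < m then M i j \<in> carrier D else M i j = \<zero>\<^bsub>D\<^esub>},
     monoid.mult = (\<lambda>M N i j. finsum D (\<lambda>k. M i k \<otimes>\<^bsub>D\<^esub> N k j) {..<m}),
     one = (\<lambda>i j. if i = j \<and> i < m then \<one>\<^bsub>D\<^esub> else \<zero>\<^bsub>D\<^esub>),
     ring.zero = (\<lambda>i j. \<zero>\<^bsub>D\<^esub>),
     ring.add = (\<lambda>M N i j. M i j \<oplus>\<^bsub>D\<^esub> N i j)\<rparr>"

definition scalar_matrix :: "nat \<Rightarrow> ('d, 'n) ring_scheme \<Rightarrow> 'd \<Rightarrow> nat \<Rightarrow> nat \<Rightarrow> 'd" where
  "scalar_matrix m D d = (\<lambda>i j. if i = j \<and> i < m then d else \<zero>\<^bsub>D\<^esub>)"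

text \<open>
  \<open>D\<close> is the division algebra component of the central simple \<open>K\<close>-algebra \<open>S\<close>: \<open>S\<close> is isomorphic
  over \<open>K\<close> to a matrix algebra over \<open>D\<close>. By Wedderburn \<open>D\<close> is the division algebra in the Brauer
  class of \<open>S\<close>, unique up to isomorphism.
\<close>
definition division_component :: "('a, 'm) ring_scheme \<Rightarrow> ('s, 'n) ring_scheme \<Rightarrow> ('a \<Rightarrow> 's) \<Rightarrow>
    ('d, 'o) ring_scheme \<Rightarrow> ('a \<Rightarrow> 'd) \<Rightarrow> bool" where
  "division_component K S \<sigma> D \<delta> \<longleftrightarrow> central_division_algebra K D \<delta> \<and>
     (\<exists>m>0. \<exists>h\<in>ring_iso S (matrix_ring m D).
        \<forall>c\<in>carrier K. h (\<sigma> c) = scalar_matrix m D (\<delta> c))"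

text \<open>\<open>A\<close> is an order over the subring \<open>V\<close> of \<open>F\<close> in the \<open>F\<close>-algebra \<open>E\<close> with structure map \<open>\<epsilon>\<close>:
  a subring that is a finitely generated \<open>V\<close>-module and spans \<open>E\<close> over \<open>F\<close>.\<close>
definition is_order :: "('f, 'm) ring_scheme \<Rightarrow> 'f set \<Rightarrow> ('e, 'n) ring_scheme \<Rightarrow>
    ('f \<Rightarrow> 'e) \<Rightarrow> 'e set \<Rightarrow> bool" where
  "is_order F V E \<epsilon> A \<longleftrightarrow> subring A E \<and> \<epsilon> ` V \<subseteq> A \<and>
     (\<exists>Us. set Us \<subseteq> carrier E \<and> A = ring.Span E (\<epsilon> ` V) Us) \<and>
     (\<exists>Us. set Us \<subseteq> A \<and> ring.Span E (\<epsilon> ` carrier F) Us = carrier E)"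

definition maximal_order :: "('f, 'm) ring_scheme \<Rightarrow> 'f set \<Rightarrow> ('e, 'n) ring_scheme \<Rightarrow>
    ('f \<Rightarrow> 'e) \<Rightarrow> 'e set \<Rightarrow> bool" where
  "maximal_order F V E \<epsilon> A \<longleftrightarrow> is_order F V E \<epsilon> A \<and>
     (\<forall>B. is_order F V E \<epsilon> B \<longrightarrow> A \<subseteq> B \<longrightarrow> B = A)"

definition left_ideal :: "'b set \<Rightarrow> ('b, 'm) ring_scheme \<Rightarrow> bool" where
  "left_ideal I B \<longleftrightarrow> additive_subgroup I B \<and> (\<forall>b\<in>carrier B. \<forall>x\<in>I. b \<otimes>\<^bsub>B\<^esub> x \<in> I)"

definition maximal_left_ideal :: "'b set \<Rightarrow> ('b, 'm) ring_scheme \<Rightarrow> bool" where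
  "maximal_left_ideal I B \<longleftrightarrow> left_ideal I B \<and> I \<noteq> carrier B \<and>
     (\<forall>J. left_ideal J B \<longrightarrow> I \<subseteq> J \<longrightarrow> J = I \<or> J = carrier B)"

definition jacobson_radical :: "('b, 'm) ring_scheme \<Rightarrow> 'b set" where
  "jacobson_radical B = {x \<in> carrier B. \<forall>I. maximal_left_ideal I B \<longrightarrow> x \<in> I}"


section \<open>Ramification\<close>

text \<open>
  The extension \<open>L\<close> of \<open>k(x)\<close> with inclusion \<open>\<phi>\<close> is the ramification of the central simple
  \<open>K\<close>-algebra \<open>S\<close> with structure map \<open>\<sigma>\<close> along the codimension one point \<open>p\<close>. The residue algebra
  of a maximal order is central simple over \<open>L\<close>, that is, \<open>L\<close> is its centre. The map \<open>\<phi>\<close> is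
  induced by the composite of the stalk at \<open>p\<close> with its completion, the order \<open>A\<close> and
  the residue algebra of \<open>A\<close>.

  For the notion to be well behaved the residue field has to be perfect, or its characteristic prime
  to \<open>(D : K)\<close>. This is not repeated here: for the symbol of degree \<open>q\<close> the degree \<open>(D : K)\<close>
  divides \<open>q\<^sup>2\<close>, and \<open>q\<close> is assumed to be invertible in \<open>R\<close>.

  A division algebra component embeds in the algebra of which it is a component, so letting
  \<open>D\<close> and \<open>E\<close> range over rings on the element types of \<open>S\<close> and of the tensor product
  loses nothing.
\<close>
definition is_ramification :: "('a, 'm) ring_scheme \<Rightarrow> 'a set \<Rightarrow> 'a set \<Rightarrow> 's ring \<Rightarrow> ('a \<Rightarrow> 's) \<Rightarrow>
    ('s \<times> (nat \<Rightarrow> 'a) set \<Rightarrow> int) set set ring \<Rightarrow>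
    ('a set \<Rightarrow> ('s \<times> (nat \<Rightarrow> 'a) set \<Rightarrow> int) set set) \<Rightarrow> bool" where
  "is_ramification K R p S \<sigma> L \<phi> \<longleftrightarrow>
    (let v = valuation K R p; V = stalk K R p; F = completion K v; \<iota> = completion_map K v in
     \<exists>(D :: 's ring) \<delta> (E :: ('s \<times> (nat \<Rightarrow> 'a) set \<Rightarrow> int) set ring) \<epsilon> A.
       division_component K S \<sigma> D \<delta> \<and>
       division_component F (tensor_algebra K D \<delta> F \<iota>) (tensor_map K D \<delta> F \<iota>) E \<epsilon> \<and>
       maximal_order F (completed_subring K v V) E \<epsilon> A \<and>
       (let J = jacobson_radical (E\<lparr>carrier := A\<rparr>); B = E\<lparr>carrier := A\<rparr> Quot J in
        L = B\<lparr>carrier := ring_center B\<rparr> \<and>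
        \<phi> = (\<lambda>C. the_elem ((\<lambda>a. J +>\<^bsub>E\<lparr>carrier := A\<rparr>\<^esub> \<epsilon> (\<iota> a)) ` C))))"

definition trivial_extension ::
    "('k, 'm) ring_scheme \<Rightarrow> ('l, 'n) ring_scheme \<Rightarrow> ('k \<Rightarrow> 'l) \<Rightarrow> bool" where
  "trivial_extension k L \<phi> \<longleftrightarrow> \<phi> ` carrier k = carrier L"

definition ramification_divisor ::
    "('a, 'm) ring_scheme \<Rightarrow> 'a set \<Rightarrow> 's ring \<Rightarrow> ('a \<Rightarrow> 's) \<Rightarrow> 'a set set" where
  "ramification_divisor K R S \<sigma> = {p \<in> codim1_points K R.
     \<exists>L \<phi>. is_ramification K R p S \<sigma> L \<phi> \<and> \<not> trivial_extension (residue_field K R p) L \<phi>}"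


section \<open>Hypotheses on the entries of the symbol\<close>

definition power_modulo :: "('a, 'm) ring_scheme \<Rightarrow> 'a set \<Rightarrow> nat \<Rightarrow> 'a \<Rightarrow> 'a \<Rightarrow> bool" where
  "power_modulo K R q \<alpha> \<beta> \<longleftrightarrow> (\<exists>s\<in>R. \<alpha> \<ominus>\<^bsub>K\<^esub> s [^]\<^bsub>K\<^esub> q \<in> PIdl\<^bsub>K\<lparr>carrier := R\<rparr>\<^esub> \<beta>)"

definition nat_invertible :: "('a, 'm) ring_scheme \<Rightarrow> nat \<Rightarrow> bool" where
  "nat_invertible A n \<longleftrightarrow> [n] \<cdot>\<^bsub>A\<^esub> \<one>\<^bsub>A\<^esub> \<in> Units A"

definition primitive_root_of_unity :: "('a, 'm) ring_scheme \<Rightarrow> nat \<Rightarrow> 'a \<Rightarrow> bool" where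
  "primitive_root_of_unity A n \<zeta> \<longleftrightarrow> \<zeta> \<in> carrier A \<and> \<zeta> [^]\<^bsub>A\<^esub> n = \<one>\<^bsub>A\<^esub> \<and>
     (\<forall>k::nat. 0 < k \<and> k < n \<longrightarrow> \<zeta> [^]\<^bsub>A\<^esub> k \<noteq> \<one>\<^bsub>A\<^esub>)"

end

theory Submission imports Defs begin

text \<open>
  Fix a point \<open>p\<close> of codimension one at which \<open>\<alpha>\<close> has valuation zero. The stalk at \<open>p\<close> is a
  discrete valuation ring; let \<open>F\<close> be its completed field of fractions, \<open>V\<close> the valuation ring of \<open>F\<close>,
  \<open>\<pi>\<close> a uniformizer, and \<open>E\<close> the division algebra component of the symbol over \<open>F\<close>. The claim is
  that the centre of the residue algebra of a maximal order of \<open>E\<close> is the residue field at \<open>p\<close>.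

  The symbol over \<open>F\<close> is a matrix algebra of some size \<open>N\<close> over \<open>E\<close>. It is generated by \<open>u\<close> and \<open>v\<close>, and
  the \<open>q\<^sup>2\<close> monomials \<open>u\<^sup>i v\<^sup>j\<close> are linearly independent because conjugation by \<open>u\<close> and
  \<open>v\<close> separates them by roots of unity. So \<open>N\<^sup>2 (E : F) = q\<^sup>2\<close>, and as \<open>q\<close> is prime, either
  \<open>E = F\<close> or \<open>N = 1\<close> and \<open>E\<close> is the symbol itself (\<open>division_component_dichotomy\<close>). If \<open>E = F\<close>, the
  maximal order is \<open>V\<close> and there is nothing left to prove.

  Let \<open>E\<close> be the symbol. It has no zero divisors, so \<open>\<alpha>\<close> is not a \<open>q\<close>-th power in \<open>F\<close>
  (\<open>not_power\<close>). If \<open>\<beta>\<close> were not a unit at \<open>p\<close>, then \<open>\<alpha>\<close> would be congruent to the \<open>q\<close>-th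
  power of a unit modulo \<open>\<pi>\<close>; as \<open>q\<close> is a unit, Hensel's lemma (\<open>hensel_root\<close>) would turn it into a
  \<open>q\<close>-th power. Hence \<open>\<beta>\<close> is a unit as well, and this is the one place where the congruence
  modulo \<open>\<beta>\<close> enters.

  With \<open>\<alpha>\<close>, \<open>\<beta>\<close> and \<open>q\<close> units, the combinations of the monomials with coefficients in \<open>V\<close> form an
  order \<open>\<Lambda>\<close> that behaves like a discrete valuation ring with the same uniformizer \<open>\<pi>\<close>
  (\<open>valuation_order_\<Lambda>\<close>): every nonzero element of \<open>E\<close> is a unit of \<open>\<Lambda>\<close> times a power of \<open>\<pi>\<close>. What has to
  be seen is that a combination with some unit coefficient is a unit. Completeness, and the absence of
  nontrivial idempotents in \<open>E\<close>, make \<open>\<Lambda>\<close> a local ring (\<open>local_\<Lambda>\<close>), so its nonunits form a two-sided ideal.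
  This ideal is stable under the averages over conjugation by \<open>u\<close> and \<open>v\<close> that extract a single term
  from a combination. A nonunit with a unit coefficient would thus yield a nonunit that is a unit
  multiple of a monomial, but monomials are units.

  An order with this property contains every other order (\<open>order_sub_L\<close>), so it is the only maximal
  order. Its radical is \<open>\<pi> \<Lambda>\<close>, and the averages also show that an element central
  modulo \<open>\<pi>\<close> is congruent to its constant coefficient (\<open>central_mod_P\<close>). The centre of the residue algebra
  is therefore the residue field of \<open>V\<close>, which is the residue field of the stalk.

  The first part of the theorem is the case \<open>q = 2\<close>, in which \<open>-1\<close> is a primitive root of unity.
\<close>

section \<open>Monoid rings\<close>

lemma (in abelian_monoid) finsum_swap:
  assumes "finite A" "finite B" "\<And>i j. i \<in> A \<Longrightarrow> j \<in> B \<Longrightarrow> f i j \<in> carrier G"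
  shows "(\<Oplus>i\<in>A. \<Oplus>j\<in>B. f i j) = (\<Oplus>j\<in>B. \<Oplus>i\<in>A. f i j)"
  using assms(1,3)
proof (induction A rule: finite_induct)
  case empty
  then show ?case by (simp add: finsum_zero)
next
  case (insert a A)
  have "(\<Oplus>i\<in>insert a A. \<Oplus>j\<in>B. f i j) = (\<Oplus>j\<in>B. f a j) \<oplus> (\<Oplus>i\<in>A. \<Oplus>j\<in>B. f i j)"
    using insert by (intro finsum_insert) (auto intro!: finsum_closed)
  also have "\<dots> = (\<Oplus>j\<in>B. f a j) \<oplus> (\<Oplus>j\<in>B. \<Oplus>i\<in>A. f i j)" using insert by simp
  also have "\<dots> = (\<Oplus>j\<in>B. f a j \<oplus> (\<Oplus>i\<in>A. f i j))"
    using insert by (intro finsum_addf[symmetric]) (auto intro!: finsum_closed)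
  also have "\<dots> = (\<Oplus>j\<in>B. \<Oplus>i\<in>insert a A. f i j)"
    using insert by (intro finsum_cong' refl finsum_insert[symmetric]) (auto intro!: finsum_closed)
  finally show ?case .
qed

lemma monoid_ring_carrierD:
  "f \<in> carrier (monoid_ring R G) \<Longrightarrow> f x \<in> carrier R"
  "f \<in> carrier (monoid_ring R G) \<Longrightarrow> finite {x. f x \<noteq> \<zero>\<^bsub>R\<^esub>}"
  "f \<in> carrier (monoid_ring R G) \<Longrightarrow> {x. f x \<noteq> \<zero>\<^bsub>R\<^esub>} \<subseteq> carrier G"
  by (auto simp: monoid_ring_def)

lemma monoid_ring_carrier_iff:
  "f \<in> carrier (monoid_ring R G) \<longleftrightarrow> (\<forall>x. f x \<in> carrier R) \<and>
     finite {x. f x \<noteq> \<zero>\<^bsub>R\<^esub>} \<and> {x. f x \<noteq> \<zero>\<^bsub>R\<^esub>} \<subseteq> carrier G"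
  by (simp add: monoid_ring_def)

lemma (in ring) monomial_carrier:
  assumes "c \<in> carrier R" "x \<in> carrier G"
  shows "monomial R c x \<in> carrier (monoid_ring R G)"
proof -
  have sub: "{y. monomial R c x y \<noteq> \<zero>} \<subseteq> {x}" by (auto simp: monomial_def)
  have "\<forall>y. monomial R c x y \<in> carrier R" using assms by (simp add: monomial_def)
  then show ?thesis
    using assms sub finite_subset[OF sub] unfolding monoid_ring_carrier_iff by blast
qed

lemma (in ring) monoid_ring_add_carrier:
  assumes "f \<in> carrier (monoid_ring R G)" "g \<in> carrier (monoid_ring R G)"
  shows "f \<oplus>\<^bsub>monoid_ring R G\<^esub> g \<in> carrier (monoid_ring R G)"
proof -
  note D = monoid_ring_carrierD[OF assms(1)] monoid_ring_carrierD[OF assms(2)]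
  have sub: "{x. f x \<oplus> g x \<noteq> \<zero>} \<subseteq> {x. f x \<noteq> \<zero>} \<union> {x. g x \<noteq> \<zero>}" by auto
  have add: "f \<oplus>\<^bsub>monoid_ring R G\<^esub> g = (\<lambda>x. f x \<oplus> g x)" by (simp add: monoid_ring_def)
  have "finite {x. f x \<oplus> g x \<noteq> \<zero>}" by (rule finite_subset[OF sub]) (simp add: D)
  moreover have "{x. f x \<oplus> g x \<noteq> \<zero>} \<subseteq> carrier G" using sub D by blast
  ultimately show ?thesis using D(1,4) unfolding add monoid_ring_carrier_iff by blast
qed

text \<open>Every element is a finite sum of monomials, so additive properties need to be checked on
  monomials only.\<close>
lemma (in ring) monoid_ring_induct [consumes 1, case_names zero mono add]:
  assumes f: "f \<in> carrier (monoid_ring R G)"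
    and zero: "P \<zero>\<^bsub>monoid_ring R G\<^esub>"
    and mono: "\<And>c x. c \<in> carrier R \<Longrightarrow> x \<in> carrier G \<Longrightarrow> P (monomial R c x)"
    and add: "\<And>f g. f \<in> carrier (monoid_ring R G) \<Longrightarrow> g \<in> carrier (monoid_ring R G) \<Longrightarrow>
       P f \<Longrightarrow> P g \<Longrightarrow> P (f \<oplus>\<^bsub>monoid_ring R G\<^esub> g)"
  shows "P f"
proof -
  have "finite A \<Longrightarrow> f \<in> carrier (monoid_ring R G) \<Longrightarrow> {x. f x \<noteq> \<zero>} \<subseteq> A \<Longrightarrow> P f" for A f
  proof (induction A arbitrary: f rule: finite_induct)
    case empty
    then have "f = \<zero>\<^bsub>monoid_ring R G\<^esub>" by (auto simp: monoid_ring_def)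
    then show ?case using zero by simp
  next
    case (insert a A)
    show ?case
    proof (cases "f a = \<zero>")
      case True
      then have "{x. f x \<noteq> \<zero>} \<subseteq> A" using insert(5) by auto
      then show ?thesis using insert.IH insert(4) by blast
    next
      case False
      let ?g = "f(a := \<zero>)"
      have a: "a \<in> carrier G" "f a \<in> carrier R" using False insert by (auto simp: monoid_ring_def)
      have sub: "{x. ?g x \<noteq> \<zero>} \<subseteq> {x. f x \<noteq> \<zero>}" by auto
      have g: "?g \<in> carrier (monoid_ring R G)"
        using insert(4) finite_subset[OF sub] sub unfolding monoid_ring_carrier_iff
        by simp blast
      have "P ?g" by (rule insert.IH[OF g]) (use insert(5) in auto)
      moreover have "f = monomial R (f a) a \<oplus>\<^bsub>monoid_ring R G\<^esub> ?g"
        using monoid_ring_carrierD(1)[OF insert(4)] by (auto simp: monoid_ring_def monomial_def)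
      ultimately show ?thesis using add mono a g monomial_carrier by metis
    qed
  qed
  then show ?thesis using f monoid_ring_carrierD[OF f] by blast
qed

lemma (in ring) monoid_ring_mult_eq:
  assumes f: "f \<in> carrier (monoid_ring R G)" and g: "g \<in> carrier (monoid_ring R G)"
    and A: "finite A" "{x. f x \<noteq> \<zero>} \<subseteq> A" and B: "finite B" "{x. g x \<noteq> \<zero>} \<subseteq> B"
  shows "(f \<otimes>\<^bsub>monoid_ring R G\<^esub> g) z =
    (\<Oplus>p\<in>A \<times> B. if fst p \<otimes>\<^bsub>G\<^esub> snd p = z then f (fst p) \<otimes> g (snd p) else \<zero>)"
proof -
  let ?S = "{(x, y). f x \<noteq> \<zero> \<and> g y \<noteq> \<zero> \<and> x \<otimes>\<^bsub>G\<^esub> y = z}"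
  have "(f \<otimes>\<^bsub>monoid_ring R G\<^esub> g) z = finsum R (\<lambda>(x, y). f x \<otimes> g y) ?S"
    by (simp add: monoid_ring_def)
  also have "\<dots> = (\<Oplus>p\<in>A \<times> B. if fst p \<otimes>\<^bsub>G\<^esub> snd p = z then f (fst p) \<otimes> g (snd p) else \<zero>)"
    using A B monoid_ring_carrierD(1)[OF f] monoid_ring_carrierD(1)[OF g]
    by (intro add.finprod_mono_neutral_cong_left) auto
  finally show ?thesis .
qed

lemma (in ring) monomial_mult:
  assumes "c \<in> carrier R" "d \<in> carrier R" "x \<in> carrier G" "y \<in> carrier G"
  shows "monomial R c x \<otimes>\<^bsub>monoid_ring R G\<^esub> monomial R d y = monomial R (c \<otimes> d) (x \<otimes>\<^bsub>G\<^esub> y)"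
proof
  fix z
  have "(monomial R c x \<otimes>\<^bsub>monoid_ring R G\<^esub> monomial R d y) z =
     (\<Oplus>p\<in>{x} \<times> {y}. if fst p \<otimes>\<^bsub>G\<^esub> snd p = z then monomial R c x (fst p) \<otimes> monomial R d y (snd p) else \<zero>)"
    using assms by (intro monoid_ring_mult_eq monomial_carrier) (auto simp: monomial_def)
  also have "\<dots> = monomial R (c \<otimes> d) (x \<otimes>\<^bsub>G\<^esub> y) z" 
    using assms by (auto simp: monomial_def finsum_insert)
  finally show "(monomial R c x \<otimes>\<^bsub>monoid_ring R G\<^esub> monomial R d y) z = monomial R (c \<otimes> d) (x \<otimes>\<^bsub>G\<^esub> y) z" .
qed

lemma (in ring) monomial_add:
  assumes "c \<in> carrier R" "d \<in> carrier R"
  shows "monomial R c x \<oplus>\<^bsub>monoid_ring R G\<^esub> monomial R d x = monomial R (c \<oplus> d) x"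
  using assms by (auto simp: monomial_def monoid_ring_def)

lemma (in ring) monoid_ring_distr:
  assumes f: "f \<in> carrier (monoid_ring R G)" and g: "g \<in> carrier (monoid_ring R G)"
    and h: "h \<in> carrier (monoid_ring R G)"
  shows "(f \<oplus>\<^bsub>monoid_ring R G\<^esub> g) \<otimes>\<^bsub>monoid_ring R G\<^esub> h =
      f \<otimes>\<^bsub>monoid_ring R G\<^esub> h \<oplus>\<^bsub>monoid_ring R G\<^esub> g \<otimes>\<^bsub>monoid_ring R G\<^esub> h" (is ?l)
    and "h \<otimes>\<^bsub>monoid_ring R G\<^esub> (f \<oplus>\<^bsub>monoid_ring R G\<^esub> g) =
      h \<otimes>\<^bsub>monoid_ring R G\<^esub> f \<oplus>\<^bsub>monoid_ring R G\<^esub> h \<otimes>\<^bsub>monoid_ring R G\<^esub> g" (is ?r)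
proof -
  let ?A = "{x. f x \<noteq> \<zero>} \<union> {x. g x \<noteq> \<zero>}" and ?B = "{x. h x \<noteq> \<zero>}"
  note D = monoid_ring_carrierD[OF f] monoid_ring_carrierD[OF g] monoid_ring_carrierD[OF h]
  have fg: "f \<oplus>\<^bsub>monoid_ring R G\<^esub> g \<in> carrier (monoid_ring R G)"
    by (rule monoid_ring_add_carrier[OF f g])
  have s: "{x. (f \<oplus>\<^bsub>monoid_ring R G\<^esub> g) x \<noteq> \<zero>} \<subseteq> ?A" by (auto simp: monoid_ring_def)
  have a: "(f \<oplus>\<^bsub>monoid_ring R G\<^esub> g) x = f x \<oplus> g x" for f g x by (simp add: monoid_ring_def)
  have fin: "finite ?A" "finite ?B" using D by auto
  show ?l
  proof
    fix z
    have "((f \<oplus>\<^bsub>monoid_ring R G\<^esub> g) \<otimes>\<^bsub>monoid_ring R G\<^esub> h) z =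
      (\<Oplus>p\<in>?A \<times> ?B. if fst p \<otimes>\<^bsub>G\<^esub> snd p = z then (f \<oplus>\<^bsub>monoid_ring R G\<^esub> g) (fst p) \<otimes> h (snd p) else \<zero>)"
      by (rule monoid_ring_mult_eq[OF fg h fin(1) s fin(2) order_refl])
    also have "\<dots> = (\<Oplus>p\<in>?A \<times> ?B. (if fst p \<otimes>\<^bsub>G\<^esub> snd p = z then f (fst p) \<otimes> h (snd p) else \<zero>)
        \<oplus> (if fst p \<otimes>\<^bsub>G\<^esub> snd p = z then g (fst p) \<otimes> h (snd p) else \<zero>))"
      using D by (intro finsum_cong') (auto simp: a l_distr)
    also have "\<dots> = (f \<otimes>\<^bsub>monoid_ring R G\<^esub> h) z \<oplus> (g \<otimes>\<^bsub>monoid_ring R G\<^esub> h) z"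
      using D by (subst finsum_addf) (auto intro!: arg_cong2[where f="(\<oplus>)"] monoid_ring_mult_eq[OF f h fin(1) _ fin(2), symmetric]
          monoid_ring_mult_eq[OF g h fin(1) _ fin(2), symmetric])
    finally show "((f \<oplus>\<^bsub>monoid_ring R G\<^esub> g) \<otimes>\<^bsub>monoid_ring R G\<^esub> h) z =
      (f \<otimes>\<^bsub>monoid_ring R G\<^esub> h \<oplus>\<^bsub>monoid_ring R G\<^esub> g \<otimes>\<^bsub>monoid_ring R G\<^esub> h) z" by (simp add: a)
  qed
  show ?r
  proof
    fix z
    have "(h \<otimes>\<^bsub>monoid_ring R G\<^esub> (f \<oplus>\<^bsub>monoid_ring R G\<^esub> g)) z =
      (\<Oplus>p\<in>?B \<times> ?A. if fst p \<otimes>\<^bsub>G\<^esub> snd p = z then h (fst p) \<otimes> (f \<oplus>\<^bsub>monoid_ring R G\<^esub> g) (snd p) else \<zero>)"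
      by (rule monoid_ring_mult_eq[OF h fg fin(2) order_refl fin(1) s])
    also have "\<dots> = (\<Oplus>p\<in>?B \<times> ?A. (if fst p \<otimes>\<^bsub>G\<^esub> snd p = z then h (fst p) \<otimes> f (snd p) else \<zero>)
        \<oplus> (if fst p \<otimes>\<^bsub>G\<^esub> snd p = z then h (fst p) \<otimes> g (snd p) else \<zero>))"
      using D by (intro finsum_cong') (auto simp: a r_distr)
    also have "\<dots> = (h \<otimes>\<^bsub>monoid_ring R G\<^esub> f) z \<oplus> (h \<otimes>\<^bsub>monoid_ring R G\<^esub> g) z"
      using D by (subst finsum_addf) (auto intro!: arg_cong2[where f="(\<oplus>)"] monoid_ring_mult_eq[OF h f fin(2) _ fin(1), symmetric]
          monoid_ring_mult_eq[OF h g fin(2) _ fin(1), symmetric])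
    finally show "(h \<otimes>\<^bsub>monoid_ring R G\<^esub> (f \<oplus>\<^bsub>monoid_ring R G\<^esub> g)) z =
      (h \<otimes>\<^bsub>monoid_ring R G\<^esub> f \<oplus>\<^bsub>monoid_ring R G\<^esub> h \<otimes>\<^bsub>monoid_ring R G\<^esub> g) z" by (simp add: a)
  qed
qed

lemma (in ring) monoid_ring_mult_zero:
  assumes "f \<in> carrier (monoid_ring R G)"
  shows "\<zero>\<^bsub>monoid_ring R G\<^esub> \<otimes>\<^bsub>monoid_ring R G\<^esub> f = \<zero>\<^bsub>monoid_ring R G\<^esub>"
    "f \<otimes>\<^bsub>monoid_ring R G\<^esub> \<zero>\<^bsub>monoid_ring R G\<^esub> = \<zero>\<^bsub>monoid_ring R G\<^esub>"
  by (auto simp: monoid_ring_def)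

lemma (in ring) monoid_ring_zero_carrier: "\<zero>\<^bsub>monoid_ring R G\<^esub> \<in> carrier (monoid_ring R G)"
  by (auto simp: monoid_ring_def)

lemma (in ring) monoid_ring_mult_carrier:
  assumes G: "monoid G"
    and f: "f \<in> carrier (monoid_ring R G)" and g: "g \<in> carrier (monoid_ring R G)"
  shows "f \<otimes>\<^bsub>monoid_ring R G\<^esub> g \<in> carrier (monoid_ring R G)"
  using f
proof (induction f rule: monoid_ring_induct)
  case zero
  show ?case using g monoid_ring_mult_zero monoid_ring_zero_carrier by metis
next
  case (mono c x)
  show ?case using g
  proof (induction g rule: monoid_ring_induct)
    case zero
    show ?case using monomial_carrier[OF mono] monoid_ring_mult_zero monoid_ring_zero_carrier by metis
  next
    case (mono d y)
    then show ?case using \<open>c \<in> _\<close> \<open>x \<in> _\<close> monoid.m_closed[OF G]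
      by (simp add: monomial_mult monomial_carrier)
  next
    case (add f g)
    then show ?case using monoid_ring_distr(2)[OF add(1,2) monomial_carrier[OF mono]] monoid_ring_add_carrier
      by metis
  qed
next
  case (add f g')
  then show ?case using monoid_ring_distr(1)[OF add(1,2) g] monoid_ring_add_carrier
    by metis
qed

lemma (in ring) monoid_ring_mult_assoc:
  assumes G: "monoid G"
    and f: "f \<in> carrier (monoid_ring R G)" and g: "g \<in> carrier (monoid_ring R G)"
    and h: "h \<in> carrier (monoid_ring R G)"
  shows "f \<otimes>\<^bsub>monoid_ring R G\<^esub> g \<otimes>\<^bsub>monoid_ring R G\<^esub> h = f \<otimes>\<^bsub>monoid_ring R G\<^esub> (g \<otimes>\<^bsub>monoid_ring R G\<^esub> h)"
proof -
  note mc = monoid_ring_mult_carrier[OF G]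
  note mc2 = monomial_carrier[where G = G]
  show ?thesis using f
  proof (induction f rule: monoid_ring_induct)
    case zero
    show ?case using g h mc by (simp add: monoid_ring_mult_zero)
  next
    case (mono c x)
    show ?case using g
    proof (induction g rule: monoid_ring_induct)
      case zero
      show ?case using mono h mc mc2 by (simp add: monoid_ring_mult_zero)
    next
      case (mono d y)
      show ?case using h
      proof (induction h rule: monoid_ring_induct)
        case zero
        show ?case using mono \<open>c \<in> _\<close> \<open>x \<in> _\<close> mc mc2 by (simp add: monoid_ring_mult_zero)
      next
        case (mono e z)
        then show ?case using \<open>c \<in> _\<close> \<open>x \<in> _\<close>  \<open>d \<in> _\<close> \<open>y \<in> _\<close> monoid.m_closed[OF G]
          by (simp add: monomial_mult m_assoc monoid.m_assoc[OF G])
      next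
        case (add f g)
        then show ?case
          using mc2[OF \<open>c \<in> _\<close> \<open>x \<in> _\<close>] mc2[OF \<open>d \<in> _\<close> \<open>y \<in> _\<close>] mc by (simp add: monoid_ring_distr)
      qed
    next
      case (add f g)
      then show ?case using mc2[OF \<open>c \<in> _\<close> \<open>x \<in> _\<close>] mc h by (simp add: monoid_ring_distr)
    qed
  next
    case (add f f')
    then show ?case using g h mc by (simp add: monoid_ring_distr)
  qed
qed

lemma (in ring) monoid_ring_mult_one:
  assumes G: "monoid G" and f: "f \<in> carrier (monoid_ring R G)"
  shows "\<one>\<^bsub>monoid_ring R G\<^esub> \<otimes>\<^bsub>monoid_ring R G\<^esub> f = f" "f \<otimes>\<^bsub>monoid_ring R G\<^esub> \<one>\<^bsub>monoid_ring R G\<^esub> = f"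
proof -
  have one: "\<one>\<^bsub>monoid_ring R G\<^esub> = monomial R \<one> \<one>\<^bsub>G\<^esub>" by (auto simp: monoid_ring_def monomial_def)
  note c = monoid.one_closed[OF G] monomial_carrier[OF one_closed monoid.one_closed[OF G]]
  show "\<one>\<^bsub>monoid_ring R G\<^esub> \<otimes>\<^bsub>monoid_ring R G\<^esub> f = f" using f unfolding one
    by (induction f rule: monoid_ring_induct)
       (simp_all add: c monomial_mult monoid.l_one[OF G] monoid_ring_distr monoid_ring_mult_zero)
  show "f \<otimes>\<^bsub>monoid_ring R G\<^esub> \<one>\<^bsub>monoid_ring R G\<^esub> = f" using f unfolding one
    by (induction f rule: monoid_ring_induct)
       (simp_all add: c monomial_mult monoid.r_one[OF G] monoid_ring_distr monoid_ring_mult_zero)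
qed

lemma (in ring) monoid_ring_is_ring:
  assumes G: "monoid G"
  shows "ring (monoid_ring R G)"
proof (rule ringI)
  show "abelian_group (monoid_ring R G)"
  proof (rule abelian_groupI)
    fix f assume f: "f \<in> carrier (monoid_ring R G)"
    then have "(\<lambda>x. \<ominus> f x) \<in> carrier (monoid_ring R G)"
      unfolding monoid_ring_def by (auto elim!: rev_finite_subset)
    moreover have "(\<lambda>x. \<ominus> f x) \<oplus>\<^bsub>monoid_ring R G\<^esub> f = \<zero>\<^bsub>monoid_ring R G\<^esub>"
      using monoid_ring_carrierD(1)[OF f] by (auto simp: monoid_ring_def l_neg)
    ultimately show "\<exists>y\<in>carrier (monoid_ring R G). y \<oplus>\<^bsub>monoid_ring R G\<^esub> f = \<zero>\<^bsub>monoid_ring R G\<^esub>" by blast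
  next
    fix f g assume "f \<in> carrier (monoid_ring R G)" "g \<in> carrier (monoid_ring R G)"
    then show "f \<oplus>\<^bsub>monoid_ring R G\<^esub> g = g \<oplus>\<^bsub>monoid_ring R G\<^esub> f"
      using monoid_ring_carrierD(1)[of f R G] monoid_ring_carrierD(1)[of g R G]
      by (auto simp: monoid_ring_def intro!: ext a_comm)
  qed (auto simp: monoid_ring_add_carrier monoid_ring_zero_carrier, auto simp: monoid_ring_def a_assoc)
  show "monoid (monoid_ring R G)"
  proof (rule monoidI)
    show "\<one>\<^bsub>monoid_ring R G\<^esub> \<in> carrier (monoid_ring R G)"
      using monomial_carrier[OF one_closed monoid.one_closed[OF G]]
      by (simp add: monoid_ring_def monomial_def)
  qed (simp_all add: monoid_ring_mult_carrier[OF G] monoid_ring_mult_assoc[OF G] monoid_ring_mult_one[OF G])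
qed (simp_all add: monoid_ring_distr)

lemma ring_hom_nat_pow:
  assumes "h \<in> ring_hom R S" "ring R" "ring S" "x \<in> carrier R"
  shows "h (x [^]\<^bsub>R\<^esub> (n::nat)) = h x [^]\<^bsub>S\<^esub> n"
proof (induction n)
  case 0
  then show ?case using assms(1) by (simp add: ring_hom_one)
next
  case (Suc n)
  have "x [^]\<^bsub>R\<^esub> n \<in> carrier R" using assms by (simp add: monoid.nat_pow_closed ring.is_monoid)
  then show ?case using assms Suc by (simp add: ring_hom_mult)
qed

lemma carrier_FactRing: "carrier (R Quot I) = (\<lambda>x. I +>\<^bsub>R\<^esub> x) ` carrier R"
  by (auto simp: FactRing_def A_RCOSETS_def RCOSETS_def a_r_coset_def)

text \<open>Closure under sums and products suffices as a notion of subalgebra: the generating sets below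
  contain a field, and with it \<open>0\<close> and \<open>-1\<close>.\<close>
definition generated_by :: "('b, 'm) ring_scheme \<Rightarrow> 'b set \<Rightarrow> bool" where
  "generated_by M G \<longleftrightarrow> G \<subseteq> carrier M \<and> (\<forall>C. G \<subseteq> C \<longrightarrow>
     (\<forall>x\<in>C \<inter> carrier M. \<forall>y\<in>C \<inter> carrier M. x \<oplus>\<^bsub>M\<^esub> y \<in> C \<and> x \<otimes>\<^bsub>M\<^esub> y \<in> C) \<longrightarrow> carrier M \<subseteq> C)"

lemma generated_by_induct [consumes 2, case_names gen add mult]:
  assumes "generated_by M G" "x \<in> carrier M"
    and "\<And>x. x \<in> G \<Longrightarrow> P x"
    and "\<And>x y. x \<in> carrier M \<Longrightarrow> y \<in> carrier M \<Longrightarrow> P x \<Longrightarrow> P y \<Longrightarrow> P (x \<oplus>\<^bsub>M\<^esub> y)"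
    and "\<And>x y. x \<in> carrier M \<Longrightarrow> y \<in> carrier M \<Longrightarrow> P x \<Longrightarrow> P y \<Longrightarrow> P (x \<otimes>\<^bsub>M\<^esub> y)"
  shows "P x"
proof -
  have "carrier M \<subseteq> Collect P"
    using assms(1) unfolding generated_by_def
    by (elim conjE allE[of _ "Collect P"] impE) (use assms(3-5) in auto)
  then show ?thesis using assms(2) by auto
qed

section \<open>Symbol algebras\<close>

lemma words_monoid: "monoid words"
  by (rule monoidI) (auto simp: words_def)

text \<open>The quotient of the free algebra by the defining relations satisfies them, and a word in the two
  letters is a product of generators.\<close>
lemma symbol_algebra_presentation:
  fixes K (structure) and q :: nat
  assumes K: "ring K" and \<zeta>: "\<zeta> \<in> carrier K" and \<alpha>: "\<alpha> \<in> carrier K" and \<beta>: "\<beta> \<in> carrier K"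
  defines "S \<equiv> symbol_algebra K q \<zeta> \<alpha> \<beta>" and "\<sigma> \<equiv> symbol_map K q \<zeta> \<alpha> \<beta>"
  obtains u v where "ring S" "\<sigma> \<in> ring_hom K S" "u \<in> carrier S" "v \<in> carrier S"
    "u [^]\<^bsub>S\<^esub> q = \<sigma> \<alpha>" "v [^]\<^bsub>S\<^esub> q = \<sigma> \<beta>" "u \<otimes>\<^bsub>S\<^esub> v = \<sigma> \<zeta> \<otimes>\<^bsub>S\<^esub> (v \<otimes>\<^bsub>S\<^esub> u)"
    "generated_by S (\<sigma> ` carrier K \<union> {u, v})"
proof -
  interpret K: ring K by fact
  let ?F = "free_algebra K" and ?I = "symbol_ideal K q \<zeta> \<alpha> \<beta>"
  interpret F: ring ?F by (rule K.monoid_ring_is_ring[OF words_monoid])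
  let ?m = "\<lambda>c w. monomial K c (w :: letter list)"
  define gu gv where "gu = ?m \<one> [Gen_u]" and "gv = ?m \<one> [Gen_v]"
  have mc: "?m c w \<in> carrier ?F" if "c \<in> carrier K" for c w
    using K.monomial_carrier[OF that, of w words] by (simp add: words_def)
  have mm: "?m c w \<otimes>\<^bsub>?F\<^esub> ?m d w' = ?m (c \<otimes> d) (w @ w')"
    if "c \<in> carrier K" "d \<in> carrier K" for c d w w'
    using K.monomial_mult[OF that, of w words w'] by (simp add: words_def)
  have one: "\<one>\<^bsub>?F\<^esub> = ?m \<one> []" by (simp add: monoid_ring_def words_def monomial_def)
  have g: "gu \<in> carrier ?F" "gv \<in> carrier ?F" by (simp_all add: gu_def gv_def mc)
  let ?r1 = "gu [^]\<^bsub>?F\<^esub> q \<ominus>\<^bsub>?F\<^esub> ?m \<alpha> []" and ?r2 = "gv [^]\<^bsub>?F\<^esub> q \<ominus>\<^bsub>?F\<^esub> ?m \<beta> []"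
    and ?r3 = "gu \<otimes>\<^bsub>?F\<^esub> gv \<ominus>\<^bsub>?F\<^esub> ?m \<zeta> [] \<otimes>\<^bsub>?F\<^esub> (gv \<otimes>\<^bsub>?F\<^esub> gu)"
  have I_eq: "?I = Idl\<^bsub>?F\<^esub> {?r1, ?r2, ?r3}" by (simp add: symbol_ideal_def Let_def gu_def gv_def)
  have r: "{?r1, ?r2, ?r3} \<subseteq> carrier ?F" using g mc \<alpha> \<beta> \<zeta> by simp
  interpret I: ideal ?I ?F unfolding I_eq by (rule F.genideal_ideal[OF r])
  define p where "p = (\<lambda>x. ?I +>\<^bsub>?F\<^esub> x)"
  have S: "S = ?F Quot ?I" by (simp add: S_def symbol_algebra_def)
  interpret S: ring S unfolding S by (rule I.quotient_is_ring)
  have p: "p \<in> ring_hom ?F S" unfolding S p_def by (rule I.rcos_ring_hom)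
  have peq: "p a = p b" if "a \<ominus>\<^bsub>?F\<^esub> b \<in> {?r1, ?r2, ?r3}" "a \<in> carrier ?F" "b \<in> carrier ?F" for a b
  proof -
    have "a \<ominus>\<^bsub>?F\<^esub> b \<in> ?I" using F.genideal_self[OF r] that(1) unfolding I_eq by blast
    then show ?thesis unfolding p_def
      using F.quotient_eq_iff_same_a_r_cos[OF I.ideal_axioms that(2,3)] by blast
  qed
  have \<sigma>: "\<sigma> c = p (?m c [])" for c by (simp add: \<sigma>_def symbol_map_def p_def)
  have \<sigma>_hom: "\<sigma> \<in> ring_hom K S"
  proof (rule ring_hom_memI)
    fix c d assume cd: "c \<in> carrier K" "d \<in> carrier K"
    show "\<sigma> c \<in> carrier S" using ring_hom_closed[OF p mc] cd \<sigma> by simp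
    show "\<sigma> (c \<otimes> d) = \<sigma> c \<otimes>\<^bsub>S\<^esub> \<sigma> d"
      using ring_hom_mult[OF p mc[OF cd(1)] mc[OF cd(2)], of "[]" "[]"] cd by (simp add: \<sigma> mm)
    show "\<sigma> (c \<oplus> d) = \<sigma> c \<oplus>\<^bsub>S\<^esub> \<sigma> d"
      using ring_hom_add[OF p mc[OF cd(1)] mc[OF cd(2)], of "[]" "[]"] cd
      by (simp add: \<sigma> K.monomial_add)
  next
    show "\<sigma> \<one> = \<one>\<^bsub>S\<^esub>" using ring_hom_one[OF p] by (simp add: \<sigma> one)
  qed
  show ?thesis
  proof (rule that[of "p gu" "p gv"])
    show "ring S" by (rule S.ring_axioms)
    show "\<sigma> \<in> ring_hom K S" by fact
    show pg: "p gu \<in> carrier S" "p gv \<in> carrier S" using ring_hom_closed[OF p] g by auto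
    have "p (gu [^]\<^bsub>?F\<^esub> q) = p (?m \<alpha> [])" by (rule peq) (use g mc \<alpha> in auto)
    then show "p gu [^]\<^bsub>S\<^esub> q = \<sigma> \<alpha>"
      using ring_hom_nat_pow[OF p F.ring_axioms S.ring_axioms g(1)] by (simp add: \<sigma>)
    have "p (gv [^]\<^bsub>?F\<^esub> q) = p (?m \<beta> [])" by (rule peq) (use g mc \<beta> in auto)
    then show "p gv [^]\<^bsub>S\<^esub> q = \<sigma> \<beta>"
      using ring_hom_nat_pow[OF p F.ring_axioms S.ring_axioms g(2)] by (simp add: \<sigma>)
    have "p (gu \<otimes>\<^bsub>?F\<^esub> gv) = p (?m \<zeta> [] \<otimes>\<^bsub>?F\<^esub> (gv \<otimes>\<^bsub>?F\<^esub> gu))" by (rule peq) (use g mc \<zeta> in auto)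
    then show "p gu \<otimes>\<^bsub>S\<^esub> p gv = \<sigma> \<zeta> \<otimes>\<^bsub>S\<^esub> (p gv \<otimes>\<^bsub>S\<^esub> p gu)"
      using g mc[OF \<zeta>] by (simp add: \<sigma> ring_hom_mult[OF p])
    show "generated_by S (\<sigma> ` carrier K \<union> {p gu, p gv})"
      unfolding generated_by_def
    proof (intro conjI allI impI subsetI)
      fix x assume "x \<in> \<sigma> ` carrier K \<union> {p gu, p gv}"
      then consider c where "c \<in> carrier K" "x = \<sigma> c" | "x = p gu" | "x = p gv" by blast
      then show "x \<in> carrier S" by cases (simp_all only: pg ring_hom_closed[OF \<sigma>_hom])
    next
      fix C x assume C: "\<sigma> ` carrier K \<union> {p gu, p gv} \<subseteq> C"
        and cl: "\<forall>x\<in>C \<inter> carrier S. \<forall>y\<in>C \<inter> carrier S. x \<oplus>\<^bsub>S\<^esub> y \<in> C \<and> x \<otimes>\<^bsub>S\<^esub> y \<in> C"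
        and x: "x \<in> carrier S"
      have pc: "p f \<in> carrier S" if "f \<in> carrier ?F" for f using ring_hom_closed[OF p that] .
      have w: "p (?m \<one> w) \<in> C" for w
      proof (induction w)
        case Nil
        have "\<sigma> \<one> \<in> C" using C K.one_closed by blast
        then show ?case by (simp only: \<sigma>)
      next
        case (Cons a w)
        have "p (?m \<one> [a]) \<in> C" using C by (cases a) (auto simp: gu_def gv_def)
        moreover have "?m \<one> (a # w) = ?m \<one> [a] \<otimes>\<^bsub>?F\<^esub> ?m \<one> w" by (simp add: mm)
        ultimately show ?case using cl Cons by (simp add: ring_hom_mult[OF p] mc pc)
      qed
      obtain f where f: "f \<in> carrier ?F" "x = p f"
        using x unfolding S p_def by (auto simp: carrier_FactRing)
      have "p f \<in> C" using f(1)
      proof (induction f rule: K.monoid_ring_induct)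
        case zero
        have "\<zero>\<^bsub>?F\<^esub> = ?m \<zero> []" by (auto simp: monoid_ring_def monomial_def)
        moreover have "\<sigma> \<zero> \<in> C" using C K.zero_closed by blast
        ultimately show ?case by (simp only: \<sigma>)
      next
        case (mono c w)
        have "?m c w = ?m c [] \<otimes>\<^bsub>?F\<^esub> ?m \<one> w" using mono by (simp add: mm)
        moreover have "\<sigma> c \<in> C" using C mono by blast
        then have "p (?m c []) \<in> C" by (simp only: \<sigma>)
        ultimately show ?case using cl w mono by (simp add: ring_hom_mult[OF p] mc pc)
      next
        case (add f g)
        then show ?case using cl by (simp add: ring_hom_add[OF p] pc)
      qed
      then show "x \<in> C" using f by simp
    qed
  qed
qed

section \<open>Tensor products\<close>

text \<open>Sums of pure tensors exhaust the tensor product: negatives are available because \<open>-(d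
  \<otimes> f)\<close> is the pure tensor \<open>(-d) \<otimes> f\<close>.\<close>
lemma tensor_algebra_generators:
  fixes D (structure) and F :: "('f, 'o) ring_scheme" and \<delta> :: "'a \<Rightarrow> 'd"
  assumes K: "ring K" and D: "ring D" and F: "ring F"
    and \<delta>: "\<delta> \<in> ring_hom K D" and \<iota>: "\<iota> \<in> ring_hom K F"
  defines "T \<equiv> tensor_algebra K D \<delta> F \<iota>" and "\<kappa> \<equiv> tensor_map K D \<delta> F \<iota>"
  obtains \<tau> where "ring T" "\<tau> \<in> ring_hom D T" "\<kappa> \<in> ring_hom F T"
    "\<forall>c\<in>carrier K. \<tau> (\<delta> c) = \<kappa> (\<iota> c)"
    "\<forall>P. (\<forall>d\<in>carrier D. \<forall>f\<in>carrier F. P (\<tau> d \<otimes>\<^bsub>T\<^esub> \<kappa> f)) \<longrightarrow>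
       (\<forall>x\<in>carrier T. \<forall>y\<in>carrier T. P x \<longrightarrow> P y \<longrightarrow> P (x \<oplus>\<^bsub>T\<^esub> y)) \<longrightarrow> (\<forall>t\<in>carrier T. P t)"
proof -
  interpret K: ring K by fact
  interpret D: ring D by fact
  interpret F: ring F by fact
  have Z: "ring \<Z>" by (rule cring.axioms(1)[OF int_is_cring])
  note Zc = ring.monomial_carrier[OF Z] and Zm = ring.monomial_mult[OF Z] and Za = ring.monomial_add[OF Z]
  let ?G = "D \<times>\<times> F"
  have G: "monoid ?G" by (rule DirProd_monoid[OF D.monoid_axioms F.monoid_axioms])
  let ?M = "monoid_ring \<Z> ?G" and ?I = "tensor_ideal K D \<delta> F \<iota>"
  interpret M: ring ?M by (rule ring.monoid_ring_is_ring[OF Z G])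
  let ?t = "\<lambda>d f. monomial \<Z> 1 (d, f) :: 'd \<times> 'f \<Rightarrow> int"
  have tc: "?t d f \<in> carrier ?M" if "d \<in> carrier D" "f \<in> carrier F" for d f
    using Zc[of 1 "(d, f)" ?G] that by simp
  have tm: "?t d f \<otimes>\<^bsub>?M\<^esub> ?t d' f' = ?t (d \<otimes> d') (f \<otimes>\<^bsub>F\<^esub> f')"
    if "d \<in> carrier D" "f \<in> carrier F" "d' \<in> carrier D" "f' \<in> carrier F" for d f d' f'
    using Zm[of 1 1 "(d, f)" ?G "(d', f')"] that by simp
  have one: "\<one>\<^bsub>?M\<^esub> = ?t \<one> \<one>\<^bsub>F\<^esub>" by (intro ext) (simp add: monoid_ring_def monomial_def)
  define r1 where "r1 = {?t (d \<oplus> d') f \<ominus>\<^bsub>?M\<^esub> (?t d f \<oplus>\<^bsub>?M\<^esub> ?t d' f) |d d' f.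
            d \<in> carrier D \<and> d' \<in> carrier D \<and> f \<in> carrier F}"
  define r2 where "r2 = {?t d (f \<oplus>\<^bsub>F\<^esub> f') \<ominus>\<^bsub>?M\<^esub> (?t d f \<oplus>\<^bsub>?M\<^esub> ?t d f') |d f f'.
            d \<in> carrier D \<and> f \<in> carrier F \<and> f' \<in> carrier F}"
  define r3 where "r3 = {?t (\<delta> c \<otimes> d) f \<ominus>\<^bsub>?M\<^esub> ?t d (\<iota> c \<otimes>\<^bsub>F\<^esub> f) |c d f.
            c \<in> carrier K \<and> d \<in> carrier D \<and> f \<in> carrier F}"
  have I_eq: "?I = Idl\<^bsub>?M\<^esub> (r1 \<union> r2 \<union> r3)"
    by (simp add: tensor_ideal_def Let_def r1_def r2_def r3_def)
  have "r1 \<subseteq> carrier ?M" unfolding r1_def by (auto intro!: M.minus_closed M.a_closed tc)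
  moreover have "r2 \<subseteq> carrier ?M" unfolding r2_def by (auto intro!: M.minus_closed M.a_closed tc)
  moreover have "r3 \<subseteq> carrier ?M" unfolding r3_def
    by (auto intro!: M.minus_closed tc D.m_closed F.m_closed ring_hom_closed[OF \<delta>] ring_hom_closed[OF \<iota>])
  ultimately have r: "r1 \<union> r2 \<union> r3 \<subseteq> carrier ?M" by blast
  interpret I: ideal ?I ?M unfolding I_eq by (rule M.genideal_ideal[OF r])
  define p where "p = (\<lambda>x. ?I +>\<^bsub>?M\<^esub> x)"
  have T: "T = ?M Quot ?I" by (simp add: T_def tensor_algebra_def)
  interpret T: ring T unfolding T by (rule I.quotient_is_ring)
  have p: "p \<in> ring_hom ?M T" unfolding T p_def by (rule I.rcos_ring_hom)
  have pc: "p f \<in> carrier T" if "f \<in> carrier ?M" for f using ring_hom_closed[OF p that] .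
  have peq: "p a = p b" if "a \<ominus>\<^bsub>?M\<^esub> b \<in> r1 \<union> r2 \<union> r3" "a \<in> carrier ?M" "b \<in> carrier ?M" for a b
  proof -
    have "a \<ominus>\<^bsub>?M\<^esub> b \<in> ?I" using M.genideal_self[OF r] that(1) unfolding I_eq by blast
    then show ?thesis unfolding p_def
      using M.quotient_eq_iff_same_a_r_cos[OF I.ideal_axioms that(2,3)] by blast
  qed
  have \<kappa>: "\<kappa> f = p (?t \<one> f)" for f by (simp add: \<kappa>_def tensor_map_def p_def)
  define \<tau> where "\<tau> d = p (?t d \<one>\<^bsub>F\<^esub>)" for d
  have add1: "p (?t (d \<oplus> d') f) = p (?t d f) \<oplus>\<^bsub>T\<^esub> p (?t d' f)"
    if "d \<in> carrier D" "d' \<in> carrier D" "f \<in> carrier F" for d d' f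
  proof -
    have "p (?t (d \<oplus> d') f) = p (?t d f \<oplus>\<^bsub>?M\<^esub> ?t d' f)"
      by (rule peq) (use that in \<open>auto simp: r1_def tc\<close>)
    then show ?thesis using that by (simp add: ring_hom_add[OF p] tc)
  qed
  have add2: "p (?t d (f \<oplus>\<^bsub>F\<^esub> f')) = p (?t d f) \<oplus>\<^bsub>T\<^esub> p (?t d f')"
    if "d \<in> carrier D" "f' \<in> carrier F" "f \<in> carrier F" for d f f'
  proof -
    have "p (?t d (f \<oplus>\<^bsub>F\<^esub> f')) = p (?t d f \<oplus>\<^bsub>?M\<^esub> ?t d f')"
      by (rule peq) (use that in \<open>auto simp: r2_def tc\<close>)
    then show ?thesis using that by (simp add: ring_hom_add[OF p] tc)
  qed
  have \<tau>_hom: "\<tau> \<in> ring_hom D T"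
    by (rule ring_hom_memI)
      (simp_all add: \<tau>_def pc tc add1 ring_hom_mult[OF p, symmetric] tm one[symmetric] ring_hom_one[OF p])
  have \<kappa>_hom: "\<kappa> \<in> ring_hom F T"
    by (rule ring_hom_memI)
      (simp_all add: \<kappa> pc tc add2 ring_hom_mult[OF p, symmetric] tm one[symmetric] ring_hom_one[OF p])
  have \<tau>\<kappa>: "p (?t d f) = \<tau> d \<otimes>\<^bsub>T\<^esub> \<kappa> f" if "d \<in> carrier D" "f \<in> carrier F" for d f
    using that by (simp add: \<tau>_def \<kappa> ring_hom_mult[OF p, symmetric] tm tc)
  show ?thesis
  proof (rule that[of \<tau>])
    show "ring T" by (rule T.ring_axioms)
    show "\<tau> \<in> ring_hom D T" by fact
    show "\<kappa> \<in> ring_hom F T" by fact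
    show "\<forall>c\<in>carrier K. \<tau> (\<delta> c) = \<kappa> (\<iota> c)"
    proof
      fix c assume c: "c \<in> carrier K"
      have cc: "\<delta> c \<in> carrier D" "\<iota> c \<in> carrier F"
        using c ring_hom_closed[OF \<delta>] ring_hom_closed[OF \<iota>] by auto
      have "p (?t (\<delta> c \<otimes> \<one>) \<one>\<^bsub>F\<^esub>) = p (?t \<one> (\<iota> c \<otimes>\<^bsub>F\<^esub> \<one>\<^bsub>F\<^esub>))"
        by (rule peq) (use c cc in \<open>auto simp: r3_def tc simp del: D.r_one F.r_one\<close>)
      then show "\<tau> (\<delta> c) = \<kappa> (\<iota> c)" using cc by (simp add: \<tau>_def \<kappa>)
    qed
  next
    show "\<forall>P. (\<forall>d\<in>carrier D. \<forall>f\<in>carrier F. P (\<tau> d \<otimes>\<^bsub>T\<^esub> \<kappa> f)) \<longrightarrow>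
       (\<forall>x\<in>carrier T. \<forall>y\<in>carrier T. P x \<longrightarrow> P y \<longrightarrow> P (x \<oplus>\<^bsub>T\<^esub> y)) \<longrightarrow> (\<forall>t\<in>carrier T. P t)"
    proof (intro allI impI ballI)
    fix P and t assume t: "t \<in> carrier T"
      and "\<forall>d\<in>carrier D. \<forall>f\<in>carrier F. P (\<tau> d \<otimes>\<^bsub>T\<^esub> \<kappa> f)"
      and "\<forall>x\<in>carrier T. \<forall>y\<in>carrier T. P x \<longrightarrow> P y \<longrightarrow> P (x \<oplus>\<^bsub>T\<^esub> y)"
    then have gen: "\<And>d f. d \<in> carrier D \<Longrightarrow> f \<in> carrier F \<Longrightarrow> P (\<tau> d \<otimes>\<^bsub>T\<^esub> \<kappa> f)"
      and add: "\<And>x y. x \<in> carrier T \<Longrightarrow> y \<in> carrier T \<Longrightarrow> P x \<Longrightarrow> P y \<Longrightarrow> P (x \<oplus>\<^bsub>T\<^esub> y)"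
      by auto
    have P0: "P \<zero>\<^bsub>T\<^esub>"
      using gen[of \<zero> "\<zero>\<^bsub>F\<^esub>"] ring_hom_zero[OF \<tau>_hom D T.ring_axioms] ring_hom_zero[OF \<kappa>_hom F T.ring_axioms]
      by simp
    obtain h where h: "h \<in> carrier ?M" "t = p h"
      using t unfolding T p_def by (auto simp: carrier_FactRing)
    have mc: "monomial \<Z> n (d, f) \<in> carrier ?M" if "d \<in> carrier D" "f \<in> carrier F" for n d f
      using Zc[of n "(d, f)" ?G] that by simp
    have p0: "p \<zero>\<^bsub>?M\<^esub> = \<zero>\<^bsub>T\<^esub>" by (rule ring_hom_zero[OF p M.ring_axioms T.ring_axioms])
    have mono: "P (p (monomial \<Z> n (d, f)))" if df: "d \<in> carrier D" "f \<in> carrier F" for n d f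
    proof -
      have z: "monomial \<Z> 0 (d, f) = \<zero>\<^bsub>?M\<^esub>" by (intro ext) (simp add: monoid_ring_def monomial_def)
      have s: "monomial \<Z> (m + n) (d, f) = monomial \<Z> m (d, f) \<oplus>\<^bsub>?M\<^esub> monomial \<Z> n (d, f)" for m n
        using Za[of m n ?G "(d, f)"] by simp
      have sp: "p (monomial \<Z> (m + n) (d, f)) = p (monomial \<Z> m (d, f)) \<oplus>\<^bsub>T\<^esub> p (monomial \<Z> n (d, f))" for m n
        unfolding s using df by (simp add: ring_hom_add[OF p] mc)
      have P1: "P (p (?t d f))" using gen df by (simp add: \<tau>\<kappa>)
      have "p (?t d f) \<oplus>\<^bsub>T\<^esub> p (monomial \<Z> (- 1) (d, f)) = \<zero>\<^bsub>T\<^esub>"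
        using sp[of 1 "-1"] z p0 by simp
      moreover have "p (?t d f) \<oplus>\<^bsub>T\<^esub> p (?t (\<ominus> d) f) = \<zero>\<^bsub>T\<^esub>"
        using add1[of d "\<ominus> d" f] df \<tau>\<kappa>[of \<zero> f] ring_hom_zero[OF \<tau>_hom D T.ring_axioms]
          ring_hom_closed[OF \<kappa>_hom df(2)] by (simp add: D.r_neg)
      ultimately have "p (monomial \<Z> (- 1) (d, f)) = p (?t (\<ominus> d) f)"
        using T.add.inv_equality T.a_comm df by (metis D.a_inv_closed mc pc)
      then have P2: "P (p (monomial \<Z> (- 1) (d, f)))" using gen[of "\<ominus> d" f] df by (simp add: \<tau>\<kappa>)
      show ?thesis
      proof (induction n rule: int_induct[of _ 0])
        case base
        then show ?case using P0 z p0 by simp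
      next
        case (step1 i)
        then show ?case unfolding sp by (intro add) (use P1 df in \<open>simp_all add: mc pc\<close>)
      next
        case (step2 i)
        have "i - 1 = i + - 1" by simp
        then show ?case using step2 unfolding \<open>i - 1 = _\<close> sp
          by (intro add) (use P2 df in \<open>simp_all add: mc pc\<close>)
      qed
    qed
    have "P (p h)" using h(1)
    proof (induction h rule: ring.monoid_ring_induct[OF Z, consumes 1, case_names zero mono add])
      case zero
      show ?case using P0 p0 by simp
    next
      case (mono c x)
      then show ?case using \<open>\<And>n d f. _ \<Longrightarrow> _ \<Longrightarrow> P (p (monomial \<Z> n (d, f)))\<close> by (cases x) simp
    next
      case (add f g)
      then show ?case using \<open>\<And>x y. _ \<Longrightarrow> _ \<Longrightarrow> _ \<Longrightarrow> _ \<Longrightarrow> P (x \<oplus>\<^bsub>T\<^esub> y)\<close>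
        by (simp add: ring_hom_add[OF p] pc)
    qed
    then show "P t" using h by simp
    qed
  qed
qed

section \<open>Matrix rings\<close>

text \<open>Matrices with rows and columns indexed by an arbitrary set, so that a matrix of matrices can be
  indexed by pairs.\<close>
definition mat_ring :: "'i set \<Rightarrow> ('d, 'n) ring_scheme \<Rightarrow> ('i \<Rightarrow> 'i \<Rightarrow> 'd) ring" where
  "mat_ring I D = \<lparr>
     carrier = {M. \<forall>i j. if i \<in> I \<and> j \<in> I then M i j \<in> carrier D else M i j = \<zero>\<^bsub>D\<^esub>},
     monoid.mult = (\<lambda>M N i j. finsum D (\<lambda>k. M i k \<otimes>\<^bsub>D\<^esub> N k j) I),
     one = (\<lambda>i j. if i = j \<and> i \<in> I then \<one>\<^bsub>D\<^esub> else \<zero>\<^bsub>D\<^esub>),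
     ring.zero = (\<lambda>i j. \<zero>\<^bsub>D\<^esub>),
     ring.add = (\<lambda>M N i j. M i j \<oplus>\<^bsub>D\<^esub> N i j)\<rparr>"

definition scalar_mat :: "'i set \<Rightarrow> ('d, 'n) ring_scheme \<Rightarrow> 'd \<Rightarrow> 'i \<Rightarrow> 'i \<Rightarrow> 'd" where
  "scalar_mat I D d = (\<lambda>i j. if i = j \<and> i \<in> I then d else \<zero>\<^bsub>D\<^esub>)"

definition unit_mat :: "('d, 'n) ring_scheme \<Rightarrow> 'i \<Rightarrow> 'i \<Rightarrow> 'd \<Rightarrow> 'i \<Rightarrow> 'i \<Rightarrow> 'd" where
  "unit_mat D i j d = (\<lambda>a b. if a = i \<and> b = j then d else \<zero>\<^bsub>D\<^esub>)"

lemma matrix_ring_eq_mat_ring: "matrix_ring m D = mat_ring {..<m} D"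
  by (simp add: matrix_ring_def mat_ring_def)

lemma scalar_matrix_eq_scalar_mat: "scalar_matrix m D d = scalar_mat {..<m} D d"
  by (simp add: scalar_matrix_def scalar_mat_def)

context ring
begin

lemma mat_ring_simps:
  "\<zero>\<^bsub>mat_ring I R\<^esub> = (\<lambda>i j. \<zero>)" "\<one>\<^bsub>mat_ring I R\<^esub> = scalar_mat I R \<one>"
  "(U \<oplus>\<^bsub>mat_ring I R\<^esub> W) i j = U i j \<oplus> W i j"
  "(U \<otimes>\<^bsub>mat_ring I R\<^esub> W) i j = (\<Oplus>k\<in>I. U i k \<otimes> W k j)"
  by (simp_all add: mat_ring_def scalar_mat_def)

lemma mat_carrier_iff:
  "U \<in> carrier (mat_ring I R) \<longleftrightarrow> (\<forall>i j. U i j \<in> carrier R \<and> (U i j \<noteq> \<zero> \<longrightarrow> i \<in> I \<and> j \<in> I))"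
  by (auto simp: mat_ring_def) (metis zero_closed)+

lemma mat_entry [simp]: "U \<in> carrier (mat_ring I R) \<Longrightarrow> U i j \<in> carrier R"
  by (simp add: mat_carrier_iff)

lemma mat_entry_outside:
  "U \<in> carrier (mat_ring I R) \<Longrightarrow> i \<notin> I \<or> j \<notin> I \<Longrightarrow> U i j = \<zero>"
  by (auto simp: mat_carrier_iff)

lemma scalar_mat_carrier: "d \<in> carrier R \<Longrightarrow> scalar_mat I R d \<in> carrier (mat_ring I R)"
  by (simp add: mat_carrier_iff scalar_mat_def)

lemma unit_mat_carrier: "d \<in> carrier R \<Longrightarrow> i \<in> I \<Longrightarrow> j \<in> I \<Longrightarrow> unit_mat R i j d \<in> carrier (mat_ring I R)"
  by (simp add: mat_carrier_iff unit_mat_def)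

lemma mat_mult_carrier:
  assumes "U \<in> carrier (mat_ring I R)" "W \<in> carrier (mat_ring I R)"
  shows "U \<otimes>\<^bsub>mat_ring I R\<^esub> W \<in> carrier (mat_ring I R)"
proof -
  have "(\<Oplus>k\<in>I. U i k \<otimes> W k j) = \<zero>" if "i \<notin> I \<or> j \<notin> I" for i j
  proof -
    have "(\<Oplus>k\<in>I. U i k \<otimes> W k j) = (\<Oplus>k\<in>I. \<zero>)"
      using assms that mat_entry_outside[OF assms(1), of i] mat_entry_outside[OF assms(2), of _ j]
      by (intro finsum_cong') (auto simp del: finsum_zero)
    then show ?thesis by (simp add: finsum_zero)
  qed
  moreover have "(\<Oplus>k\<in>I. U i k \<otimes> W k j) \<in> carrier R" for i j
    using assms by (intro finsum_closed) auto
  ultimately show ?thesis by (auto simp: mat_carrier_iff mat_ring_simps)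
qed

lemma finsum_delta:
  assumes "finite I" "i \<in> I" "f i \<in> carrier R"
  shows "(\<Oplus>k\<in>I. if k = i then f k else \<zero>) = f i"
proof -
  have "(\<Oplus>k\<in>I. if k = i then f k else \<zero>) = (\<Oplus>k\<in>{i}. f k)"
    using assms by (intro add.finprod_mono_neutral_cong_right) auto
  then show ?thesis using assms by (simp add: finsum_insert)
qed

lemma scalar_mat_mult:
  assumes "finite I" "d \<in> carrier R" "U \<in> carrier (mat_ring I R)"
  shows "scalar_mat I R d \<otimes>\<^bsub>mat_ring I R\<^esub> U = (\<lambda>i j. d \<otimes> U i j)"
    and "U \<otimes>\<^bsub>mat_ring I R\<^esub> scalar_mat I R d = (\<lambda>i j. U i j \<otimes> d)"
proof -
  have "(\<Oplus>k\<in>I. scalar_mat I R d i k \<otimes> U k j) = d \<otimes> U i j" for i j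
  proof (cases "i \<in> I")
    case True
    have "(\<Oplus>k\<in>I. scalar_mat I R d i k \<otimes> U k j) = (\<Oplus>k\<in>I. if k = i then d \<otimes> U k j else \<zero>)"
      using assms by (intro finsum_cong') (auto simp: scalar_mat_def)
    also have "\<dots> = d \<otimes> U i j" using True assms by (intro finsum_delta) auto
    finally show ?thesis .
  next
    case False
    have "(\<Oplus>k\<in>I. scalar_mat I R d i k \<otimes> U k j) = (\<Oplus>k\<in>I. \<zero>)"
      using assms False by (intro finsum_cong') (auto simp: scalar_mat_def)
    then show ?thesis using False assms mat_entry_outside[OF assms(3)] by (simp add: finsum_zero)
  qed
  then show "scalar_mat I R d \<otimes>\<^bsub>mat_ring I R\<^esub> U = (\<lambda>i j. d \<otimes> U i j)"
    by (intro ext) (simp add: mat_ring_simps)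
  have "(\<Oplus>k\<in>I. U i k \<otimes> scalar_mat I R d k j) = U i j \<otimes> d" for i j
  proof (cases "j \<in> I")
    case True
    have "(\<Oplus>k\<in>I. U i k \<otimes> scalar_mat I R d k j) = (\<Oplus>k\<in>I. if k = j then U i k \<otimes> d else \<zero>)"
      using assms by (intro finsum_cong') (auto simp: scalar_mat_def)
    also have "\<dots> = U i j \<otimes> d" using True assms by (intro finsum_delta) auto
    finally show ?thesis .
  next
    case False
    have "(\<Oplus>k\<in>I. U i k \<otimes> scalar_mat I R d k j) = (\<Oplus>k\<in>I. \<zero>)"
      using assms False by (intro finsum_cong') (auto simp: scalar_mat_def)
    then show ?thesis using False assms mat_entry_outside[OF assms(3)] by (simp add: finsum_zero)
  qed
  then show "U \<otimes>\<^bsub>mat_ring I R\<^esub> scalar_mat I R d = (\<lambda>i j. U i j \<otimes> d)"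
    by (intro ext) (simp add: mat_ring_simps)
qed

lemma mat_mult_assoc:
  assumes I: "finite I" and U: "U \<in> carrier (mat_ring I R)" and W: "W \<in> carrier (mat_ring I R)"
    and Q: "Q \<in> carrier (mat_ring I R)"
  shows "U \<otimes>\<^bsub>mat_ring I R\<^esub> W \<otimes>\<^bsub>mat_ring I R\<^esub> Q = U \<otimes>\<^bsub>mat_ring I R\<^esub> (W \<otimes>\<^bsub>mat_ring I R\<^esub> Q)"
proof (intro ext)
  fix i j
  have "(U \<otimes>\<^bsub>mat_ring I R\<^esub> W \<otimes>\<^bsub>mat_ring I R\<^esub> Q) i j = (\<Oplus>k\<in>I. (\<Oplus>l\<in>I. U i l \<otimes> W l k) \<otimes> Q k j)"
    by (simp add: mat_ring_simps)
  also have "\<dots> = (\<Oplus>k\<in>I. \<Oplus>l\<in>I. U i l \<otimes> W l k \<otimes> Q k j)"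
    using assms by (intro finsum_cong' refl finsum_ldistr) (auto intro!: finsum_closed)
  also have "\<dots> = (\<Oplus>l\<in>I. \<Oplus>k\<in>I. U i l \<otimes> W l k \<otimes> Q k j)"
    using assms by (intro finsum_swap) auto
  also have "\<dots> = (\<Oplus>l\<in>I. \<Oplus>k\<in>I. U i l \<otimes> (W l k \<otimes> Q k j))"
    using assms by (intro finsum_cong' refl) (auto intro!: finsum_closed simp: m_assoc)
  also have "\<dots> = (\<Oplus>l\<in>I. U i l \<otimes> (\<Oplus>k\<in>I. W l k \<otimes> Q k j))"
    using assms by (intro finsum_cong' refl finsum_rdistr[symmetric]) (auto intro!: finsum_closed)
  also have "\<dots> = (U \<otimes>\<^bsub>mat_ring I R\<^esub> (W \<otimes>\<^bsub>mat_ring I R\<^esub> Q)) i j"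
    by (simp add: mat_ring_simps)
  finally show "(U \<otimes>\<^bsub>mat_ring I R\<^esub> W \<otimes>\<^bsub>mat_ring I R\<^esub> Q) i j = (U \<otimes>\<^bsub>mat_ring I R\<^esub> (W \<otimes>\<^bsub>mat_ring I R\<^esub> Q)) i j" .
qed

lemma mat_ring_is_ring:
  assumes I: "finite I"
  shows "ring (mat_ring I R)"
proof (rule ringI)
  show "abelian_group (mat_ring I R)"
  proof (rule abelian_groupI)
    fix U assume U: "U \<in> carrier (mat_ring I R)"
    have "(\<lambda>i j. \<ominus> U i j) \<in> carrier (mat_ring I R)"
      using U by (auto simp: mat_carrier_iff)
    moreover have "(\<lambda>i j. \<ominus> U i j) \<oplus>\<^bsub>mat_ring I R\<^esub> U = \<zero>\<^bsub>mat_ring I R\<^esub>"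
      using U by (intro ext) (simp add: mat_ring_simps l_neg)
    ultimately show "\<exists>W\<in>carrier (mat_ring I R). W \<oplus>\<^bsub>mat_ring I R\<^esub> U = \<zero>\<^bsub>mat_ring I R\<^esub>" by blast
  next
    fix U W assume "U \<in> carrier (mat_ring I R)" "W \<in> carrier (mat_ring I R)"
    then show "U \<oplus>\<^bsub>mat_ring I R\<^esub> W \<in> carrier (mat_ring I R)"
      by (simp add: mat_carrier_iff mat_ring_simps) (metis l_zero zero_closed)
  next
    fix U W Q assume "U \<in> carrier (mat_ring I R)" "W \<in> carrier (mat_ring I R)" "Q \<in> carrier (mat_ring I R)"
    then show "U \<oplus>\<^bsub>mat_ring I R\<^esub> W \<oplus>\<^bsub>mat_ring I R\<^esub> Q = U \<oplus>\<^bsub>mat_ring I R\<^esub> (W \<oplus>\<^bsub>mat_ring I R\<^esub> Q)"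
      by (intro ext) (simp add: mat_ring_simps a_assoc)
  next
    fix U W assume "U \<in> carrier (mat_ring I R)" "W \<in> carrier (mat_ring I R)"
    then show "U \<oplus>\<^bsub>mat_ring I R\<^esub> W = W \<oplus>\<^bsub>mat_ring I R\<^esub> U"
      by (intro ext) (simp add: mat_ring_simps a_comm)
  qed (auto intro!: ext simp: mat_ring_simps mat_carrier_iff)
  show "monoid (mat_ring I R)"
    by (rule monoidI)
      (simp_all add: mat_mult_carrier mat_mult_assoc[OF I] mat_ring_simps scalar_mat_mult[OF I] scalar_mat_carrier)
next
  fix U W Q assume c: "U \<in> carrier (mat_ring I R)" "W \<in> carrier (mat_ring I R)" "Q \<in> carrier (mat_ring I R)"
  show "(U \<oplus>\<^bsub>mat_ring I R\<^esub> W) \<otimes>\<^bsub>mat_ring I R\<^esub> Q = U \<otimes>\<^bsub>mat_ring I R\<^esub> Q \<oplus>\<^bsub>mat_ring I R\<^esub> W \<otimes>\<^bsub>mat_ring I R\<^esub> Q"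
    using c by (intro ext) (simp add: mat_ring_simps l_distr finsum_addf Pi_def)
  show "Q \<otimes>\<^bsub>mat_ring I R\<^esub> (U \<oplus>\<^bsub>mat_ring I R\<^esub> W) = Q \<otimes>\<^bsub>mat_ring I R\<^esub> U \<oplus>\<^bsub>mat_ring I R\<^esub> Q \<otimes>\<^bsub>mat_ring I R\<^esub> W"
    using c by (intro ext) (simp add: mat_ring_simps r_distr finsum_addf Pi_def)
qed

lemma scalar_mat_hom:
  assumes I: "finite I"
  shows "scalar_mat I R \<in> ring_hom R (mat_ring I R)"
  by (rule ring_hom_memI)
    (use I in \<open>auto intro!: ext simp: scalar_mat_carrier mat_ring_simps scalar_mat_mult, auto simp: scalar_mat_def\<close>)

lemma mat_induct [consumes 2, case_names zero unit add]:
  assumes I: "finite I" and U: "U \<in> carrier (mat_ring I R)"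
    and zero: "P \<zero>\<^bsub>mat_ring I R\<^esub>"
    and unit: "\<And>i j d. i \<in> I \<Longrightarrow> j \<in> I \<Longrightarrow> d \<in> carrier R \<Longrightarrow> P (unit_mat R i j d)"
    and add: "\<And>U W. U \<in> carrier (mat_ring I R) \<Longrightarrow> W \<in> carrier (mat_ring I R) \<Longrightarrow> P U \<Longrightarrow> P W \<Longrightarrow>
       P (U \<oplus>\<^bsub>mat_ring I R\<^esub> W)"
  shows "P U"
proof -
  have main: "U \<in> carrier (mat_ring I R) \<Longrightarrow> (\<And>i j. U i j \<noteq> \<zero> \<Longrightarrow> (i, j) \<in> A) \<Longrightarrow> P U"
    if "finite A" "A \<subseteq> I \<times> I" for A U
    using that
  proof (induction A arbitrary: U rule: finite_induct)
    case empty
    then have "U = \<zero>\<^bsub>mat_ring I R\<^esub>" by (intro ext) (auto simp: mat_ring_simps)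
    then show ?case using zero by simp
  next
    case (insert p A)
    obtain i j where p: "p = (i, j)" by (cases p)
    let ?W = "\<lambda>a b. if a = i \<and> b = j then \<zero> else U a b"
    have ij: "i \<in> I" "j \<in> I" using insert p by auto
    have W: "?W \<in> carrier (mat_ring I R)" using insert(4) by (simp add: mat_carrier_iff)
    have "P ?W" by (rule insert.IH[OF W]) (use insert.prems p in \<open>auto split: if_splits\<close>)
    then have "P (unit_mat R i j (U i j) \<oplus>\<^bsub>mat_ring I R\<^esub> ?W)"
      by (intro add unit_mat_carrier W unit ij mat_entry[OF insert(4)])
    moreover have "unit_mat R i j (U i j) \<oplus>\<^bsub>mat_ring I R\<^esub> ?W = U"
      using insert(4) by (intro ext) (simp add: mat_ring_simps unit_mat_def)
    ultimately show ?case by (simp only:)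
  qed
  have "(i, j) \<in> I \<times> I" if "U i j \<noteq> \<zero>" for i j
    using that mat_entry_outside[OF U] by blast
  then show ?thesis by (intro main[OF _ order_refl U]) (use I in simp_all)
qed

end

lemma map_mat_hom:
  assumes "ring D" "ring T" "finite I" and h: "h \<in> ring_hom D T"
  shows "(\<lambda>U i j. h (U i j)) \<in> ring_hom (mat_ring I D) (mat_ring I T)"
proof -
  interpret D: ring D by fact
  interpret T: ring T by fact
  have h0: "h \<zero>\<^bsub>D\<^esub> = \<zero>\<^bsub>T\<^esub>" by (rule ring_hom_zero[OF h assms(1,2)])
  interpret ring_hom_ring D T h by (rule ring_hom_ringI2) fact+
  show ?thesis
  proof (rule ring_hom_memI)
    fix U assume "U \<in> carrier (mat_ring I D)"
    then show "(\<lambda>i j. h (U i j)) \<in> carrier (mat_ring I T)"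
      unfolding D.mat_carrier_iff T.mat_carrier_iff using h0 hom_closed by metis
  next
    fix U W assume c: "U \<in> carrier (mat_ring I D)" "W \<in> carrier (mat_ring I D)"
    show "(\<lambda>i j. h ((U \<otimes>\<^bsub>mat_ring I D\<^esub> W) i j)) = (\<lambda>i j. h (U i j)) \<otimes>\<^bsub>mat_ring I T\<^esub> (\<lambda>i j. h (W i j))"
      using c by (intro ext) (simp add: D.mat_ring_simps T.mat_ring_simps Pi_def o_def)
    show "(\<lambda>i j. h ((U \<oplus>\<^bsub>mat_ring I D\<^esub> W) i j)) = (\<lambda>i j. h (U i j)) \<oplus>\<^bsub>mat_ring I T\<^esub> (\<lambda>i j. h (W i j))"
      using c by (intro ext) (simp add: D.mat_ring_simps T.mat_ring_simps)
  next
    show "(\<lambda>i j. h (\<one>\<^bsub>mat_ring I D\<^esub> i j)) = \<one>\<^bsub>mat_ring I T\<^esub>"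
      by (intro ext) (auto simp: D.mat_ring_simps T.mat_ring_simps scalar_mat_def h0)
  qed
qed

text \<open>A block matrix, read as a matrix indexed by pairs.\<close>
definition flatten_mat :: "('i \<Rightarrow> 'i \<Rightarrow> 'j \<Rightarrow> 'j \<Rightarrow> 'd) \<Rightarrow> 'i \<times> 'j \<Rightarrow> 'i \<times> 'j \<Rightarrow> 'd" where
  "flatten_mat U p p' = U (fst p) (fst p') (snd p) (snd p')"

context ring
begin

lemma finsum_Times:
  assumes "finite A" "finite B" "\<And>i j. i \<in> A \<Longrightarrow> j \<in> B \<Longrightarrow> f i j \<in> carrier R"
  shows "(\<Oplus>p\<in>A \<times> B. f (fst p) (snd p)) = (\<Oplus>i\<in>A. \<Oplus>j\<in>B. f i j)"
  using assms(1,3)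
proof (induction A rule: finite_induct)
  case empty
  then show ?case by simp
next
  case (insert a A)
  have d: "insert a A \<times> B = (Pair a ` B) \<union> (A \<times> B)" by auto
  have "(\<Oplus>p\<in>insert a A \<times> B. f (fst p) (snd p)) =
      (\<Oplus>p\<in>Pair a ` B. f (fst p) (snd p)) \<oplus> (\<Oplus>p\<in>A \<times> B. f (fst p) (snd p))"
    unfolding d using insert assms(2) by (intro finsum_Un_disjoint) auto
  also have "(\<Oplus>p\<in>Pair a ` B. f (fst p) (snd p)) = (\<Oplus>j\<in>B. f a j)"
    using insert by (subst finsum_reindex) (auto simp: inj_on_def)
  also have "(\<Oplus>p\<in>A \<times> B. f (fst p) (snd p)) = (\<Oplus>i\<in>A. \<Oplus>j\<in>B. f i j)"
    using insert by simp
  also have "(\<Oplus>j\<in>B. f a j) \<oplus> (\<Oplus>i\<in>A. \<Oplus>j\<in>B. f i j) = (\<Oplus>i\<in>insert a A. \<Oplus>j\<in>B. f i j)"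
    using insert by (intro finsum_insert[symmetric]) (auto intro!: finsum_closed)
  finally show ?case .
qed

lemma finsum_mat_entry:
  assumes "finite J" "finite A" "\<And>k. k \<in> A \<Longrightarrow> U k \<in> carrier (mat_ring J R)"
  shows "(finsum (mat_ring J R) U A) a b = (\<Oplus>k\<in>A. U k a b)"
proof -
  interpret M: ring "mat_ring J R" by (rule mat_ring_is_ring) fact
  show ?thesis using assms(2,3)
  proof (induction A rule: finite_induct)
    case empty
    show ?case by (simp add: mat_ring_simps)
  next
    case (insert k A)
    then have "(\<lambda>k. U k a b) \<in> A \<rightarrow> carrier R" "U k a b \<in> carrier R" by (auto intro: mat_entry)
    then show ?case using insert by (simp add: mat_ring_simps Pi_def)
  qed
qed

lemma flatten_hom:
  assumes I: "finite I" and J: "finite J"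
  shows "flatten_mat \<in> ring_hom (mat_ring I (mat_ring J R)) (mat_ring (I \<times> J) R)"
proof -
  interpret M: ring "mat_ring J R" by (rule mat_ring_is_ring) fact
  show ?thesis
  proof (rule ring_hom_memI)
    fix U assume "U \<in> carrier (mat_ring I (mat_ring J R))"
    note e = M.mat_entry[OF this] M.mat_entry_outside[OF this]
    show "flatten_mat U \<in> carrier (mat_ring (I \<times> J) R)"
      unfolding mat_carrier_iff
    proof (intro allI conjI impI)
      fix p p'
      show "flatten_mat U p p' \<in> carrier R" by (simp add: flatten_mat_def mat_entry[OF e(1)])
      assume nz: "flatten_mat U p p' \<noteq> \<zero>"
      then have "U (fst p) (fst p') \<noteq> \<zero>\<^bsub>mat_ring J R\<^esub>" by (auto simp: flatten_mat_def mat_ring_simps)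
      then have 1: "fst p \<in> I" "fst p' \<in> I" using e(2) by blast+
      have 2: "snd p \<in> J" "snd p' \<in> J" using nz mat_entry_outside[OF e(1)] unfolding flatten_mat_def by blast+
      show "p \<in> I \<times> J" "p' \<in> I \<times> J" using 1 2 by (simp_all add: mem_Times_iff)
    qed
  next
    fix U W assume c: "U \<in> carrier (mat_ring I (mat_ring J R))" "W \<in> carrier (mat_ring I (mat_ring J R))"
    show "flatten_mat (U \<oplus>\<^bsub>mat_ring I (mat_ring J R)\<^esub> W) = flatten_mat U \<oplus>\<^bsub>mat_ring (I \<times> J) R\<^esub> flatten_mat W"
      by (intro ext) (simp add: flatten_mat_def mat_ring_simps M.mat_ring_simps)
    show "flatten_mat (U \<otimes>\<^bsub>mat_ring I (mat_ring J R)\<^esub> W) = flatten_mat U \<otimes>\<^bsub>mat_ring (I \<times> J) R\<^esub> flatten_mat W"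
    proof (intro ext)
      fix p p' :: "'c \<times> 'd"
      note e = M.mat_entry[OF c(1)] M.mat_entry[OF c(2)]
      have "flatten_mat (U \<otimes>\<^bsub>mat_ring I (mat_ring J R)\<^esub> W) p p' =
          (\<Oplus>k\<in>I. (U (fst p) k \<otimes>\<^bsub>mat_ring J R\<^esub> W k (fst p')) (snd p) (snd p'))"
        using e I J by (simp add: flatten_mat_def M.mat_ring_simps finsum_mat_entry)
      also have "\<dots> = (\<Oplus>k\<in>I. \<Oplus>l\<in>J. U (fst p) k (snd p) l \<otimes> W k (fst p') l (snd p'))"
        by (simp add: mat_ring_simps)
      also have "\<dots> = (\<Oplus>x\<in>I \<times> J. U (fst p) (fst x) (snd p) (snd x) \<otimes> W (fst x) (fst p') (snd x) (snd p'))"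
        using I J by (intro finsum_Times[symmetric]) (auto intro!: m_closed mat_entry[OF e(1)] mat_entry[OF e(2)])
      also have "\<dots> = (flatten_mat U \<otimes>\<^bsub>mat_ring (I \<times> J) R\<^esub> flatten_mat W) p p'"
        by (simp add: mat_ring_simps flatten_mat_def)
      finally show "flatten_mat (U \<otimes>\<^bsub>mat_ring I (mat_ring J R)\<^esub> W) p p' =
        (flatten_mat U \<otimes>\<^bsub>mat_ring (I \<times> J) R\<^esub> flatten_mat W) p p'" .
    qed
  next
    show "flatten_mat \<one>\<^bsub>mat_ring I (mat_ring J R)\<^esub> = \<one>\<^bsub>mat_ring (I \<times> J) R\<^esub>"
      by (intro ext) (auto simp: flatten_mat_def mat_ring_simps M.mat_ring_simps scalar_mat_def)
  qed
qed

lemma flatten_surj: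
  "carrier (mat_ring (I \<times> J) R) \<subseteq> flatten_mat ` carrier (mat_ring I (mat_ring J R))"
proof
  fix W :: "'c \<times> 'd \<Rightarrow> 'c \<times> 'd \<Rightarrow> 'a" assume W: "W \<in> carrier (mat_ring (I \<times> J) R)"
  let ?U = "\<lambda>i i' j j'. W (i, j) (i', j')"
  have "?U i i' = \<zero>\<^bsub>mat_ring J R\<^esub>" if "i \<notin> I \<or> i' \<notin> I" for i i'
    unfolding mat_ring_simps by (intro ext mat_entry_outside[OF W]) (use that in blast)
  moreover have "?U i i' \<in> carrier (mat_ring J R)" for i i'
    using mat_entry[OF W] mat_entry_outside[OF W] unfolding mat_carrier_iff by blast
  ultimately have "?U \<in> carrier (mat_ring I (mat_ring J R))" by (simp add: mat_ring_def)
  moreover have "W = flatten_mat ?U" by (intro ext) (simp add: flatten_mat_def)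
  ultimately show "W \<in> flatten_mat ` carrier (mat_ring I (mat_ring J R))" by blast
qed

end

lemma division_component_rings:
  assumes "division_component K S \<sigma> D \<delta>"
  shows "ring D" "\<delta> \<in> ring_hom K D"
  using assms by (simp_all add: division_component_def central_division_algebra_def)

lemma flatten_scalar_mat:
  assumes "ring E"
  shows "flatten_mat (scalar_mat I (mat_ring J E) (scalar_mat J E e)) = scalar_mat (I \<times> J) E e"
  by (intro ext) (auto simp: flatten_mat_def scalar_mat_def ring.mat_ring_simps[OF assms])

text \<open>The symbol is a matrix ring over \<open>D\<close> and \<open>D \<otimes> F\<close> is a matrix ring
  over \<open>E\<close>, so \<open>u\<close> and \<open>v\<close> become block matrices over \<open>E\<close>.
  They generate all of them together with the scalars: a matrix unit whose entry is a pure tensor \<open>d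
  \<otimes> f\<close> is the image of a matrix unit over \<open>D\<close>, which is a polynomial in
  \<open>u\<close> and \<open>v\<close>, times the scalar \<open>f\<close>.\<close>
lemma symbol_in_matrices_over_component:
  fixes F :: "('f, 'o) ring_scheme" and q :: nat
  assumes K: "ring K" and F: "ring F" and \<iota>: "\<iota> \<in> ring_hom K F"
    and c: "\<zeta> \<in> carrier K" "\<alpha> \<in> carrier K" "\<beta> \<in> carrier K"
    and D: "division_component K (symbol_algebra K q \<zeta> \<alpha> \<beta>) (symbol_map K q \<zeta> \<alpha> \<beta>) D \<delta>"
    and E: "division_component F (tensor_algebra K D \<delta> F \<iota>) (tensor_map K D \<delta> F \<iota>) E \<epsilon>"
  obtains I :: "(nat \<times> nat) set" and u v where
    "finite I" "I \<noteq> {}" "u \<in> carrier (mat_ring I E)" "v \<in> carrier (mat_ring I E)"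
    "u [^]\<^bsub>mat_ring I E\<^esub> q = scalar_mat I E (\<epsilon> (\<iota> \<alpha>))"
    "v [^]\<^bsub>mat_ring I E\<^esub> q = scalar_mat I E (\<epsilon> (\<iota> \<beta>))"
    "u \<otimes>\<^bsub>mat_ring I E\<^esub> v = scalar_mat I E (\<epsilon> (\<iota> \<zeta>)) \<otimes>\<^bsub>mat_ring I E\<^esub> (v \<otimes>\<^bsub>mat_ring I E\<^esub> u)"
    "generated_by (mat_ring I E) (scalar_mat I E ` \<epsilon> ` carrier F \<union> {u, v})"
proof -
  let ?S = "symbol_algebra K q \<zeta> \<alpha> \<beta>" and ?\<sigma> = "symbol_map K q \<zeta> \<alpha> \<beta>"
  let ?T = "tensor_algebra K D \<delta> F \<iota>" and ?\<kappa> = "tensor_map K D \<delta> F \<iota>"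
  have rD: "ring D" and \<delta>: "\<delta> \<in> ring_hom K D" using division_component_rings[OF D] by auto
  have rE: "ring E" and \<epsilon>: "\<epsilon> \<in> ring_hom F E" using division_component_rings[OF E] by auto
  interpret D: ring D by fact
  interpret E: ring E by fact
  obtain r h where r: "r > 0" and h: "h \<in> ring_iso ?S (matrix_ring r D)"
    and h\<sigma>: "\<And>c. c \<in> carrier K \<Longrightarrow> h (?\<sigma> c) = scalar_matrix r D (\<delta> c)"
    using D unfolding division_component_def by blast
  obtain m g where m: "m > 0" and g: "g \<in> ring_iso ?T (matrix_ring m E)"
    and g\<kappa>: "\<And>f. f \<in> carrier F \<Longrightarrow> g (?\<kappa> f) = scalar_matrix m E (\<epsilon> f)"
    using E unfolding division_component_def by blast
  obtain us vs where S: "ring ?S" "?\<sigma> \<in> ring_hom K ?S" "us \<in> carrier ?S" "vs \<in> carrier ?S"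
    "us [^]\<^bsub>?S\<^esub> q = ?\<sigma> \<alpha>" "vs [^]\<^bsub>?S\<^esub> q = ?\<sigma> \<beta>" "us \<otimes>\<^bsub>?S\<^esub> vs = ?\<sigma> \<zeta> \<otimes>\<^bsub>?S\<^esub> (vs \<otimes>\<^bsub>?S\<^esub> us)"
    "generated_by ?S (?\<sigma> ` carrier K \<union> {us, vs})"
    by (rule symbol_algebra_presentation[OF K c, of q])
  obtain \<tau> where T: "ring ?T" "\<tau> \<in> ring_hom D ?T" "?\<kappa> \<in> ring_hom F ?T"
    "\<forall>c\<in>carrier K. \<tau> (\<delta> c) = ?\<kappa> (\<iota> c)"
    "\<forall>P. (\<forall>d\<in>carrier D. \<forall>f\<in>carrier F. P (\<tau> d \<otimes>\<^bsub>?T\<^esub> ?\<kappa> f)) \<longrightarrow>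
       (\<forall>x\<in>carrier ?T. \<forall>y\<in>carrier ?T. P x \<longrightarrow> P y \<longrightarrow> P (x \<oplus>\<^bsub>?T\<^esub> y)) \<longrightarrow> (\<forall>t\<in>carrier ?T. P t)"
    by (rule tensor_algebra_generators[OF K rD F \<delta> \<iota>])
  note T_ind = T(5)[rule_format, rotated -1]
  define I0 J where "I0 = {..<r}" and "J = {..<m}"
  have fin: "finite I0" "finite J" and ne: "I0 \<times> J \<noteq> {}" using r m by (auto simp: I0_def J_def)
  define T' where "T' = mat_ring J E"
  define M where "M = mat_ring (I0 \<times> J) E"
  let ?s = "scalar_mat (I0 \<times> J) E"
  have rT': "ring T'" unfolding T'_def by (rule E.mat_ring_is_ring[OF fin(2)])
  interpret T': ring T' by (rule rT')
  have rM: "ring M" unfolding M_def by (rule E.mat_ring_is_ring) (simp add: fin)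
  interpret M: ring M by (rule rM)
  have hD: "h \<in> ring_hom ?S (mat_ring I0 D)" and hsurj: "h ` carrier ?S = carrier (mat_ring I0 D)"
    using h unfolding matrix_ring_eq_mat_ring I0_def ring_iso_def bij_betw_def by auto
  have gT: "g \<in> ring_hom ?T T'" and gsurj: "g ` carrier ?T = carrier T'"
    using g unfolding matrix_ring_eq_mat_ring T'_def J_def ring_iso_def bij_betw_def by auto
  have g\<kappa>': "g (?\<kappa> f) = scalar_mat J E (\<epsilon> f)" if "f \<in> carrier F" for f
    using g\<kappa>[OF that] by (simp add: scalar_matrix_eq_scalar_mat J_def)
  define G where "G d = g (\<tau> d)" for d
  have G: "G \<in> ring_hom D T'"
    using ring_hom_trans[OF T(2) gT] by (simp add: G_def[abs_def] o_def)
  have G0: "G \<zero>\<^bsub>D\<^esub> = \<zero>\<^bsub>T'\<^esub>" by (rule ring_hom_zero[OF G rD rT'])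
  define \<Phi> where "\<Phi> U = flatten_mat (\<lambda>i j. G (U i j))" for U :: "nat \<Rightarrow> nat \<Rightarrow> _"
  have fl: "flatten_mat \<in> ring_hom (mat_ring I0 T') M"
    using E.flatten_hom[OF fin] by (simp add: T'_def M_def)
  have \<Phi>: "\<Phi> \<in> ring_hom (mat_ring I0 D) M"
    using ring_hom_trans[OF map_mat_hom[OF rD rT' fin(1) G] fl] by (simp add: \<Phi>_def[abs_def] o_def)
  define \<Theta> where "\<Theta> s = \<Phi> (h s)" for s
  have \<Theta>: "\<Theta> \<in> ring_hom ?S M"
    using ring_hom_trans[OF hD \<Phi>] by (simp add: \<Theta>_def[abs_def] o_def)
  have \<Theta>\<sigma>: "\<Theta> (?\<sigma> c) = ?s (\<epsilon> (\<iota> c))" if c: "c \<in> carrier K" for c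
  proof -
    have "G (\<delta> c) = scalar_mat J E (\<epsilon> (\<iota> c))"
      using bspec[OF T(4) c] g\<kappa>'[OF ring_hom_closed[OF \<iota> c]] by (simp add: G_def)
    then have "(\<lambda>i j. G (scalar_mat I0 D (\<delta> c) i j)) = scalar_mat I0 T' (scalar_mat J E (\<epsilon> (\<iota> c)))"
      by (intro ext) (auto simp: scalar_mat_def[of I0] G0)
    then show ?thesis
      using h\<sigma>[OF c] unfolding \<Theta>_def \<Phi>_def
      by (simp add: scalar_matrix_eq_scalar_mat I0_def[symmetric] T'_def flatten_scalar_mat[OF rE])
  qed
  have sM: "?s e \<in> carrier M" if "e \<in> carrier E" for e
    unfolding M_def by (rule E.scalar_mat_carrier[OF that])
  show ?thesis
  proof (rule that[of "I0 \<times> J" "\<Theta> us" "\<Theta> vs", folded M_def])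
    show "finite (I0 \<times> J)" using fin by simp
    show "I0 \<times> J \<noteq> {}" by fact
    show uv: "\<Theta> us \<in> carrier M" "\<Theta> vs \<in> carrier M" using ring_hom_closed[OF \<Theta>] S by auto
    show "\<Theta> us [^]\<^bsub>M\<^esub> q = ?s (\<epsilon> (\<iota> \<alpha>))"
      using ring_hom_nat_pow[OF \<Theta> S(1) rM S(3), of q] by (simp add: S(5) \<Theta>\<sigma> c)
    show "\<Theta> vs [^]\<^bsub>M\<^esub> q = ?s (\<epsilon> (\<iota> \<beta>))"
      using ring_hom_nat_pow[OF \<Theta> S(1) rM S(4), of q] by (simp add: S(6) \<Theta>\<sigma> c)
    have cl: "?\<sigma> \<zeta> \<in> carrier ?S" "vs \<otimes>\<^bsub>?S\<^esub> us \<in> carrier ?S"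
      using ring_hom_closed[OF S(2) c(1)] S(3,4) ring.ring_simprules(5)[OF S(1)] by auto
    show "\<Theta> us \<otimes>\<^bsub>M\<^esub> \<Theta> vs = ?s (\<epsilon> (\<iota> \<zeta>)) \<otimes>\<^bsub>M\<^esub> (\<Theta> vs \<otimes>\<^bsub>M\<^esub> \<Theta> us)"
      unfolding ring_hom_mult[OF \<Theta> S(3,4), symmetric] S(7) ring_hom_mult[OF \<Theta> cl]
        ring_hom_mult[OF \<Theta> S(4,3)] \<Theta>\<sigma>[OF c(1)] ..
    show "generated_by M (?s ` \<epsilon> ` carrier F \<union> {\<Theta> us, \<Theta> vs})"
      unfolding generated_by_def
    proof (intro conjI allI impI)
      show "?s ` \<epsilon> ` carrier F \<union> {\<Theta> us, \<Theta> vs} \<subseteq> carrier M"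
        using uv sM ring_hom_closed[OF \<epsilon>] by blast
      fix C assume gen: "?s ` \<epsilon> ` carrier F \<union> {\<Theta> us, \<Theta> vs} \<subseteq> C"
        and cl: "\<forall>x\<in>C \<inter> carrier M. \<forall>y\<in>C \<inter> carrier M. x \<oplus>\<^bsub>M\<^esub> y \<in> C \<and> x \<otimes>\<^bsub>M\<^esub> y \<in> C"
      have sC: "?s (\<epsilon> f) \<in> C" if "f \<in> carrier F" for f using gen that by blast
      have c1: "\<Theta> s \<in> C" if "s \<in> carrier ?S" for s
        using S(8) that
      proof (induction rule: generated_by_induct)
        case (gen x)
        then consider c where "c \<in> carrier K" "x = ?\<sigma> c" | "x = us" | "x = vs" by blast
        then show ?case
        proof cases
          case (1 c)
          then show ?thesis using \<Theta>\<sigma> sC ring_hom_closed[OF \<iota>] by simp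
        qed (use \<open>_ \<subseteq> C\<close> in simp_all)
      next
        case (add x y)
        then show ?case using cl ring_hom_closed[OF \<Theta>] by (simp add: ring_hom_add[OF \<Theta>])
      next
        case (mult x y)
        then show ?case using cl ring_hom_closed[OF \<Theta>] by (simp add: ring_hom_mult[OF \<Theta>])
      qed
      have c2: "\<Phi> U \<in> C" if U: "U \<in> carrier (mat_ring I0 D)" for U
      proof -
        obtain s where "s \<in> carrier ?S" "U = h s" using U hsurj by blast
        then show ?thesis using c1 by (simp add: \<Theta>_def)
      qed
      have flc: "flatten_mat U \<in> carrier M" if "U \<in> carrier (mat_ring I0 T')" for U
        using ring_hom_closed[OF fl that] .
      have c3: "flatten_mat (unit_mat T' i j t) \<in> C" if t: "t \<in> carrier T'" and ij: "i \<in> I0" "j \<in> I0" for i j t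
      proof -
        obtain t' where t': "t' \<in> carrier ?T" "t = g t'" using t gsurj by blast
        have "flatten_mat (unit_mat T' i j (g t')) \<in> C"
        proof (rule T_ind[OF t'(1)])
          fix d f assume df: "d \<in> carrier D" "f \<in> carrier F"
          let ?U = "\<lambda>a b. G (unit_mat D i j d a b)"
          let ?e = "scalar_mat J E (\<epsilon> f)"
          have e: "\<epsilon> f \<in> carrier E" using df ring_hom_closed[OF \<epsilon>] by blast
          have e': "?e \<in> carrier T'" unfolding T'_def by (rule E.scalar_mat_carrier[OF e])
          have U: "?U \<in> carrier (mat_ring I0 T')"
            by (rule ring_hom_closed[OF map_mat_hom[OF rD rT' fin(1) G] D.unit_mat_carrier[OF df(1) ij]])
          have Gd: "G d \<in> carrier T'" using ring_hom_closed[OF G df(1)] .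
          have "g (\<tau> d \<otimes>\<^bsub>?T\<^esub> ?\<kappa> f) = G d \<otimes>\<^bsub>T'\<^esub> ?e"
            using ring_hom_mult[OF gT ring_hom_closed[OF T(2) df(1)] ring_hom_closed[OF T(3) df(2)]] g\<kappa>'[OF df(2)]
            by (simp add: G_def)
          then have "unit_mat T' i j (g (\<tau> d \<otimes>\<^bsub>?T\<^esub> ?\<kappa> f)) = ?U \<otimes>\<^bsub>mat_ring I0 T'\<^esub> scalar_mat I0 T' ?e"
            unfolding T'.scalar_mat_mult(2)[OF fin(1) e' U]
            using e' Gd by (intro ext) (simp add: unit_mat_def G0)
          then have "flatten_mat (unit_mat T' i j (g (\<tau> d \<otimes>\<^bsub>?T\<^esub> ?\<kappa> f))) = \<Phi> (unit_mat D i j d) \<otimes>\<^bsub>M\<^esub> ?s (\<epsilon> f)"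
            using ring_hom_mult[OF fl U T'.scalar_mat_carrier[OF e']] flatten_scalar_mat[OF rE, of I0 J "\<epsilon> f"]
            by (simp add: \<Phi>_def T'_def)
          then show "flatten_mat (unit_mat T' i j (g (\<tau> d \<otimes>\<^bsub>?T\<^esub> ?\<kappa> f))) \<in> C"
            using cl c2[OF D.unit_mat_carrier[OF df(1) ij]] sC[OF df(2)] sM[OF e]
              ring_hom_closed[OF \<Phi> D.unit_mat_carrier[OF df(1) ij]] by simp
        next
          fix x y assume xy: "x \<in> carrier ?T" "y \<in> carrier ?T"
            "flatten_mat (unit_mat T' i j (g x)) \<in> C" "flatten_mat (unit_mat T' i j (g y)) \<in> C"
          have gc: "g x \<in> carrier T'" "g y \<in> carrier T'" using xy ring_hom_closed[OF gT] by auto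
          note uc = T'.unit_mat_carrier[OF gc(1) ij] T'.unit_mat_carrier[OF gc(2) ij]
          have "unit_mat T' i j (g (x \<oplus>\<^bsub>?T\<^esub> y)) =
              unit_mat T' i j (g x) \<oplus>\<^bsub>mat_ring I0 T'\<^esub> unit_mat T' i j (g y)"
            using gc xy by (intro ext) (simp add: T'.mat_ring_simps unit_mat_def ring_hom_add[OF gT])
          then show "flatten_mat (unit_mat T' i j (g (x \<oplus>\<^bsub>?T\<^esub> y))) \<in> C"
            using xy cl flc uc by (simp add: ring_hom_add[OF fl])
        qed
        then show ?thesis using t' by simp
      qed
      have c4: "flatten_mat U \<in> C" if "U \<in> carrier (mat_ring I0 T')" for U
        using fin(1) that
      proof (induction rule: T'.mat_induct)
        case zero
        have z: "\<epsilon> \<zero>\<^bsub>F\<^esub> = \<zero>\<^bsub>E\<^esub>" by (rule ring_hom_zero[OF \<epsilon> F rE])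
        have "flatten_mat \<zero>\<^bsub>mat_ring I0 T'\<^esub> = ?s (\<epsilon> \<zero>\<^bsub>F\<^esub>)"
          by (intro ext) (simp add: flatten_mat_def T'.mat_ring_simps scalar_mat_def z, simp add: T'_def E.mat_ring_simps)
        then show ?case using sC ring.ring_simprules(2)[OF F] by simp
      next
        case (unit i j d)
        then show ?case using c3 by simp
      next
        case (add U W)
        then show ?case using cl flc by (simp add: ring_hom_add[OF fl])
      qed
      show "carrier M \<subseteq> C"
        using E.flatten_surj[of I0 J] c4 unfolding M_def T'_def by blast
    qed
  qed
qed

section \<open>Elements satisfying the relations of a symbol\<close>

text \<open>Elements \<open>u\<close> and \<open>v\<close> of an algebra over a central field \<open>Z\<close>
  that satisfy the relations of the symbol \<open>(\<alpha>, \<beta>)\<close>. The algebra may be larger than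
  the one they generate; it is used both for a matrix ring over a division algebra and for the division
  algebra.\<close>
locale symbol_relations = ring M for M (structure) +
  fixes Z :: "'a set" and u v \<zeta> \<alpha> \<beta> :: 'a and q :: nat
  assumes subfield_Z: "subfield Z M"
    and central: "z \<in> Z \<Longrightarrow> x \<in> carrier M \<Longrightarrow> x \<otimes> z = z \<otimes> x"
    and u [simp]: "u \<in> carrier M" and v [simp]: "v \<in> carrier M"
    and \<zeta>: "\<zeta> \<in> Z" and \<alpha>: "\<alpha> \<in> Z" "\<alpha> \<noteq> \<zero>" and \<beta>: "\<beta> \<in> Z" "\<beta> \<noteq> \<zero>"
    and upow: "u [^] q = \<alpha>" and vpow: "v [^] q = \<beta>" and uv: "u \<otimes> v = \<zeta> \<otimes> (v \<otimes> u)"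
    and q: "0 < q" and \<zeta>q: "\<zeta> [^] q = \<one>" and prim: "0 < k \<Longrightarrow> k < q \<Longrightarrow> \<zeta> [^] k \<noteq> \<one>"
    and q_nonzero: "[q] \<cdot> \<one> \<noteq> \<zero>"
begin

lemma subring_Z: "subring Z M" using subfieldE(1)[OF subfield_Z] .

lemma Z_carrier [simp]: "z \<in> Z \<Longrightarrow> z \<in> carrier M"
  using subringE(1)[OF subring_Z] by blast

lemma Z_closed [simp]:
  "\<zero> \<in> Z" "\<one> \<in> Z" "x \<in> Z \<Longrightarrow> y \<in> Z \<Longrightarrow> x \<otimes> y \<in> Z" "x \<in> Z \<Longrightarrow> y \<in> Z \<Longrightarrow> x \<oplus> y \<in> Z"
  "x \<in> Z \<Longrightarrow> \<ominus> x \<in> Z"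
  using subringE[OF subring_Z] by auto

lemma Z_pow [simp]: "x \<in> Z \<Longrightarrow> x [^] (n::nat) \<in> Z"
  by (induction n) auto

lemma \<zeta>_carrier [simp]: "\<zeta> \<in> carrier M" "\<alpha> \<in> carrier M" "\<beta> \<in> carrier M"
  using \<zeta> \<alpha> \<beta> by auto

lemma Z_inverse: "z \<in> Z \<Longrightarrow> z \<noteq> \<zero> \<Longrightarrow> \<exists>w\<in>Z. w \<otimes> z = \<one>"
  using subfield_m_inv[OF subfield_Z, of z] by blast

lemma Z_cancel:
  assumes "z \<in> Z" "z \<noteq> \<zero>" "x \<in> carrier M" "z \<otimes> x = \<zero>"
  shows "x = \<zero>"
proof -
  obtain w where w: "w \<in> Z" "w \<otimes> z = \<one>" using Z_inverse assms by blast
  have "x = w \<otimes> (z \<otimes> x)" using w assms(1,3) by (simp add: m_assoc[symmetric])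
  then show ?thesis using assms(4) w by simp
qed

lemma left_comm: "z \<in> Z \<Longrightarrow> x \<in> carrier M \<Longrightarrow> y \<in> carrier M \<Longrightarrow> x \<otimes> (z \<otimes> y) = z \<otimes> (x \<otimes> y)"
  using central[of z x] by (simp add: m_assoc[symmetric])

lemma one_nonzero: "\<one> \<noteq> \<zero>" using subfieldE(6)[OF subfield_Z] by simp

lemma \<zeta>_pow_q_mult [simp]: "\<zeta> [^] (q * n) = \<one>"
  using nat_pow_pow[of \<zeta> q n] by (simp add: \<zeta>q)

lemma \<zeta>_pow_eq_one_iff: "\<zeta> [^] n = \<one> \<longleftrightarrow> q dvd n"
proof -
  have "\<zeta> [^] n = \<zeta> [^] (q * (n div q) + n mod q)" by simp
  also have "\<dots> = \<zeta> [^] (q * (n div q)) \<otimes> \<zeta> [^] (n mod q)" by (rule nat_pow_mult[symmetric]) simp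
  also have "\<dots> = \<zeta> [^] (n mod q)" by simp
  finally have "\<zeta> [^] n = \<zeta> [^] (n mod q)" .
  moreover have "\<zeta> [^] (n mod q) = \<one> \<longleftrightarrow> n mod q = 0"
    using prim[of "n mod q"] q by (cases "n mod q = 0") auto
  ultimately show ?thesis by (simp add: dvd_eq_mod_eq_0)
qed

lemma geometric_sum:
  assumes "z \<in> carrier M"
  shows "z \<otimes> (\<Oplus>a\<in>{..<n::nat}. z [^] a) \<oplus> \<one> = (\<Oplus>a\<in>{..<n}. z [^] a) \<oplus> z [^] n"
proof (induction n)
  case 0
  show ?case using assms by simp
next
  case (Suc n)
  let ?S = "\<Oplus>a\<in>{..<n}. z [^] a"
  have S: "?S \<in> carrier M" using assms by (intro finsum_closed) auto
  have step: "(\<Oplus>a\<in>{..<Suc n}. z [^] a) = z [^] n \<oplus> ?S"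
    unfolding lessThan_Suc using assms by (intro finsum_insert) auto
  have "z \<otimes> (z [^] n \<oplus> ?S) \<oplus> \<one> = z [^] Suc n \<oplus> (z \<otimes> ?S \<oplus> \<one>)"
    using assms S nat_pow_Suc2[OF assms, of n] by (simp add: r_distr a_assoc)
  also have "\<dots> = z [^] Suc n \<oplus> (?S \<oplus> z [^] n)" using Suc by simp
  also have "\<dots> = (z [^] n \<oplus> ?S) \<oplus> z [^] Suc n"
    using assms S by (simp add: a_ac)
  finally show ?case unfolding step .
qed

lemma sum_pow_\<zeta>: "(\<Oplus>a\<in>{..<q}. (\<zeta> [^] (n::nat)) [^] a) = (if q dvd n then [q] \<cdot> \<one> else \<zero>)"
proof (cases "q dvd n")
  case True
  then have "\<zeta> [^] n = \<one>" by (simp add: \<zeta>_pow_eq_one_iff)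
  then have "(\<Oplus>a\<in>{..<q}. (\<zeta> [^] n) [^] a) = (\<Oplus>a\<in>{..<q}. \<one>)" by simp
  also have "\<dots> = [q] \<cdot> \<one>" using add.finprod_const[of \<one> "{..<q}"] by simp
  finally show ?thesis using True by simp
next
  case False
  let ?z = "\<zeta> [^] n" and ?S = "\<Oplus>a\<in>{..<q}. (\<zeta> [^] n) [^] a"
  have z: "?z \<in> Z" using \<zeta> by simp
  have S: "?S \<in> carrier M" by (intro finsum_closed) auto
  have "?z [^] q = \<one>"
    using nat_pow_pow[of \<zeta> n q] \<zeta>_pow_q_mult[of n] by (simp add: mult.commute[of n q])
  then have "?z \<otimes> ?S \<oplus> \<one> = ?S \<oplus> \<one>" using geometric_sum[of ?z q] by simp
  then have "?z \<otimes> ?S = ?S" using S by (simp add: add.r_cancel)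
  then have "(?z \<ominus> \<one>) \<otimes> ?S = \<zero>" using S by (simp add: l_distr minus_eq l_minus r_neg)
  moreover have "?z \<ominus> \<one> \<noteq> \<zero>" using False by (simp add: \<zeta>_pow_eq_one_iff)
  moreover have "?z \<ominus> \<one> \<in> Z" using z by (simp add: minus_eq)
  ultimately have "?S = \<zero>" using Z_cancel S by blast
  then show ?thesis using False by simp
qed

subsection \<open>The monomials\<close>

lemma u_vpow: "u \<otimes> v [^] (j::nat) = \<zeta> [^] j \<otimes> (v [^] j \<otimes> u)"
proof (induction j)
  case (Suc j)
  have "u \<otimes> v [^] Suc j = (u \<otimes> v [^] j) \<otimes> v" by (simp add: m_assoc)
  also have "\<dots> = \<zeta> [^] j \<otimes> (v [^] j \<otimes> (u \<otimes> v))" using Suc by (simp add: m_assoc)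
  also have "\<dots> = \<zeta> [^] j \<otimes> (\<zeta> \<otimes> (v [^] j \<otimes> (v \<otimes> u)))"
    unfolding uv using \<zeta> by (simp add: left_comm)
  finally show ?case by (simp add: m_assoc)
qed simp

lemma upow_vpow: "u [^] (a::nat) \<otimes> v [^] (j::nat) = \<zeta> [^] (a * j) \<otimes> (v [^] j \<otimes> u [^] a)"
proof (induction a)
  case (Suc a)
  have "u [^] Suc a \<otimes> v [^] j = u [^] a \<otimes> (u \<otimes> v [^] j)" by (simp add: m_assoc)
  also have "\<dots> = \<zeta> [^] j \<otimes> (u [^] a \<otimes> v [^] j \<otimes> u)"
    unfolding u_vpow using \<zeta> by (simp add: left_comm m_assoc)
  also have "\<dots> = \<zeta> [^] j \<otimes> \<zeta> [^] (a * j) \<otimes> (v [^] j \<otimes> (u [^] a \<otimes> u))"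
    unfolding Suc by (simp add: m_assoc)
  also have "\<zeta> [^] j \<otimes> \<zeta> [^] (a * j) = \<zeta> [^] (Suc a * j)" by (simp add: nat_pow_mult)
  finally show ?case by simp
qed simp

text \<open>The inverse of \<open>\<zeta>\<close> is written as the power \<open>\<zeta>\<^bsup>q -
  1\<^esup>\<close>.\<close>
lemma vpow_upow: "v [^] (j::nat) \<otimes> u [^] (a::nat) = \<zeta> [^] ((q - 1) * a * j) \<otimes> (u [^] a \<otimes> v [^] j)"
proof -
  have e: "(q - 1) * a * j + a * j = q * (a * j)" using q by (cases q) (simp_all add: algebra_simps)
  have "\<zeta> [^] ((q - 1) * a * j) \<otimes> (u [^] a \<otimes> v [^] j) =
      \<zeta> [^] ((q - 1) * a * j) \<otimes> \<zeta> [^] (a * j) \<otimes> (v [^] j \<otimes> u [^] a)"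
    unfolding upow_vpow by (simp add: m_assoc)
  also have "\<zeta> [^] ((q - 1) * a * j) \<otimes> \<zeta> [^] (a * j) = \<one>"
    unfolding nat_pow_mult[OF \<zeta>_carrier(1)] e by simp
  finally show ?thesis by simp
qed

definition mon :: "nat \<Rightarrow> nat \<Rightarrow> 'a" where "mon i j = u [^] i \<otimes> v [^] j"

lemma mon_carrier [simp]: "mon i j \<in> carrier M" by (simp add: mon_def)

lemma mon_reduce:
  "mon i j = \<alpha> [^] (i div q) \<otimes> \<beta> [^] (j div q) \<otimes> mon (i mod q) (j mod q)"
proof -
  have r: "w [^] (n::nat) = (w [^] q) [^] (n div q) \<otimes> w [^] (n mod q)" if "w \<in> carrier M" for w n
    using that by (simp add: nat_pow_pow nat_pow_mult)
  have "mon i j = (\<alpha> [^] (i div q) \<otimes> u [^] (i mod q)) \<otimes> (\<beta> [^] (j div q) \<otimes> v [^] (j mod q))"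
    unfolding mon_def r[OF u, of i] r[OF v, of j] upow vpow ..
  also have "\<dots> = \<alpha> [^] (i div q) \<otimes> (\<beta> [^] (j div q) \<otimes> (u [^] (i mod q) \<otimes> v [^] (j mod q)))"
    using left_comm[of "\<beta> [^] (j div q)" "u [^] (i mod q)"] \<beta>(1) by (simp add: m_assoc)
  finally show ?thesis by (simp add: mon_def m_assoc)
qed

lemma mon_mult: "mon i j \<otimes> mon k l = \<zeta> [^] ((q - 1) * k * j) \<otimes> mon (i + k) (j + l)"
proof -
  have "mon i j \<otimes> mon k l = u [^] i \<otimes> (v [^] j \<otimes> u [^] k) \<otimes> v [^] l" by (simp add: mon_def m_assoc)
  also have "\<dots> = \<zeta> [^] ((q - 1) * k * j) \<otimes> (u [^] i \<otimes> u [^] k \<otimes> (v [^] j \<otimes> v [^] l))"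
    unfolding vpow_upow using left_comm[of "\<zeta> [^] ((q - 1) * k * j)"] \<zeta> by (simp add: m_assoc)
  finally show ?thesis by (simp add: mon_def nat_pow_mult)
qed

text \<open>An inverse of \<open>u\<close> is \<open>\<alpha>\<^bsup>-1\<^esup> u\<^bsup>q - 1\<^esup>\<close>,
  and similarly for \<open>v\<close>, so that any multiplicative set containing \<open>u\<close>,
  \<open>v\<close> and the scalars contains the inverses.\<close>
lemma mon_unit:
  assumes "subring Q M" "Q \<subseteq> Z" "u \<in> L" "v \<in> L" "Q \<subseteq> L" "\<And>x y. x \<in> L \<Longrightarrow> y \<in> L \<Longrightarrow> x \<otimes> y \<in> L"
    and a: "a \<in> Q" "a \<otimes> \<alpha> = \<one>" and b: "b \<in> Q" "b \<otimes> \<beta> = \<one>"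
  shows "\<exists>w\<in>L. w \<otimes> mon i j = \<one> \<and> mon i j \<otimes> w = \<one>"
proof -
  have one: "\<one> \<in> L" using subringE(3)[OF assms(1)] assms(5) by blast
  have pw: "x [^] (n::nat) \<in> L" if "x \<in> L" for x n
    using that by (induction n) (auto simp: one assms(6))
  have aZ: "a \<in> Z" "b \<in> Z" using a b assms(2) by auto
  have powinv: "\<exists>w\<in>L. w \<in> carrier M \<and> w \<otimes> x [^] n = \<one> \<and> x [^] n \<otimes> w = \<one>"
    if x: "x \<in> L" "x \<in> carrier M" "c \<in> Q" "c \<in> Z" "c \<otimes> x [^] q = \<one>" for x c and n :: nat
  proof -
    let ?y = "c \<otimes> x [^] (q - 1)"
    have y: "?y \<in> L" "?y \<in> carrier M" using x assms(5,6) pw by auto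
    have "x [^] (q - 1) \<otimes> x = x [^] q" using q by (cases q) auto
    then have 1: "?y \<otimes> x = \<one>" using x by (simp add: m_assoc)
    have "x \<otimes> x [^] (q - 1) = x [^] q" using q x nat_pow_Suc2[of x "q - 1"] by simp
    then have 2: "x \<otimes> ?y = \<one>" using x by (simp add: left_comm)
    have "?y [^] n \<otimes> x [^] n = \<one>"
    proof (induction n)
      case (Suc n)
      have "?y [^] Suc n \<otimes> x [^] Suc n = ?y [^] n \<otimes> (?y \<otimes> x) \<otimes> x [^] n"
        using y x nat_pow_Suc2[of x n] by (simp add: m_assoc del: )
      then show ?case using 1 Suc y by simp
    qed simp
    moreover have "x [^] n \<otimes> ?y [^] n = \<one>"
    proof (induction n)
      case (Suc n)
      have "x [^] Suc n \<otimes> ?y [^] Suc n = x [^] n \<otimes> (x \<otimes> ?y) \<otimes> ?y [^] n"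
        using y x nat_pow_Suc2[of ?y n] by (simp add: m_assoc)
      then show ?case using 2 Suc x by simp
    qed simp
    ultimately show ?thesis using pw[OF y(1), of n] y by blast
  qed
  obtain wu where wu: "wu \<in> L" "wu \<in> carrier M" "wu \<otimes> u [^] i = \<one>" "u [^] i \<otimes> wu = \<one>"
    using powinv[of u a i] assms a aZ upow by auto
  obtain wv where wv: "wv \<in> L" "wv \<in> carrier M" "wv \<otimes> v [^] j = \<one>" "v [^] j \<otimes> wv = \<one>"
    using powinv[of v b j] assms b aZ vpow by auto
  have "wv \<otimes> wu \<otimes> mon i j = wv \<otimes> (wu \<otimes> u [^] i) \<otimes> v [^] j"
    using wu(2) wv(2) by (simp add: mon_def m_assoc)
  moreover have "mon i j \<otimes> (wv \<otimes> wu) = u [^] i \<otimes> (v [^] j \<otimes> wv) \<otimes> wu"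
    using wu(2) wv(2) by (simp add: mon_def m_assoc)
  ultimately show ?thesis using wu wv assms(6)[OF wv(1) wu(1)] by (intro bexI[of _ "wv \<otimes> wu"]) simp_all
qed

subsection \<open>Combinations of monomials\<close>

text \<open>Exponents below \<open>q\<close> suffice, since \<open>u\<^sup>q\<close> and
  \<open>v\<^sup>q\<close> are scalars.\<close>
definition idx :: "(nat \<times> nat) set" where "idx = {..<q} \<times> {..<q}"

definition comb :: "(nat \<times> nat \<Rightarrow> 'a) \<Rightarrow> 'a" where
  "comb c = (\<Oplus>p\<in>idx. c p \<otimes> mon (fst p) (snd p))"

definition combs :: "'a set \<Rightarrow> 'a set" where "combs Q = comb ` (idx \<rightarrow> Q)"

lemma idx_finite [simp]: "finite idx" by (simp add: idx_def)

lemma comb_carrier [simp]: "c \<in> idx \<rightarrow> Z \<Longrightarrow> comb c \<in> carrier M"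
  unfolding comb_def by (intro finsum_closed) (auto simp: Pi_iff)

lemma comb_single:
  assumes "(i, j) \<in> idx" "z \<in> Z"
  shows "comb (\<lambda>p. if p = (i, j) then z else \<zero>) = z \<otimes> mon i j"
proof -
  have "comb (\<lambda>p. if p = (i, j) then z else \<zero>) =
      (\<Oplus>p\<in>idx. if p = (i, j) then z \<otimes> mon (fst p) (snd p) else \<zero>)"
    unfolding comb_def using assms by (intro finsum_cong') auto
  also have "\<dots> = z \<otimes> mon i j" using assms by (subst finsum_delta) auto
  finally show ?thesis .
qed

lemma combs_add:
  assumes "subring Q M" "Q \<subseteq> Z" "x \<in> combs Q" "y \<in> combs Q"
  shows "x \<oplus> y \<in> combs Q"
proof -
  obtain c d where c: "c \<in> idx \<rightarrow> Q" "x = comb c" and d: "d \<in> idx \<rightarrow> Q" "y = comb d"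
    using assms unfolding combs_def by blast
  have cZ: "p \<in> idx \<Longrightarrow> c p \<in> carrier M" "p \<in> idx \<Longrightarrow> d p \<in> carrier M" for p
    using c d assms(2) by auto
  have "comb (\<lambda>p. c p \<oplus> d p) = (\<Oplus>p\<in>idx. c p \<otimes> mon (fst p) (snd p) \<oplus> d p \<otimes> mon (fst p) (snd p))"
    unfolding comb_def using cZ by (intro finsum_cong') (auto simp: l_distr)
  also have "\<dots> = x \<oplus> y"
    unfolding c d comb_def using cZ by (intro finsum_addf) auto
  finally have "x \<oplus> y = comb (\<lambda>p. c p \<oplus> d p)" ..
  moreover have "(\<lambda>p. c p \<oplus> d p) \<in> idx \<rightarrow> Q" using c d subringE(7)[OF assms(1)] by auto
  ultimately show ?thesis unfolding combs_def by blast
qed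

lemma combs_single:
  assumes "subring Q M" "Q \<subseteq> Z" "(i, j) \<in> idx" "z \<in> Q"
  shows "z \<otimes> mon i j \<in> combs Q"
proof -
  have "comb (\<lambda>p. if p = (i, j) then z else \<zero>) = z \<otimes> mon i j"
    using assms by (intro comb_single) auto
  moreover have "(\<lambda>p. if p = (i, j) then z else \<zero>) \<in> idx \<rightarrow> Q"
    using assms subringE(2)[OF assms(1)] by auto
  ultimately show ?thesis unfolding combs_def by (metis imageI)
qed

lemma combs_induct [consumes 3, case_names single add]:
  assumes Q: "subring Q M" "Q \<subseteq> Z" and x: "x \<in> combs Q"
    and single: "\<And>z i j. z \<in> Q \<Longrightarrow> (i, j) \<in> idx \<Longrightarrow> P (z \<otimes> mon i j)"
    and add: "\<And>x y. x \<in> combs Q \<Longrightarrow> y \<in> combs Q \<Longrightarrow> P x \<Longrightarrow> P y \<Longrightarrow> P (x \<oplus> y)"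
  shows "P x"
proof -
  obtain c where c: "c \<in> idx \<rightarrow> Q" "x = comb c" using x unfolding combs_def by blast
  have 00: "(0, 0) \<in> idx" using q by (simp add: idx_def)
  have z: "\<zero> \<in> combs Q" "P \<zero>"
    using combs_single[OF Q 00 subringE(2)[OF Q(1)]] single[OF subringE(2)[OF Q(1)] 00] by simp_all
  have tc: "c p \<otimes> mon (fst p) (snd p) \<in> carrier M" if "p \<in> idx" for p
    using c(1) Q(2) that by (intro m_closed mon_carrier Z_carrier) auto
  have "(\<Oplus>p\<in>A. c p \<otimes> mon (fst p) (snd p)) \<in> combs Q \<and> P (\<Oplus>p\<in>A. c p \<otimes> mon (fst p) (snd p))"
    if "finite A" "A \<subseteq> idx" for A
    using that
  proof (induction A rule: finite_induct)
    case (insert p A)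
    have p: "c p \<in> Q" "(fst p, snd p) \<in> idx" using insert c by auto
    have "(\<Oplus>p\<in>insert p A. c p \<otimes> mon (fst p) (snd p)) =
        c p \<otimes> mon (fst p) (snd p) \<oplus> (\<Oplus>p\<in>A. c p \<otimes> mon (fst p) (snd p))"
      using insert tc by (intro finsum_insert) (auto simp del: m_closed)
    then show ?case using insert add combs_add[OF Q] single[OF p] combs_single[OF Q p(2,1)] by simp
  qed (use z in simp)
  then show ?thesis using c(2) by (simp add: comb_def)
qed

lemma combs_carrier: "Q \<subseteq> Z \<Longrightarrow> combs Q \<subseteq> carrier M"
  unfolding combs_def by (auto intro!: comb_carrier)

lemma combs_mon:
  assumes Q: "subring Q M" "Q \<subseteq> Z" and c: "\<alpha> \<in> Q" "\<beta> \<in> Q" and z: "z \<in> Q"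
  shows "z \<otimes> mon i j \<in> combs Q"
proof -
  have pw: "x [^] (n::nat) \<in> Q" if "x \<in> Q" for x n
    using that by (induction n) (auto intro: subringE[OF Q(1)])
  have zc: "z \<in> carrier M" using z Q(2) by auto
  have "z \<otimes> mon i j = (z \<otimes> (\<alpha> [^] (i div q) \<otimes> \<beta> [^] (j div q))) \<otimes> mon (i mod q) (j mod q)"
    using zc by (subst mon_reduce) (simp add: m_assoc)
  then show ?thesis
    using pw c z q subringE(6)[OF Q(1)] by (auto simp: idx_def intro!: combs_single[OF Q])
qed

lemma combs_mult:
  assumes Q: "subring Q M" "Q \<subseteq> Z" and c: "\<zeta> \<in> Q" "\<alpha> \<in> Q" "\<beta> \<in> Q"
    and x: "x \<in> combs Q" and y: "y \<in> combs Q"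
  shows "x \<otimes> y \<in> combs Q"
proof -
  have pw: "x [^] (n::nat) \<in> Q" if "x \<in> Q" for x n
    using that by (induction n) (auto intro: subringE[OF Q(1)])
  have cc: "w \<in> carrier M" if "w \<in> combs Q" for w using that combs_carrier[OF Q(2)] by blast
  have Oc: "w \<in> carrier M" if "w \<in> Q" for w using that Q(2) by auto
  show ?thesis using Q x
  proof (induction x rule: combs_induct)
    case (single z i j)
    show ?case using Q y
    proof (induction y rule: combs_induct)
      case (single w k l)
      have "z \<otimes> mon i j \<otimes> (w \<otimes> mon k l) = z \<otimes> (mon i j \<otimes> (w \<otimes> mon k l))"
        using \<open>z \<in> Q\<close> single Oc by (simp add: m_assoc)
      also have "\<dots> = z \<otimes> (w \<otimes> (mon i j \<otimes> mon k l))"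
        using single Q(2) by (subst left_comm) auto
      also have "\<dots> = (z \<otimes> w \<otimes> \<zeta> [^] ((q - 1) * k * j)) \<otimes> mon (i + k) (j + l)"
        unfolding mon_mult using \<open>z \<in> Q\<close> single Oc by (simp add: m_assoc)
      finally show ?case
        using combs_mon[OF Q c(2,3)] \<open>z \<in> Q\<close> single pw c(1) subringE(6)[OF Q(1)] by simp
    next
      case (add x y)
      then show ?case using \<open>z \<in> Q\<close> Oc cc combs_add[OF Q] by (simp add: r_distr)
    qed
  next
    case (add x x')
    then show ?case using y cc combs_add[OF Q] by (simp add: l_distr)
  qed
qed

lemma combs_scalar:
  assumes Q: "subring Q M" "Q \<subseteq> Z" and "z \<in> Q"
  shows "z \<in> combs Q"
proof -
  have "(0, 0) \<in> idx" using q by (simp add: idx_def)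
  then show ?thesis using combs_single[OF Q _ assms(3), of 0 0] assms by (auto simp: mon_def)
qed

lemma combs_uv:
  assumes Q: "subring Q M" "Q \<subseteq> Z" and c: "\<alpha> \<in> Q" "\<beta> \<in> Q"
  shows "u \<in> combs Q" "v \<in> combs Q"
  using combs_mon[OF Q c subringE(3)[OF Q(1)], of 1 0] combs_mon[OF Q c subringE(3)[OF Q(1)], of 0 1]
  by (simp_all add: mon_def)

lemma combs_subring:
  assumes Q: "subring Q M" "Q \<subseteq> Z" and c: "\<zeta> \<in> Q" "\<alpha> \<in> Q" "\<beta> \<in> Q"
  shows "subring (combs Q) M"
proof (rule ring.subringI[OF ring_axioms])
  show "combs Q \<subseteq> carrier M" by (rule combs_carrier[OF Q(2)])
  show "\<one> \<in> combs Q" by (rule combs_scalar[OF Q subringE(3)[OF Q(1)]])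
  fix x assume x: "x \<in> combs Q"
  have "\<ominus> \<one> \<in> combs Q" by (intro combs_scalar Q subringE(5)[OF Q(1)] subringE(3)[OF Q(1)])
  then have "\<ominus> \<one> \<otimes> x \<in> combs Q" using combs_mult[OF Q c] x by blast
  moreover have "x \<in> carrier M" using x combs_carrier[OF Q(2)] by blast
  ultimately show "\<ominus> x \<in> combs Q" by (simp add: l_minus)
qed (use combs_mult[OF Q c] combs_add[OF Q] in blast)+

subsection \<open>Averaging\<close>

text \<open>As \<open>w\<^sup>q\<close> will be central, each summand is \<open>w\<^sup>q\<close> times a
  conjugate of \<open>x\<close> under a power of \<open>w\<close>, formed without inverting \<open>w\<close>.
  The weights \<open>t\<^sup>a\<close> are powers of a root of unity, so that the sum picks out an eigenspace of
  the conjugation.\<close>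
definition avg :: "'a \<Rightarrow> 'a \<Rightarrow> 'a \<Rightarrow> 'a" where
  "avg w t x = (\<Oplus>a\<in>{..<q}. t [^] a \<otimes> (w [^] a \<otimes> x \<otimes> w [^] (q - a)))"

lemma avg_carrier [simp]:
  "w \<in> carrier M \<Longrightarrow> t \<in> carrier M \<Longrightarrow> x \<in> carrier M \<Longrightarrow> avg w t x \<in> carrier M"
  unfolding avg_def by (intro finsum_closed) auto

lemma avg_add:
  assumes "w \<in> carrier M" "t \<in> carrier M" "x \<in> carrier M" "y \<in> carrier M"
  shows "avg w t (x \<oplus> y) = avg w t x \<oplus> avg w t y"
  unfolding avg_def using assms
  by (subst finsum_addf[symmetric]) (auto intro!: finsum_cong' simp: l_distr r_distr)

text \<open>The averages preserve any additive set that is stable under multiplication by \<open>w\<close> and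
  by \<open>t\<close>. It is this stability that later lets them act on ideals.\<close>
lemma avg_mem:
  assumes N: "N \<subseteq> carrier M" "\<zero> \<in> N" "\<And>x y. x \<in> N \<Longrightarrow> y \<in> N \<Longrightarrow> x \<oplus> y \<in> N"
    and w: "w \<in> carrier M" "\<And>x. x \<in> N \<Longrightarrow> w \<otimes> x \<in> N" "\<And>x. x \<in> N \<Longrightarrow> x \<otimes> w \<in> N"
    and t: "t \<in> carrier M" "\<And>x. x \<in> N \<Longrightarrow> t \<otimes> x \<in> N" and x: "x \<in> N"
  shows "avg w t x \<in> N"
proof -
  have 1: "s [^] (a::nat) \<otimes> y \<in> N"
    if "s \<in> carrier M" "\<And>x. x \<in> N \<Longrightarrow> s \<otimes> x \<in> N" "y \<in> N" for s y a
  proof (induction a)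
    case (Suc a)
    have "s [^] Suc a \<otimes> y = s \<otimes> (s [^] a \<otimes> y)"
      using nat_pow_Suc2[of s a] that(1,3) N(1) by (simp add: m_assoc subset_iff)
    then show ?case using Suc that(2) by metis
  qed (use that N(1) in auto)
  have 2: "y \<otimes> w [^] (a::nat) \<in> N" if "y \<in> N" for y a
    using that w(1,3) N(1) by (induction a) (auto simp: m_assoc[symmetric])
  have summand: "t [^] a \<otimes> (w [^] a \<otimes> x \<otimes> w [^] (q - a)) \<in> N" for a
    by (intro 1 t 2 w x)
  have "finite A \<Longrightarrow> (\<Oplus>a\<in>A. t [^] a \<otimes> (w [^] a \<otimes> x \<otimes> w [^] (q - a))) \<in> N" for A
  proof (induction A rule: finite_induct)
    case (insert a A)
    then show ?case using N summand by (subst finsum_insert) auto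
  qed (use N in simp)
  then show ?thesis unfolding avg_def by simp
qed

lemma avg_eigen:
  assumes w: "w \<in> carrier M" and x: "x \<in> carrier M" and \<gamma>: "\<gamma> \<in> Z" and c: "c \<in> Z"
    and e: "\<And>a. a < q \<Longrightarrow> w [^] a \<otimes> x \<otimes> w [^] (q - a) = (\<zeta> [^] n) [^] a \<otimes> (\<gamma> \<otimes> x)"
  shows "avg w (\<zeta> [^] (m::nat)) (c \<otimes> x) = (if q dvd m + n then [q] \<cdot> \<one> \<otimes> \<gamma> \<otimes> (c \<otimes> x) else \<zero>)"
proof -
  have "avg w (\<zeta> [^] m) (c \<otimes> x) = (\<Oplus>a\<in>{..<q}. (\<zeta> [^] (m + n)) [^] a \<otimes> (\<gamma> \<otimes> (c \<otimes> x)))"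
    unfolding avg_def
  proof (intro finsum_cong' refl)
    fix a assume "a \<in> {..<q}"
    then have a: "a < q" by simp
    have "w [^] a \<otimes> (c \<otimes> x) \<otimes> w [^] (q - a) = c \<otimes> (w [^] a \<otimes> x \<otimes> w [^] (q - a))"
      using w x c by (simp add: left_comm m_assoc)
    also have "\<dots> = (\<zeta> [^] n) [^] a \<otimes> (c \<otimes> (\<gamma> \<otimes> x))"
      unfolding e[OF a] using \<zeta> c \<gamma> x by (simp add: left_comm)
    also have "\<dots> = (\<zeta> [^] n) [^] a \<otimes> (\<gamma> \<otimes> (c \<otimes> x))" using c \<gamma> x by (simp add: left_comm)
    finally have "(\<zeta> [^] m) [^] a \<otimes> (w [^] a \<otimes> (c \<otimes> x) \<otimes> w [^] (q - a)) =
        (\<zeta> [^] m) [^] a \<otimes> (\<zeta> [^] n) [^] a \<otimes> (\<gamma> \<otimes> (c \<otimes> x))"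
      using \<gamma> c x by (simp add: m_assoc)
    also have "(\<zeta> [^] m) [^] a \<otimes> (\<zeta> [^] n) [^] a = (\<zeta> [^] (m + n)) [^] a"
      by (simp add: nat_pow_pow nat_pow_mult algebra_simps)
    finally show "(\<zeta> [^] m) [^] a \<otimes> (w [^] a \<otimes> (c \<otimes> x) \<otimes> w [^] (q - a)) =
      (\<zeta> [^] (m + n)) [^] a \<otimes> (\<gamma> \<otimes> (c \<otimes> x))" .
  qed (use \<gamma> c x in auto)
  also have "\<dots> = (\<Oplus>a\<in>{..<q}. (\<zeta> [^] (m + n)) [^] a) \<otimes> (\<gamma> \<otimes> (c \<otimes> x))"
    using \<gamma> c x by (intro finsum_ldistr[symmetric]) auto
  finally show ?thesis unfolding sum_pow_\<zeta> using \<gamma> c x by (simp add: m_assoc)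
qed

lemma avg_u_mon:
  assumes "c \<in> Z"
  shows "avg u (\<zeta> [^] (m::nat)) (c \<otimes> mon i k) = (if q dvd m + k then [q] \<cdot> \<one> \<otimes> \<alpha> \<otimes> (c \<otimes> mon i k) else \<zero>)"
proof (rule avg_eigen)
  fix a assume a: "a < q"
  have "u [^] a \<otimes> mon i k \<otimes> u [^] (q - a) = (u [^] a \<otimes> u [^] i) \<otimes> v [^] k \<otimes> u [^] (q - a)"
    by (simp add: mon_def m_assoc)
  also have "u [^] a \<otimes> u [^] i = u [^] i \<otimes> u [^] a" by (simp add: nat_pow_mult add.commute)
  also have "u [^] i \<otimes> u [^] a \<otimes> v [^] k \<otimes> u [^] (q - a) = u [^] i \<otimes> (u [^] a \<otimes> v [^] k) \<otimes> u [^] (q - a)"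
    by (simp add: m_assoc)
  also have "\<dots> = \<zeta> [^] (a * k) \<otimes> (u [^] i \<otimes> v [^] k \<otimes> (u [^] a \<otimes> u [^] (q - a)))"
    unfolding upow_vpow[of a k] using \<zeta> left_comm[of "\<zeta> [^] (a * k)" "u [^] i"] by (simp add: m_assoc)
  also have "u [^] a \<otimes> u [^] (q - a) = \<alpha>" using a by (simp add: nat_pow_mult upow)
  also have "u [^] i \<otimes> v [^] k \<otimes> \<alpha> = \<alpha> \<otimes> mon i k" using \<alpha> by (simp add: central mon_def)
  finally show "u [^] a \<otimes> mon i k \<otimes> u [^] (q - a) = (\<zeta> [^] k) [^] a \<otimes> (\<alpha> \<otimes> mon i k)"
    by (simp add: nat_pow_pow mult.commute)
qed (use assms \<alpha> in simp_all)

lemma avg_v_mon: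
  assumes "c \<in> Z"
  shows "avg v (\<zeta> [^] (m::nat)) (c \<otimes> mon k j) =
     (if q dvd m + (q - 1) * k then [q] \<cdot> \<one> \<otimes> \<beta> \<otimes> (c \<otimes> mon k j) else \<zero>)"
proof (rule avg_eigen)
  fix a assume a: "a < q"
  have "v [^] a \<otimes> mon k j \<otimes> v [^] (q - a) = (v [^] a \<otimes> u [^] k) \<otimes> (v [^] j \<otimes> v [^] (q - a))"
    by (simp add: mon_def m_assoc)
  also have "\<dots> = \<zeta> [^] ((q - 1) * k * a) \<otimes> (u [^] k \<otimes> (v [^] a \<otimes> (v [^] j \<otimes> v [^] (q - a))))"
    unfolding vpow_upow by (simp add: m_assoc)
  also have "v [^] a \<otimes> (v [^] j \<otimes> v [^] (q - a)) = v [^] j \<otimes> v [^] q"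
    using a by (simp add: nat_pow_mult add.commute)
  also have "u [^] k \<otimes> (v [^] j \<otimes> v [^] q) = \<beta> \<otimes> mon k j"
    using \<beta> by (simp add: vpow central mon_def m_assoc[symmetric])
  finally show "v [^] a \<otimes> mon k j \<otimes> v [^] (q - a) = (\<zeta> [^] ((q - 1) * k)) [^] a \<otimes> (\<beta> \<otimes> mon k j)"
    by (simp add: nat_pow_pow)
qed (use assms \<beta> in simp_all)

text \<open>Conjugation by \<open>u\<close> multiplies \<open>u\<^sup>k v\<^sup>l\<close> by
  \<open>\<zeta>\<^sup>l\<close>, and conjugation by \<open>v\<close> multiplies it by
  \<open>\<zeta>\<^bsup>-k\<^esup>\<close>; the weights are the inverse characters, written with nonnegative
  exponents. The result is the term with exponents \<open>i\<close> and \<open>j\<close>, multiplied by the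
  constant \<open>\<kappa>\<close>.\<close>
definition proj :: "nat \<Rightarrow> nat \<Rightarrow> 'a \<Rightarrow> 'a" where
  "proj i j x = avg v (\<zeta> [^] i) (avg u (\<zeta> [^] (q - j)) x)"

lemma proj_add: "x \<in> carrier M \<Longrightarrow> y \<in> carrier M \<Longrightarrow> proj i j (x \<oplus> y) = proj i j x \<oplus> proj i j y"
  by (simp add: proj_def avg_add)

lemma proj_carrier [simp]: "x \<in> carrier M \<Longrightarrow> proj i j x \<in> carrier M"
  by (simp add: proj_def)

definition \<kappa> :: 'a where "\<kappa> = [q] \<cdot> \<one> \<otimes> \<beta> \<otimes> ([q] \<cdot> \<one> \<otimes> \<alpha>)"

lemma qZ [simp]: "[(n::nat)] \<cdot> \<one> \<in> Z"
  by (induction n) (auto simp: add.nat_pow_Suc)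

lemma \<kappa>_Z [simp]: "\<kappa> \<in> Z" using \<alpha> \<beta> by (simp add: \<kappa>_def)

lemma Z_mult_nonzero: "x \<in> Z \<Longrightarrow> y \<in> Z \<Longrightarrow> x \<noteq> \<zero> \<Longrightarrow> y \<noteq> \<zero> \<Longrightarrow> x \<otimes> y \<noteq> \<zero>"
  using Z_cancel Z_carrier by metis

lemma \<kappa>_nonzero: "\<kappa> \<noteq> \<zero>"
  unfolding \<kappa>_def using q_nonzero \<alpha> \<beta> by (intro Z_mult_nonzero) simp_all

lemma proj_mon:
  assumes c: "c \<in> Z" and "(i, j) \<in> idx" "(k, l) \<in> idx"
  shows "proj i j (c \<otimes> mon k l) = (if (k, l) = (i, j) then \<kappa> \<otimes> (c \<otimes> mon k l) else \<zero>)"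
proof -
  have lt: "i < q" "j < q" "k < q" "l < q" using assms by (auto simp: idx_def)
  have small: "x = 0" if "q dvd x" "x < q" for x :: nat
    using that by (metis dvd_imp_le not_less gr0I)
  have 1: "q dvd q - j + l \<longleftrightarrow> l = j"
  proof
    assume d: "q dvd q - j + l"
    show "l = j"
    proof (cases "j \<le> l")
      case True
      then have "q - j + l = q + (l - j)" using lt by linarith
      then have "q dvd l - j" using d by (metis dvd_add_triv_left_iff)
      then show ?thesis using small[of "l - j"] True lt by linarith
    next
      case False
      then show ?thesis using small[OF d] lt by linarith
    qed
  qed (use lt in simp)
  have 2: "q dvd i + (q - 1) * k \<longleftrightarrow> k = i"
  proof
    assume d: "q dvd i + (q - 1) * k"
    have e: "i + (q - 1) * k + k = i + q * k" using q by (cases q) simp_all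
    show "k = i"
    proof (cases "k \<le> i")
      case True
      then have "i + (q - 1) * k = q * k + (i - k)" using e by linarith
      then have "q dvd i - k" using d by (metis dvd_add_right_iff dvd_triv_left)
      then show ?thesis using small[of "i - k"] True lt by linarith
    next
      case False
      then have "i + (q - 1) * k + (k - i) = q * k" using e by linarith
      then have "q dvd k - i" using d by (metis dvd_add_right_iff dvd_triv_left)
      then show ?thesis using small[of "k - i"] False lt by linarith
    qed
  next
    assume "k = i"
    then have "i + (q - 1) * k = q * k" using q by (cases q) simp_all
    then show "q dvd i + (q - 1) * k" by simp
  qed
  have z: "avg v (\<zeta> [^] i) \<zero> = \<zero>"
    using avg_v_mon[of \<zero> i 0 0] by (simp split: if_splits)
  have "avg v (\<zeta> [^] i) ([q] \<cdot> \<one> \<otimes> \<alpha> \<otimes> (c \<otimes> mon k l)) = avg v (\<zeta> [^] i) (([q] \<cdot> \<one> \<otimes> \<alpha> \<otimes> c) \<otimes> mon k l)"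
    using c by (simp add: m_assoc)
  also have "\<dots> = (if k = i then [q] \<cdot> \<one> \<otimes> \<beta> \<otimes> (([q] \<cdot> \<one> \<otimes> \<alpha> \<otimes> c) \<otimes> mon k l) else \<zero>)"
    using avg_v_mon[of "[q] \<cdot> \<one> \<otimes> \<alpha> \<otimes> c" i k l, unfolded 2] c \<alpha>(1) by simp
  finally show ?thesis
    unfolding proj_def using c avg_u_mon[OF c, of "q - j" k l] 1 z by (auto simp: \<kappa>_def m_assoc)
qed

lemma proj_comb:
  assumes c: "c \<in> idx \<rightarrow> Z" and ij: "(i, j) \<in> idx"
  shows "proj i j (comb c) = \<kappa> \<otimes> (c (i, j) \<otimes> mon i j)"
proof -
  have z: "proj i j \<zero> = \<zero>" using proj_mon[OF _ ij ij, of \<zero>] by simp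
  have "proj i j (\<Oplus>p\<in>A. c p \<otimes> mon (fst p) (snd p)) =
      (\<Oplus>p\<in>A. if p = (i, j) then \<kappa> \<otimes> (c p \<otimes> mon (fst p) (snd p)) else \<zero>)"
    if "finite A" "A \<subseteq> idx" for A
    using that
  proof (induction A rule: finite_induct)
    case (insert p A)
    have p: "c p \<in> Z" "(fst p, snd p) \<in> idx" using insert c by auto
    have tc: "c p \<otimes> mon (fst p) (snd p) \<in> carrier M" "\<kappa> \<otimes> (c p \<otimes> mon (fst p) (snd p)) \<in> carrier M"
      if "p \<in> idx" for p
      using funcset_mem[OF c that] by simp_all
    have A: "(\<lambda>p. c p \<otimes> mon (fst p) (snd p)) \<in> A \<rightarrow> carrier M"
      "(\<lambda>p. if p = (i, j) then \<kappa> \<otimes> (c p \<otimes> mon (fst p) (snd p)) else \<zero>) \<in> A \<rightarrow> carrier M"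
      using insert(4) tc by (auto simp del: m_closed simp: subset_iff)
    let ?f = "\<lambda>p. c p \<otimes> mon (fst p) (snd p)"
      and ?g = "\<lambda>p. if p = (i, j) then \<kappa> \<otimes> (c p \<otimes> mon (fst p) (snd p)) else \<zero>"
    have f: "finsum M ?f (insert p A) = ?f p \<oplus> finsum M ?f A"
      using insert(1,2,4) A(1) tc by (intro finsum_insert) auto
    have g: "finsum M ?g (insert p A) = ?g p \<oplus> finsum M ?g A"
      using insert(1,2,4) A(2) tc by (intro finsum_insert) auto
    have "proj i j (?f p) = ?g p" using proj_mon[OF p(1) ij p(2)] by (simp add: prod_eq_iff)
    then show ?case
      unfolding f g using insert tc[of p] finsum_closed[OF A(1)] by (simp add: proj_add)
  qed (simp add: z)
  from this[of idx] have "proj i j (comb c) = (\<Oplus>p\<in>idx. if p = (i, j) then \<kappa> \<otimes> (c p \<otimes> mon (fst p) (snd p)) else \<zero>)"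
    by (simp add: comb_def)
  also have "\<dots> = \<kappa> \<otimes> (c (i, j) \<otimes> mon i j)"
    using ij funcset_mem[OF c ij] by (subst finsum_delta) auto
  finally show ?thesis .
qed

text \<open>The monomials are independent because \<open>proj\<close> isolates each coefficient.\<close>
lemma comb_zero_imp:
  assumes c: "c \<in> idx \<rightarrow> Z" and "comb c = \<zero>" and p: "p \<in> idx"
  shows "c p = \<zero>"
proof -
  obtain i j where ij: "p = (i, j)" by (cases p)
  have cp: "c p \<in> Z" using c p by auto
  have "proj i j \<zero> = \<zero>" using proj_mon[of \<zero> i j i j] p ij by simp
  then have "\<kappa> \<otimes> (c p \<otimes> mon i j) = \<zero>" using proj_comb[OF c, of i j] p ij assms(2) by simp
  then have 0: "c p \<otimes> mon i j = \<zero>" using Z_cancel[OF \<kappa>_Z \<kappa>_nonzero] cp by simp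
  obtain a where a: "a \<in> Z" "a \<otimes> \<alpha> = \<one>" using Z_inverse \<alpha> by blast
  obtain b where b: "b \<in> Z" "b \<otimes> \<beta> = \<one>" using Z_inverse \<beta> by blast
  obtain w where w: "w \<in> carrier M" "mon i j \<otimes> w = \<one>"
    using mon_unit[of Z "carrier M" a b i j] subring_Z subringE(1)[OF subring_Z] a b by auto
  have "c p = c p \<otimes> (mon i j \<otimes> w)" using w cp by simp
  also have "\<dots> = c p \<otimes> mon i j \<otimes> w" using w cp by (simp add: m_assoc)
  finally show ?thesis using 0 w by simp
qed

end

subsection \<open>Dimensions\<close>

lemma (in ring) combine_map_upt:
  assumes "\<And>i. i < n \<Longrightarrow> f i \<in> carrier R" "\<And>i. i < n \<Longrightarrow> g i \<in> carrier R"
  shows "combine (map f [0..<n]) (map g [0..<n]) = (\<Oplus>i\<in>{..<n}. f i \<otimes> g i)"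
  using assms
proof (induction n)
  case (Suc n)
  have c: "set (map f [0..<n]) \<subseteq> carrier R" "set (map g [0..<n]) \<subseteq> carrier R"
    "set [f n] \<subseteq> carrier R" "set [g n] \<subseteq> carrier R"
    using Suc.prems by auto
  have "combine (map f [0..<Suc n]) (map g [0..<Suc n]) =
      combine (map f [0..<n]) (map g [0..<n]) \<oplus> combine [f n] [g n]"
    using combine_append[OF _ c(1,2,3,4)] by simp
  also have "combine (map f [0..<n]) (map g [0..<n]) = (\<Oplus>i\<in>{..<n}. f i \<otimes> g i)"
    using Suc by simp
  also have "combine [f n] [g n] = f n \<otimes> g n" using Suc.prems by simp
  also have "(\<Oplus>i\<in>{..<n}. f i \<otimes> g i) \<oplus> f n \<otimes> g n = (\<Oplus>i\<in>{..<Suc n}. f i \<otimes> g i)"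
    unfolding lessThan_Suc using Suc.prems by (subst finsum_insert) (auto intro!: a_comm finsum_closed)
  finally show ?case .
qed simp

context symbol_relations
begin

lemma comb_upt:
  assumes c: "c \<in> idx \<rightarrow> Z"
  shows "combine (map (\<lambda>n. c (n div q, n mod q)) [0..<q * q]) (map (\<lambda>n. mon (n div q) (n mod q)) [0..<q * q])
    = comb c"
proof -
  have i: "(n div q, n mod q) \<in> idx" if "n < q * q" for n
    using that q by (simp add: idx_def less_mult_imp_div_less)
  have cc: "c (n div q, n mod q) \<in> carrier M" if "n < q * q" for n
    using funcset_mem[OF c i[OF that]] by simp
  have "combine (map (\<lambda>n. c (n div q, n mod q)) [0..<q * q]) (map (\<lambda>n. mon (n div q) (n mod q)) [0..<q * q])
    = (\<Oplus>n\<in>{..<q * q}. c (n div q, n mod q) \<otimes> mon (n div q) (n mod q))"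
    using cc by (intro combine_map_upt) auto
  also have "\<dots> = (\<Oplus>p\<in>(\<lambda>n. (n div q, n mod q)) ` {..<q * q}. c p \<otimes> mon (fst p) (snd p))"
  proof (subst finsum_reindex)
    show "inj_on (\<lambda>n. (n div q, n mod q)) {..<q * q}"
      by (rule inj_onI) (metis Pair_inject div_mult_mod_eq)
    show "(\<lambda>p. c p \<otimes> mon (fst p) (snd p)) \<in> (\<lambda>n. (n div q, n mod q)) ` {..<q * q} \<rightarrow> carrier M"
      using cc by auto
  qed simp
  also have "(\<lambda>n. (n div q, n mod q)) ` {..<q * q} = idx"
  proof
    show "idx \<subseteq> (\<lambda>n. (n div q, n mod q)) ` {..<q * q}"
    proof
      fix p assume "p \<in> idx"
      then obtain i j where p: "p = (i, j)" "i < q" "j < q" by (auto simp: idx_def)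
      have "i * q + j < Suc i * q" using p by simp
      also have "\<dots> \<le> q * q" using p by (intro mult_le_mono1) simp
      finally show "p \<in> (\<lambda>n. (n div q, n mod q)) ` {..<q * q}"
        using p by (intro image_eqI[of _ _ "i * q + j"]) auto
    qed
  qed (use i in auto)
  finally show ?thesis by (simp add: comb_def)
qed

text \<open>The \<open>q\<^sup>2\<close> monomials are numbered by \<open>n = i q + j\<close>.\<close>
lemma dimension_combs: "dimension (q * q) Z (combs Z)"
proof -
  let ?Us = "map (\<lambda>n. mon (n div q) (n mod q)) [0..<q * q]"
  have Us: "set ?Us \<subseteq> carrier M" by auto
  have lift: "combine Ks ?Us = comb (\<lambda>p. Ks ! (fst p * q + snd p))"
    "(\<lambda>p. Ks ! (fst p * q + snd p)) \<in> idx \<rightarrow> Z"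
    if Ks: "set Ks \<subseteq> Z" "length Ks = q * q" for Ks
  proof -
    show 1: "(\<lambda>p. Ks ! (fst p * q + snd p)) \<in> idx \<rightarrow> Z"
    proof
      fix p assume "p \<in> idx"
      then have p: "fst p < q" "snd p < q" by (auto simp: idx_def)
      have "fst p * q + snd p < Suc (fst p) * q" using p by simp
      also have "\<dots> \<le> q * q" using p by (intro mult_le_mono1) simp
      finally show "Ks ! (fst p * q + snd p) \<in> Z" using Ks nth_mem by fastforce
    qed
    have "Ks = map (\<lambda>n. (\<lambda>p. Ks ! (fst p * q + snd p)) (n div q, n mod q)) [0..<q * q]"
      using Ks(2) by (intro nth_equalityI) auto
    then show "combine Ks ?Us = comb (\<lambda>p. Ks ! (fst p * q + snd p))"
      using comb_upt[OF 1] by simp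
  qed
  have "independent Z ?Us"
  proof (rule trivial_combine_imp_independent[OF subfield_Z Us])
    fix Ks assume Ks: "set Ks \<subseteq> Z" "combine Ks ?Us = \<zero>"
    define Ls where "Ls = take (q * q) Ks @ replicate (q * q - length Ks) \<zero>"
    have Lset: "set Ls \<subseteq> Z" using Ks(1) set_take_subset[of "q * q" Ks] by (auto simp: Ls_def)
    have Llen: "length Ls = q * q" by (simp add: Ls_def)
    have "combine Ls ?Us = combine (take (q * q) Ks) ?Us"
      unfolding Ls_def by (rule combine_append_replicate[OF Us])
    also have "\<dots> = \<zero>" using combine_take[of ?Us Ks] Ks(2) by simp
    finally have "comb (\<lambda>p. Ls ! (fst p * q + snd p)) = \<zero>" using lift(1)[OF Lset Llen] by simp
    from comb_zero_imp[OF lift(2)[OF Lset Llen] this]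
    have z: "Ls ! (i * q + j) = \<zero>" if "i < q" "j < q" for i j using that by (auto simp: idx_def)
    have "Ls ! n = \<zero>" if "n < q * q" for n
      using z[of "n div q" "n mod q"] that q by (simp add: less_mult_imp_div_less)
    then have "set Ls \<subseteq> {\<zero>}" using Llen by (auto simp: set_conv_nth)
    then show "set (take (length ?Us) Ks) \<subseteq> {\<zero>}" by (simp add: Ls_def)
  qed
  moreover have "Span Z ?Us = combs Z"
  proof
    show "Span Z ?Us \<subseteq> combs Z"
      unfolding Span_eq_combine_set_length_version[OF subfield_Z Us] combs_def using lift by fastforce
    show "combs Z \<subseteq> Span Z ?Us"
    proof
      fix x assume "x \<in> combs Z"
      then obtain c where c: "c \<in> idx \<rightarrow> Z" "x = comb c" unfolding combs_def by blast
      let ?Ks = "map (\<lambda>n. c (n div q, n mod q)) [0..<q * q]"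
      have "set ?Ks \<subseteq> Z" using c(1) q by (auto simp: idx_def less_mult_imp_div_less)
      moreover have "length ?Ks = length ?Us" by simp
      moreover have "x = combine ?Ks ?Us" using comb_upt[OF c(1)] c(2) by simp
      ultimately show "x \<in> Span Z ?Us"
        unfolding Span_mem_iff_length_version[OF subfield_Z Us] by blast
    qed
  qed
  ultimately show ?thesis using dimensionI[OF subfield_Z, of ?Us] by simp
qed

lemma generated_imp_combs:
  assumes "generated_by M (Z \<union> {u, v})"
  shows "carrier M = combs Z"
proof
  note Q = subring_Z order_refl
  show "combs Z \<subseteq> carrier M" by (rule combs_carrier) simp
  show "carrier M \<subseteq> combs Z"
  proof
    fix x assume "x \<in> carrier M"
    with assms show "x \<in> combs Z"
    proof (induction rule: generated_by_induct)
      case (gen x)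
      then show ?case using combs_scalar[OF Q] combs_uv[OF Q \<alpha>(1) \<beta>(1)] by blast
    next
      case (add x y)
      then show ?case using combs_add[OF Q] by blast
    next
      case (mult x y)
      then show ?case using combs_mult[OF Q \<zeta> \<alpha>(1) \<beta>(1)] by blast
    qed
  qed
qed

end

text \<open>A semilinear injection preserves dimensions.\<close>
lemma dimension_semilinear_image:
  assumes "ring E" "ring M" and d: "ring.dimension E n Z V" and Z: "Z \<subseteq> carrier E"
    and f: "\<And>x. x \<in> carrier E \<Longrightarrow> f x \<in> carrier M" "inj_on f (carrier E)"
      "\<And>x y. x \<in> carrier E \<Longrightarrow> y \<in> carrier E \<Longrightarrow> f (x \<oplus>\<^bsub>E\<^esub> y) = f x \<oplus>\<^bsub>M\<^esub> f y"
      "\<And>z x. z \<in> Z \<Longrightarrow> x \<in> carrier E \<Longrightarrow> f (z \<otimes>\<^bsub>E\<^esub> x) = h z \<otimes>\<^bsub>M\<^esub> f x"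
  shows "ring.dimension M n (h ` Z) (f ` V) \<and> V \<subseteq> carrier E"
proof -
  interpret E: ring E by fact
  interpret M: ring M by fact
  show ?thesis using d Z f(4)
  proof (induction rule: E.dimension.induct)
    case (zero_dim Z)
    have "f \<zero>\<^bsub>E\<^esub> \<oplus>\<^bsub>M\<^esub> f \<zero>\<^bsub>E\<^esub> = f \<zero>\<^bsub>E\<^esub>" using f(3)[of "\<zero>\<^bsub>E\<^esub>" "\<zero>\<^bsub>E\<^esub>"] by simp
    then have "f \<zero>\<^bsub>E\<^esub> = \<zero>\<^bsub>M\<^esub>" using f(1)[OF E.zero_closed] by (metis M.add.l_cancel_one')
    then show ?case by (simp add: M.dimension.zero_dim)
  next
    case (Suc_dim v V n Z)
    have V: "V \<subseteq> carrier E" and dim: "M.dimension n (h ` Z) (f ` V)" using Suc_dim by auto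
    have "f v \<notin> f ` V" using Suc_dim(1,2) V f(2) by (auto dest: inj_onD)
    then have "M.dimension (Suc n) (h ` Z) (M.line_extension (h ` Z) (f v) (f ` V))"
      using M.dimension.Suc_dim[OF f(1)[OF Suc_dim(1)] _ dim] by blast
    moreover have "M.line_extension (h ` Z) (f v) (f ` V) = f ` E.line_extension Z v V"
    proof -
      have e: "f (k \<otimes>\<^bsub>E\<^esub> v \<oplus>\<^bsub>E\<^esub> w) = h k \<otimes>\<^bsub>M\<^esub> f v \<oplus>\<^bsub>M\<^esub> f w" if "k \<in> Z" "w \<in> V" for k w
      proof -
        have "w \<in> carrier E" "k \<in> carrier E" using that V Suc_dim(5) by auto
        then show ?thesis using f(3) Suc_dim(1,6) that by simp
      qed
      show ?thesis
      proof
        show "M.line_extension (h ` Z) (f v) (f ` V) \<subseteq> f ` E.line_extension Z v V"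
        proof
          fix y assume "y \<in> M.line_extension (h ` Z) (f v) (f ` V)"
          then obtain k w where kw: "k \<in> Z" "w \<in> V" "y = h k \<otimes>\<^bsub>M\<^esub> f v \<oplus>\<^bsub>M\<^esub> f w"
            unfolding M.line_extension_mem_iff by blast
          have "k \<otimes>\<^bsub>E\<^esub> v \<oplus>\<^bsub>E\<^esub> w \<in> E.line_extension Z v V"
            unfolding E.line_extension_mem_iff using kw by blast
          then show "y \<in> f ` E.line_extension Z v V" using e[OF kw(1,2)] kw(3) by (metis imageI)
        qed
        show "f ` E.line_extension Z v V \<subseteq> M.line_extension (h ` Z) (f v) (f ` V)"
        proof
          fix y assume "y \<in> f ` E.line_extension Z v V"
          then obtain x where x: "x \<in> E.line_extension Z v V" "y = f x" by blast
          then obtain k w where kw: "k \<in> Z" "w \<in> V" "y = f (k \<otimes>\<^bsub>E\<^esub> v \<oplus>\<^bsub>E\<^esub> w)"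
            unfolding E.line_extension_mem_iff by blast
          then show "y \<in> M.line_extension (h ` Z) (f v) (f ` V)"
            unfolding M.line_extension_mem_iff using e by blast
        qed
      qed
    qed
    moreover have "E.line_extension Z v V \<subseteq> carrier E"
      by (rule E.line_extension_in_carrier[OF Suc_dim(5,1) V])
    ultimately show ?case by simp
  qed
qed

text \<open>By induction on the set of positions at which entries may be nonzero: every position adds a copy of
  \<open>R\<close>.\<close>
lemma (in ring) dimension_mat_ring:
  assumes I: "finite I" and Z: "Z \<subseteq> carrier R" and d: "dimension n Z (carrier R)"
    and sf: "subfield (scalar_mat I R ` Z) (mat_ring I R)"
  shows "ring.dimension (mat_ring I R) (card I * card I * n) (scalar_mat I R ` Z) (carrier (mat_ring I R))"
proof -
  interpret M: ring "mat_ring I R" by (rule mat_ring_is_ring[OF I])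
  let ?Z = "scalar_mat I R ` Z"
  define supp where "supp A = {U \<in> carrier (mat_ring I R). \<forall>i j. U i j \<noteq> \<zero> \<longrightarrow> (i, j) \<in> A}" for A
  have "M.dimension (card A * n) ?Z (supp A)" if "finite A" "A \<subseteq> I \<times> I" for A
    using that
  proof (induction A rule: finite_induct)
    case empty
    have "supp {} = {\<zero>\<^bsub>mat_ring I R\<^esub>}"
    proof
      show "supp {} \<subseteq> {\<zero>\<^bsub>mat_ring I R\<^esub>}" by (auto simp: supp_def mat_ring_simps)
      show "{\<zero>\<^bsub>mat_ring I R\<^esub>} \<subseteq> supp {}" using M.zero_closed by (auto simp: supp_def mat_ring_simps)
    qed
    then show ?case by (simp add: M.dimension.zero_dim)
  next
    case (insert p A)
    obtain i j where p: "p = (i, j)" by (cases p)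
    have ij: "i \<in> I" "j \<in> I" using insert p by auto
    let ?f = "unit_mat R i j"
    have "M.dimension n ?Z (?f ` carrier R) \<and> carrier R \<subseteq> carrier R"
    proof (rule dimension_semilinear_image[OF ring_axioms M.ring_axioms d Z])
      show "?f x \<in> carrier (mat_ring I R)" if "x \<in> carrier R" for x
        by (rule unit_mat_carrier[OF that ij])
      show "inj_on ?f (carrier R)"
        by (rule inj_onI) (metis unit_mat_def)
      show "?f (x \<oplus> y) = ?f x \<oplus>\<^bsub>mat_ring I R\<^esub> ?f y" if "x \<in> carrier R" "y \<in> carrier R" for x y
        using that by (intro ext) (simp add: mat_ring_simps unit_mat_def)
      show "?f (z \<otimes> x) = scalar_mat I R z \<otimes>\<^bsub>mat_ring I R\<^esub> ?f x" if "z \<in> Z" "x \<in> carrier R" for z x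
      proof -
        have "z \<in> carrier R" using that Z by blast
        then show ?thesis
          using scalar_mat_mult(1)[OF I _ unit_mat_carrier[OF that(2) ij], of z] that
          by (intro ext) (simp add: unit_mat_def)
      qed
    qed
    then have dp: "M.dimension n ?Z (?f ` carrier R)" by simp
    have dA: "M.dimension (card A * n) ?Z (supp A)" using insert by simp
    have "?f ` carrier R \<inter> supp A = {\<zero>\<^bsub>mat_ring I R\<^esub>}"
    proof
      show "?f ` carrier R \<inter> supp A \<subseteq> {\<zero>\<^bsub>mat_ring I R\<^esub>}"
      proof
        fix U assume U: "U \<in> ?f ` carrier R \<inter> supp A"
        then obtain x where x: "U = ?f x" by blast
        have "U i j = \<zero>" using U insert(2) p unfolding supp_def by blast
        then have "x = \<zero>" by (simp add: x unit_mat_def)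
        then show "U \<in> {\<zero>\<^bsub>mat_ring I R\<^esub>}" by (auto simp: x unit_mat_def mat_ring_simps)
      qed
      have "?f \<zero> = \<zero>\<^bsub>mat_ring I R\<^esub>" by (intro ext) (simp add: unit_mat_def mat_ring_simps)
      then have "\<zero>\<^bsub>mat_ring I R\<^esub> \<in> ?f ` carrier R" by (metis imageI zero_closed)
      moreover have "\<zero>\<^bsub>mat_ring I R\<^esub> \<in> supp A"
        using M.zero_closed by (simp add: supp_def mat_ring_simps)
      ultimately show "{\<zero>\<^bsub>mat_ring I R\<^esub>} \<subseteq> ?f ` carrier R \<inter> supp A" by blast
    qed
    note sum = M.dimension_direct_sum_space[OF sf dp dA this]
    have "?f ` carrier R <+>\<^bsub>mat_ring I R\<^esub> supp A = supp (insert p A)"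
    proof
      show "?f ` carrier R <+>\<^bsub>mat_ring I R\<^esub> supp A \<subseteq> supp (insert p A)"
      proof
        fix U assume "U \<in> ?f ` carrier R <+>\<^bsub>mat_ring I R\<^esub> supp A"
        then obtain x W where x: "x \<in> carrier R" "W \<in> supp A" "U = ?f x \<oplus>\<^bsub>mat_ring I R\<^esub> W"
          unfolding set_add_def' by blast
        have W: "W \<in> carrier (mat_ring I R)" "\<And>a b. (a, b) \<notin> A \<Longrightarrow> W a b = \<zero>"
          using x(2) unfolding supp_def by blast+
        have "U a b = \<zero>" if "(a, b) \<notin> insert p A" for a b
          using that W(2)[of a b] p by (auto simp: x(3) mat_ring_simps unit_mat_def)
        moreover have "U \<in> carrier (mat_ring I R)"
          unfolding x(3) by (intro M.a_closed W unit_mat_carrier x ij)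
        ultimately show "U \<in> supp (insert p A)" unfolding supp_def by blast
      qed
      show "supp (insert p A) \<subseteq> ?f ` carrier R <+>\<^bsub>mat_ring I R\<^esub> supp A"
      proof
        fix U assume U: "U \<in> supp (insert p A)"
        have Uc: "U \<in> carrier (mat_ring I R)" "\<And>a b. (a, b) \<notin> insert p A \<Longrightarrow> U a b = \<zero>"
          using U unfolding supp_def by blast+
        let ?W = "\<lambda>a b. if a = i \<and> b = j then \<zero> else U a b"
        have "?W \<in> carrier (mat_ring I R)" using Uc(1) by (simp add: mat_carrier_iff)
        moreover have "?W a b = \<zero>" if "(a, b) \<notin> A" for a b using Uc(2)[of a b] that p by auto
        ultimately have "?W \<in> supp A" unfolding supp_def by blast
        moreover have "?f (U i j) \<oplus>\<^bsub>mat_ring I R\<^esub> ?W = U"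
          using Uc(1) by (intro ext) (simp add: mat_ring_simps unit_mat_def)
        moreover have "?f (U i j) \<in> ?f ` carrier R" using Uc(1) by simp
        ultimately show "U \<in> ?f ` carrier R <+>\<^bsub>mat_ring I R\<^esub> supp A"
          unfolding set_add_def' by blast
      qed
    qed
    then show ?case using sum insert by (simp add: add.commute)
  qed
  from this[of "I \<times> I"] have "M.dimension (card I * card I * n) ?Z (supp (I \<times> I))"
    using I by (simp add: card_cartesian_product)
  moreover have "supp (I \<times> I) = carrier (mat_ring I R)"
  proof -
    have "\<forall>i j. U i j \<noteq> \<zero> \<longrightarrow> (i, j) \<in> I \<times> I" if U: "U \<in> carrier (mat_ring I R)" for U
      using U by (simp add: mat_carrier_iff)
    then show ?thesis unfolding supp_def by auto
  qed
  ultimately show ?thesis by simp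
qed

lemma (in ring) dimension_one_subfield:
  assumes Z: "subfield Z R" and d: "dimension 1 Z V" and V: "Z \<subseteq> V"
  shows "V = Z"
proof -
  have "Span Z [\<one>] = Z"
    using line_extension_mem_iff[of _ Z \<one> "{ \<zero> }"] subfieldE(3)[OF Z] by (auto simp add: rev_subsetD)
  moreover have "independent Z [\<one>]"
    using subfieldE(6)[OF Z] by (intro li_Cons) auto
  moreover have "set [\<one>] \<subseteq> V" using V subringE(3)[OF subfieldE(1)[OF Z]] by auto
  ultimately show ?thesis using independent_length_eq_dimension[OF Z d, of "[\<one>]"] by simp
qed

section \<open>The division algebra component of a symbol of prime degree\<close>

lemma ring_hom_add_pow:
  assumes h: "h \<in> ring_hom R S" and "ring R" "ring S" "x \<in> carrier R"
  shows "h ([(n::nat)] \<cdot>\<^bsub>R\<^esub> x) = [n] \<cdot>\<^bsub>S\<^esub> h x"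
proof -
  interpret R: ring R by fact
  interpret S: ring S by fact
  show ?thesis
  proof (induction n)
    case 0
    then show ?case using ring_hom_zero[OF h assms(2,3)] by simp
  next
    case (Suc n)
    then show ?case using ring_hom_add[OF h] assms(4) by (simp add: R.add.nat_pow_Suc S.add.nat_pow_Suc)
  qed
qed

lemma symbol_relations_via_hom:
  assumes K: "field K" and M: "ring M" and h: "h \<in> ring_hom K M"
    and Z: "subfield Z M" "h ` carrier K \<subseteq> Z"
    and central: "\<And>z x. z \<in> Z \<Longrightarrow> x \<in> carrier M \<Longrightarrow> x \<otimes>\<^bsub>M\<^esub> z = z \<otimes>\<^bsub>M\<^esub> x"
    and uv: "u \<in> carrier M" "v \<in> carrier M" "u [^]\<^bsub>M\<^esub> q = h \<alpha>" "v [^]\<^bsub>M\<^esub> q = h \<beta>"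
      "u \<otimes>\<^bsub>M\<^esub> v = h \<zeta> \<otimes>\<^bsub>M\<^esub> (v \<otimes>\<^bsub>M\<^esub> u)"
    and \<alpha>: "\<alpha> \<in> carrier K" "\<alpha> \<noteq> \<zero>\<^bsub>K\<^esub>" and \<beta>: "\<beta> \<in> carrier K" "\<beta> \<noteq> \<zero>\<^bsub>K\<^esub>"
    and q: "0 < q" "[q] \<cdot>\<^bsub>K\<^esub> \<one>\<^bsub>K\<^esub> \<noteq> \<zero>\<^bsub>K\<^esub>" and \<zeta>: "primitive_root_of_unity K q \<zeta>"
  shows "symbol_relations M Z u v (h \<zeta>) (h \<alpha>) (h \<beta>) q"
proof -
  interpret K: field K by fact
  interpret M: ring M by fact
  interpret h: ring_hom_ring K M h by (rule ring_hom_ringI2) (use h K.ring_axioms M in auto)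
  have "\<one>\<^bsub>M\<^esub> \<noteq> \<zero>\<^bsub>M\<^esub>" using subfieldE(6)[OF Z(1)] .
  then have inj: "inj_on h (carrier K)"
    using h.img_is_subfield(1)[OF K.carrier_is_subfield] by simp
  have nz: "h x \<noteq> \<zero>\<^bsub>M\<^esub>" if "x \<in> carrier K" "x \<noteq> \<zero>\<^bsub>K\<^esub>" for x
    using inj_onD[OF inj, of x "\<zero>\<^bsub>K\<^esub>"] that by auto
  have \<zeta>c: "\<zeta> \<in> carrier K" "\<zeta> [^]\<^bsub>K\<^esub> q = \<one>\<^bsub>K\<^esub>" and prim: "\<And>k. 0 < k \<Longrightarrow> k < q \<Longrightarrow> \<zeta> [^]\<^bsub>K\<^esub> k \<noteq> \<one>\<^bsub>K\<^esub>"
    using \<zeta> unfolding primitive_root_of_unity_def by auto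
  have hp: "h \<zeta> [^]\<^bsub>M\<^esub> k = h (\<zeta> [^]\<^bsub>K\<^esub> k)" for k :: nat
    using ring_hom_nat_pow[OF h K.ring_axioms M \<zeta>c(1)] by simp
  show ?thesis
  proof (intro symbol_relations.intro symbol_relations_axioms.intro)
    show "h \<zeta> [^]\<^bsub>M\<^esub> q = \<one>\<^bsub>M\<^esub>" using hp \<zeta>c by simp
    show "h \<zeta> [^]\<^bsub>M\<^esub> k \<noteq> \<one>\<^bsub>M\<^esub>" if "0 < k" "k < q" for k
      using hp[of k] prim[OF that] inj_onD[OF inj, of "\<zeta> [^]\<^bsub>K\<^esub> k" "\<one>\<^bsub>K\<^esub>"] \<zeta>c by auto
    have "[q] \<cdot>\<^bsub>M\<^esub> \<one>\<^bsub>M\<^esub> = h ([q] \<cdot>\<^bsub>K\<^esub> \<one>\<^bsub>K\<^esub>)"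
      using ring_hom_add_pow[OF h K.ring_axioms M, of "\<one>\<^bsub>K\<^esub>" q] by simp
    then show "[q] \<cdot>\<^bsub>M\<^esub> \<one>\<^bsub>M\<^esub> \<noteq> \<zero>\<^bsub>M\<^esub>" using nz[OF _ q(2)] by simp
    show "h \<zeta> \<in> Z" "h \<alpha> \<in> Z" "h \<beta> \<in> Z" using Z(2) \<zeta>c \<alpha> \<beta> by auto
    show "h \<alpha> \<noteq> \<zero>\<^bsub>M\<^esub>" "h \<beta> \<noteq> \<zero>\<^bsub>M\<^esub>" using nz \<alpha> \<beta> by auto
  qed (use M Z central uv q in auto)
qed

lemma central_division_algebra_center:
  assumes F: "field F" and E: "central_division_algebra F E \<epsilon>"
  shows "subfield (\<epsilon> ` carrier F) E"
    and "z \<in> \<epsilon> ` carrier F \<Longrightarrow> x \<in> carrier E \<Longrightarrow> x \<otimes>\<^bsub>E\<^esub> z = z \<otimes>\<^bsub>E\<^esub> x"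
    and "\<one>\<^bsub>E\<^esub> \<noteq> \<zero>\<^bsub>E\<^esub>"
proof -
  interpret F: field F by fact
  have r: "ring E" and U: "Units E = carrier E - {\<zero>\<^bsub>E\<^esub>}" and \<epsilon>: "\<epsilon> \<in> ring_hom F E"
    and c: "\<epsilon> ` carrier F = ring_center E"
    using E unfolding central_division_algebra_def by auto
  interpret E: ring E by fact
  show ne: "\<one>\<^bsub>E\<^esub> \<noteq> \<zero>\<^bsub>E\<^esub>" using U E.Units_one_closed by auto
  interpret h: ring_hom_ring F E \<epsilon> by (rule ring_hom_ringI2) (use \<epsilon> F.ring_axioms r in auto)
  show "subfield (\<epsilon> ` carrier F) E" by (rule h.img_is_subfield(2)[OF F.carrier_is_subfield ne])
  show "x \<otimes>\<^bsub>E\<^esub> z = z \<otimes>\<^bsub>E\<^esub> x" if "z \<in> \<epsilon> ` carrier F" "x \<in> carrier E"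
    using that unfolding c ring_center_def by simp
qed

text \<open>Comparing the two dimensions of the matrix ring over \<open>E\<close> gives \<open>N\<^sup>2 n =
  q\<^sup>2\<close> with \<open>N\<close> the size of the matrices and \<open>n = (E : F)\<close>. So
  \<open>N\<close> divides the prime \<open>q\<close>; for \<open>N = q\<close> the dimension \<open>n\<close>
  is one, and for \<open>N = 1\<close> the matrices are elements of \<open>E\<close>.\<close>
theorem division_component_dichotomy:
  fixes F :: "('f, 'o) ring_scheme" and E :: "('e, 'p) ring_scheme" and q :: nat
  assumes K: "field K" and F: "field F" and \<iota>: "\<iota> \<in> ring_hom K F" and q: "Factorial_Ring.prime q"
    and c: "\<alpha> \<in> carrier K" "\<alpha> \<noteq> \<zero>\<^bsub>K\<^esub>" "\<beta> \<in> carrier K" "\<beta> \<noteq> \<zero>\<^bsub>K\<^esub>"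
    and qK: "[q] \<cdot>\<^bsub>K\<^esub> \<one>\<^bsub>K\<^esub> \<noteq> \<zero>\<^bsub>K\<^esub>" and \<zeta>: "primitive_root_of_unity K q \<zeta>"
    and D: "division_component K (symbol_algebra K q \<zeta> \<alpha> \<beta>) (symbol_map K q \<zeta> \<alpha> \<beta>) D \<delta>"
    and E: "division_component F (tensor_algebra K D \<delta> F \<iota>) (tensor_map K D \<delta> F \<iota>) E \<epsilon>"
  shows "carrier E = \<epsilon> ` carrier F \<or>
    (\<exists>u v. symbol_relations E (\<epsilon> ` carrier F) u v (\<epsilon> (\<iota> \<zeta>)) (\<epsilon> (\<iota> \<alpha>)) (\<epsilon> (\<iota> \<beta>)) q \<and>
       generated_by E (\<epsilon> ` carrier F \<union> {u, v}))"
proof -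
  interpret K: field K by fact
  interpret F: field F by fact
  let ?Z = "\<epsilon> ` carrier F"
  have cda: "central_division_algebra F E \<epsilon>" using E unfolding division_component_def by simp
  have rE: "ring E" and \<epsilon>: "\<epsilon> \<in> ring_hom F E" using division_component_rings[OF E] by auto
  interpret E: ring E by fact
  note sfE = central_division_algebra_center(1)[OF F cda]
  note cE = central_division_algebra_center(2)[OF F cda]
  have ZE: "?Z \<subseteq> carrier E" using ring_hom_closed[OF \<epsilon>] by blast
  have \<zeta>c: "\<zeta> \<in> carrier K" using \<zeta> by (simp add: primitive_root_of_unity_def)
  obtain I :: "(nat \<times> nat) set" and u v where I: "finite I" "I \<noteq> {}"
    and uv: "u \<in> carrier (mat_ring I E)" "v \<in> carrier (mat_ring I E)"
    "u [^]\<^bsub>mat_ring I E\<^esub> q = scalar_mat I E (\<epsilon> (\<iota> \<alpha>))"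
    "v [^]\<^bsub>mat_ring I E\<^esub> q = scalar_mat I E (\<epsilon> (\<iota> \<beta>))"
    "u \<otimes>\<^bsub>mat_ring I E\<^esub> v = scalar_mat I E (\<epsilon> (\<iota> \<zeta>)) \<otimes>\<^bsub>mat_ring I E\<^esub> (v \<otimes>\<^bsub>mat_ring I E\<^esub> u)"
    and gen: "generated_by (mat_ring I E) (scalar_mat I E ` \<epsilon> ` carrier F \<union> {u, v})"
    by (rule symbol_in_matrices_over_component[OF K.ring_axioms F.ring_axioms \<iota> \<zeta>c c(1,3) D E])
  let ?M = "mat_ring I E" and ?s = "scalar_mat I E"
  interpret M: ring ?M by (rule E.mat_ring_is_ring[OF I(1)])
  have s: "?s \<in> ring_hom E ?M" by (rule E.scalar_mat_hom[OF I(1)])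
  interpret s: ring_hom_ring E ?M ?s by (rule ring_hom_ringI2) (use s rE M.ring_axioms in auto)
  have oneM: "\<one>\<^bsub>?M\<^esub> \<noteq> \<zero>\<^bsub>?M\<^esub>"
  proof
    obtain i where i: "i \<in> I" using I by blast
    assume "\<one>\<^bsub>?M\<^esub> = \<zero>\<^bsub>?M\<^esub>"
    then have "\<one>\<^bsub>?M\<^esub> i i = \<zero>\<^bsub>?M\<^esub> i i" by simp
    then show False using central_division_algebra_center(3)[OF F cda] i
      by (simp add: E.mat_ring_simps scalar_mat_def)
  qed
  have sfM: "subfield (?s ` ?Z) ?M" by (rule s.img_is_subfield(2)[OF sfE oneM])
  have cM: "x \<otimes>\<^bsub>?M\<^esub> z = z \<otimes>\<^bsub>?M\<^esub> x" if z: "z \<in> ?s ` ?Z" and x: "x \<in> carrier ?M" for z x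
  proof -
    obtain e where e: "e \<in> ?Z" "z = ?s e" using z by blast
    then show ?thesis using E.scalar_mat_mult[OF I(1) _ x, of e] ZE cE[OF e(1)] E.mat_entry[OF x]
      by (auto intro!: ext)
  qed
  have hE: "\<epsilon> \<circ> \<iota> \<in> ring_hom K E" by (rule ring_hom_trans[OF \<iota> \<epsilon>])
  have hM: "?s \<circ> (\<epsilon> \<circ> \<iota>) \<in> ring_hom K ?M" by (rule ring_hom_trans[OF hE s])
  have hZ: "(\<epsilon> \<circ> \<iota>) ` carrier K \<subseteq> ?Z" using ring_hom_closed[OF \<iota>] by auto
  have q0: "0 < q" using q prime_gt_0_nat by blast
  have "symbol_relations ?M (?s ` ?Z) u v ((?s \<circ> (\<epsilon> \<circ> \<iota>)) \<zeta>) ((?s \<circ> (\<epsilon> \<circ> \<iota>)) \<alpha>) ((?s \<circ> (\<epsilon> \<circ> \<iota>)) \<beta>) q"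
    by (rule symbol_relations_via_hom[OF K M.ring_axioms hM sfM _ cM])
      (use hZ uv c q0 qK \<zeta> in auto)
  then interpret S: symbol_relations ?M "?s ` ?Z" u v "?s (\<epsilon> (\<iota> \<zeta>))" "?s (\<epsilon> (\<iota> \<alpha>))" "?s (\<epsilon> (\<iota> \<beta>))" q
    by simp
  obtain n where n: "E.dimension n ?Z (carrier E)"
    using cda unfolding central_division_algebra_def E.finite_dimension_def by blast
  have "M.dimension (card I * card I * n) (?s ` ?Z) (carrier ?M)"
    by (rule E.dimension_mat_ring[OF I(1) ZE n sfM])
  moreover have "M.dimension (q * q) (?s ` ?Z) (carrier ?M)"
    using S.dimension_combs S.generated_imp_combs[OF gen] by simp
  ultimately have eq: "card I * card I * n = q * q" using M.dimension_is_inj[OF sfM] by blast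
  have "(card I)\<^sup>2 dvd q\<^sup>2" using eq by (metis dvd_triv_left power2_eq_square)
  then have "card I dvd q" by (simp add: pow_divides_pow_iff)
  then have "card I = 1 \<or> card I = q" using q by (simp add: prime_nat_iff)
  then show ?thesis
  proof
    assume "card I = q"
    then have "n = 1" using eq q0 by simp
    then show ?thesis using E.dimension_one_subfield[OF sfE _ ZE] n by simp
  next
    assume "card I = 1"
    then obtain s where Is: "I = {s}" by (auto simp: card_1_singleton_iff)
    define \<pi> where "\<pi> U = U s s" for U :: "nat \<times> nat \<Rightarrow> nat \<times> nat \<Rightarrow> 'e"
    have \<pi>: "\<pi> \<in> ring_hom ?M E"
      by (rule ring_hom_memI)
        (simp_all add: \<pi>_def E.mat_ring_simps Is scalar_mat_def)
    have \<pi>s: "\<pi> (?s x) = x" for x by (simp add: \<pi>_def scalar_mat_def Is)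
    have surj: "x \<in> \<pi> ` carrier ?M" if "x \<in> carrier E" for x
      using \<pi>s[of x] E.scalar_mat_carrier[OF that, of I] by (metis imageI)
    have uvE: "\<pi> u \<in> carrier E" "\<pi> v \<in> carrier E" using ring_hom_closed[OF \<pi>] uv by auto
    have pw: "\<pi> u [^]\<^bsub>E\<^esub> q = \<epsilon> (\<iota> \<alpha>)" "\<pi> v [^]\<^bsub>E\<^esub> q = \<epsilon> (\<iota> \<beta>)"
      using ring_hom_nat_pow[OF \<pi> M.ring_axioms rE uv(1), of q] ring_hom_nat_pow[OF \<pi> M.ring_axioms rE uv(2), of q]
        uv(3,4) \<pi>s by simp_all
    have \<epsilon>\<zeta>: "?s (\<epsilon> (\<iota> \<zeta>)) \<in> carrier ?M"
      by (intro E.scalar_mat_carrier ring_hom_closed[OF \<epsilon>] ring_hom_closed[OF \<iota>] \<zeta>c)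
    have "\<pi> (u \<otimes>\<^bsub>?M\<^esub> v) = \<pi> (?s (\<epsilon> (\<iota> \<zeta>)) \<otimes>\<^bsub>?M\<^esub> (v \<otimes>\<^bsub>?M\<^esub> u))" using uv(5) by simp
    then have "\<pi> u \<otimes>\<^bsub>E\<^esub> \<pi> v = \<epsilon> (\<iota> \<zeta>) \<otimes>\<^bsub>E\<^esub> (\<pi> v \<otimes>\<^bsub>E\<^esub> \<pi> u)"
      using uv(1,2) \<epsilon>\<zeta> by (simp add: ring_hom_mult[OF \<pi>] \<pi>s)
    then have "symbol_relations E ?Z (\<pi> u) (\<pi> v) ((\<epsilon> \<circ> \<iota>) \<zeta>) ((\<epsilon> \<circ> \<iota>) \<alpha>) ((\<epsilon> \<circ> \<iota>) \<beta>) q"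
      by (intro symbol_relations_via_hom[OF K rE hE sfE hZ cE])
        (use uvE pw c q0 qK \<zeta> in auto)
    moreover have "generated_by E (?Z \<union> {\<pi> u, \<pi> v})"
      unfolding generated_by_def
    proof (intro conjI allI impI subsetI)
      show "x \<in> carrier E" if "x \<in> ?Z \<union> {\<pi> u, \<pi> v}" for x using that uvE ZE by blast
      fix C x assume C: "?Z \<union> {\<pi> u, \<pi> v} \<subseteq> C" and x: "x \<in> carrier E"
        and cl: "\<forall>x\<in>C \<inter> carrier E. \<forall>y\<in>C \<inter> carrier E. x \<oplus>\<^bsub>E\<^esub> y \<in> C \<and> x \<otimes>\<^bsub>E\<^esub> y \<in> C"
      have "\<pi> U \<in> C" if "U \<in> carrier ?M" for U
        using gen that
      proof (induction rule: generated_by_induct)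
        case (gen U)
        then consider z where "z \<in> ?Z" "U = ?s z" | "U = u" | "U = v" by blast
        then show ?case using C \<pi>s by cases auto
      next
        case (add U W)
        then show ?case using cl ring_hom_closed[OF \<pi>] by (simp add: ring_hom_add[OF \<pi>])
      next
        case (mult U W)
        then show ?case using cl ring_hom_closed[OF \<pi>] by (simp add: ring_hom_mult[OF \<pi>])
      qed
      then show "x \<in> C" using surj[OF x] by blast
    qed
    ultimately show ?thesis by auto
  qed
qed

section \<open>Complete discrete valuation rings\<close>

text \<open>\<open>Q\<close> is a complete discrete valuation ring with uniformizer \<open>\<pi>\<close> and
  field of fractions \<open>Z\<close>, placed inside a ring \<open>M\<close> that need not be commutative. The
  valuation is expressed through the decomposition into a unit times a power of \<open>\<pi>\<close>, where the
  power is moved to the other side if its exponent is negative. The last condition is the convergence of the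
  series with terms \<open>\<pi>\<^sup>n d\<^sub>n\<close>.\<close>
locale complete_dvr = ring M for M (structure) +
  fixes Z Q :: "'a set" and \<pi> :: 'a
  assumes subfield_Z: "subfield Z M" and subring_Q: "subring Q M" and Q_sub_Z: "Q \<subseteq> Z"
    and \<pi>: "\<pi> \<in> Q" "\<pi> \<noteq> \<zero>" and \<pi>_nonunit: "\<And>w. w \<in> Q \<Longrightarrow> w \<otimes> \<pi> \<noteq> \<one>"
    and decomp: "\<And>x. x \<in> Z \<Longrightarrow> x \<noteq> \<zero> \<Longrightarrow>
      \<exists>(n::nat). \<exists>y\<in>Q. \<exists>w\<in>Q. w \<otimes> y = \<one> \<and> (x = \<pi> [^] n \<otimes> y \<or> \<pi> [^] n \<otimes> x = y)"
    and complete: "\<And>f :: nat \<Rightarrow> 'a. (\<And>n. f n \<in> Q) \<Longrightarrow> (\<And>n. \<exists>d\<in>Q. f (Suc n) = f n \<oplus> \<pi> [^] n \<otimes> d) \<Longrightarrow>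
      \<exists>a\<in>Q. \<forall>n. \<exists>d\<in>Q. a = f n \<oplus> \<pi> [^] n \<otimes> d"

lemma complete_dvr_image:
  assumes F: "field F" and V: "complete_dvr F (carrier F) V \<pi>" and E: "ring E"
    and h: "h \<in> ring_hom F E" and ne: "\<one>\<^bsub>E\<^esub> \<noteq> \<zero>\<^bsub>E\<^esub>"
  shows "complete_dvr E (h ` carrier F) (h ` V) (h \<pi>)"
proof -
  interpret F: field F by fact
  interpret V: complete_dvr F "carrier F" V \<pi> by fact
  interpret E: ring E by fact
  interpret h: ring_hom_ring F E h by (rule ring_hom_ringI2) (use h F.ring_axioms E in auto)
  have inj: "inj_on h (carrier F)" by (rule h.img_is_subfield(1)[OF F.carrier_is_subfield ne])
  have VF [simp]: "x \<in> V \<Longrightarrow> x \<in> carrier F" for x using V.Q_sub_Z by blast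
  have \<pi>: "\<pi> \<in> carrier F" using V.\<pi> by simp
  have hp: "h \<pi> [^]\<^bsub>E\<^esub> n = h (\<pi> [^]\<^bsub>F\<^esub> n)" for n :: nat
    using ring_hom_nat_pow[OF h F.ring_axioms E \<pi>] by simp
  have h0: "h x = \<zero>\<^bsub>E\<^esub> \<longleftrightarrow> x = \<zero>\<^bsub>F\<^esub>" if "x \<in> carrier F" for x
    using inj_onD[OF inj, of x "\<zero>\<^bsub>F\<^esub>"] that by auto
  have h1: "h x = \<one>\<^bsub>E\<^esub> \<longleftrightarrow> x = \<one>\<^bsub>F\<^esub>" if "x \<in> carrier F" for x
    using inj_onD[OF inj, of x "\<one>\<^bsub>F\<^esub>"] that by auto
  show ?thesis
    unfolding complete_dvr_def complete_dvr_axioms_def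
  proof (intro conjI allI impI)
    show "subfield (h ` carrier F) E" by (rule h.img_is_subfield(2)[OF F.carrier_is_subfield ne])
    show "subring (h ` V) E" by (rule h.img_is_subring[OF V.subring_Q])
    show "h \<pi> \<noteq> \<zero>\<^bsub>E\<^esub>" using h0[OF \<pi>] V.\<pi> by simp
  next
    fix w assume "w \<in> h ` V"
    then obtain y where y: "y \<in> V" "w = h y" by blast
    then show "w \<otimes>\<^bsub>E\<^esub> h \<pi> \<noteq> \<one>\<^bsub>E\<^esub>" using V.\<pi>_nonunit[OF y(1)] h1[of "y \<otimes>\<^bsub>F\<^esub> \<pi>"] \<pi> by simp
  next
    fix x assume x: "x \<in> h ` carrier F" "x \<noteq> \<zero>\<^bsub>E\<^esub>"
    show "\<exists>(n::nat). \<exists>y\<in>h ` V. \<exists>w\<in>h ` V. w \<otimes>\<^bsub>E\<^esub> y = \<one>\<^bsub>E\<^esub> \<and>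
        (x = h \<pi> [^]\<^bsub>E\<^esub> n \<otimes>\<^bsub>E\<^esub> y \<or> h \<pi> [^]\<^bsub>E\<^esub> n \<otimes>\<^bsub>E\<^esub> x = y)"
    proof -
      obtain t where t: "t \<in> carrier F" "x = h t" using x(1) by blast
      then have t0: "t \<noteq> \<zero>\<^bsub>F\<^esub>" using x(2) h0[OF t(1)] by blast
      obtain n :: nat and y w where y: "y \<in> V" "w \<in> V" "w \<otimes>\<^bsub>F\<^esub> y = \<one>\<^bsub>F\<^esub>"
        and d: "t = \<pi> [^]\<^bsub>F\<^esub> n \<otimes>\<^bsub>F\<^esub> y \<or> \<pi> [^]\<^bsub>F\<^esub> n \<otimes>\<^bsub>F\<^esub> t = y"
        using V.decomp[OF t(1) t0] by blast
      have "h w \<otimes>\<^bsub>E\<^esub> h y = \<one>\<^bsub>E\<^esub>" using y h.hom_mult[of w y] by simp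
      moreover have "x = h \<pi> [^]\<^bsub>E\<^esub> n \<otimes>\<^bsub>E\<^esub> h y \<or> h \<pi> [^]\<^bsub>E\<^esub> n \<otimes>\<^bsub>E\<^esub> x = h y"
        using d t y \<pi> h.hom_mult[of "\<pi> [^]\<^bsub>F\<^esub> n" y] h.hom_mult[of "\<pi> [^]\<^bsub>F\<^esub> n" t] by (auto simp: hp)
      ultimately show ?thesis using y by blast
    qed
  next
    fix f :: "nat \<Rightarrow> _"
    assume f: "\<forall>n. f n \<in> h ` V" and d: "\<forall>n. \<exists>d\<in>h ` V. f (Suc n) = f n \<oplus>\<^bsub>E\<^esub> h \<pi> [^]\<^bsub>E\<^esub> n \<otimes>\<^bsub>E\<^esub> d"
    show "\<exists>a\<in>h ` V. \<forall>n. \<exists>d\<in>h ` V. a = f n \<oplus>\<^bsub>E\<^esub> h \<pi> [^]\<^bsub>E\<^esub> n \<otimes>\<^bsub>E\<^esub> d"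
    proof -
      have "\<exists>y. y \<in> V \<and> f n = h y" for n using f by blast
      then obtain g where g: "\<And>n. g n \<in> V" "\<And>n. f n = h (g n)" by metis
      have step: "\<exists>e\<in>V. g (Suc n) = g n \<oplus>\<^bsub>F\<^esub> \<pi> [^]\<^bsub>F\<^esub> n \<otimes>\<^bsub>F\<^esub> e" for n
      proof -
        obtain e where e: "e \<in> V" "f (Suc n) = f n \<oplus>\<^bsub>E\<^esub> h \<pi> [^]\<^bsub>E\<^esub> n \<otimes>\<^bsub>E\<^esub> h e" using d by blast
        have "h (g (Suc n)) = h (g n \<oplus>\<^bsub>F\<^esub> \<pi> [^]\<^bsub>F\<^esub> n \<otimes>\<^bsub>F\<^esub> e)" using e g \<pi> by (simp add: hp)
        then have "g (Suc n) = g n \<oplus>\<^bsub>F\<^esub> \<pi> [^]\<^bsub>F\<^esub> n \<otimes>\<^bsub>F\<^esub> e"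
          by (rule inj_onD[OF inj]) (use g e \<pi> in simp_all)
        then show ?thesis using e by blast
      qed
      then obtain a where a: "a \<in> V" "\<forall>n. \<exists>e\<in>V. a = g n \<oplus>\<^bsub>F\<^esub> \<pi> [^]\<^bsub>F\<^esub> n \<otimes>\<^bsub>F\<^esub> e"
        using V.complete[of g, OF g(1) step] by blast
      have "\<exists>d\<in>h ` V. h a = f n \<oplus>\<^bsub>E\<^esub> h \<pi> [^]\<^bsub>E\<^esub> n \<otimes>\<^bsub>E\<^esub> d" for n
      proof -
        obtain e where e: "e \<in> V" "a = g n \<oplus>\<^bsub>F\<^esub> \<pi> [^]\<^bsub>F\<^esub> n \<otimes>\<^bsub>F\<^esub> e" using a by blast
        have "h a = f n \<oplus>\<^bsub>E\<^esub> h \<pi> [^]\<^bsub>E\<^esub> n \<otimes>\<^bsub>E\<^esub> h e" unfolding e(2) using e g \<pi> by (simp add: hp)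
        then show ?thesis using e by blast
      qed
      then show ?thesis using a by blast
    qed
  qed (use E V.Q_sub_Z V.\<pi> in auto)
qed

section \<open>The completion of a discretely valued field\<close>

locale discretely_valued_field = field K for K (structure) +
  fixes v :: "'a \<Rightarrow> int" and \<pi> :: 'a
  assumes v_mult: "\<And>x y. \<lbrakk>x \<in> carrier K; y \<in> carrier K; x \<noteq> \<zero>; y \<noteq> \<zero>\<rbrakk> \<Longrightarrow> v (x \<otimes> y) = v x + v y"
    and v_add: "\<And>x y. \<lbrakk>x \<in> carrier K; y \<in> carrier K; x \<noteq> \<zero>; y \<noteq> \<zero>; x \<oplus> y \<noteq> \<zero>\<rbrakk> \<Longrightarrow> min (v x) (v y) \<le> v (x \<oplus> y)"
    and \<pi>: "\<pi> \<in> carrier K" "\<pi> \<noteq> \<zero>" "v \<pi> = 1"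
begin

text \<open>The value of \<open>v\<close> at zero is arbitrary, whereas zero is to have infinite
  valuation.\<close>
definition ge :: "int \<Rightarrow> 'a \<Rightarrow> bool" where "ge N x \<longleftrightarrow> x = \<zero> \<or> N \<le> v x"

definition V :: "'a set" where "V = {x \<in> carrier K. ge 0 x}"

lemma nonzero_inv [simp]: "x \<in> carrier K \<Longrightarrow> x \<noteq> \<zero> \<Longrightarrow> inv x \<in> carrier K"
  "x \<in> carrier K \<Longrightarrow> x \<noteq> \<zero> \<Longrightarrow> inv x \<noteq> \<zero>"
  "x \<in> carrier K \<Longrightarrow> x \<noteq> \<zero> \<Longrightarrow> x \<otimes> inv x = \<one>"
  "x \<in> carrier K \<Longrightarrow> x \<noteq> \<zero> \<Longrightarrow> inv x \<otimes> x = \<one>"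
  using field_Units Units_inv_Units by auto

lemma v_one [simp]: "v \<one> = 0"
  using v_mult[of \<one> \<one>] by simp

lemma v_inv: "x \<in> carrier K \<Longrightarrow> x \<noteq> \<zero> \<Longrightarrow> v (inv x) = - v x"
  using v_mult[of x "inv x"] by simp

lemma v_minus: "x \<in> carrier K \<Longrightarrow> x \<noteq> \<zero> \<Longrightarrow> v (\<ominus> x) = v x"
proof -
  assume x: "x \<in> carrier K" "x \<noteq> \<zero>"
  have m: "\<ominus> \<one> \<noteq> \<zero>" using one_not_zero by (metis minus_minus minus_zero one_closed)
  have "v (\<ominus> \<one>) + v (\<ominus> \<one>) = v (\<ominus> \<one> \<otimes> \<ominus> \<one>)" using v_mult[of "\<ominus> \<one>" "\<ominus> \<one>"] m by simp
  also have "\<ominus> \<one> \<otimes> \<ominus> \<one> = \<one>" by (simp add: l_minus)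
  finally have "v (\<ominus> \<one>) = 0" by simp
  moreover have "\<ominus> x = \<ominus> \<one> \<otimes> x" using x by (simp add: l_minus)
  ultimately show ?thesis using v_mult[of "\<ominus> \<one>" x] m x by simp
qed

lemma ge_zero [simp]: "ge N \<zero>" by (simp add: ge_def)

lemma ge_mono: "ge N x \<Longrightarrow> N' \<le> N \<Longrightarrow> ge N' x" by (auto simp: ge_def)

lemma ge_add: "x \<in> carrier K \<Longrightarrow> y \<in> carrier K \<Longrightarrow> ge N x \<Longrightarrow> ge N y \<Longrightarrow> ge N (x \<oplus> y)"
  using v_add[of x y] by (cases "x = \<zero>"; cases "y = \<zero>") (auto simp: ge_def)

lemma ge_minus: "x \<in> carrier K \<Longrightarrow> ge N x \<Longrightarrow> ge N (\<ominus> x)"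
  using v_minus[of x] by (cases "x = \<zero>") (auto simp: ge_def)

lemma ge_diff: "x \<in> carrier K \<Longrightarrow> y \<in> carrier K \<Longrightarrow> ge N x \<Longrightarrow> ge N y \<Longrightarrow> ge N (x \<ominus> y)"
  unfolding minus_eq by (intro ge_add ge_minus) auto

lemma ge_mult: "x \<in> carrier K \<Longrightarrow> y \<in> carrier K \<Longrightarrow> ge N x \<Longrightarrow> ge N' y \<Longrightarrow> ge (N + N') (x \<otimes> y)"
  using v_mult[of x y] by (cases "x = \<zero>"; cases "y = \<zero>") (auto simp: ge_def)

lemma diff_add: "x \<in> carrier K \<Longrightarrow> y \<in> carrier K \<Longrightarrow> y \<oplus> (x \<ominus> y) = x"
  by (simp add: minus_eq a_comm[of x] r_neg2)

lemma ge_eq: \<comment> \<open>a perturbation of higher valuation does not change the valuation\<close>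
  assumes "x \<in> carrier K" "y \<in> carrier K" "x \<noteq> \<zero>" "ge N (y \<ominus> x)" "v x < N"
  shows "y \<noteq> \<zero> \<and> v y = v x"
proof -
  have y: "y = x \<oplus> (y \<ominus> x)" using assms diff_add[of y x] by simp
  have 1: "\<not> ge N y"
  proof
    assume "ge N y"
    then have "ge N (y \<ominus> (y \<ominus> x))" using assms by (intro ge_diff[of y "y \<ominus> x"]) simp_all
    moreover have "y \<ominus> (y \<ominus> x) = x" using assms by (simp add: minus_eq minus_add r_neg2)
    ultimately show False using assms by (simp add: ge_def)
  qed
  have "ge (v x) y"
    by (subst y, rule ge_add) (use assms ge_mono[OF assms(4)] in \<open>auto simp: ge_def\<close>)
  moreover have "\<not> ge (v x + 1) y"
  proof
    assume "ge (v x + 1) y"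
    moreover have "ge (v x + 1) (y \<ominus> x)" using assms by (intro ge_mono[OF assms(4)]) simp
    ultimately have "ge (v x + 1) (y \<ominus> (y \<ominus> x))"
      using assms by (intro ge_diff[of y "y \<ominus> x"]) simp_all
    moreover have "y \<ominus> (y \<ominus> x) = x" using assms by (simp add: minus_eq minus_add r_neg2)
    ultimately show False using assms by (simp add: ge_def)
  qed
  ultimately show ?thesis using 1 by (auto simp: ge_def)
qed

lemma v_pow: "v (\<pi> [^] (n::nat)) = int n" and \<pi>_pow_nonzero [simp]: "\<pi> [^] (n::nat) \<noteq> \<zero>"
proof -
  have "\<pi> [^] n \<noteq> \<zero> \<and> v (\<pi> [^] n) = int n"
  proof (induction n)
    case (Suc n)
    then have "\<pi> [^] n \<otimes> \<pi> \<noteq> \<zero>" using \<pi> integral by fastforce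
    then show ?case using Suc v_mult[of "\<pi> [^] n" \<pi>] \<pi> by simp
  qed simp
  then show "v (\<pi> [^] n) = int n" "\<pi> [^] n \<noteq> \<zero>" by auto
qed

lemma V_subring: "subring V K"
proof (rule subringI)
  fix x y assume "x \<in> V" "y \<in> V"
  then show "x \<otimes> y \<in> V" "x \<oplus> y \<in> V" using ge_mult[of x y 0 0] ge_add[of x y 0] by (auto simp: V_def)
qed (auto simp: V_def ge_minus, simp add: ge_def)

subsection \<open>Cauchy sequences\<close>

abbreviation "C \<equiv> cauchy_ring K v"

lemma cauchy_iff: "s \<in> cauchy_seqs K v \<longleftrightarrow> (\<forall>i. s i \<in> carrier K) \<and> (\<forall>N. \<exists>k. \<forall>i\<ge>k. \<forall>j\<ge>k. ge N (s i \<ominus> s j))"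
  unfolding cauchy_seqs_def ge_def mem_Collect_eq using r_right_minus_eq by metis

lemma null_iff: "s \<in> null_seqs K v \<longleftrightarrow> (\<forall>i. s i \<in> carrier K) \<and> (\<forall>N. \<exists>k. \<forall>i\<ge>k. ge N (s i))"
  by (simp add: null_seqs_def ge_def)

lemma cauchyE: "s \<in> cauchy_seqs K v \<Longrightarrow> \<exists>k. \<forall>i\<ge>k. \<forall>j\<ge>k. ge N (s i \<ominus> s j)"
  by (simp add: cauchy_iff)

lemma nullE: "s \<in> null_seqs K v \<Longrightarrow> \<exists>k. \<forall>i\<ge>k. ge N (s i)"
  by (simp add: null_iff)

lemma cauchyI:
  assumes "\<And>i. s i \<in> carrier K" "\<And>N. \<exists>k. \<forall>i\<ge>k. ge N (s i \<ominus> s k)"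
  shows "s \<in> cauchy_seqs K v"
  unfolding cauchy_iff
proof (intro conjI allI)
  fix N
  obtain k where k: "\<And>i. i \<ge> k \<Longrightarrow> ge N (s i \<ominus> s k)" using assms(2) by blast
  have "ge N (s i \<ominus> s j)" if "i \<ge> k" "j \<ge> k" for i j
  proof -
    have "s i \<ominus> s j = (s i \<ominus> s k) \<ominus> (s j \<ominus> s k)"
      using assms(1)[of i] assms(1)[of j] assms(1)[of k] by algebra
    then show ?thesis using ge_diff[OF _ _ k[OF that(1)] k[OF that(2)]] assms(1) by simp
  qed
  then show "\<exists>k. \<forall>i\<ge>k. \<forall>j\<ge>k. ge N (s i \<ominus> s j)" by blast
qed (use assms in auto)

lemma null_cauchy: "s \<in> null_seqs K v \<Longrightarrow> s \<in> cauchy_seqs K v"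
  unfolding cauchy_iff null_iff by (meson ge_diff)

lemma const_cauchy: "c \<in> carrier K \<Longrightarrow> (\<lambda>_. c) \<in> cauchy_seqs K v"
  unfolding cauchy_iff by (simp add: r_neg minus_eq)

lemma cauchy_bounded:
  assumes s: "s \<in> cauchy_seqs K v"
  shows "\<exists>B. \<forall>i. ge B (s i)"
proof -
  obtain k where k: "\<And>i. i \<ge> k \<Longrightarrow> ge 0 (s i \<ominus> s k)" using cauchyE[OF s, of 0] by blast
  have c: "s i \<in> carrier K" for i using s by (simp add: cauchy_iff)
  define B where "B = Min (insert 0 (v ` s ` {..k}))"
  have B: "ge B (s i)" if "i \<le> k" for i
    using that unfolding ge_def B_def by (intro disjI2 Min_le) auto
  have "ge B (s i)" for i
  proof (cases "i \<le> k")
    case False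
    have "B \<le> 0" unfolding B_def by (intro Min_le) auto
    then have "ge B (s i \<ominus> s k)" by (rule ge_mono[of 0, rotated]) (use k[of i] False in auto)
    then have "ge B (s k \<oplus> (s i \<ominus> s k))" using B[of k] c by (intro ge_add) auto
    then show ?thesis using c by (simp add: diff_add)
  qed (rule B)
  then show ?thesis by blast
qed

lemma cauchy_add: "s \<in> cauchy_seqs K v \<Longrightarrow> t \<in> cauchy_seqs K v \<Longrightarrow> (\<lambda>i. s i \<oplus> t i) \<in> cauchy_seqs K v"
proof (rule cauchyI)
  assume st: "s \<in> cauchy_seqs K v" "t \<in> cauchy_seqs K v"
  then have c: "s i \<in> carrier K" "t i \<in> carrier K" for i by (simp_all add: cauchy_iff)
  then show "s i \<oplus> t i \<in> carrier K" for i by simp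
  fix N
  obtain k l where k: "\<And>i j. i \<ge> k \<Longrightarrow> j \<ge> k \<Longrightarrow> ge N (s i \<ominus> s j)" and l: "\<And>i j. i \<ge> l \<Longrightarrow> j \<ge> l \<Longrightarrow> ge N (t i \<ominus> t j)"
    using cauchyE[OF st(1), of N] cauchyE[OF st(2), of N] by blast
  have "ge N ((s i \<oplus> t i) \<ominus> (s (max k l) \<oplus> t (max k l)))" if "i \<ge> max k l" for i
  proof -
    have "(s i \<oplus> t i) \<ominus> (s (max k l) \<oplus> t (max k l)) = (s i \<ominus> s (max k l)) \<oplus> (t i \<ominus> t (max k l))"
      using c by (simp add: minus_eq minus_add a_ac)
    then show ?thesis using ge_add[OF _ _ k l] c that by simp
  qed
  then show "\<exists>k. \<forall>i\<ge>k. ge N ((s i \<oplus> t i) \<ominus> (s k \<oplus> t k))" by blast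
qed

lemma cauchy_mult: "s \<in> cauchy_seqs K v \<Longrightarrow> t \<in> cauchy_seqs K v \<Longrightarrow> (\<lambda>i. s i \<otimes> t i) \<in> cauchy_seqs K v"
proof (rule cauchyI)
  assume st: "s \<in> cauchy_seqs K v" "t \<in> cauchy_seqs K v"
  then have c: "s i \<in> carrier K" "t i \<in> carrier K" for i by (simp_all add: cauchy_iff)
  then show "s i \<otimes> t i \<in> carrier K" for i by simp
  fix N
  obtain B B' where B: "\<And>i. ge B (s i)" and B': "\<And>i. ge B' (t i)"
    using cauchy_bounded[OF st(1)] cauchy_bounded[OF st(2)] by blast
  obtain k l where k: "\<And>i j. i \<ge> k \<Longrightarrow> j \<ge> k \<Longrightarrow> ge (N - B') (s i \<ominus> s j)"
    and l: "\<And>i j. i \<ge> l \<Longrightarrow> j \<ge> l \<Longrightarrow> ge (N - B) (t i \<ominus> t j)"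
    using cauchyE[OF st(1), of "N - B'"] cauchyE[OF st(2), of "N - B"] by blast
  let ?m = "max k l"
  have "ge N ((s i \<otimes> t i) \<ominus> (s ?m \<otimes> t ?m))" if "i \<ge> ?m" for i
  proof -
    have "(s i \<otimes> t i) \<ominus> (s ?m \<otimes> t ?m) = s i \<otimes> (t i \<ominus> t ?m) \<oplus> (s i \<ominus> s ?m) \<otimes> t ?m"
      using c by (simp add: minus_eq r_distr l_distr l_minus r_minus a_assoc r_neg1)
    moreover have "ge (B + (N - B)) (s i \<otimes> (t i \<ominus> t ?m))" using c that by (intro ge_mult B l) auto
    moreover have "ge ((N - B') + B') ((s i \<ominus> s ?m) \<otimes> t ?m)" using c that by (intro ge_mult B' k) auto
    ultimately show ?thesis using c ge_add by simp
  qed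
  then show "\<exists>k. \<forall>i\<ge>k. ge N ((s i \<otimes> t i) \<ominus> (s k \<otimes> t k))" by blast
qed

lemma C_simps: "carrier C = cauchy_seqs K v" "\<one>\<^bsub>C\<^esub> = (\<lambda>_. \<one>)" "\<zero>\<^bsub>C\<^esub> = (\<lambda>_. \<zero>)"
  "s \<otimes>\<^bsub>C\<^esub> t = (\<lambda>i. s i \<otimes> t i)" "s \<oplus>\<^bsub>C\<^esub> t = (\<lambda>i. s i \<oplus> t i)"
  by (simp_all add: cauchy_ring_def)

lemma cauchy_entry: "s \<in> cauchy_seqs K v \<Longrightarrow> s i \<in> carrier K" by (simp add: cauchy_iff)

lemma C_cring: "cring C"
proof (rule cringI)
  show "abelian_group C"
  proof (rule abelian_groupI)
    fix s assume s: "s \<in> carrier C"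
    then have c: "s i \<in> carrier K" for i by (simp add: C_simps cauchy_entry)
    have "(\<lambda>i. \<ominus> \<one> \<otimes> s i) \<in> cauchy_seqs K v"
      using s by (intro cauchy_mult const_cauchy) (auto simp: C_simps)
    moreover have "(\<lambda>i. \<ominus> \<one> \<otimes> s i) \<oplus>\<^bsub>C\<^esub> s = \<zero>\<^bsub>C\<^esub>" using c by (simp add: C_simps l_minus l_neg)
    ultimately show "\<exists>t\<in>carrier C. t \<oplus>\<^bsub>C\<^esub> s = \<zero>\<^bsub>C\<^esub>" unfolding C_simps(1) by blast
  qed (auto simp: C_simps cauchy_add const_cauchy cauchy_entry a_ac)
  show "Group.comm_monoid C"
    by (rule comm_monoidI) (auto simp: C_simps cauchy_mult const_cauchy cauchy_entry m_ac)
qed (auto simp: C_simps cauchy_entry l_distr)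

lemma C_minus: "s \<in> cauchy_seqs K v \<Longrightarrow> t \<in> cauchy_seqs K v \<Longrightarrow> s \<ominus>\<^bsub>C\<^esub> t = (\<lambda>i. s i \<ominus> t i)"
proof -
  interpret C: cring C by (rule C_cring)
  assume st: "s \<in> cauchy_seqs K v" "t \<in> cauchy_seqs K v"
  have c: "s i \<in> carrier K" "t i \<in> carrier K" for i using st by (simp_all add: cauchy_entry)
  have n: "(\<lambda>i. \<ominus> t i) \<in> cauchy_seqs K v"
    using cauchy_mult[OF const_cauchy[of "\<ominus> \<one>"] st(2)] c by (simp add: l_minus)
  have "(\<lambda>i. \<ominus> t i) \<oplus>\<^bsub>C\<^esub> t = \<zero>\<^bsub>C\<^esub>" using c by (simp add: C_simps l_neg)
  then have "\<ominus>\<^bsub>C\<^esub> t = (\<lambda>i. \<ominus> t i)" using n st C.minus_equality by (simp add: C_simps(1))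
  then show "s \<ominus>\<^bsub>C\<^esub> t = (\<lambda>i. s i \<ominus> t i)" by (simp add: C.minus_eq C_simps minus_eq)
qed

lemma null_ideal: "ideal (null_seqs K v) C"
proof (rule idealI)
  show "ring C" using C_cring by (rule cring.axioms(1))
  interpret C: cring C by (rule C_cring)
  have nm: "(\<lambda>i. t i \<otimes> s i) \<in> null_seqs K v" if s: "s \<in> null_seqs K v" and t: "t \<in> cauchy_seqs K v" for s t
    unfolding null_iff
  proof (intro conjI allI)
    have c: "s i \<in> carrier K" "t i \<in> carrier K" for i using s t by (simp_all add: null_iff cauchy_iff)
    then show "t i \<otimes> s i \<in> carrier K" for i by simp
    fix N
    obtain B where B: "\<And>i. ge B (t i)" using cauchy_bounded[OF t] by blast
    obtain k where k: "\<And>i. i \<ge> k \<Longrightarrow> ge (N - B) (s i)" using nullE[OF s, of "N - B"] by blast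
    have "ge N (t i \<otimes> s i)" if "i \<ge> k" for i
      using ge_mult[OF c(2) c(1) B k[OF that]] by simp
    then show "\<exists>k. \<forall>i\<ge>k. ge N (t i \<otimes> s i)" by blast
  qed
  show "subgroup (null_seqs K v) (add_monoid C)"
  proof (rule subgroup.intro)
    show "null_seqs K v \<subseteq> carrier (add_monoid C)" using null_cauchy by (auto simp: C_simps)
    show "\<one>\<^bsub>add_monoid C\<^esub> \<in> null_seqs K v" by (simp add: C_simps null_iff)
  next
    fix s t assume st: "s \<in> null_seqs K v" "t \<in> null_seqs K v"
    then have c: "s i \<in> carrier K" "t i \<in> carrier K" for i by (simp_all add: null_iff)
    have "(\<lambda>i. s i \<oplus> t i) \<in> null_seqs K v"
      unfolding null_iff
    proof (intro conjI allI)
      show "s i \<oplus> t i \<in> carrier K" for i using c by simp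
      fix N
      obtain k l where "\<forall>i\<ge>k. ge N (s i)" "\<forall>i\<ge>l. ge N (t i)" using nullE[OF st(1), of N] nullE[OF st(2), of N] by blast
      then have "\<forall>i\<ge>max k l. ge N (s i \<oplus> t i)" using c ge_add by simp
      then show "\<exists>k. \<forall>i\<ge>k. ge N (s i \<oplus> t i)" by blast
    qed
    then show "s \<otimes>\<^bsub>add_monoid C\<^esub> t \<in> null_seqs K v" by (simp add: C_simps)
  next
    fix s assume s: "s \<in> null_seqs K v"
    have "(\<lambda>i. \<ominus> \<one> \<otimes> s i) \<in> null_seqs K v" by (rule nm[OF s const_cauchy]) simp
    moreover have "(\<lambda>i. \<ominus> \<one> \<otimes> s i) = \<ominus>\<^bsub>C\<^esub> s"
    proof -
      have c: "s i \<in> carrier K" for i using s by (simp add: null_iff)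
      have "(\<lambda>i. \<ominus> \<one> \<otimes> s i) \<oplus>\<^bsub>C\<^esub> s = \<zero>\<^bsub>C\<^esub>" using c by (simp add: C_simps l_minus l_neg)
      then show ?thesis using C.minus_equality null_cauchy[OF s] null_cauchy[OF \<open>(\<lambda>i. \<ominus> \<one> \<otimes> s i) \<in> null_seqs K v\<close>]
        by (simp add: C_simps(1))
    qed
    ultimately show "inv\<^bsub>add_monoid C\<^esub> s \<in> null_seqs K v" by (simp add: a_inv_def)
  qed
  fix s t assume s: "s \<in> null_seqs K v" and "t \<in> carrier C"
  then have t: "t \<in> cauchy_seqs K v" by (simp add: C_simps)
  show "t \<otimes>\<^bsub>C\<^esub> s \<in> null_seqs K v" using nm[OF s t] by (simp add: C_simps)
  then show "s \<otimes>\<^bsub>C\<^esub> t \<in> null_seqs K v" using C.m_comm[of s t] s t null_cauchy by (simp add: C_simps(1))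
qed

subsection \<open>The completion\<close>

abbreviation "F \<equiv> completion K v"
abbreviation "cls \<equiv> completion_class K v"
abbreviation "\<iota> \<equiv> completion_map K v"
abbreviation "VF \<equiv> completed_subring K v V"

lemma F_cring: "cring F"
  unfolding completion_def by (rule ideal.quotient_is_cring[OF null_ideal C_cring])

lemma cls_hom: "cls \<in> ring_hom C F"
  unfolding completion_def completion_class_def by (rule ideal.rcos_ring_hom[OF null_ideal])

lemma cls_surj: "x \<in> carrier F \<Longrightarrow> \<exists>s\<in>cauchy_seqs K v. x = cls s"
  unfolding completion_def completion_class_def carrier_FactRing by (auto simp: C_simps)

lemma cls_closed: "s \<in> cauchy_seqs K v \<Longrightarrow> cls s \<in> carrier F"
  using ring_hom_closed[OF cls_hom] by (simp add: C_simps)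

lemma cls_eq_iff: "s \<in> cauchy_seqs K v \<Longrightarrow> t \<in> cauchy_seqs K v \<Longrightarrow> cls s = cls t \<longleftrightarrow> (\<lambda>i. s i \<ominus> t i) \<in> null_seqs K v"
  using ring.quotient_eq_iff_same_a_r_cos[OF cring.axioms(1)[OF C_cring] null_ideal, of s t]
  by (simp add: C_minus completion_class_def C_simps(1))

lemma cls_eqI:
  assumes "s \<in> cauchy_seqs K v" "t \<in> cauchy_seqs K v" "\<And>i. i \<ge> k \<Longrightarrow> s i = t i"
  shows "cls s = cls t"
  unfolding cls_eq_iff[OF assms(1,2)] null_iff
proof (intro conjI allI)
  fix N
  have "ge N (s i \<ominus> t i)" if "i \<ge> k" for i
    using assms(3)[OF that] cauchy_entry[OF assms(2)] by (simp add: minus_eq r_neg)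
  then show "\<exists>k. \<forall>i\<ge>k. ge N (s i \<ominus> t i)" by blast
qed (use assms in \<open>simp add: cauchy_entry\<close>)

lemma cls_mult: "s \<in> cauchy_seqs K v \<Longrightarrow> t \<in> cauchy_seqs K v \<Longrightarrow> cls s \<otimes>\<^bsub>F\<^esub> cls t = cls (\<lambda>i. s i \<otimes> t i)"
  using ring_hom_mult[OF cls_hom, of s t] by (simp add: C_simps)

lemma cls_add: "s \<in> cauchy_seqs K v \<Longrightarrow> t \<in> cauchy_seqs K v \<Longrightarrow> cls s \<oplus>\<^bsub>F\<^esub> cls t = cls (\<lambda>i. s i \<oplus> t i)"
  using ring_hom_add[OF cls_hom, of s t] by (simp add: C_simps)

lemma \<iota>_hom: "\<iota> \<in> ring_hom K F"
  unfolding completion_map_def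
  by (rule ring_hom_memI)
    (simp_all add: cls_closed const_cauchy cls_mult cls_add ring_hom_one[OF cls_hom, unfolded C_simps])

lemma F_one: "\<one>\<^bsub>F\<^esub> = cls (\<lambda>_. \<one>)" using ring_hom_one[OF cls_hom] by (simp add: C_simps)

lemma F_zero: "\<zero>\<^bsub>F\<^esub> = cls (\<lambda>_. \<zero>)"
  using ring_hom_zero[OF cls_hom cring.axioms(1)[OF C_cring] cring.axioms(1)[OF F_cring]] by (simp add: C_simps)

text \<open>By the ultrametric inequality the valuation of a term no longer changes once the differences of
  later terms have larger valuation than the term itself.\<close>
lemma cauchy_eventually:
  assumes s: "s \<in> cauchy_seqs K v" and nz: "cls s \<noteq> \<zero>\<^bsub>F\<^esub>"
  shows "\<exists>k m. \<forall>i\<ge>k. s i \<noteq> \<zero> \<and> v (s i) = m"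
proof -
  note c = cauchy_entry[OF s]
  have "(\<lambda>i. s i \<ominus> \<zero>) = s" using c by (simp add: minus_eq)
  then have "s \<notin> null_seqs K v" using nz cls_eq_iff[OF s const_cauchy[of \<zero>]] by (simp add: F_zero)
  then obtain N where N: "\<And>k. \<exists>i\<ge>k. \<not> ge N (s i)" using c unfolding null_iff by blast
  obtain k where k: "\<And>i j. i \<ge> k \<Longrightarrow> j \<ge> k \<Longrightarrow> ge N (s i \<ominus> s j)" using cauchyE[OF s, of N] by blast
  obtain i where i: "i \<ge> k" "\<not> ge N (s i)" using N by blast
  have "s j \<noteq> \<zero> \<and> v (s j) = v (s i)" if "j \<ge> k" for j
    using ge_eq[OF c c _ k[OF that i(1)]] i(2) by (auto simp: ge_def)
  then show ?thesis by blast
qed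

lemma cauchy_inverse:
  assumes s: "s \<in> cauchy_seqs K v" and m: "\<And>i. i \<ge> k \<Longrightarrow> s i \<noteq> \<zero> \<and> v (s i) = m"
  defines "t \<equiv> \<lambda>i. if i < k then \<one> else inv (s i)"
  shows "t \<in> cauchy_seqs K v" "cls t \<otimes>\<^bsub>F\<^esub> cls s = \<one>\<^bsub>F\<^esub>"
proof -
  note c = cauchy_entry[OF s]
  have tc: "t i \<in> carrier K" for i using c m by (simp add: t_def)
  show t: "t \<in> cauchy_seqs K v"
  proof (rule cauchyI[OF tc])
    fix N
    obtain l where l: "\<And>i j. i \<ge> l \<Longrightarrow> j \<ge> l \<Longrightarrow> ge (N + 2 * m) (s i \<ominus> s j)" using cauchyE[OF s, of "N + 2 * m"] by blast
    let ?l = "max k l"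
    have "ge N (t i \<ominus> t ?l)" if i: "i \<ge> ?l" for i
    proof -
      have nz: "s i \<noteq> \<zero>" "s ?l \<noteq> \<zero>" "v (s i) = m" "v (s ?l) = m" using m i by auto
      have "inv (s i) \<otimes> inv (s ?l) \<otimes> (s ?l \<ominus> s i) = inv (s i) \<otimes> (inv (s ?l) \<otimes> s ?l) \<ominus> inv (s ?l) \<otimes> (inv (s i) \<otimes> s i)"
        using nonzero_inv(1)[OF c nz(1)] nonzero_inv(1)[OF c nz(2)] c[of i] c[of ?l] by algebra
      also have "\<dots> = t i \<ominus> t ?l" using c nz i by (simp add: t_def)
      finally have e: "t i \<ominus> t ?l = inv (s i) \<otimes> inv (s ?l) \<otimes> (s ?l \<ominus> s i)" ..
      have "ge (- m) (inv (s i))" "ge (- m) (inv (s ?l))" using v_inv c nz by (auto simp: ge_def)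
      then have "ge (- m + - m + (N + 2 * m)) (inv (s i) \<otimes> inv (s ?l) \<otimes> (s ?l \<ominus> s i))"
        using c nz i by (intro ge_mult l) auto
      then show ?thesis unfolding e by simp
    qed
    then show "\<exists>k. \<forall>i\<ge>k. ge N (t i \<ominus> t k)" by blast
  qed
  show "cls t \<otimes>\<^bsub>F\<^esub> cls s = \<one>\<^bsub>F\<^esub>"
    unfolding cls_mult[OF t s] F_one
  proof (rule cls_eqI[OF cauchy_mult[OF t s] const_cauchy[OF one_closed]])
    show "t i \<otimes> s i = \<one>" if "i \<ge> k" for i using c m[OF that] that by (simp add: t_def)
  qed
qed

lemma F_field: "field F"
proof -
  interpret F: cring F by (rule F_cring)
  show ?thesis
  proof (rule F.cring_fieldI2)
    show "\<zero>\<^bsub>F\<^esub> \<noteq> \<one>\<^bsub>F\<^esub>"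
    proof
      assume "\<zero>\<^bsub>F\<^esub> = \<one>\<^bsub>F\<^esub>"
      then have "(\<lambda>i. \<zero> \<ominus> \<one>) \<in> null_seqs K v"
        unfolding F_one F_zero using cls_eq_iff[OF const_cauchy[of \<zero>] const_cauchy[of \<one>]] by simp
      then have "ge 1 (\<zero> \<ominus> \<one>)" unfolding null_iff by blast
      then have "ge 1 \<one>" using ge_minus[of "\<zero> \<ominus> \<one>" 1] by (simp add: minus_eq)
      then show False by (simp add: ge_def)
    qed
    fix a assume a: "a \<in> carrier F" "a \<noteq> \<zero>\<^bsub>F\<^esub>"
    then obtain s where s: "s \<in> cauchy_seqs K v" "a = cls s" using cls_surj[OF a(1)] by blast
    obtain k m where km: "\<And>i. i \<ge> k \<Longrightarrow> s i \<noteq> \<zero> \<and> v (s i) = m" using cauchy_eventually[OF s(1)] s a by blast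
    note t = cauchy_inverse[OF s(1) km, of k]
    show "\<exists>b\<in>carrier F. a \<otimes>\<^bsub>F\<^esub> b = \<one>\<^bsub>F\<^esub>"
      using t(2) cls_closed[OF t(1)] a(1) F.m_comm s(2) by metis
  qed
qed

lemma VF_memI:
  assumes s: "s \<in> cauchy_seqs K v" and k: "\<And>i. i \<ge> k \<Longrightarrow> ge 0 (s i)"
  shows "cls s \<in> VF"
proof -
  let ?t = "\<lambda>i. if i < k then \<zero> else s i"
  note c = cauchy_entry[OF s]
  have t: "?t \<in> cauchy_seqs K v"
    unfolding cauchy_iff
  proof (intro conjI allI)
    fix N
    obtain l where "\<And>i j. i \<ge> l \<Longrightarrow> j \<ge> l \<Longrightarrow> ge N (s i \<ominus> s j)" using cauchyE[OF s, of N] by blast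
    then have "\<forall>i\<ge>max k l. \<forall>j\<ge>max k l. ge N (?t i \<ominus> ?t j)" by simp
    then show "\<exists>k'. \<forall>i\<ge>k'. \<forall>j\<ge>k'. ge N (?t i \<ominus> ?t j)" by blast
  qed (use c in simp)
  moreover have "?t i \<in> V" for i using c k by (simp add: V_def)
  moreover have "cls s = cls ?t" by (rule cls_eqI[OF s t, of k]) simp
  ultimately show ?thesis unfolding completed_subring_def by blast
qed

lemma VF_memE:
  assumes "x \<in> VF"
  shows "\<exists>s. s \<in> cauchy_seqs K v \<and> (\<forall>i. s i \<in> carrier K) \<and> (\<forall>i. ge 0 (s i)) \<and> x = cls s"
  using assms unfolding completed_subring_def V_def by blast

lemma \<iota>_pow: "\<iota> \<pi> [^]\<^bsub>F\<^esub> (n::nat) = \<iota> (\<pi> [^] n)"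
  using ring_hom_nat_pow[OF \<iota>_hom ring_axioms cring.axioms(1)[OF F_cring] \<pi>(1)] by simp

lemma cls_divisible:
  assumes s: "s \<in> cauchy_seqs K v" and k: "\<And>i. i \<ge> k \<Longrightarrow> ge (int n) (s i)"
  shows "\<exists>d\<in>VF. cls s = \<iota> \<pi> [^]\<^bsub>F\<^esub> n \<otimes>\<^bsub>F\<^esub> d"
proof -
  note c = cauchy_entry[OF s]
  have i: "inv (\<pi> [^] n) \<in> carrier K" "ge (- int n) (inv (\<pi> [^] n))"
    using v_inv[of "\<pi> [^] n"] \<pi> v_pow by (auto simp: ge_def)
  let ?t = "\<lambda>j. inv (\<pi> [^] n) \<otimes> s j"
  have t: "?t \<in> cauchy_seqs K v" by (intro cauchy_mult const_cauchy i s)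
  have "ge 0 (?t j)" if "j \<ge> k" for j using ge_mult[OF i(1) c i(2) k[OF that]] by simp
  then have "cls ?t \<in> VF" by (rule VF_memI[OF t])
  moreover have "\<iota> \<pi> [^]\<^bsub>F\<^esub> n \<otimes>\<^bsub>F\<^esub> cls ?t = cls s"
    unfolding \<iota>_pow unfolding completion_map_def
    using t c \<pi> by (simp add: cls_mult const_cauchy m_assoc[symmetric])
  ultimately show ?thesis by metis
qed

lemma divisible_imp_ge:
  assumes x: "x \<in> carrier K" and d: "d \<in> VF" and e: "\<iota> x = \<iota> \<pi> [^]\<^bsub>F\<^esub> n \<otimes>\<^bsub>F\<^esub> d"
  shows "ge (int n) x"
proof -
  obtain s where s: "s \<in> cauchy_seqs K v" "\<And>i. s i \<in> carrier K" "\<And>i. ge 0 (s i)" "d = cls s" using VF_memE[OF d] by blast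
  have t: "(\<lambda>i. \<pi> [^] n \<otimes> s i) \<in> cauchy_seqs K v" using \<pi> s by (intro cauchy_mult const_cauchy) auto
  have "cls (\<lambda>_. x) = cls (\<lambda>i. \<pi> [^] n \<otimes> s i)"
    using e unfolding \<iota>_pow unfolding completion_map_def s(4) using \<pi> s by (simp add: cls_mult const_cauchy)
  then have "(\<lambda>i. x \<ominus> \<pi> [^] n \<otimes> s i) \<in> null_seqs K v" using cls_eq_iff[OF const_cauchy[OF x] t] by simp
  then obtain k where k: "ge (int n) (x \<ominus> \<pi> [^] n \<otimes> s k)" unfolding null_iff by blast
  have "ge (int n + 0) (\<pi> [^] n \<otimes> s k)" using \<pi> s v_pow by (intro ge_mult) (auto simp: ge_def)
  then have "ge (int n) (\<pi> [^] n \<otimes> s k \<oplus> (x \<ominus> \<pi> [^] n \<otimes> s k))" using \<pi> s x k by (intro ge_add) auto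
  then show ?thesis using diff_add[of x "\<pi> [^] n \<otimes> s k"] \<pi> s x by simp
qed

text \<open>The element is approximated by a far term of a sequence that represents it.\<close>
lemma VF_approx:
  assumes x: "x \<in> VF"
  shows "\<exists>a\<in>V. \<exists>d\<in>VF. x = \<iota> a \<oplus>\<^bsub>F\<^esub> \<iota> \<pi> [^]\<^bsub>F\<^esub> (n::nat) \<otimes>\<^bsub>F\<^esub> d"
proof -
  obtain s where s: "s \<in> cauchy_seqs K v" "\<And>i. s i \<in> carrier K" "\<And>i. ge 0 (s i)" "x = cls s" using VF_memE[OF x] by blast
  obtain k where k: "\<And>i j. i \<ge> k \<Longrightarrow> j \<ge> k \<Longrightarrow> ge (int n) (s i \<ominus> s j)" using cauchyE[OF s(1), of "int n"] by blast
  have c: "(\<lambda>i. \<ominus> s k) \<in> cauchy_seqs K v" using s by (intro const_cauchy) auto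
  have t: "(\<lambda>i. s i \<ominus> s k) \<in> cauchy_seqs K v" using cauchy_add[OF s(1) c] by (simp add: minus_eq)
  obtain d where d: "d \<in> VF" "cls (\<lambda>i. s i \<ominus> s k) = \<iota> \<pi> [^]\<^bsub>F\<^esub> n \<otimes>\<^bsub>F\<^esub> d"
    using cls_divisible[OF t, of k n] k by blast
  have "x = \<iota> (s k) \<oplus>\<^bsub>F\<^esub> cls (\<lambda>i. s i \<ominus> s k)"
    unfolding s(4) completion_map_def using s t by (simp add: cls_add const_cauchy diff_add)
  then have "x = \<iota> (s k) \<oplus>\<^bsub>F\<^esub> \<iota> \<pi> [^]\<^bsub>F\<^esub> n \<otimes>\<^bsub>F\<^esub> d" using d(2) by (simp only:)
  moreover have "s k \<in> V" using s by (simp add: V_def)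
  ultimately show ?thesis using d(1) by blast
qed

lemma \<iota>_V: "a \<in> V \<Longrightarrow> \<iota> a \<in> VF"
  unfolding completion_map_def by (rule VF_memI[of _ 0]) (auto simp: V_def const_cauchy)

text \<open>For completeness, approximate the \<open>n\<close>-th partial sum modulo
  \<open>\<pi>\<^sup>n\<close> by an element of \<open>V\<close>. These elements form a Cauchy sequence, and its
  class is the limit.\<close>
theorem completion_complete_dvr: "complete_dvr F (carrier F) VF (\<iota> \<pi>)"
proof -
  interpret F: field F by (rule F_field)
  have VFc: "x \<in> carrier F" if "x \<in> VF" for x using VF_memE[OF that] cls_closed by blast
  have \<pi>V: "\<pi> \<in> V" using \<pi> by (simp add: V_def ge_def)
  have \<iota>c: "\<iota> x \<in> carrier F" if "x \<in> carrier K" for x using ring_hom_closed[OF \<iota>_hom that] .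
  have subVF: "subring VF F"
  proof (rule F.subringI)
    show "VF \<subseteq> carrier F" using VFc by blast
    show "\<one>\<^bsub>F\<^esub> \<in> VF" unfolding F_one by (rule VF_memI[of _ 0]) (simp_all add: const_cauchy ge_def)
    fix x y assume "x \<in> VF" "y \<in> VF"
    then obtain s t where s: "s \<in> cauchy_seqs K v" "\<And>i. s i \<in> carrier K" "\<And>i. ge 0 (s i)" "x = cls s"
      and t: "t \<in> cauchy_seqs K v" "\<And>i. t i \<in> carrier K" "\<And>i. ge 0 (t i)" "y = cls t"
      using VF_memE[of x] VF_memE[of y] by blast
    show "x \<otimes>\<^bsub>F\<^esub> y \<in> VF"
      unfolding s t cls_mult[OF s(1) t(1)]
      using ge_mult[OF s(2) t(2) s(3) t(3)] by (intro VF_memI[of _ 0] cauchy_mult s t) auto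
    show "x \<oplus>\<^bsub>F\<^esub> y \<in> VF"
      unfolding s t cls_add[OF s(1) t(1)]
      using ge_add[OF s(2) t(2) s(3) t(3)] by (intro VF_memI[of _ 0] cauchy_add s t) auto
    have m: "(\<lambda>i. \<ominus> \<one> \<otimes> s i) \<in> cauchy_seqs K v" using s by (intro cauchy_mult const_cauchy) auto
    have "cls (\<lambda>i. \<ominus> \<one> \<otimes> s i) \<oplus>\<^bsub>F\<^esub> x = \<zero>\<^bsub>F\<^esub>"
      unfolding s(4) cls_add[OF m s(1)] F_zero using s by (simp add: l_minus l_neg)
    then have "\<ominus>\<^bsub>F\<^esub> x = cls (\<lambda>i. \<ominus> \<one> \<otimes> s i)"
      using F.minus_equality[of "cls (\<lambda>i. \<ominus> \<one> \<otimes> s i)" x] cls_closed[OF m] VFc[OF \<open>x \<in> VF\<close>] by simp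
    moreover have "cls (\<lambda>i. \<ominus> \<one> \<otimes> s i) \<in> VF"
      using s ge_minus by (intro VF_memI[of _ 0] m) (simp add: l_minus)
    ultimately show "\<ominus>\<^bsub>F\<^esub> x \<in> VF" by simp
  qed
  show ?thesis
    unfolding complete_dvr_def complete_dvr_axioms_def
  proof (intro conjI allI impI)
    show "subfield (carrier F) F" by (rule F.carrier_is_subfield)
    show "subring VF F" by (rule subVF)
    show "\<iota> \<pi> \<in> VF" by (rule \<iota>_V[OF \<pi>V])
  next
    fix w assume that: "w \<in> VF"
    show "w \<otimes>\<^bsub>F\<^esub> \<iota> \<pi> \<noteq> \<one>\<^bsub>F\<^esub>"
    proof
      assume "w \<otimes>\<^bsub>F\<^esub> \<iota> \<pi> = \<one>\<^bsub>F\<^esub>"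
      then have "\<iota> \<one> = \<iota> \<pi> [^]\<^bsub>F\<^esub> (1::nat) \<otimes>\<^bsub>F\<^esub> w"
        using ring_hom_one[OF \<iota>_hom] F.m_comm VFc[OF that] \<iota>c[OF \<pi>(1)] by simp
      from divisible_imp_ge[OF _ that this] show False by (simp add: ge_def)
    qed
  next
    show "\<iota> \<pi> \<noteq> \<zero>\<^bsub>F\<^esub>"
    proof
      assume "\<iota> \<pi> = \<zero>\<^bsub>F\<^esub>"
      then have "\<iota> \<pi> = \<iota> \<pi> [^]\<^bsub>F\<^esub> (2::nat) \<otimes>\<^bsub>F\<^esub> \<iota> \<pi>" using F.nat_pow_closed[of "\<iota> \<pi>" 2] by simp
      from divisible_imp_ge[OF \<pi>(1) \<iota>_V[OF \<pi>V] this] show False using \<pi> by (simp add: ge_def)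
    qed
  next
    fix x assume x: "x \<in> carrier F" "x \<noteq> \<zero>\<^bsub>F\<^esub>"
    show "\<exists>(n::nat). \<exists>y\<in>VF. \<exists>w\<in>VF. w \<otimes>\<^bsub>F\<^esub> y = \<one>\<^bsub>F\<^esub> \<and>
       (x = \<iota> \<pi> [^]\<^bsub>F\<^esub> n \<otimes>\<^bsub>F\<^esub> y \<or> \<iota> \<pi> [^]\<^bsub>F\<^esub> n \<otimes>\<^bsub>F\<^esub> x = y)"
    proof -
      obtain s where s: "s \<in> cauchy_seqs K v" "x = cls s" using cls_surj[OF x(1)] by blast
      note c = cauchy_entry[OF s(1)]
      obtain k m where km: "\<And>i. i \<ge> k \<Longrightarrow> s i \<noteq> \<zero> \<and> v (s i) = m" using cauchy_eventually[OF s(1)] s x by blast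
      define N where "N = nat \<bar>m\<bar>"
      have N: "int N = \<bar>m\<bar>" by (simp add: N_def)
      define p where "p = \<pi> [^] N"
      define a where "a = (if 0 \<le> m then inv p else p)"
      have p: "p \<in> carrier K" "p \<noteq> \<zero>" "v p = \<bar>m\<bar>" using \<pi>(1) v_pow[of N] N by (simp_all add: p_def)
      have a: "a \<in> carrier K" "a \<noteq> \<zero>" "v a = - m" using p v_inv[of p] by (auto simp: a_def)
      let ?y = "\<lambda>i. a \<otimes> s i"
      have y: "?y \<in> cauchy_seqs K v" by (intro cauchy_mult const_cauchy a s)
      have y0: "?y i \<noteq> \<zero> \<and> v (?y i) = 0" if "i \<ge> k" for i
        using km[OF that] v_mult[OF a(1) c a(2)] integral[OF _ a(1) c] a by auto
      note w = cauchy_inverse[OF y y0, of k]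
      let ?w = "\<lambda>i. if i < k then \<one> else inv (?y i)"
      have wV: "cls ?w \<in> VF" using y0 v_inv c a by (intro VF_memI[OF w(1), of k]) (auto simp: ge_def)
      have yV: "cls ?y \<in> VF" using y0 by (intro VF_memI[OF y, of k]) (auto simp: ge_def)
      have \<iota>a: "\<iota> a \<otimes>\<^bsub>F\<^esub> x = cls ?y" unfolding completion_map_def s(2) using a s by (simp add: cls_mult const_cauchy)
      have "x = \<iota> p \<otimes>\<^bsub>F\<^esub> cls ?y \<or> \<iota> p \<otimes>\<^bsub>F\<^esub> x = cls ?y"
      proof (cases "0 \<le> m")
        case True
        have "\<iota> p \<otimes>\<^bsub>F\<^esub> cls ?y = (\<iota> p \<otimes>\<^bsub>F\<^esub> \<iota> a) \<otimes>\<^bsub>F\<^esub> x"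
          unfolding \<iota>a[symmetric] using \<iota>c p a x by (simp add: F.m_assoc)
        also have "\<iota> p \<otimes>\<^bsub>F\<^esub> \<iota> a = \<one>\<^bsub>F\<^esub>"
          using ring_hom_mult[OF \<iota>_hom p(1) a(1)] ring_hom_one[OF \<iota>_hom] True p by (simp add: a_def)
        finally show ?thesis using x by simp
      next
        case False
        then show ?thesis using \<iota>a by (simp add: a_def)
      qed
      then show ?thesis using wV yV w(2) unfolding p_def \<iota>_pow[symmetric] by blast
    qed
  next
    fix f :: "nat \<Rightarrow> _"
    assume f: "\<forall>n. f n \<in> VF" and step: "\<forall>n. \<exists>d\<in>VF. f (Suc n) = f n \<oplus>\<^bsub>F\<^esub> \<iota> \<pi> [^]\<^bsub>F\<^esub> n \<otimes>\<^bsub>F\<^esub> d"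
    show "\<exists>a\<in>VF. \<forall>n. \<exists>d\<in>VF. a = f n \<oplus>\<^bsub>F\<^esub> \<iota> \<pi> [^]\<^bsub>F\<^esub> n \<otimes>\<^bsub>F\<^esub> d"
    proof -
      let ?p = "\<lambda>n::nat. \<iota> \<pi> [^]\<^bsub>F\<^esub> n"
      have pc: "?p n \<in> carrier F" for n using \<iota>c[OF \<pi>(1)] by simp
      have "\<forall>n. \<exists>a d. a \<in> V \<and> d \<in> VF \<and> f n = \<iota> a \<oplus>\<^bsub>F\<^esub> ?p n \<otimes>\<^bsub>F\<^esub> d" using VF_approx[OF spec[OF f]] by blast
      then obtain a e where a: "\<And>n. a n \<in> V" and e: "\<And>n. e n \<in> VF" and fa: "\<And>n. f n = \<iota> (a n) \<oplus>\<^bsub>F\<^esub> ?p n \<otimes>\<^bsub>F\<^esub> e n"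
        by metis
      have aK: "a n \<in> carrier K" for n using a[of n] by (simp add: V_def)
      have d1: "ge (int n) (a (Suc n) \<ominus> a n)" for n
      proof -
        obtain d where d: "d \<in> VF" "f (Suc n) = f n \<oplus>\<^bsub>F\<^esub> ?p n \<otimes>\<^bsub>F\<^esub> d" using step by blast
        note cc = VFc[OF d(1)] VFc[OF e[of n]] VFc[OF e[of "Suc n"]] \<iota>c[OF aK[of n]] \<iota>c[OF aK[of "Suc n"]] pc[of n] \<iota>c[OF \<pi>(1)]
        have eq: "\<iota> (a (Suc n)) \<oplus>\<^bsub>F\<^esub> ?p (Suc n) \<otimes>\<^bsub>F\<^esub> e (Suc n) = \<iota> (a n) \<oplus>\<^bsub>F\<^esub> ?p n \<otimes>\<^bsub>F\<^esub> e n \<oplus>\<^bsub>F\<^esub> ?p n \<otimes>\<^bsub>F\<^esub> d"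
          using d(2) fa by simp
        have "\<iota> (a (Suc n)) \<ominus>\<^bsub>F\<^esub> \<iota> (a n) =
            (\<iota> (a (Suc n)) \<oplus>\<^bsub>F\<^esub> ?p (Suc n) \<otimes>\<^bsub>F\<^esub> e (Suc n)) \<ominus>\<^bsub>F\<^esub> ?p n \<otimes>\<^bsub>F\<^esub> \<iota> \<pi> \<otimes>\<^bsub>F\<^esub> e (Suc n) \<ominus>\<^bsub>F\<^esub> \<iota> (a n)"
          using cc unfolding F.nat_pow_Suc by algebra
        also have "\<dots> = ?p n \<otimes>\<^bsub>F\<^esub> (e n \<oplus>\<^bsub>F\<^esub> d \<ominus>\<^bsub>F\<^esub> \<iota> \<pi> \<otimes>\<^bsub>F\<^esub> e (Suc n))"
          unfolding eq using cc by algebra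
        finally have "\<iota> (a (Suc n)) \<ominus>\<^bsub>F\<^esub> \<iota> (a n) = ?p n \<otimes>\<^bsub>F\<^esub> (e n \<oplus>\<^bsub>F\<^esub> d \<ominus>\<^bsub>F\<^esub> \<iota> \<pi> \<otimes>\<^bsub>F\<^esub> e (Suc n))" .
        moreover have "e n \<oplus>\<^bsub>F\<^esub> d \<ominus>\<^bsub>F\<^esub> \<iota> \<pi> \<otimes>\<^bsub>F\<^esub> e (Suc n) \<in> VF"
          unfolding F.minus_eq
          by (intro subringE(5,6,7)[OF subVF] e d \<iota>_V \<pi>V)
        moreover have "\<iota> (a (Suc n)) \<ominus>\<^bsub>F\<^esub> \<iota> (a n) = \<iota> (a (Suc n) \<ominus> a n)"
        proof -
          interpret h: ring_hom_ring K F \<iota> by (rule ring_hom_ringI2) (use \<iota>_hom ring_axioms F.ring_axioms in auto)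
          show ?thesis using aK by (simp add: F.minus_eq minus_eq)
        qed
        ultimately show ?thesis using divisible_imp_ge[of "a (Suc n) \<ominus> a n"] aK by simp
      qed
      have d2: "ge (int n) (a (n + m) \<ominus> a n)" for n m
      proof (induction m)
        case (Suc m)
        have "a (n + Suc m) \<ominus> a n = (a (Suc (n + m)) \<ominus> a (n + m)) \<oplus> (a (n + m) \<ominus> a n)"
          using aK by (simp add: minus_eq a_assoc r_neg1)
        moreover have "ge (int n) (a (Suc (n + m)) \<ominus> a (n + m))" by (rule ge_mono[OF d1]) simp
        ultimately show ?case using Suc ge_add aK by simp
      qed (use aK in \<open>simp add: minus_eq r_neg\<close>)
      have ac: "a \<in> cauchy_seqs K v"
      proof (rule cauchyI[OF aK])
        fix N
        have "ge N (a i \<ominus> a (nat N))" if "i \<ge> nat N" for i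
          using d2[of "nat N" "i - nat N"] that by (auto intro: ge_mono[of "int (nat N)"])
        then show "\<exists>k. \<forall>i\<ge>k. ge N (a i \<ominus> a k)" by blast
      qed
      have aV: "cls a \<in> VF" using a by (intro VF_memI[OF ac, of 0]) (simp add: V_def)
      have "\<exists>d\<in>VF. cls a = f n \<oplus>\<^bsub>F\<^esub> ?p n \<otimes>\<^bsub>F\<^esub> d" for n
      proof -
        have c: "(\<lambda>i. \<ominus> a n) \<in> cauchy_seqs K v" using aK by (intro const_cauchy) auto
        have t: "(\<lambda>i. a i \<ominus> a n) \<in> cauchy_seqs K v" using cauchy_add[OF ac c] by (simp add: minus_eq)
        have "ge (int n) (a i \<ominus> a n)" if "i \<ge> n" for i using d2[of n "i - n"] that by simp
        then obtain d where d: "d \<in> VF" "cls (\<lambda>i. a i \<ominus> a n) = ?p n \<otimes>\<^bsub>F\<^esub> d"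
          using cls_divisible[OF t, of n n] by blast
        have "cls a = \<iota> (a n) \<oplus>\<^bsub>F\<^esub> cls (\<lambda>i. a i \<ominus> a n)"
          unfolding completion_map_def using aK t by (simp add: cls_add const_cauchy diff_add)
        then have 1: "cls a = \<iota> (a n) \<oplus>\<^bsub>F\<^esub> ?p n \<otimes>\<^bsub>F\<^esub> d" using d by simp
        note cc = VFc[OF d(1)] VFc[OF e[of n]] \<iota>c[OF aK[of n]] pc[of n]
        have "cls a = f n \<oplus>\<^bsub>F\<^esub> ?p n \<otimes>\<^bsub>F\<^esub> (d \<ominus>\<^bsub>F\<^esub> e n)"
          unfolding 1 fa[of n] using cc by algebra
        moreover have "d \<ominus>\<^bsub>F\<^esub> e n \<in> VF"
          unfolding F.minus_eq by (intro subringE(5,7)[OF subVF] e d)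
        ultimately show ?thesis by blast
      qed
      then show ?thesis using aV by blast
    qed
  qed (use F.ring_axioms VFc in auto)
qed

end

section \<open>The stalk at a point of codimension one\<close>

context field
begin

lemma int_pow_units:
  assumes "x \<in> carrier R" "x \<noteq> \<zero>"
  shows "x [^]\<^bsub>units_of R\<^esub> (n::int) = x [^] n"
proof -
  have U: "x \<in> Units R" using assms field_Units by simp
  have p: "x [^]\<^bsub>units_of R\<^esub> (k::nat) = x [^] k" for k
    by (induction k) (simp_all add: units_of_mult units_of_one)
  have pw: "x [^] (k::nat) \<in> Units R" for k using U by (induction k) auto
  show ?thesis unfolding int_pow_def2 p by (simp only: units_of_inv[OF pw])
qed

lemma int_pow_field:
  assumes "x \<in> carrier R" "x \<noteq> \<zero>"
  shows "x [^] (n::int) \<in> carrier R" "x [^] n \<noteq> \<zero>"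
    "x [^] (n + m) = x [^] n \<otimes> x [^] m"
    "y \<in> carrier R \<Longrightarrow> y \<noteq> \<zero> \<Longrightarrow> (x \<otimes> y) [^] n = x [^] n \<otimes> y [^] n"
proof -
  interpret G: comm_group "units_of R" by (rule units_comm_group)
  have U: "z \<in> carrier (units_of R) \<longleftrightarrow> z \<in> carrier R \<and> z \<noteq> \<zero>" for z
    by (simp add: units_of_carrier field_Units)
  have x: "x \<in> carrier (units_of R)" using assms U by simp
  have "x [^]\<^bsub>units_of R\<^esub> n \<in> carrier (units_of R)" using x by simp
  then show "x [^] n \<in> carrier R" "x [^] n \<noteq> \<zero>" unfolding int_pow_units[OF assms] U by auto
  show "x [^] (n + m) = x [^] n \<otimes> x [^] m"
    using G.int_pow_mult[OF x, of n m] unfolding int_pow_units[OF assms] by (simp add: units_of_mult)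
  assume y: "y \<in> carrier R" "y \<noteq> \<zero>"
  have "x \<otimes> y \<noteq> \<zero>" using integral[of x y] assms y by blast
  then show "(x \<otimes> y) [^] n = x [^] n \<otimes> y [^] n"
    using G.int_pow_distrib[OF x, of y n] y U assms by (simp add: int_pow_units units_of_mult)
qed

end

locale codim1_point = field K for K (structure) +
  fixes R p :: "'a set"
  assumes quot: "is_quotient_field K R" and reg: "regular_domain K R" and p: "p \<in> codim1_points K R"
begin

abbreviation "A \<equiv> K\<lparr>carrier := R\<rparr>"
abbreviation "V \<equiv> stalk K R p"
abbreviation "B \<equiv> K\<lparr>carrier := V\<rparr>"
abbreviation "\<mm> \<equiv> stalk_max K R p"

lemma subring_R: "subring R K" and fractions: "x \<in> carrier K \<Longrightarrow> \<exists>a\<in>R. \<exists>b\<in>R - {\<zero>}. x = a \<otimes> inv b"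
  using quot by (auto simp: is_quotient_field_def)

lemma R_carrier: "a \<in> R \<Longrightarrow> a \<in> carrier K" using subringE(1)[OF subring_R] by blast

lemma prime_p: "primeideal p A" and height_p: "height A p = 1"
  using p by (auto simp: codim1_points_def)

lemma A_cring: "cring A" by (rule primeideal.axioms(2)[OF prime_p])

lemma p_sub: "p \<subseteq> R"
  using additive_subgroup.a_subset[OF ideal.axioms(1)[OF primeideal.axioms(1)[OF prime_p]]] by simp

lemma p_props:
  "a \<in> p \<Longrightarrow> r \<in> R \<Longrightarrow> a \<otimes> r \<in> p" "a \<in> p \<Longrightarrow> b \<in> p \<Longrightarrow> a \<oplus> b \<in> p" "\<zero> \<in> p" "\<one> \<notin> p"
  "a \<in> R \<Longrightarrow> b \<in> R \<Longrightarrow> a \<otimes> b \<in> p \<Longrightarrow> a \<in> p \<or> b \<in> p"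
proof -
  interpret p: primeideal p A by (rule prime_p)
  show "a \<in> p \<Longrightarrow> r \<in> R \<Longrightarrow> a \<otimes> r \<in> p" using p.I_r_closed[of a r] by simp
  show "a \<in> p \<Longrightarrow> b \<in> p \<Longrightarrow> a \<oplus> b \<in> p" 
    using additive_subgroup.a_closed[OF ideal.axioms(1)[OF primeideal.axioms(1)[OF prime_p]], of a b] by simp
  show "\<zero> \<in> p" 
    using additive_subgroup.zero_closed[OF ideal.axioms(1)[OF primeideal.axioms(1)[OF prime_p]]] by simp
  show "\<one> \<notin> p" using p.one_imp_carrier p.I_notcarr by auto
  show "a \<in> R \<Longrightarrow> b \<in> R \<Longrightarrow> a \<otimes> b \<in> p \<Longrightarrow> a \<in> p \<or> b \<in> p" using p.I_prime[of a b] by simp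
qed

lemma denominators: "b \<in> R - p \<Longrightarrow> b \<in> carrier K" "b \<in> R - p \<Longrightarrow> b \<noteq> \<zero>"
  "b \<in> R - p \<Longrightarrow> c \<in> R - p \<Longrightarrow> b \<otimes> c \<in> R - p" "\<one> \<in> R - p"
  using R_carrier p_props(3,4) p_props(5)[of b c] subringE(3,6)[OF subring_R] by auto

lemma field_inv: "b \<in> carrier K \<Longrightarrow> b \<noteq> \<zero> \<Longrightarrow> inv b \<in> carrier K"
  "b \<in> carrier K \<Longrightarrow> b \<noteq> \<zero> \<Longrightarrow> inv b \<otimes> b = \<one>" "b \<in> carrier K \<Longrightarrow> b \<noteq> \<zero> \<Longrightarrow> b \<otimes> inv b = \<one>"
  using field_Units by auto

lemma fraction_iff: "a \<in> carrier K \<Longrightarrow> b \<in> R - p \<Longrightarrow> x = a \<otimes> inv b \<longleftrightarrow> x \<in> carrier K \<and> x \<otimes> b = a"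
proof -
  assume a: "a \<in> carrier K" and b: "b \<in> R - p"
  note bb = denominators(1,2)[OF b] and bi = field_inv[OF denominators(1,2)[OF b]]
  have "a \<otimes> inv b \<otimes> b = a" using a bb bi by (simp add: m_assoc)
  moreover have "x = x \<otimes> b \<otimes> inv b" if "x \<in> carrier K" using that bb bi by (simp add: m_assoc)
  ultimately show ?thesis using a bi by (metis m_closed)
qed

lemma V_iff: "x \<in> V \<longleftrightarrow> x \<in> carrier K \<and> (\<exists>b\<in>R - p. x \<otimes> b \<in> R)"
proof
  assume "x \<in> V"
  then obtain a b where ab: "a \<in> R" "b \<in> R - p" "x = a \<otimes> inv b" by (auto simp: stalk_def)
  then show "x \<in> carrier K \<and> (\<exists>b\<in>R - p. x \<otimes> b \<in> R)" using fraction_iff[OF R_carrier[OF ab(1)] ab(2)] by metis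
next
  assume x: "x \<in> carrier K \<and> (\<exists>b\<in>R - p. x \<otimes> b \<in> R)"
  then obtain b where b: "b \<in> R - p" "x \<otimes> b \<in> R" by blast
  then have "x = (x \<otimes> b) \<otimes> inv b" using fraction_iff[OF R_carrier[OF b(2)] b(1)] x by blast
  then show "x \<in> V" unfolding stalk_def using b by blast
qed

lemma \<mm>_iff: "x \<in> \<mm> \<longleftrightarrow> x \<in> carrier K \<and> (\<exists>b\<in>R - p. x \<otimes> b \<in> p)"
proof
  assume "x \<in> \<mm>"
  then obtain a b where ab: "a \<in> p" "b \<in> R - p" "x = a \<otimes> inv b" by (auto simp: stalk_max_def)
  then have "a \<in> carrier K" using p_sub R_carrier by blast
  then show "x \<in> carrier K \<and> (\<exists>b\<in>R - p. x \<otimes> b \<in> p)" using fraction_iff[OF _ ab(2)] ab by metis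
next
  assume x: "x \<in> carrier K \<and> (\<exists>b\<in>R - p. x \<otimes> b \<in> p)"
  then obtain b where b: "b \<in> R - p" "x \<otimes> b \<in> p" by blast
  then have "x \<otimes> b \<in> carrier K" using p_sub R_carrier by blast
  then have "x = (x \<otimes> b) \<otimes> inv b" using fraction_iff[OF _ b(1)] x by blast
  then show "x \<in> \<mm>" unfolding stalk_max_def using b by blast
qed

lemma V_carrier: "x \<in> V \<Longrightarrow> x \<in> carrier K" by (simp add: V_iff)

lemma R_sub_V: "a \<in> R \<Longrightarrow> a \<in> V"
  using denominators(4) R_carrier by (auto simp: V_iff intro!: bexI[of _ \<one>])

lemma V_subring: "subring V K"
proof (rule subringI)
  show "V \<subseteq> carrier K" using V_carrier by blast
  show "\<one> \<in> V" by (rule R_sub_V[OF subringE(3)[OF subring_R]])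
next
  fix x assume "x \<in> V"
  then obtain b where b: "x \<in> carrier K" "b \<in> R - p" "x \<otimes> b \<in> R" unfolding V_iff by blast
  have "\<ominus> x \<otimes> b = \<ominus> (x \<otimes> b)" using b denominators(1) by (simp add: l_minus)
  then have "\<ominus> x \<otimes> b \<in> R" using subringE(5)[OF subring_R b(3)] by simp
  then show "\<ominus> x \<in> V" unfolding V_iff using b by blast
next
  fix x y assume "x \<in> V" "y \<in> V"
  then obtain b c where b: "x \<in> carrier K" "b \<in> R - p" "x \<otimes> b \<in> R" and c: "y \<in> carrier K" "c \<in> R - p" "y \<otimes> c \<in> R"
    unfolding V_iff by blast
  note cc = b(1) c(1) denominators(1)[OF b(2)] denominators(1)[OF c(2)]
  have "(x \<otimes> y) \<otimes> (b \<otimes> c) = (x \<otimes> b) \<otimes> (y \<otimes> c)" "(x \<oplus> y) \<otimes> (b \<otimes> c) = (x \<otimes> b) \<otimes> c \<oplus> (y \<otimes> c) \<otimes> b"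
    using cc by algebra+
  moreover have "(x \<otimes> b) \<otimes> (y \<otimes> c) \<in> R" "(x \<otimes> b) \<otimes> c \<oplus> (y \<otimes> c) \<otimes> b \<in> R"
    using b c by (auto intro!: subringE(6,7)[OF subring_R])
  ultimately show "x \<otimes> y \<in> V" "x \<oplus> y \<in> V"
    unfolding V_iff using cc denominators(3)[OF b(2) c(2)] by (metis a_closed m_closed)+
qed

lemma \<mm>_sub_V: "x \<in> \<mm> \<Longrightarrow> x \<in> V" unfolding V_iff \<mm>_iff using p_sub by blast

lemma \<mm>_add: "x \<in> \<mm> \<Longrightarrow> y \<in> \<mm> \<Longrightarrow> x \<oplus> y \<in> \<mm>"
proof -
  assume "x \<in> \<mm>" "y \<in> \<mm>"
  then obtain b c where b: "x \<in> carrier K" "b \<in> R - p" "x \<otimes> b \<in> p" and c: "y \<in> carrier K" "c \<in> R - p" "y \<otimes> c \<in> p"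
    unfolding \<mm>_iff by blast
  note cc = b(1) c(1) denominators(1)[OF b(2)] denominators(1)[OF c(2)]
  have "(x \<oplus> y) \<otimes> (b \<otimes> c) = (x \<otimes> b) \<otimes> c \<oplus> (y \<otimes> c) \<otimes> b" using cc by algebra
  moreover have "(x \<otimes> b) \<otimes> c \<oplus> (y \<otimes> c) \<otimes> b \<in> p"
    by (rule p_props(2)[OF p_props(1)[OF b(3)] p_props(1)[OF c(3)]]) (use b c in auto)
  ultimately show "x \<oplus> y \<in> \<mm>" unfolding \<mm>_iff using cc denominators(3)[OF b(2) c(2)] by (metis a_closed)
qed

lemma \<mm>_mult: "x \<in> \<mm> \<Longrightarrow> y \<in> V \<Longrightarrow> x \<otimes> y \<in> \<mm>"
proof -
  assume "x \<in> \<mm>" "y \<in> V"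
  then obtain b c where b: "x \<in> carrier K" "b \<in> R - p" "x \<otimes> b \<in> p" and c: "y \<in> carrier K" "c \<in> R - p" "y \<otimes> c \<in> R"
    unfolding \<mm>_iff V_iff by blast
  note cc = b(1) c(1) denominators(1)[OF b(2)] denominators(1)[OF c(2)]
  have "(x \<otimes> y) \<otimes> (b \<otimes> c) = (x \<otimes> b) \<otimes> (y \<otimes> c)" using cc by algebra
  moreover have "(x \<otimes> b) \<otimes> (y \<otimes> c) \<in> p" by (rule p_props(1)[OF b(3) c(3)])
  ultimately show "x \<otimes> y \<in> \<mm>" unfolding \<mm>_iff using cc denominators(3)[OF b(2) c(2)] by (metis m_closed)
qed

lemma unit_V: "x \<in> V \<Longrightarrow> x \<notin> \<mm> \<Longrightarrow> x \<noteq> \<zero> \<and> inv x \<in> V"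
proof -
  assume x: "x \<in> V" "x \<notin> \<mm>"
  then obtain b where b: "x \<in> carrier K" "b \<in> R - p" "x \<otimes> b \<in> R" unfolding V_iff by blast
  then have xb: "x \<otimes> b \<in> R - p" using x(2) unfolding \<mm>_iff by blast
  then have nz: "x \<noteq> \<zero>" using denominators(2)[OF xb] denominators(1)[OF b(2)] by auto
  have "inv x \<otimes> (x \<otimes> b) = b"
    using b(1) nz field_inv denominators(1)[OF b(2)] by (simp add: m_assoc[symmetric])
  then have "inv x \<otimes> (x \<otimes> b) \<in> R" using b(2) by simp
  then show ?thesis unfolding V_iff using nz xb field_inv(1)[OF b(1) nz] by blast
qed

lemma \<mm>_nonunit: "x \<in> \<mm> \<Longrightarrow> y \<in> V \<Longrightarrow> x \<otimes> y \<noteq> \<one>"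
proof
  assume "x \<in> \<mm>" "y \<in> V" "x \<otimes> y = \<one>"
  then have "\<one> \<in> \<mm>" using \<mm>_mult by metis
  then obtain b where "b \<in> R - p" "\<one> \<otimes> b \<in> p" unfolding \<mm>_iff by blast
  then show False using denominators(1) by auto
qed

lemma regular_V: "regular_local_ring B" using reg prime_p by (simp add: regular_domain_def)

lemma B_cring: "cring B" using regular_V by (simp add: regular_local_ring_def)

lemma \<mm>_ideal: "ideal \<mm> B"
proof (rule idealI)
  show "ring B" using B_cring by (rule cring.axioms(1))
  interpret B: cring B by (rule B_cring)
  have neg: "\<ominus> \<one> \<in> V" using subringE(3,5)[OF V_subring] by blast
  show "subgroup \<mm> (add_monoid B)"
  proof (rule subgroup.intro)
    show "\<mm> \<subseteq> carrier (add_monoid B)" using \<mm>_sub_V by auto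
    show "\<one>\<^bsub>add_monoid B\<^esub> \<in> \<mm>"
      using p_props(3) denominators(1,4) by (auto simp: \<mm>_iff intro!: bexI[of _ \<one>])
    fix x assume x: "x \<in> \<mm>"
    have xc: "x \<in> carrier K" using x by (simp add: \<mm>_iff)
    have "x \<otimes> \<ominus> \<one> \<in> \<mm>" by (rule \<mm>_mult[OF x neg])
    then have m: "\<ominus> x \<in> \<mm>" using xc by (simp add: r_minus)
    have "\<ominus>\<^bsub>B\<^esub> x = \<ominus> x"
      by (rule B.minus_equality) (use m x \<mm>_sub_V xc in \<open>auto simp: l_neg\<close>)
    then show "inv\<^bsub>add_monoid B\<^esub> x \<in> \<mm>" using m by (simp add: a_inv_def)
  qed (use \<mm>_add in auto)
qed (use \<mm>_mult \<mm>_iff V_iff m_comm in auto)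

lemma maximal_is_\<mm>: assumes "maximalideal M B" shows "M = \<mm>"
proof -
  interpret M: maximalideal M B by fact
  have "M \<subseteq> \<mm>"
  proof
    fix x assume x: "x \<in> M"
    then have xV: "x \<in> V" using M.a_subset by auto
    show "x \<in> \<mm>"
    proof (rule ccontr)
      assume "x \<notin> \<mm>"
      then have i: "x \<noteq> \<zero>" "inv x \<in> V" using unit_V xV by auto
      then have "inv x \<otimes> x \<in> M" using M.I_l_closed[OF x, of "inv x"] by simp
      then have "\<one> \<in> M" using field_inv V_carrier[OF xV] i by simp
      then show False using M.one_imp_carrier M.I_notcarr by auto
    qed
  qed
  moreover have "\<mm> \<noteq> V" using \<mm>_nonunit[of \<one> \<one>] subringE(3)[OF V_subring] by auto
  ultimately show ?thesis using M.I_maximal[OF \<mm>_ideal] \<mm>_sub_V by auto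
qed

subsection \<open>The stalk has dimension one\<close>

lemma height_chain:
  assumes "\<And>i. i \<le> n \<Longrightarrow> primeideal (Q i) A" "\<And>i. i < n \<Longrightarrow> Q i \<subset> Q (Suc i)" "Q n = p"
  shows "n \<le> 1"
proof -
  have "enat n \<le> height A p"
    unfolding height_def by (rule Sup_upper) (use assms in blast)
  then show ?thesis unfolding height_p by (simp add: one_enat_def)
qed

lemma p_nonzero: "\<exists>a\<in>p. a \<noteq> \<zero>"
proof (rule ccontr)
  assume "\<not> ?thesis"
  then have z: "p \<subseteq> {\<zero>}" by blast
  have "height A p \<le> 0"
    unfolding height_def
  proof (rule Sup_least)
    fix e assume "e \<in> {enat n |n. \<exists>Q. (\<forall>i\<le>n. primeideal (Q i) A) \<and> (\<forall>i<n. Q i \<subset> Q (Suc i)) \<and> Q n = p}"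
    then obtain n Q where n: "e = enat n" "\<And>i. i \<le> n \<Longrightarrow> primeideal (Q i) A" "\<And>i. i < n \<Longrightarrow> Q i \<subset> Q (Suc i)" "Q n = p"
      by blast
    have "n = 0"
    proof (rule ccontr)
      assume "n \<noteq> 0"
      then obtain m where m: "n = Suc m" by (cases n) auto
      have "Q m \<subset> p" using n(3)[of m] n(4) m by simp
      moreover have "\<zero> \<in> Q m"
        using additive_subgroup.zero_closed[OF ideal.axioms(1)[OF primeideal.axioms(1)[OF n(2)[of m]]]] m by simp
      ultimately show False using z by blast
    qed
    then show "e \<le> 0" using n(1) by (simp add: zero_enat_def)
  qed
  then show False unfolding height_p by simp
qed

text \<open>Primes of the stalk correspond to primes of the ring inside \<open>p\<close>.\<close>
lemma contraction:
  assumes "primeideal Q B"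
  shows "primeideal (Q \<inter> R) A" "Q \<inter> R \<subseteq> p"
    "x \<in> Q \<Longrightarrow> b \<in> R - p \<Longrightarrow> x \<otimes> b \<in> R \<Longrightarrow> x \<otimes> b \<in> Q \<inter> R"
    "x \<in> V \<Longrightarrow> b \<in> R - p \<Longrightarrow> x \<otimes> b \<in> Q \<Longrightarrow> x \<in> Q"
proof -
  interpret Q: primeideal Q B by fact
  have QV: "Q \<subseteq> V" using Q.a_subset by simp
  have invb: "inv b \<in> V" if "b \<in> R - p" for b
  proof -
    have "inv b \<otimes> b \<in> R" using field_inv denominators that subringE(3)[OF subring_R] by simp
    then show ?thesis unfolding V_iff using field_inv denominators that by blast
  qed
  have unit: "b \<notin> Q" if "b \<in> R - p" for b
  proof
    assume "b \<in> Q"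
    then have "inv b \<otimes> b \<in> Q" using Q.I_l_closed[of b "inv b"] invb[OF that] by simp
    then have "\<one> \<in> Q" using field_inv denominators that by simp
    then show False using Q.one_imp_carrier Q.I_notcarr by auto
  qed
  have "(\<lambda>x. x) \<in> ring_hom A B" by (rule ring_hom_memI) (auto simp: R_sub_V)
  then have "ring_hom_ring A B (\<lambda>x. x)"
    using A_cring B_cring by (intro ring_hom_ringI2) (auto dest: cring.axioms(1))
  from ring_hom_ring.primeideal_vimage[OF this A_cring assms] have "primeideal {r \<in> R. r \<in> Q} A" by simp
  moreover have "{r \<in> R. r \<in> Q} = Q \<inter> R" by blast
  ultimately show "primeideal (Q \<inter> R) A" by simp
  show "Q \<inter> R \<subseteq> p" using unit by blast
  show "x \<in> Q \<Longrightarrow> b \<in> R - p \<Longrightarrow> x \<otimes> b \<in> R \<Longrightarrow> x \<otimes> b \<in> Q \<inter> R"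
    using Q.I_r_closed[of x b] R_sub_V by auto
  show "x \<in> V \<Longrightarrow> b \<in> R - p \<Longrightarrow> x \<otimes> b \<in> Q \<Longrightarrow> x \<in> Q"
    using Q.I_prime[of x b] R_sub_V unit by auto
qed

text \<open>A chain of primes of the stalk contracts to a strict chain of primes inside \<open>p\<close>, which
  has height one.\<close>
lemma krull_dim_V: "krull_dim B \<le> 1"
  unfolding krull_dim_def
proof (rule Sup_least)
  fix e assume "e \<in> {height B P |P. primeideal P B}"
  then obtain P where e: "e = height B P" by blast
  show "e \<le> 1"
    unfolding e height_def
  proof (rule Sup_least)
    fix e assume "e \<in> {enat n |n. \<exists>Q. (\<forall>i\<le>n. primeideal (Q i) B) \<and> (\<forall>i<n. Q i \<subset> Q (Suc i)) \<and> Q n = P}"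
    then obtain n Q where n: "e = enat n" and pr: "\<And>i. i \<le> n \<Longrightarrow> primeideal (Q i) B"
      and sub: "\<And>i. i < n \<Longrightarrow> Q i \<subset> Q (Suc i)" by blast
    have sub': "Q i \<inter> R \<subset> Q (Suc i) \<inter> R" if i: "i < n" for i
    proof -
      have pi: "primeideal (Q i) B" "primeideal (Q (Suc i)) B" using pr i by auto
      obtain x where x: "x \<in> Q (Suc i)" "x \<notin> Q i" using sub[OF i] by blast
      have "Q (Suc i) \<subseteq> V"
        using additive_subgroup.a_subset[OF ideal.axioms(1)[OF primeideal.axioms(1)[OF pi(2)]]] by simp
      then have xV: "x \<in> V" using x by blast
      then obtain b where b: "b \<in> R - p" "x \<otimes> b \<in> R" unfolding V_iff by blast
      have "x \<otimes> b \<in> Q (Suc i) \<inter> R" by (rule contraction(3)[OF pi(2) x(1) b])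
      moreover have "x \<otimes> b \<notin> Q i" using contraction(4)[OF pi(1) xV b(1)] x(2) by blast
      ultimately show ?thesis using sub[OF i] by blast
    qed
    have "n \<le> 1"
    proof (cases "Q n \<inter> R = p")
      case True
      show ?thesis by (rule height_chain[of n "\<lambda>i. Q i \<inter> R"]) (use True contraction(1) pr sub' in auto)
    next
      case False
      have sp: "Q n \<inter> R \<subset> p" using False contraction(2)[OF pr[of n]] by blast
      let ?Q = "\<lambda>i. if i \<le> n then Q i \<inter> R else p"
      have "Suc n \<le> 1"
      proof (rule height_chain[of "Suc n" ?Q])
        fix i assume "i < Suc n"
        then consider "i < n" | "i = n" by linarith
        then show "?Q i \<subset> ?Q (Suc i)"
        proof cases
          case 1
          then show ?thesis using sub'[OF 1] by simp
        qed (use sp in simp)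
      qed (use contraction(1) pr prime_p in auto)
      then show ?thesis by simp
    qed
    then show "e \<le> 1" by (simp add: n one_enat_def)
  qed
qed

text \<open>A regular local ring of dimension at most one has a maximal ideal with at most one generator, and
  the ideal is nonzero because \<open>p\<close> is not minimal.\<close>
lemma uniformizer_exists: "\<exists>\<pi>\<in>V. \<pi> \<noteq> \<zero> \<and> PIdl\<^bsub>B\<^esub> \<pi> = \<mm>"
proof -
  interpret B: cring B by (rule B_cring)
  obtain M G where M: "maximalideal M B" and G: "finite G" "G \<subseteq> V" "enat (card G) \<le> krull_dim B" "Idl\<^bsub>B\<^esub> G = M"
    using regular_V unfolding regular_local_ring_def by auto
  note Mm = maximal_is_\<mm>[OF M]
  have "enat (card G) \<le> 1" using G(3) krull_dim_V by (rule order_trans)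
  then have c: "card G \<le> 1" by (simp add: one_enat_def)
  obtain a where a: "a \<in> p" "a \<noteq> \<zero>" using p_nonzero by blast
  have am: "a \<in> \<mm>" using a p_sub denominators(4) R_carrier by (auto simp: \<mm>_iff intro!: bexI[of _ \<one>])
  have "G \<noteq> {}"
  proof
    assume "G = {}"
    then have "M \<subseteq> {\<zero>}" using B.genideal_minimal[OF B.zeroideal, of G] G(4) by simp
    then show False using am a Mm by blast
  qed
  then obtain g where g: "G = {g}" using c G(1) by (metis card_1_singletonE card_0_eq le_SucE le_zero_eq One_nat_def)
  have gV: "g \<in> V" using g G by blast
  have P: "PIdl\<^bsub>B\<^esub> g = \<mm>" using B.cgenideal_eq_genideal[of g] gV G(4) g Mm by simp
  have "g \<noteq> \<zero>"
  proof
    assume "g = \<zero>"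
    then have "\<mm> \<subseteq> {\<zero>}" using P V_carrier unfolding cgenideal_def by auto
    then show False using am a by blast
  qed
  then show ?thesis using gV P by blast
qed

definition \<pi> :: 'a where "\<pi> = (SOME \<pi>. \<pi> \<in> V \<and> \<pi> \<noteq> \<zero> \<and> PIdl\<^bsub>B\<^esub> \<pi> = \<mm>)"

lemma \<pi>: "\<pi> \<in> V" "\<pi> \<noteq> \<zero>" "PIdl\<^bsub>B\<^esub> \<pi> = \<mm>"
  using someI_ex[of "\<lambda>\<pi>. \<pi> \<in> V \<and> \<pi> \<noteq> \<zero> \<and> PIdl\<^bsub>B\<^esub> \<pi> = \<mm>"] uniformizer_exists unfolding \<pi>_def by blast+

lemma \<pi>_carrier: "\<pi> \<in> carrier K" using \<pi>(1) V_carrier by blast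

lemma \<mm>_eq: "x \<in> \<mm> \<longleftrightarrow> (\<exists>r\<in>V. x = r \<otimes> \<pi>)"
  unfolding \<pi>(3)[symmetric] cgenideal_def by auto

definition U :: "'a set" where "U = V - \<mm>"

lemma U_iff: "x \<in> U \<longleftrightarrow> x \<in> V \<and> x \<noteq> \<zero> \<and> inv x \<in> V"
proof
  assume "x \<in> U"
  then show "x \<in> V \<and> x \<noteq> \<zero> \<and> inv x \<in> V" using unit_V by (auto simp: U_def)
next
  assume "x \<in> V \<and> x \<noteq> \<zero> \<and> inv x \<in> V"
  then show "x \<in> U" using \<mm>_nonunit[of x "inv x"] field_inv(3)[OF V_carrier] by (auto simp: U_def)
qed

lemma U_carrier: "x \<in> U \<Longrightarrow> x \<in> carrier K" "x \<in> U \<Longrightarrow> x \<noteq> \<zero>"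
  using U_iff V_carrier by auto

lemma U_inv: "x \<in> U \<Longrightarrow> inv x \<in> U"
proof -
  assume x: "x \<in> U"
  have "inv (inv x) = x" using Units_inv_inv field_Units U_carrier[OF x] by simp
  moreover have "inv x \<noteq> \<zero>" using field_inv(2)[OF U_carrier[OF x]] U_carrier[OF x] by auto
  ultimately show ?thesis using x by (simp add: U_iff)
qed

lemma U_mult: "x \<in> U \<Longrightarrow> y \<in> U \<Longrightarrow> x \<otimes> y \<in> U"
proof -
  assume xy: "x \<in> U" "y \<in> U"
  have V: "x \<otimes> y \<in> V" "inv y \<otimes> inv x \<in> V"
    using xy U_iff by (auto intro!: subringE(6)[OF V_subring])
  have "(x \<otimes> y) \<otimes> (inv y \<otimes> inv x) = x \<otimes> (y \<otimes> inv y) \<otimes> inv x"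
    using U_carrier(1) U_inv xy by (simp add: m_assoc)
  then have "(x \<otimes> y) \<otimes> (inv y \<otimes> inv x) = \<one>"
    using field_inv U_carrier xy by simp
  then show ?thesis using \<mm>_nonunit[OF _ V(2), of "x \<otimes> y"] V by (auto simp: U_def)
qed

lemma Units_B: "Units B = U"
proof
  show "Units B \<subseteq> U" using \<mm>_nonunit by (auto simp: Units_def U_def)
  show "U \<subseteq> Units B"
  proof
    fix x assume x: "x \<in> U"
    then have "inv x \<otimes> x = \<one>" "x \<otimes> inv x = \<one>" using field_inv U_carrier by auto
    then show "x \<in> Units B" using x U_iff by (auto simp: Units_def)
  qed
qed

lemma pi_pow: "\<pi> [^] (n::int) \<in> carrier K" "\<pi> [^] (n::int) \<noteq> \<zero>"
  using int_pow_field[OF \<pi>_carrier \<pi>(2)] by auto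

lemma pi_pow_pos: "0 < n \<Longrightarrow> r \<in> V \<Longrightarrow> r \<otimes> \<pi> [^] (n::int) \<in> \<mm>"
proof -
  assume n: "0 < n" and r: "r \<in> V"
  obtain m where m: "n = int (Suc m)" using n by (metis pos_int_cases gr0_conv_Suc)
  have pV: "\<pi> [^] m \<in> V" using \<pi>(1) by (induction m) (auto intro: subringE(3,6)[OF V_subring])
  have "r \<otimes> \<pi> [^] n = (r \<otimes> \<pi> [^] m) \<otimes> \<pi>"
    unfolding m int_pow_int using V_carrier[OF r] V_carrier[OF pV] \<pi>_carrier by (simp add: m_assoc)
  then show ?thesis unfolding \<mm>_eq using subringE(6)[OF V_subring r pV] by blast
qed

text \<open>Otherwise \<open>x\<close> is divisible by every power of \<open>\<pi>\<close>, and the quotients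
  generate a chain of principal ideals that never becomes stationary.\<close>
lemma V_decomp: "x \<in> V \<Longrightarrow> x \<noteq> \<zero> \<Longrightarrow> \<exists>n::nat. \<exists>u\<in>U. x = u \<otimes> \<pi> [^] n"
proof (rule ccontr)
  assume x: "x \<in> V" "x \<noteq> \<zero>" and no: "\<not> (\<exists>n::nat. \<exists>u\<in>U. x = u \<otimes> \<pi> [^] n)"
  interpret B: noetherian_ring B using regular_V by (simp add: regular_local_ring_def)
  interpret B: cring B by (rule B_cring)
  have step: "\<exists>y\<in>V. x = y \<otimes> \<pi> [^] n" for n :: nat
  proof (induction n)
    case 0
    then show ?case using x V_carrier by (intro bexI[of _ x]) auto
  next
    case (Suc n)
    then obtain y where y: "y \<in> V" "x = y \<otimes> \<pi> [^] n" by blast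
    then have "y \<in> \<mm>" using no by (auto simp: U_def)
    then obtain r where r: "r \<in> V" "y = r \<otimes> \<pi>" unfolding \<mm>_eq by blast
    have "x = r \<otimes> \<pi> [^] Suc n"
      using y(2) r V_carrier[OF r(1)] \<pi>_carrier nat_pow_Suc2[OF \<pi>_carrier, of n] by (simp add: m_assoc)
    then show ?case using r by blast
  qed
  then obtain y where y: "\<And>n. y n \<in> V" "\<And>n. x = y n \<otimes> \<pi> [^] (n::nat)" by metis
  have yc: "y n \<in> carrier K" for n using V_carrier[OF y(1)] .
  have pn: "\<pi> [^] (n::nat) \<in> carrier K" "\<pi> [^] n \<noteq> \<zero>" for n
    using \<pi>_carrier pi_pow(2)[of "int n"] by (simp_all add: int_pow_int)
  have ys: "y n = \<pi> \<otimes> y (Suc n)" for n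
  proof -
    have "y n \<otimes> \<pi> [^] n = y (Suc n) \<otimes> (\<pi> [^] n \<otimes> \<pi>)"
      using y(2)[of n] y(2)[of "Suc n"] by (metis nat_pow_Suc)
    also have "\<dots> = (\<pi> \<otimes> y (Suc n)) \<otimes> \<pi> [^] n"
      using yc[of "Suc n"] \<pi>_carrier pn(1)[of n] by (simp add: m_ac)
    finally show ?thesis
      using m_rcancel[OF pn(2)[of n] pn(1)[of n] yc[of n], of "\<pi> \<otimes> y (Suc n)"] yc[of "Suc n"] \<pi>_carrier
      by simp
  qed
  let ?C = "range (\<lambda>n. PIdl\<^bsub>B\<^esub> (y n))"
  have up: "PIdl\<^bsub>B\<^esub> (y n) \<subseteq> PIdl\<^bsub>B\<^esub> (y (Suc n))" for n
  proof -
    have "ideal (PIdl\<^bsub>B\<^esub> (y (Suc n))) B" using B.cgenideal_ideal y(1) by simp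
    moreover have "y n \<in> PIdl\<^bsub>B\<^esub> (y (Suc n))" unfolding cgenideal_def using ys[of n] \<pi>(1) by auto
    ultimately show ?thesis by (rule B.cgenideal_minimal)
  qed
  have mono: "PIdl\<^bsub>B\<^esub> (y n) \<subseteq> PIdl\<^bsub>B\<^esub> (y m)" if "n \<le> m" for n m
    using that by (rule lift_Suc_mono_le[of "\<lambda>n. PIdl\<^bsub>B\<^esub> (y n)", OF up])
  have "subset.chain {I. ideal I B} ?C"
    unfolding pred_on.chain_def
  proof (intro conjI ballI)
    show "?C \<subseteq> {I. ideal I B}" using B.cgenideal_ideal y(1) by auto
    fix I J assume "I \<in> ?C" "J \<in> ?C"
    then obtain n m where "I = PIdl\<^bsub>B\<^esub> (y n)" "J = PIdl\<^bsub>B\<^esub> (y m)" by blast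
    then show "(\<subset>)\<^sup>=\<^sup>= I J \<or> (\<subset>)\<^sup>=\<^sup>= J I" using mono[of n m] mono[of m n] by (cases "n \<le> m") auto
  qed
  then have "\<Union>?C \<in> ?C" using B.ideal_chain_is_trivial by blast
  then obtain n where n: "\<Union>?C = PIdl\<^bsub>B\<^esub> (y n)" by blast
  have "y (Suc n) \<in> PIdl\<^bsub>B\<^esub> (y (Suc n))" using B.cgenideal_self[of "y (Suc n)"] y(1) by simp
  then have "y (Suc n) \<in> PIdl\<^bsub>B\<^esub> (y n)" unfolding n[symmetric] by blast
  then obtain r where r: "r \<in> V" "y (Suc n) = r \<otimes> y n" unfolding cgenideal_def by auto
  have rc: "r \<in> carrier K" using V_carrier r by blast
  have nz: "y (Suc n) \<noteq> \<zero>" using x(2) y(2)[of "Suc n"] pn(1)[of "Suc n"] by auto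
  have "\<one> \<otimes> y (Suc n) = (\<pi> \<otimes> r) \<otimes> y (Suc n)"
  proof -
    have "(\<pi> \<otimes> r) \<otimes> y (Suc n) = r \<otimes> (\<pi> \<otimes> y (Suc n))" using rc \<pi>_carrier yc[of "Suc n"] by (simp add: m_ac)
    also have "\<dots> = y (Suc n)" using r(2) ys[of n] by simp
    finally show ?thesis using yc[of "Suc n"] by simp
  qed
  then have "\<one> = \<pi> \<otimes> r"
    using m_rcancel[OF nz yc one_closed, of "\<pi> \<otimes> r"] rc \<pi>_carrier by simp
  then have "\<pi> \<otimes> r = \<one>" by simp
  moreover have "\<pi> \<in> \<mm>" unfolding \<mm>_eq using \<pi>_carrier subringE(3)[OF V_subring] by (metis l_one)
  ultimately show False using \<mm>_nonunit r(1) by blast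
qed

lemma K_decomp: "x \<in> carrier K \<Longrightarrow> x \<noteq> \<zero> \<Longrightarrow> \<exists>n::int. \<exists>u\<in>U. x = u \<otimes> \<pi> [^] n"
proof -
  assume x: "x \<in> carrier K" "x \<noteq> \<zero>"
  obtain a b where ab: "a \<in> R" "b \<in> R" "b \<noteq> \<zero>" "x = a \<otimes> inv b" using fractions[OF x(1)] by blast
  have c: "a \<in> carrier K" "b \<in> carrier K" using ab R_carrier by auto
  have bi: "inv b \<in> carrier K" "b \<otimes> inv b = \<one>" using field_inv c ab by auto
  have a0: "a \<noteq> \<zero>" using x ab bi by auto
  obtain n :: nat and u where u: "u \<in> U" "a = u \<otimes> \<pi> [^] n" using V_decomp[OF R_sub_V[OF ab(1)] a0] by blast
  obtain m :: nat and w where w: "w \<in> U" "b = w \<otimes> \<pi> [^] m" using V_decomp[OF R_sub_V[OF ab(2)] ab(3)] by blast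
  have uw: "u \<otimes> inv w \<in> U" by (intro U_mult U_inv u w)
  note uc = U_carrier(1)[OF u(1)] U_carrier(1)[OF w(1)] U_carrier(1)[OF U_inv[OF w(1)]]
  let ?p = "\<pi> [^] (int n - int m)"
  have e: "\<pi> [^] m \<otimes> ?p = \<pi> [^] n"
    using int_pow_field(3)[OF \<pi>_carrier \<pi>(2), of "int m" "int n - int m"] by (simp add: int_pow_int)
  have "(u \<otimes> inv w \<otimes> ?p) \<otimes> b = u \<otimes> (inv w \<otimes> w) \<otimes> (\<pi> [^] m \<otimes> ?p)"
    unfolding w(2) using uc pi_pow(1)[of "int n - int m"] nat_pow_closed[OF \<pi>_carrier, of m] by algebra
  also have "\<dots> = a" using e u(2) uc field_inv(2)[OF uc(2) U_carrier(2)[OF w(1)]] by simp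
  finally have "(u \<otimes> inv w \<otimes> ?p) \<otimes> b \<otimes> inv b = x" using ab(4) by simp
  then have "x = (u \<otimes> inv w) \<otimes> ?p" using bi c uc pi_pow(1)[of "int n - int m"] by (simp add: m_assoc)
  then show ?thesis using uw by blast
qed

lemma unit_pow_eq: \<comment> \<open>the exponent is determined\<close>
  assumes "u \<in> U" "w \<in> U" "u \<otimes> \<pi> [^] (n::int) = w \<otimes> \<pi> [^] (m::int)"
  shows "n = m"
proof -
  have le: "\<not> m < n" if "u \<in> U" "w \<in> U" "u \<otimes> \<pi> [^] (n::int) = w \<otimes> \<pi> [^] (m::int)" for u w n m
  proof
    assume "m < n"
    then have "u \<otimes> \<pi> [^] (n - m) \<in> \<mm>" using pi_pow_pos[of "n - m" u] that by (simp add: U_def)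
    moreover have "u \<otimes> \<pi> [^] (n - m) = w"
    proof -
      have "(u \<otimes> \<pi> [^] (n - m)) \<otimes> \<pi> [^] m = w \<otimes> \<pi> [^] m"
        using that(3) int_pow_field(3)[OF \<pi>_carrier \<pi>(2), of "n - m" m] U_carrier(1)[OF that(1)] pi_pow
        by (simp add: m_assoc)
      then show ?thesis
        using m_rcancel[OF pi_pow(2)[of m] pi_pow(1), of "u \<otimes> \<pi> [^] (n - m)" w] U_carrier(1)[OF that(1)]
          U_carrier(1)[OF that(2)] pi_pow(1) by simp
    qed
    ultimately show False using that(2) by (simp add: U_def)
  qed
  show ?thesis using le[OF assms] le[OF assms(2,1) assms(3)[symmetric]] by linarith
qed

abbreviation "v \<equiv> valuation K R p"

lemma U_pow: "u \<in> U \<Longrightarrow> u [^] (n::int) \<in> U"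
proof -
  assume u: "u \<in> U"
  have one: "\<one> \<in> U" using U_mult[OF u U_inv[OF u]] field_inv(3)[OF U_carrier[OF u]] by simp
  have pw: "u [^] (k::nat) \<in> U" for k using u one by (induction k) (auto intro: U_mult)
  show ?thesis unfolding int_pow_def2 by (auto simp only: pw U_inv[OF pw] split: if_split)
qed

text \<open>The valuation does not depend on the chosen generator: two generators differ by a unit.\<close>
lemma valuation_eq:
  assumes u: "u \<in> U"
  shows "v (u \<otimes> \<pi> [^] (n::int)) = n"
  unfolding valuation_def Units_B
proof (rule the_equality)
  show "\<exists>\<pi>'\<in>V. \<exists>w\<in>U. PIdl\<^bsub>B\<^esub> \<pi>' = \<mm> \<and> u \<otimes> \<pi> [^] n = w \<otimes> \<pi>' [^] n" using u \<pi> by blast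
  fix m :: int assume "\<exists>\<pi>'\<in>V. \<exists>w\<in>U. PIdl\<^bsub>B\<^esub> \<pi>' = \<mm> \<and> u \<otimes> \<pi> [^] n = w \<otimes> \<pi>' [^] m"
  then obtain \<pi>' w where *: "\<pi>' \<in> V" "w \<in> U" "PIdl\<^bsub>B\<^esub> \<pi>' = \<mm>" "u \<otimes> \<pi> [^] n = w \<otimes> \<pi>' [^] m" by blast
  interpret B: cring B by (rule B_cring)
  have "\<pi>' \<in> \<mm>" using B.cgenideal_self[of \<pi>'] * by simp
  then obtain r where r: "r \<in> V" "\<pi>' = r \<otimes> \<pi>" unfolding \<mm>_eq by blast
  have "\<pi> \<in> PIdl\<^bsub>B\<^esub> \<pi>'" using B.cgenideal_self[of \<pi>] \<pi> * by simp
  then obtain t where t: "t \<in> V" "\<pi> = t \<otimes> \<pi>'" unfolding cgenideal_def by auto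
  have c: "r \<in> carrier K" "t \<in> carrier K" using V_carrier r t by auto
  have "(r \<otimes> t) \<otimes> \<pi> = t \<otimes> (r \<otimes> \<pi>)" using c \<pi>_carrier by (simp add: m_ac)
  also have "\<dots> = \<one> \<otimes> \<pi>" using t(2) r(2) \<pi>_carrier by simp
  finally have "r \<otimes> t = \<one>" using m_rcancel[OF \<pi>(2) \<pi>_carrier, of "r \<otimes> t" \<one>] c by simp
  then have rU: "r \<in> U" using \<mm>_nonunit[of r t] r t by (auto simp: U_def)
  have "\<pi>' [^] m = r [^] m \<otimes> \<pi> [^] m"
    unfolding r(2) using int_pow_field(4)[OF U_carrier[OF rU] \<pi>_carrier \<pi>(2)] .
  then have "u \<otimes> \<pi> [^] n = (w \<otimes> r [^] m) \<otimes> \<pi> [^] m"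
    using *(2,4) U_carrier(1) U_pow[OF rU, of m] pi_pow by (simp add: m_assoc)
  then show "m = n" using unit_pow_eq[OF u U_mult[OF *(2) U_pow[OF rU, of m]]] by blast
qed

lemma V_valuation_iff: "x \<in> carrier K \<Longrightarrow> x \<noteq> \<zero> \<Longrightarrow> x \<in> V \<longleftrightarrow> 0 \<le> v x"
proof
  assume x: "x \<in> carrier K" "x \<noteq> \<zero>"
  show "0 \<le> v x" if xV: "x \<in> V"
  proof -
    obtain n :: nat and u where "u \<in> U" "x = u \<otimes> \<pi> [^] n" using V_decomp[OF xV x(2)] by blast
    then show ?thesis using valuation_eq[of u "int n"] by (simp add: int_pow_int)
  qed
  assume v: "0 \<le> v x"
  obtain n u where u: "u \<in> U" "x = u \<otimes> \<pi> [^] (n::int)" using K_decomp[OF x] by blast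
  have "v x = n" unfolding u(2) by (rule valuation_eq[OF u(1)])
  then have "n = int (nat n)" using v by simp
  then have "\<pi> [^] n = \<pi> [^] (nat n)" using int_pow_int[of K \<pi> "nat n"] by metis
  moreover have "\<pi> [^] (k::nat) \<in> V" for k
    using \<pi>(1) by (induction k) (auto intro: subringE(3,6)[OF V_subring])
  ultimately have "\<pi> [^] n \<in> V" by simp
  moreover have "u \<in> V" using u(1) by (simp add: U_def)
  ultimately show "x \<in> V" unfolding u(2) by (intro subringE(6)[OF V_subring])
qed

theorem valuation_discrete: "discretely_valued_field K v \<pi>"
  unfolding discretely_valued_field_def discretely_valued_field_axioms_def
proof (intro conjI allI impI)
  show "field K" by (rule field_axioms)
  have one: "\<one> \<in> U" using \<mm>_nonunit[of \<one> \<one>] subringE(3)[OF V_subring] by (auto simp: U_def)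
  have "\<one> \<otimes> \<pi> [^] (1::int) = \<pi>" using int_pow_int[of K \<pi> 1] \<pi>_carrier by simp
  then show "v \<pi> = 1" using valuation_eq[OF one, of 1] by simp
next
  fix x y assume xy: "x \<in> carrier K" "y \<in> carrier K" "x \<noteq> \<zero>" "y \<noteq> \<zero>"
  obtain n u where u: "u \<in> U" "x = u \<otimes> \<pi> [^] (n::int)" using K_decomp[OF xy(1,3)] by blast
  obtain m w where w: "w \<in> U" "y = w \<otimes> \<pi> [^] (m::int)" using K_decomp[OF xy(2,4)] by blast
  note c = U_carrier(1)[OF u(1)] U_carrier(1)[OF w(1)] pi_pow(1)[of n] pi_pow(1)[of m]
  have "x \<otimes> y = (u \<otimes> w) \<otimes> (\<pi> [^] n \<otimes> \<pi> [^] m)" unfolding u w using c by algebra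
  also have "\<pi> [^] n \<otimes> \<pi> [^] m = \<pi> [^] (n + m)" using int_pow_field(3)[OF \<pi>_carrier \<pi>(2)] by simp
  finally have "v (x \<otimes> y) = n + m" using valuation_eq[OF U_mult[OF u(1) w(1)]] by simp
  moreover have "v x = n" "v y = m" unfolding u(2) w(2) by (rule valuation_eq[OF u(1)], rule valuation_eq[OF w(1)])
  ultimately show "v (x \<otimes> y) = v x + v y" by simp
next
  have main: "min (v x) (v y) \<le> v (x \<oplus> y)"
    if xy: "x \<in> carrier K" "y \<in> carrier K" "x \<noteq> \<zero>" "y \<noteq> \<zero>" "x \<oplus> y \<noteq> \<zero>" and le: "v y \<le> v x" for x y
  proof -
    obtain n u where u: "u \<in> U" "x = u \<otimes> \<pi> [^] (n::int)" using K_decomp[OF xy(1,3)] by blast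
    obtain m w where w: "w \<in> U" "y = w \<otimes> \<pi> [^] (m::int)" using K_decomp[OF xy(2,4)] by blast
    have vxy: "v x = n" "v y = m" unfolding u(2) w(2) by (rule valuation_eq[OF u(1)], rule valuation_eq[OF w(1)])
    then have nm: "m \<le> n" using le by simp
    let ?p = "\<pi> [^] (n - m)"
    note c = U_carrier(1)[OF u(1)] U_carrier(1)[OF w(1)] pi_pow(1)[of "n - m"] pi_pow(1)[of m]
    have "n - m = int (nat (n - m))" using nm by simp
    then have "?p = \<pi> [^] (nat (n - m))" using int_pow_int[of K \<pi> "nat (n - m)"] by metis
    moreover have "\<pi> [^] (k::nat) \<in> V" for k
      using \<pi>(1) by (induction k) (auto intro: subringE(3,6)[OF V_subring])
    ultimately have pV: "?p \<in> V" by simp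
    have sV: "u \<otimes> ?p \<oplus> w \<in> V" using u(1) w(1) pV by (auto simp: U_def intro!: subringE(6,7)[OF V_subring])
    have "\<pi> [^] n = ?p \<otimes> \<pi> [^] m" using int_pow_field(3)[OF \<pi>_carrier \<pi>(2), of "n - m" m] by simp
    then have e: "x \<oplus> y = (u \<otimes> ?p \<oplus> w) \<otimes> \<pi> [^] m" unfolding u(2) w(2) using c by (simp add: l_distr m_assoc)
    then have "u \<otimes> ?p \<oplus> w \<noteq> \<zero>" using xy(5) c by auto
    then obtain k :: nat and t where t: "t \<in> U" "u \<otimes> ?p \<oplus> w = t \<otimes> \<pi> [^] k" using V_decomp[OF sV] by blast
    have "x \<oplus> y = t \<otimes> \<pi> [^] (int k + m)"
      unfolding e t(2) int_pow_field(3)[OF \<pi>_carrier \<pi>(2)] int_pow_int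
      using U_carrier(1)[OF t(1)] c \<pi>_carrier by (simp add: m_assoc)
    then have "v (x \<oplus> y) = int k + m" using valuation_eq[OF t(1)] by simp
    then show ?thesis using vxy by simp
  qed
  fix x y assume xy: "x \<in> carrier K" "y \<in> carrier K" "x \<noteq> \<zero>" "y \<noteq> \<zero>" "x \<oplus> y \<noteq> \<zero>"
  show "min (v x) (v y) \<le> v (x \<oplus> y)"
  proof (cases "v y \<le> v x")
    case True
    then show ?thesis using main[OF xy] by simp
  next
    case False
    then have "min (v y) (v x) \<le> v (y \<oplus> x)" using xy a_comm[of x y] by (intro main) auto
    then show ?thesis using a_comm[of x y] xy by (simp add: min.commute)
  qed
qed (use \<pi> \<pi>_carrier in auto)

end

section \<open>Orders in a division algebra over a complete field\<close>

context complete_dvr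
begin

lemma Z_carrier [simp]: "z \<in> Z \<Longrightarrow> z \<in> carrier M"
  using subringE(1)[OF subfieldE(1)[OF subfield_Z]] by blast

lemma Q_Z: "x \<in> Q \<Longrightarrow> x \<in> Z" using Q_sub_Z by blast

lemma Q_carrier [simp]: "x \<in> Q \<Longrightarrow> x \<in> carrier M" using Q_Z by simp

lemma Q_closed [simp]:
  "\<zero> \<in> Q" "\<one> \<in> Q" "x \<in> Q \<Longrightarrow> y \<in> Q \<Longrightarrow> x \<otimes> y \<in> Q" "x \<in> Q \<Longrightarrow> y \<in> Q \<Longrightarrow> x \<oplus> y \<in> Q"
  "x \<in> Q \<Longrightarrow> \<ominus> x \<in> Q" "x \<in> Q \<Longrightarrow> y \<in> Q \<Longrightarrow> x \<ominus> y \<in> Q"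
  using subringE[OF subring_Q] by (auto simp: minus_eq)

lemma Q_pow [simp]: "x \<in> Q \<Longrightarrow> x [^] (n::nat) \<in> Q"
  by (induction n) auto

lemma \<pi>_Q [simp]: "\<pi> \<in> Q" "\<pi> \<in> carrier M" using \<pi> by auto

lemma \<pi>_cancel:
  assumes "x \<in> carrier M" "y \<in> carrier M" "\<pi> [^] (n::nat) \<otimes> x = \<pi> [^] n \<otimes> y"
  shows "x = y"
proof -
  define w where "w = inv \<pi>"
  have w: "w \<in> carrier M" "w \<otimes> \<pi> = \<one>"
    unfolding w_def using subfield_m_inv(1,3)[OF subfield_Z, of \<pi>] Q_Z[OF \<pi>(1)] \<pi>(2) by auto
  have i: "w [^] n \<otimes> \<pi> [^] n = \<one>"
  proof (induction n)
    case (Suc n)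
    have "w [^] Suc n \<otimes> \<pi> [^] Suc n = w [^] n \<otimes> (w \<otimes> \<pi>) \<otimes> \<pi> [^] n"
      using w(1) nat_pow_Suc2[of \<pi> n] by (simp add: m_assoc)
    then show ?case using Suc w by simp
  qed simp
  have "w [^] n \<otimes> (\<pi> [^] n \<otimes> x) = w [^] n \<otimes> (\<pi> [^] n \<otimes> y)" using assms(3) by simp
  then show ?thesis using assms(1,2) w i by (simp add: m_assoc[symmetric])
qed

lemma Q_unit_or_divisible:
  assumes "x \<in> Q"
  shows "(\<exists>w\<in>Q. w \<otimes> x = \<one>) \<or> (\<exists>y\<in>Q. x = \<pi> \<otimes> y)"
proof (cases "x = \<zero>")
  case True
  then show ?thesis by (intro disjI2 bexI[of _ \<zero>]) auto
next
  case False
  obtain n :: nat and y w where y: "y \<in> Q" "w \<in> Q" "w \<otimes> y = \<one>" and d: "x = \<pi> [^] n \<otimes> y \<or> \<pi> [^] n \<otimes> x = y"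
    using decomp[OF Q_Z[OF assms] False] by blast
  show ?thesis
  proof (cases n)
    case 0
    then show ?thesis using y d assms by auto
  next
    case (Suc m)
    have p: "\<pi> [^] n = \<pi> \<otimes> \<pi> [^] m" unfolding Suc by (rule nat_pow_Suc2) simp
    from d show ?thesis
    proof
      assume "x = \<pi> [^] n \<otimes> y"
      then have "x = \<pi> \<otimes> (\<pi> [^] m \<otimes> y)" using y unfolding p by (simp add: m_assoc)
      moreover have "\<pi> [^] m \<otimes> y \<in> Q" using y by simp
      ultimately show ?thesis by blast
    next
      assume "\<pi> [^] n \<otimes> x = y"
      then have "(w \<otimes> \<pi> [^] n) \<otimes> x = \<one>" using y assms by (simp add: m_assoc)
      moreover have "w \<otimes> \<pi> [^] n \<in> Q" using y by simp
      ultimately show ?thesis by blast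
    qed
  qed
qed

end

locale division_over_dvr = complete_dvr +
  assumes central: "\<And>z x. z \<in> Z \<Longrightarrow> x \<in> carrier M \<Longrightarrow> x \<otimes> z = z \<otimes> x"
    and division: "Units M = carrier M - {\<zero>}"
begin

lemma left_comm: "z \<in> Z \<Longrightarrow> x \<in> carrier M \<Longrightarrow> y \<in> carrier M \<Longrightarrow> x \<otimes> (z \<otimes> y) = z \<otimes> (x \<otimes> y)"
  using central[of z x] by (simp add: m_assoc[symmetric])

lemma inverse_comm:
  assumes "x \<in> carrier M" "y \<in> carrier M" "x \<otimes> y = \<one>"
  shows "y \<otimes> x = \<one>"
proof -
  have ne: "\<one> \<noteq> \<zero>" using subfieldE(6)[OF subfield_Z] .
  then have "y \<noteq> \<zero>" using assms by auto
  then have "y \<in> Units M" using division assms by blast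
  then have i: "inv y \<in> carrier M" "y \<otimes> inv y = \<one>" by auto
  have "x = x \<otimes> (y \<otimes> inv y)" using assms i by simp
  also have "\<dots> = (x \<otimes> y) \<otimes> inv y" by (rule m_assoc[symmetric]) (use assms i in auto)
  finally have "x = inv y" using i assms(3) by simp
  then show ?thesis using i by simp
qed

lemma no_zero_divisors:
  assumes "x \<in> carrier M" "y \<in> carrier M" "x \<otimes> y = \<zero>"
  shows "x = \<zero> \<or> y = \<zero>"
proof (rule ccontr)
  assume "\<not> ?thesis"
  then have "x \<in> Units M" "y \<noteq> \<zero>" using division assms by auto
  then have ix: "inv x \<in> carrier M" "inv x \<otimes> x = \<one>" by auto
  have "y = (inv x \<otimes> x) \<otimes> y" using ix assms(2) by simp
  also have "\<dots> = inv x \<otimes> (x \<otimes> y)" by (rule m_assoc) (use ix assms in auto)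
  finally show False using assms(3) \<open>y \<noteq> \<zero>\<close> ix by simp
qed

end

locale order_over_dvr = division_over_dvr +
  fixes L :: "'a set"
  assumes L_subring: "subring L M" and Q_sub_L: "Q \<subseteq> L"
begin

text \<open>The uniformizer is central, so its multiples form a two-sided ideal.\<close>
definition P :: "'a set" where "P = (\<lambda>l. \<pi> \<otimes> l) ` L"

lemma L_carrier [simp]: "x \<in> L \<Longrightarrow> x \<in> carrier M" using subringE(1)[OF L_subring] by blast

lemma L_closed:
  "\<zero> \<in> L" "\<one> \<in> L" "x \<in> L \<Longrightarrow> y \<in> L \<Longrightarrow> x \<otimes> y \<in> L" "x \<in> L \<Longrightarrow> y \<in> L \<Longrightarrow> x \<oplus> y \<in> L" "x \<in> L \<Longrightarrow> \<ominus> x \<in> L"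
  using subringE[OF L_subring] by auto

lemma L_pow: "x \<in> L \<Longrightarrow> x [^] (n::nat) \<in> L"
  by (induction n) (auto simp: L_closed)

abbreviation "B \<equiv> M\<lparr>carrier := L\<rparr>"

lemma B_ring: "ring B" by (rule subring_is_ring[OF L_subring])

lemma P_sub: "P \<subseteq> L" 
  unfolding P_def using L_closed(3)[OF subsetD[OF Q_sub_L \<pi>_Q(1)]] by auto

lemma P_add: "x \<in> P \<Longrightarrow> y \<in> P \<Longrightarrow> x \<oplus> y \<in> P"
  unfolding P_def using L_closed(4) by (auto simp: r_distr[symmetric])

lemma P_lmult: "x \<in> P \<Longrightarrow> l \<in> L \<Longrightarrow> l \<otimes> x \<in> P"
  unfolding P_def using L_closed(3) left_comm[OF Q_Z[OF \<pi>_Q(1)]] by auto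

lemma P_rmult: "x \<in> P \<Longrightarrow> l \<in> L \<Longrightarrow> x \<otimes> l \<in> P"
  unfolding P_def using L_closed(3) by (auto simp: m_assoc)

lemma P_minus: "x \<in> P \<Longrightarrow> \<ominus> x \<in> P"
  using P_lmult[of x "\<ominus> \<one>"] L_closed(2,5) P_sub by (auto simp: l_minus subset_iff)

lemma P_zero: "\<zero> \<in> P"
proof -
  have "\<pi> \<otimes> \<zero> \<in> P" unfolding P_def using L_closed(1) by (rule imageI)
  then show ?thesis by simp
qed

lemma P_ideal: "ideal (P) B"
proof (rule idealI[OF B_ring])
  interpret B: ring B by (rule B_ring)
  show "subgroup (P) (add_monoid B)"
  proof (rule subgroup.intro)
    show "P \<subseteq> carrier (add_monoid B)" using P_sub by simp
    show "\<one>\<^bsub>add_monoid B\<^esub> \<in> P" using P_zero by simp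
    fix x assume x: "x \<in> P"
    then have xL: "x \<in> L" "\<ominus> x \<in> L" using P_sub P_minus by auto
    have "\<ominus>\<^bsub>B\<^esub> x = \<ominus> x" by (rule B.minus_equality) (use xL in \<open>auto simp: l_neg\<close>)
    then show "inv\<^bsub>add_monoid B\<^esub> x \<in> P" using P_minus[OF x] by (simp add: a_inv_def)
  qed (use P_add in auto)
qed (use P_lmult P_rmult in auto)

end

text \<open>A noncommutative analogue of a discrete valuation ring with uniformizer \<open>\<pi>\<close>.\<close>
locale valuation_order = order_over_dvr +
  assumes \<pi>_nonunit_L: "\<And>w. w \<in> L \<Longrightarrow> w \<otimes> \<pi> \<noteq> \<one>"
    and decomp_L: "\<And>x. x \<in> carrier M \<Longrightarrow> x \<noteq> \<zero> \<Longrightarrow>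
      \<exists>(n::nat). \<exists>y\<in>L. \<exists>w\<in>L. w \<otimes> y = \<one> \<and> (x = \<pi> [^] n \<otimes> y \<or> \<pi> [^] n \<otimes> x = y)"
begin

lemma P_unit: "w \<in> L \<Longrightarrow> l \<in> L \<Longrightarrow> w \<otimes> (\<pi> \<otimes> l) \<noteq> \<one>"
proof
  assume wl: "w \<in> L" "l \<in> L" "w \<otimes> (\<pi> \<otimes> l) = \<one>"
  have "(w \<otimes> l) \<otimes> \<pi> = w \<otimes> (\<pi> \<otimes> l)" using wl central[of \<pi> l] Q_Z by (simp add: m_assoc)
  then show False using wl(3) \<pi>_nonunit_L[OF L_closed(3)[OF wl(1,2)]] by simp
qed

lemma L_unit_or_P:
  assumes "x \<in> L"
  shows "(\<exists>w\<in>L. w \<otimes> x = \<one>) \<or> x \<in> P"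
proof (cases "x = \<zero>")
  case True
  have "\<pi> \<otimes> \<zero> \<in> P" unfolding P_def using L_closed(1) by (rule imageI)
  then show ?thesis using True by simp
next
  case False
  obtain n :: nat and y w where y: "y \<in> L" "w \<in> L" "w \<otimes> y = \<one>" and d: "x = \<pi> [^] n \<otimes> y \<or> \<pi> [^] n \<otimes> x = y"
    using decomp_L[OF L_carrier[OF assms] False] by blast
  have pL: "\<pi> [^] k \<in> L" for k :: nat using Q_sub_L by auto
  show ?thesis
  proof (cases n)
    case 0
    then show ?thesis using y d assms by auto
  next
    case (Suc m)
    have p: "\<pi> [^] n = \<pi> \<otimes> \<pi> [^] m" unfolding Suc by (rule nat_pow_Suc2) simp
    from d show ?thesis
    proof
      assume "x = \<pi> [^] n \<otimes> y"
      then have "x = \<pi> \<otimes> (\<pi> [^] m \<otimes> y)" using y unfolding p by (simp add: m_assoc)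
      then show ?thesis using L_closed(3)[OF pL[of m] y(1)] unfolding P_def by blast
    next
      assume "\<pi> [^] n \<otimes> x = y"
      then have "(w \<otimes> \<pi> [^] n) \<otimes> x = \<one>" using y assms by (simp add: m_assoc)
      then show ?thesis using L_closed(3)[OF y(2) pL[of n]] by blast
    qed
  qed
qed

text \<open>An element of \<open>A\<close> outside \<open>L\<close> is \<open>\<pi>\<^bsup>-n\<^esup>\<close>
  times a unit of \<open>L\<close> with \<open>n > 0\<close>, so the denominators of its powers are unbounded.
  In a finitely generated module over \<open>Q\<close> they are bounded.\<close>
lemma order_sub_L:
  assumes A: "subring A M" and span: "set Us \<subseteq> carrier M" "A = Span Q Us"
  shows "A \<subseteq> L"
proof
  have pL: "\<pi> [^] k \<in> L" for k :: nat using Q_sub_L by auto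
  have up: "\<pi> [^] m \<otimes> x \<in> L" if "\<pi> [^] n \<otimes> x \<in> L" "n \<le> m" "x \<in> carrier M" for n m :: nat and x
  proof -
    have "\<pi> [^] m \<otimes> x = \<pi> [^] (m - n) \<otimes> (\<pi> [^] n \<otimes> x)"
      using that nat_pow_mult[of \<pi> "m - n" n] by (simp add: m_assoc[symmetric])
    then show ?thesis using L_closed(3)[OF pL[of "m - n"] that(1)] by simp
  qed
  have single: "\<exists>n::nat. \<pi> [^] n \<otimes> x \<in> L" if x: "x \<in> carrier M" for x
  proof (cases "x = \<zero>")
    case True
    then show ?thesis using L_closed(1) by simp
  next
    case False
    obtain n :: nat and y where y: "y \<in> L" and d: "x = \<pi> [^] n \<otimes> y \<or> \<pi> [^] n \<otimes> x = y"
      using decomp_L[OF x False] by blast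
    from d show ?thesis
    proof
      assume "x = \<pi> [^] n \<otimes> y"
      then have "\<pi> [^] (0::nat) \<otimes> x \<in> L" using L_closed(3)[OF pL y] x by simp
      then show ?thesis by blast
    qed (use y in blast)
  qed
  have "set Us \<subseteq> carrier M \<Longrightarrow> \<exists>N::nat. \<forall>x\<in>Span Q Us. x \<in> carrier M \<and> \<pi> [^] N \<otimes> x \<in> L" for Us
  proof (induction Us)
    case Nil
    then show ?case using L_closed(1) by simp
  next
    case (Cons a Us)
    obtain N :: nat where N: "\<And>x. x \<in> Span Q Us \<Longrightarrow> x \<in> carrier M \<and> \<pi> [^] N \<otimes> x \<in> L" using Cons by auto
    have a: "a \<in> carrier M" using Cons by simp
    obtain n :: nat where n: "\<pi> [^] n \<otimes> a \<in> L" using single[OF a] by blast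
    have "x \<in> carrier M \<and> \<pi> [^] (max n N) \<otimes> x \<in> L" if x: "x \<in> Span Q (a # Us)" for x
    proof -
      obtain k e where k: "k \<in> Q" "e \<in> Span Q Us" "x = k \<otimes> a \<oplus> e"
        using x line_extension_mem_iff[of x Q a "Span Q Us"] by auto
      have e: "e \<in> carrier M" "\<pi> [^] N \<otimes> e \<in> L" using N k by auto
      have "\<pi> [^] max n N \<otimes> x = k \<otimes> (\<pi> [^] max n N \<otimes> a) \<oplus> \<pi> [^] max n N \<otimes> e"
        unfolding k(3) using k a e left_comm[OF Q_Z[OF k(1)], of "\<pi> [^] max n N" a] by (simp add: r_distr)
      moreover have "k \<otimes> (\<pi> [^] max n N \<otimes> a) \<in> L"
        using k(1) Q_sub_L by (intro L_closed(3) up[OF n]) (auto simp: a)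
      moreover have "\<pi> [^] max n N \<otimes> e \<in> L" by (rule up[OF e(2) _ e(1)]) simp
      ultimately show ?thesis using L_closed(4) k a e by simp
    qed
    then show ?case by blast
  qed
  then obtain N :: nat where N: "\<And>x. x \<in> A \<Longrightarrow> x \<in> carrier M \<and> \<pi> [^] N \<otimes> x \<in> L" using span by blast
  fix x assume xA: "x \<in> A"
  show "x \<in> L"
  proof (cases "x = \<zero>")
    case True
    then show ?thesis using L_closed(1) by simp
  next
    case False
    have x: "x \<in> carrier M" using N xA by blast
    obtain n :: nat and y w where y: "y \<in> L" "w \<in> L" "w \<otimes> y = \<one>" and d: "x = \<pi> [^] n \<otimes> y \<or> \<pi> [^] n \<otimes> x = y"
      using decomp_L[OF x False] by blast
    show ?thesis
    proof (cases "x = \<pi> [^] n \<otimes> y \<or> n = 0")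
      case True
      then show ?thesis using d y L_closed(3)[OF pL y(1)] x by auto
    next
      case False
      then have n: "0 < n" "\<pi> [^] n \<otimes> x = y" using d by auto
      have "x [^] k \<in> A" for k :: nat
        using xA by (induction k) (auto intro: subringE(3,6)[OF A])
      then have bound: "\<pi> [^] N \<otimes> x [^] Suc N \<in> L" using N by blast
      have yk: "y [^] k = \<pi> [^] (n * k) \<otimes> x [^] k" for k :: nat
      proof (induction k)
        case (Suc k)
        have "y [^] Suc k = \<pi> [^] (n * k) \<otimes> x [^] k \<otimes> (\<pi> [^] n \<otimes> x)" using Suc n(2) by simp
        also have "\<dots> = \<pi> [^] (n * k) \<otimes> (\<pi> [^] n \<otimes> (x [^] k \<otimes> x))"
          using x Q_Z left_comm[of "\<pi> [^] n" "x [^] k" x] by (simp add: m_assoc)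
        also have "\<dots> = \<pi> [^] (n * k + n) \<otimes> x [^] Suc k"
          using x nat_pow_mult[of \<pi> "n * k" n] by (simp add: m_assoc[symmetric])
        finally show ?case by (simp add: algebra_simps)
      qed simp
      have wy: "w [^] k \<otimes> y [^] k = \<one>" for k :: nat
      proof (induction k)
        case (Suc k)
        have "w [^] Suc k \<otimes> y [^] Suc k = w [^] k \<otimes> (w \<otimes> y) \<otimes> y [^] k"
          using L_carrier[OF y(1)] L_carrier[OF y(2)] nat_pow_Suc2[of y k] by (simp add: m_assoc)
        then show ?case using Suc y by simp
      qed simp
      have "N < n * Suc N" using n(1) by (cases n) auto
      then obtain r where e: "n * Suc N = Suc r + N"
        using less_imp_Suc_add[of N "n * Suc N"] by (auto simp: add.commute)
      have "y [^] Suc N = \<pi> [^] Suc r \<otimes> (\<pi> [^] N \<otimes> x [^] Suc N)"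
        unfolding yk e using x nat_pow_mult[of \<pi> "Suc r" N] by (simp add: m_assoc[symmetric])
      also have "\<dots> = \<pi> \<otimes> (\<pi> [^] r \<otimes> (\<pi> [^] N \<otimes> x [^] Suc N))"
        using x nat_pow_Suc2[of \<pi> r] by (simp add: m_assoc)
      finally have "w [^] Suc N \<otimes> (\<pi> \<otimes> (\<pi> [^] r \<otimes> (\<pi> [^] N \<otimes> x [^] Suc N))) = \<one>"
        using wy[of "Suc N"] by simp
      moreover have "\<pi> [^] r \<otimes> (\<pi> [^] N \<otimes> x [^] Suc N) \<in> L" by (rule L_closed(3)[OF pL bound])
      ultimately show ?thesis using P_unit[OF L_pow[OF y(2)]] by blast
    qed
  qed
qed

lemma one_not_P: "\<one> \<notin> P"
proof
  assume "\<one> \<in> P"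
  then obtain l where l: "l \<in> L" "\<one> = \<pi> \<otimes> l" unfolding P_def by blast
  have "\<one> \<otimes> (\<pi> \<otimes> l) = \<one>" unfolding l(2)[symmetric] by simp
  then show False using P_unit[OF L_closed(2) l(1)] by blast
qed

text \<open>Every element outside \<open>P\<close> is a unit, so \<open>P\<close> is the only maximal left
  ideal.\<close>
lemma jacobson_radical_L: "jacobson_radical B = P"
proof -
  have unit_full: "I = L" if I: "left_ideal I B" and x: "x \<in> I" "w \<in> L" "w \<otimes> x = \<one>" for I x w
  proof -
    have IL: "I \<subseteq> L" using additive_subgroup.a_subset[of I B] I by (simp add: left_ideal_def)
    have "w \<otimes> x \<in> I" using I x(1,2) unfolding left_ideal_def by simp
    then have one: "\<one> \<in> I" using x by simp
    have "y \<in> I" if y: "y \<in> L" for y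
    proof -
      have "\<forall>b\<in>L. \<forall>x\<in>I. b \<otimes> x \<in> I" using I unfolding left_ideal_def by simp
      then have "y \<otimes> \<one> \<in> I" using one y by blast
      then show ?thesis using y by simp
    qed
    then show ?thesis using IL by blast
  qed
  have small: "I \<subseteq> P" if I: "left_ideal I B" "I \<noteq> L" for I
  proof
    fix x assume x: "x \<in> I"
    have "x \<in> L" using additive_subgroup.a_subset[of I B] I x by (auto simp: left_ideal_def)
    then show "x \<in> P" using L_unit_or_P unit_full[OF I(1) x] I(2) by blast
  qed
  have li: "left_ideal (P) B"
    unfolding left_ideal_def using ideal.axioms(1)[OF P_ideal] P_lmult by simp
  have ne: "P \<noteq> L" using one_not_P L_closed(2) by blast
  have "maximal_left_ideal I B \<longleftrightarrow> I = P" for I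
  proof
    assume I: "maximal_left_ideal I B"
    then have "left_ideal I B" "I \<noteq> L" by (simp_all add: maximal_left_ideal_def)
    then have "I \<subseteq> P" by (rule small)
    then show "I = P" using I li ne unfolding maximal_left_ideal_def by auto
  next
    assume "I = P"
    then show "maximal_left_ideal I B"
      unfolding maximal_left_ideal_def using li ne small by auto
  qed
  then show ?thesis unfolding jacobson_radical_def using P_sub by auto
qed

end

lemma (in division_over_dvr) valuation_order_trivial:
  assumes "carrier M = Z"
  shows "valuation_order M Z Q \<pi> Q"
proof -
  have "order_over_dvr M Z Q \<pi> Q"
    using division_over_dvr_axioms subring_Q by (simp add: order_over_dvr_def order_over_dvr_axioms_def)
  then show ?thesis
    unfolding valuation_order_def valuation_order_axioms_def assms
    using \<pi>_nonunit decomp by blast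
qed

section \<open>Hensel's lemma for roots\<close>

lemma (in cring) binomial_first_order:
  assumes S: "subring S R" and s: "s \<in> S" and h: "h \<in> S"
  shows "\<exists>r\<in>S. (s \<oplus> h) [^] Suc n = s [^] Suc n \<oplus> ([Suc n] \<cdot> \<one>) \<otimes> s [^] n \<otimes> h \<oplus> h \<otimes> h \<otimes> r"
proof (induction n)
  case 0
  have "s \<in> carrier R" "h \<in> carrier R" using s h subringE(1)[OF S] by auto
  then show ?case using subringE(2)[OF S] by (intro bexI[of _ \<zero>]) auto
next
  case (Suc n)
  then obtain r where r: "r \<in> S"
    "(s \<oplus> h) [^] Suc n = s [^] Suc n \<oplus> ([Suc n] \<cdot> \<one>) \<otimes> s [^] n \<otimes> h \<oplus> h \<otimes> h \<otimes> r" by blast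
  have c: "s \<in> carrier R" "h \<in> carrier R" "r \<in> carrier R" using s h r subringE(1)[OF S] by auto
  have one: "[k] \<cdot> \<one> \<in> S" for k :: nat
    by (induction k) (auto simp: add.nat_pow_Suc intro: subringE(2,3,7)[OF S])
  have pw: "s [^] (k::nat) \<in> S" for k using s by (induction k) (auto intro: subringE(3,6)[OF S])
  define a where "a = [Suc n] \<cdot> \<one>"
  have a: "a \<in> S" "a \<in> carrier R" unfolding a_def using one subringE(1)[OF S] by blast+
  have a1: "[Suc (Suc n)] \<cdot> \<one> = a \<oplus> \<one>" unfolding a_def by (rule add.nat_pow_Suc)
  define t where "t = s [^] n"
  have t: "t \<in> S" "t \<in> carrier R" unfolding t_def using pw c by auto
  have p1: "s [^] Suc n = t \<otimes> s" "s [^] Suc (Suc n) = t \<otimes> s \<otimes> s" by (simp_all add: t_def)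
  let ?r = "a \<otimes> t \<oplus> r \<otimes> (s \<oplus> h)"
  have "(s \<oplus> h) [^] Suc (Suc n) = (t \<otimes> s \<oplus> a \<otimes> t \<otimes> h \<oplus> h \<otimes> h \<otimes> r) \<otimes> (s \<oplus> h)"
    unfolding nat_pow_Suc[of _ "Suc n"] r(2)[folded a_def t_def] p1 ..
  also have "\<dots> = t \<otimes> s \<otimes> s \<oplus> (a \<oplus> \<one>) \<otimes> (t \<otimes> s) \<otimes> h \<oplus> h \<otimes> h \<otimes> ?r"
    using c a(2) t(2) by algebra
  finally have "(s \<oplus> h) [^] Suc (Suc n) =
      s [^] Suc (Suc n) \<oplus> ([Suc (Suc n)] \<cdot> \<one>) \<otimes> s [^] Suc n \<otimes> h \<oplus> h \<otimes> h \<otimes> ?r"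
    unfolding a1 p1 .
  moreover have "?r \<in> S" using a t r s h by (intro subringE(6,7)[OF S]) auto
  ultimately show ?case by blast
qed

text \<open>Newton iteration for \<open>X\<^bsup>m + 1\<^esup> - \<alpha>\<close> starting at the approximate
  root \<open>s\<close>. The derivative at a unit is a unit because \<open>m + 1\<close> is invertible.\<close>
lemma hensel_root:
  fixes F (structure)
  assumes F: "field F" and V: "complete_dvr F (carrier F) V \<pi>"
    and q: "c \<in> V" "c \<otimes> ([Suc m] \<cdot> \<one>) = \<one>"
    and s: "s \<in> V" "w \<in> V" "w \<otimes> s = \<one>"
    and e: "e \<in> V" "\<alpha> = s [^] Suc m \<oplus> \<pi> \<otimes> e"
  shows "\<exists>a\<in>carrier F. a [^] Suc m = \<alpha>"
proof -
  interpret F: field F by fact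
  interpret V: complete_dvr F "carrier F" V \<pi> by fact
  let ?q = "[Suc m] \<cdot> \<one>"
  have qc: "?q \<in> carrier F" by simp
  define P where "P n t \<longleftrightarrow> t \<in> V \<and> (\<exists>w\<in>V. w \<otimes> t = \<one>) \<and>
     (\<exists>e\<in>V. \<alpha> = t [^] Suc m \<oplus> \<pi> [^] Suc n \<otimes> e)" for n :: nat and t
  have P0: "P 0 s" unfolding P_def using s e by auto
  have step: "\<exists>t'. P (Suc n) t' \<and> (\<exists>d\<in>V. t' = t \<oplus> \<pi> [^] n \<otimes> d)" if Pt: "P n t" for n t
  proof -
    obtain w e where t: "t \<in> V" and w: "w \<in> V" "w \<otimes> t = \<one>"
      and e: "e \<in> V" "\<alpha> = t [^] Suc m \<oplus> \<pi> [^] Suc n \<otimes> e" using Pt unfolding P_def by blast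
    define p where "p = \<pi> [^] n"
    have p: "p \<in> V" unfolding p_def by simp
    have pS: "\<pi> [^] Suc n = p \<otimes> \<pi>" "\<pi> [^] Suc (Suc n) = p \<otimes> \<pi> \<otimes> \<pi>" by (simp_all add: p_def)
    \<comment> \<open>the Newton correction, divided by the uniformizer power\<close>
    define d where "d = c \<otimes> w [^] m \<otimes> e"
    have d: "d \<in> V" unfolding d_def using q w e by simp
    define h where "h = p \<otimes> \<pi> \<otimes> d"
    have h: "h \<in> V" unfolding h_def using p d by simp
    obtain r where r: "r \<in> V" "(t \<oplus> h) [^] Suc m =
        t [^] Suc m \<oplus> ?q \<otimes> t [^] m \<otimes> h \<oplus> h \<otimes> h \<otimes> r"
      using F.binomial_first_order[OF V.subring_Q t h, of m] by blast
    have wt: "w [^] m \<otimes> t [^] m = \<one>"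
      using F.nat_pow_distrib[of w t m] w t by simp
    have cc: "c \<in> carrier F" "w [^] m \<in> carrier F" "t [^] m \<in> carrier F" "e \<in> carrier F" "p \<in> carrier F"
      "\<pi> \<in> carrier F" "t [^] Suc m \<in> carrier F" "r \<in> carrier F" "d \<in> carrier F" "t \<in> carrier F" "w \<in> carrier F"
      using q w t e p r d by simp_all
    have "?q \<otimes> t [^] m \<otimes> h = (c \<otimes> ?q) \<otimes> (w [^] m \<otimes> t [^] m) \<otimes> (p \<otimes> \<pi> \<otimes> e)"
      unfolding h_def d_def using cc(1-6) qc by algebra
    also have "\<dots> = p \<otimes> \<pi> \<otimes> e" using wt q cc by simp
    finally have lin: "?q \<otimes> t [^] m \<otimes> h = p \<otimes> \<pi> \<otimes> e" .
    define e' where "e' = \<ominus> (p \<otimes> d \<otimes> d \<otimes> r)"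
    have e': "e' \<in> V" unfolding e'_def using p d r by simp
    have "\<alpha> = (t \<oplus> h) [^] Suc m \<oplus> \<pi> [^] Suc (Suc n) \<otimes> e'"
      unfolding e(2) r(2) lin pS e'_def unfolding h_def using cc(4-9) by algebra
    moreover have "w \<otimes> (t \<oplus> h) = \<one> \<oplus> \<pi> \<otimes> (w \<otimes> p \<otimes> d)"
    proof -
      have "w \<otimes> (t \<oplus> h) = w \<otimes> t \<oplus> \<pi> \<otimes> (w \<otimes> p \<otimes> d)"
        unfolding h_def using cc by algebra
      then show ?thesis using w by simp
    qed
    moreover have th: "t \<oplus> h \<in> V" using t h by simp
    moreover have "\<exists>w'\<in>V. w' \<otimes> (t \<oplus> h) = \<one>"
    proof (rule ccontr)
      assume "\<not> ?thesis"
      then obtain y where y: "y \<in> V" "t \<oplus> h = \<pi> \<otimes> y" using V.Q_unit_or_divisible[OF th] by blast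
      have "(w \<otimes> y \<ominus> w \<otimes> p \<otimes> d) \<otimes> \<pi> =
          w \<otimes> (\<pi> \<otimes> y) \<ominus> \<pi> \<otimes> (w \<otimes> p \<otimes> d)"
        using cc V.Q_carrier[OF y(1)] by algebra
      also have "\<dots> = \<one> \<oplus> \<pi> \<otimes> (w \<otimes> p \<otimes> d) \<ominus> \<pi> \<otimes> (w \<otimes> p \<otimes> d)"
        using \<open>w \<otimes> (t \<oplus> h) = _\<close> y(2) by simp
      also have "\<dots> = \<one>" using cc by algebra
      finally show False using V.\<pi>_nonunit[of "w \<otimes> y \<ominus> w \<otimes> p \<otimes> d"] w y p d by simp
    qed
    ultimately have "P (Suc n) (t \<oplus> h)" unfolding P_def using e' by blast
    moreover have "t \<oplus> h = t \<oplus> \<pi> [^] n \<otimes> (\<pi> \<otimes> d)"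
      unfolding h_def p_def[symmetric] using cc by (simp add: F.m_assoc)
    moreover have "\<pi> \<otimes> d \<in> V" using d by simp
    ultimately show ?thesis by blast
  qed
  obtain f where f: "\<And>n. P n (f n)" "\<And>n. \<exists>d\<in>V. f (Suc n) = f n \<oplus> \<pi> [^] n \<otimes> d"
    using dependent_nat_choice[of P "\<lambda>n t t'. \<exists>d\<in>V. t' = t \<oplus> \<pi> [^] n \<otimes> d"] P0 step by metis
  have fV: "f n \<in> V" for n using f(1)[of n] unfolding P_def by blast
  obtain a where a: "a \<in> V" "\<And>n. \<exists>d\<in>V. a = f n \<oplus> \<pi> [^] n \<otimes> d"
    using V.complete[of f, OF fV f(2)] by blast
  have \<alpha>V: "\<alpha> \<in> V" using s e by simp
  let ?x = "\<alpha> \<ominus> a [^] Suc m"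
  have xV: "?x \<in> V" using \<alpha>V a(1) by simp
  have div: "\<exists>g\<in>V. ?x = \<pi> [^] n \<otimes> g" for n :: nat
  proof -
    obtain e where e: "e \<in> V" "\<alpha> = f n [^] Suc m \<oplus> \<pi> [^] Suc n \<otimes> e" using f(1)[of n] unfolding P_def by blast
    obtain d where d: "d \<in> V" "a = f n \<oplus> \<pi> [^] n \<otimes> d" using a(2) by blast
    define p where "p = \<pi> [^] n"
    have p: "p \<in> V" unfolding p_def by simp
    have h: "p \<otimes> d \<in> V" using p d by simp
    obtain r where r: "r \<in> V" "a [^] Suc m = f n [^] Suc m \<oplus> ?q \<otimes> f n [^] m \<otimes> (p \<otimes> d)
        \<oplus> (p \<otimes> d) \<otimes> (p \<otimes> d) \<otimes> r"
      using F.binomial_first_order[OF V.subring_Q fV[of n] h, of m] unfolding d(2) p_def by blast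
    have qV: "?q \<in> V"
      by (induction m) (auto simp: F.add.nat_pow_Suc)
    let ?g = "\<pi> \<otimes> e \<ominus> ?q \<otimes> f n [^] m \<otimes> d \<ominus> d \<otimes> (p \<otimes> d) \<otimes> r"
    have cc: "f n [^] Suc m \<in> carrier F" "f n [^] m \<in> carrier F" "p \<in> carrier F" "e \<in> carrier F" "d \<in> carrier F"
      "r \<in> carrier F" "\<pi> \<in> carrier F"
      using fV[of n] p e d r by simp_all
    have pS: "\<pi> [^] Suc n = p \<otimes> \<pi>" by (simp add: p_def)
    have "?x = p \<otimes> ?g" unfolding e(2) r(2) pS using cc qc by algebra
    moreover have "?g \<in> V" using fV[of n] p e d r qV by simp
    ultimately show ?thesis unfolding p_def by blast
  qed
  have "?x = \<zero>"
  proof (rule ccontr)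
    assume nz: "?x \<noteq> \<zero>"
    obtain n :: nat and y w where y: "y \<in> V" "w \<in> V" "w \<otimes> y = \<one>"
      and dd: "?x = \<pi> [^] n \<otimes> y \<or> \<pi> [^] n \<otimes> ?x = y"
      using V.decomp[OF V.Q_carrier[OF xV] nz] by blast
    obtain g where g: "g \<in> V" "?x = \<pi> [^] Suc n \<otimes> g" using div by blast
    have pV: "\<pi> [^] n \<in> V" by simp
    have gc: "g \<in> carrier F" "y \<in> carrier F" "w \<in> carrier F" using g y by simp_all
    have "\<exists>t\<in>V. y = \<pi> \<otimes> t"
    proof (cases "?x = \<pi> [^] n \<otimes> y")
      case True
      then have "\<pi> [^] n \<otimes> y = \<pi> [^] n \<otimes> (\<pi> \<otimes> g)" using g gc by (simp add: F.m_assoc)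
      then have "y = \<pi> \<otimes> g" by (rule V.\<pi>_cancel[rotated 2]) (use gc in simp_all)
      then show ?thesis using g by blast
    next
      case False
      then have "y = \<pi> [^] n \<otimes> (\<pi> [^] Suc n \<otimes> g)" using dd g by simp
      also have "\<dots> = \<pi> \<otimes> (\<pi> [^] n \<otimes> (\<pi> [^] n \<otimes> g))"
        using gc V.Q_carrier[OF pV] V.\<pi>_Q(2) unfolding F.nat_pow_Suc by algebra
      finally show ?thesis using V.Q_closed(3)[OF pV V.Q_closed(3)[OF pV g(1)]] by blast
    qed
    then obtain t where t: "t \<in> V" "y = \<pi> \<otimes> t" by blast
    have "(w \<otimes> t) \<otimes> \<pi> = w \<otimes> (\<pi> \<otimes> t)"
      using gc V.Q_carrier[OF t(1)] V.\<pi>_Q(2) by algebra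
    then show False using V.\<pi>_nonunit[of "w \<otimes> t"] y t by simp
  qed
  then have "a [^] Suc m = \<alpha>" using \<alpha>V a(1) F.r_right_minus_eq[of \<alpha> "a [^] Suc m"] by simp
  then show ?thesis using a(1) by auto
qed

section \<open>Symbols with unit entries\<close>

lemma (in ring) diff_eqI:
  assumes "a \<in> carrier R" "b \<in> carrier R" "c \<in> carrier R" "d \<in> carrier R" "a \<oplus> b = c \<oplus> d"
  shows "c \<ominus> a = b \<ominus> d"
proof -
  have "c \<ominus> a = (c \<oplus> d) \<ominus> d \<ominus> a" using assms(1-4) by algebra
  also have "\<dots> = b \<ominus> d" unfolding assms(5)[symmetric] using assms(1-4) by algebra
  finally show ?thesis .
qed

lemma (in ring) Span_iff_combine:
  "x \<in> Span Q Us \<longleftrightarrow> (\<exists>Ks. length Ks = length Us \<and> set Ks \<subseteq> Q \<and> x = combine Ks Us)"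
proof (induction Us arbitrary: x)
  case Nil
  then show ?case by simp
next
  case (Cons u Us)
  have "x \<in> Span Q (u # Us) \<longleftrightarrow> (\<exists>k\<in>Q. \<exists>w\<in>Span Q Us. x = k \<otimes> u \<oplus> w)"
    using line_extension_mem_iff[of x Q u "Span Q Us"] by simp
  also have "\<dots> \<longleftrightarrow> (\<exists>Ks. length Ks = length (u # Us) \<and> set Ks \<subseteq> Q \<and> x = combine Ks (u # Us))"
  proof
    assume "\<exists>k\<in>Q. \<exists>w\<in>Span Q Us. x = k \<otimes> u \<oplus> w"
    then obtain k w where kw: "k \<in> Q" "w \<in> Span Q Us" "x = k \<otimes> u \<oplus> w" by blast
    then obtain Ks where "length Ks = length Us" "set Ks \<subseteq> Q" "w = combine Ks Us"
      using Cons.IH[of w] by auto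
    with kw have "k \<in> Q" "length Ks = length Us" "set Ks \<subseteq> Q" "x = k \<otimes> u \<oplus> combine Ks Us" by simp_all
    then show "\<exists>Ks. length Ks = length (u # Us) \<and> set Ks \<subseteq> Q \<and> x = combine Ks (u # Us)"
      by (intro exI[of _ "k # Ks"]) simp
  next
    assume "\<exists>Ks. length Ks = length (u # Us) \<and> set Ks \<subseteq> Q \<and> x = combine Ks (u # Us)"
    then obtain Ks where Ks: "length Ks = length (u # Us)" "set Ks \<subseteq> Q" "x = combine Ks (u # Us)" by blast
    then obtain k Ks' where "Ks = k # Ks'" by (cases Ks) auto
    then show "\<exists>k\<in>Q. \<exists>w\<in>Span Q Us. x = k \<otimes> u \<oplus> w" using Ks Cons.IH[of "combine Ks' Us"] by auto
  qed
  finally show ?case .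
qed

context symbol_relations
begin

lemma Span_mons:
  assumes Q: "subring Q M" "Q \<subseteq> Z"
  shows "Span Q (map (\<lambda>n. mon (n div q) (n mod q)) [0..<q * q]) = combs Q"
proof
  let ?Us = "map (\<lambda>n. mon (n div q) (n mod q)) [0..<q * q]"
  show "Span Q ?Us \<subseteq> combs Q"
  proof
    fix x assume "x \<in> Span Q ?Us"
    then obtain Ks where Ks: "length Ks = q * q" "set Ks \<subseteq> Q" "x = combine Ks ?Us"
      unfolding Span_iff_combine by auto
    have 1: "(\<lambda>p. Ks ! (fst p * q + snd p)) \<in> idx \<rightarrow> Q"
    proof
      fix p assume "p \<in> idx"
      then have p: "fst p < q" "snd p < q" by (auto simp: idx_def)
      have "fst p * q + snd p < Suc (fst p) * q" using p by simp
      also have "\<dots> \<le> q * q" using p by (intro mult_le_mono1) simp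
      finally show "Ks ! (fst p * q + snd p) \<in> Q" using Ks nth_mem by fastforce
    qed
    have "Ks = map (\<lambda>n. (\<lambda>p. Ks ! (fst p * q + snd p)) (n div q, n mod q)) [0..<q * q]"
      using Ks(1) by (intro nth_equalityI) auto
    then have "x = comb (\<lambda>p. Ks ! (fst p * q + snd p))"
      using comb_upt[of "\<lambda>p. Ks ! (fst p * q + snd p)"] 1 Q(2) Ks(3) by (auto simp: Pi_iff subset_iff)
    then show "x \<in> combs Q" using 1 unfolding combs_def by blast
  qed
  show "combs Q \<subseteq> Span Q ?Us"
  proof
    fix x assume "x \<in> combs Q"
    then obtain c where c: "c \<in> idx \<rightarrow> Q" "x = comb c" unfolding combs_def by blast
    let ?Ks = "map (\<lambda>n. c (n div q, n mod q)) [0..<q * q]"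
    have cZ: "c \<in> idx \<rightarrow> Z" using c(1) Q(2) by blast
    have "set ?Ks \<subseteq> Q" using c(1) q by (auto simp: idx_def less_mult_imp_div_less)
    moreover have "x = combine ?Ks ?Us" using comb_upt[OF cZ] c(2) by simp
    ultimately show "x \<in> Span Q ?Us" unfolding Span_iff_combine by (intro exI[of _ ?Ks]) simp
  qed
qed

lemma comb_cong: "c \<in> idx \<rightarrow> Z \<Longrightarrow> (\<And>p. p \<in> idx \<Longrightarrow> c p = d p) \<Longrightarrow> comb c = comb d"
  unfolding comb_def by (intro finsum_cong') (auto simp: Pi_iff)

lemma comb_linear:
  assumes c: "c \<in> idx \<rightarrow> Z" and d: "d \<in> idx \<rightarrow> Z" and z: "z \<in> Z"
  shows "comb (\<lambda>p. c p \<oplus> z \<otimes> d p) = comb c \<oplus> z \<otimes> comb d"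
proof -
  have cc: "c p \<in> carrier M" "d p \<in> carrier M" if "p \<in> idx" for p
    using funcset_mem[OF c that] funcset_mem[OF d that] by simp_all
  have "comb (\<lambda>p. c p \<oplus> z \<otimes> d p) =
      (\<Oplus>p\<in>idx. c p \<otimes> mon (fst p) (snd p) \<oplus> z \<otimes> (d p \<otimes> mon (fst p) (snd p)))"
    unfolding comb_def using cc z by (intro finsum_cong') (auto simp: l_distr m_assoc)
  also have "\<dots> = comb c \<oplus> (\<Oplus>p\<in>idx. z \<otimes> (d p \<otimes> mon (fst p) (snd p)))"
    unfolding comb_def using cc z by (intro finsum_addf) auto
  also have "(\<Oplus>p\<in>idx. z \<otimes> (d p \<otimes> mon (fst p) (snd p))) = z \<otimes> comb d"
    unfolding comb_def using cc z by (intro finsum_rdistr[symmetric]) auto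
  finally show ?thesis .
qed

lemma comb_eq_multiple:
  assumes c: "c \<in> idx \<rightarrow> Z" and d: "d \<in> idx \<rightarrow> Z" and z: "z \<in> Z" and e: "comb c = z \<otimes> comb d" and p: "p \<in> idx"
  shows "c p = z \<otimes> d p"
proof -
  have "comb (\<lambda>p. c p \<oplus> \<ominus> z \<otimes> d p) = \<zero>"
    using comb_linear[OF c d, of "\<ominus> z"] z c d e by (simp add: l_minus r_neg)
  moreover have "(\<lambda>p. c p \<oplus> \<ominus> z \<otimes> d p) \<in> idx \<rightarrow> Z"
    using funcset_mem[OF c] funcset_mem[OF d] z by (intro funcsetI) simp
  ultimately have "c p \<oplus> \<ominus> z \<otimes> d p = \<zero>" using comb_zero_imp p by blast
  moreover have "c p \<in> carrier M" "d p \<in> carrier M" using funcset_mem[OF c p] funcset_mem[OF d p] by simp_all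
  ultimately show ?thesis using z by (simp add: l_minus r_right_minus_eq minus_eq[symmetric])
qed

text \<open>If \<open>\<alpha> = a\<^sup>q\<close>, then \<open>x = u / a\<close> satisfies \<open>x\<^sup>q =
  1\<close>. Without zero divisors such an \<open>x\<close> is a power of \<open>\<zeta>\<close>, so
  \<open>u\<close> would be central, contrary to \<open>u v = \<zeta> v u\<close>.\<close>
lemma not_power:
  assumes nz: "\<And>x y. x \<in> carrier M \<Longrightarrow> y \<in> carrier M \<Longrightarrow> x \<otimes> y = \<zero> \<Longrightarrow> x = \<zero> \<or> y = \<zero>"
    and q1: "1 < q" and a: "a \<in> Z"
  shows "a [^] q \<noteq> \<alpha>"
proof
  assume aq: "a [^] q = \<alpha>"
  have "a \<noteq> \<zero>" using aq \<alpha>(2) q nat_pow_zero[of q] by auto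
  then obtain b where b: "b \<in> Z" "b \<otimes> a = \<one>" using Z_inverse a by blast
  define x where "x = b \<otimes> u"
  have x: "x \<in> carrier M" using b by (simp add: x_def)
  have xq: "x [^] q = \<one>"
  proof -
    have "x [^] q = b [^] q \<otimes> \<alpha>"
      unfolding x_def using pow_mult_distrib[of b u q] central[OF b(1), of u] b upow by simp
    also have "\<dots> = (b \<otimes> a) [^] q"
      unfolding aq[symmetric]
      by (rule pow_mult_distrib[symmetric]) (use central[OF a, of b] a b(1) in simp_all)
    finally show ?thesis using b by simp
  qed
  \<comment> \<open>The polynomial \<open>1 + X + ... + X\<^bsup>q - 1\<^esup>\<close> is evaluated at
    \<open>\<zeta>\<^sup>m x\<close>. The values add up to \<open>q\<close>, so one of them is nonzero, and it is
    annihilated by \<open>1 - \<zeta>\<^sup>m x\<close>.\<close>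
  define S where "S m = (\<Oplus>k\<in>{..<q}. (\<zeta> [^] (m::nat) \<otimes> x) [^] k)" for m
  have zx: "(\<zeta> [^] m \<otimes> x) [^] k = (\<zeta> [^] k) [^] m \<otimes> x [^] k" for m k :: nat
    using pow_mult_distrib[of "\<zeta> [^] m" x k] central[of "\<zeta> [^] m" x] x \<zeta>
    by (simp add: nat_pow_pow mult.commute)
  have Sc: "S m \<in> carrier M" for m unfolding S_def using x by (intro finsum_closed) auto
  have "(\<Oplus>m\<in>{..<q}. S m) = (\<Oplus>k\<in>{..<q}. \<Oplus>m\<in>{..<q}. (\<zeta> [^] k) [^] m \<otimes> x [^] k)"
    unfolding S_def zx using x by (intro finsum_swap) auto
  also have "\<dots> = (\<Oplus>k\<in>{..<q}. if k = 0 then [q] \<cdot> \<one> else \<zero>)"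
  proof (intro finsum_cong' refl)
    fix k assume k: "k \<in> {..<q}"
    have "(\<Oplus>m\<in>{..<q}. (\<zeta> [^] k) [^] m \<otimes> x [^] k) = (\<Oplus>m\<in>{..<q}. (\<zeta> [^] k) [^] m) \<otimes> x [^] k"
      using x by (intro finsum_ldistr[symmetric]) auto
    also have "\<dots> = (if k = 0 then [q] \<cdot> \<one> else \<zero>)"
      unfolding sum_pow_\<zeta> using k x dvd_imp_le[of q k] by auto
    finally show "(\<Oplus>m\<in>{..<q}. (\<zeta> [^] k) [^] m \<otimes> x [^] k) = (if k = 0 then [q] \<cdot> \<one> else \<zero>)" .
  qed auto
  also have "\<dots> = [q] \<cdot> \<one>" using q by (subst finsum_delta) auto
  finally have total: "(\<Oplus>m\<in>{..<q}. S m) \<noteq> \<zero>" using q_nonzero by simp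
  have "\<exists>m. S m \<noteq> \<zero>"
  proof (rule ccontr)
    assume "\<not> ?thesis"
    then have "(\<Oplus>m\<in>{..<q}. S m) = (\<Oplus>m\<in>{..<q}. \<zero>)" by simp
    then show False using total by simp
  qed
  then obtain m where m: "S m \<noteq> \<zero>" by blast
  define z where "z = \<zeta> [^] m \<otimes> x"
  have z: "z \<in> carrier M" using x by (simp add: z_def)
  have zq: "z [^] q = \<one>" unfolding z_def zx using xq \<zeta>q x by simp
  have "z \<otimes> S m \<oplus> \<one> = S m \<oplus> \<one>"
    using geometric_sum[OF z, of q] zq unfolding S_def z_def[symmetric] by simp
  then have "z \<otimes> S m = S m" using z Sc[of m] by (simp add: add.r_cancel)
  then have "(z \<ominus> \<one>) \<otimes> S m = \<zero>" using z Sc[of m] by (simp add: minus_eq l_distr l_minus r_neg)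
  then have "z = \<one>" using nz[of "z \<ominus> \<one>" "S m"] m z Sc[of m] by simp
  then have "(\<zeta> [^] m \<otimes> b) \<otimes> u = \<one>" using b by (simp add: z_def x_def m_assoc)
  moreover have tZ: "\<zeta> [^] m \<otimes> b \<in> Z" using b \<zeta> by simp
  moreover have "\<zeta> [^] m \<otimes> b \<noteq> \<zero>"
  proof
    assume "\<zeta> [^] m \<otimes> b = \<zero>"
    then show False using calculation(1) one_nonzero by simp
  qed
  then obtain t where t: "t \<in> Z" "t \<otimes> (\<zeta> [^] m \<otimes> b) = \<one>" using Z_inverse[OF tZ] by blast
  have "t \<otimes> ((\<zeta> [^] m \<otimes> b) \<otimes> u) = (t \<otimes> (\<zeta> [^] m \<otimes> b)) \<otimes> u"
    by (rule m_assoc[symmetric]) (use t tZ in auto)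
  then have "u = t" using t calculation(1) by simp
  then have "v \<otimes> u = u \<otimes> v" using central[of u v] t by simp
  then have "(\<zeta> \<ominus> \<one>) \<otimes> (v \<otimes> u) = \<zero>" using uv by (simp add: minus_eq l_distr l_minus r_neg)
  moreover have "\<zeta> \<ominus> \<one> \<noteq> \<zero>" using prim[of 1] q1 by simp
  ultimately have "v \<otimes> u = \<zero>" using nz[of "\<zeta> \<ominus> \<one>" "v \<otimes> u"] by simp
  then have "v = \<zero> \<or> u = \<zero>" using nz[of v u] by simp
  then show False using upow vpow \<alpha>(2) \<beta>(2) q nat_pow_zero[of q] by auto
qed

end

context division_over_dvr
begin

lemma divisibility_bounded:
  assumes x: "x \<in> Z" "x \<noteq> \<zero>"
  shows "\<exists>n::nat. \<forall>k. \<forall>d\<in>Q. x = \<pi> [^] k \<otimes> d \<longrightarrow> k \<le> n"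
proof -
  obtain n :: nat and y w where y: "y \<in> Q" "w \<in> Q" "w \<otimes> y = \<one>" and dd: "x = \<pi> [^] n \<otimes> y \<or> \<pi> [^] n \<otimes> x = y"
    using decomp[OF x] by blast
  have ndiv: "y \<noteq> \<pi> \<otimes> t" if "t \<in> Q" for t
  proof
    assume yt: "y = \<pi> \<otimes> t"
    have "\<pi> \<otimes> t = t \<otimes> \<pi>" using central[OF Q_Z[OF that], of \<pi>] by simp
    then have "(w \<otimes> t) \<otimes> \<pi> = \<one>" using y yt that by (simp add: m_assoc)
    then show False using \<pi>_nonunit[of "w \<otimes> t"] y that by simp
  qed
  have "k \<le> n" if d: "d \<in> Q" "x = \<pi> [^] k \<otimes> d" for k d
  proof (rule ccontr)
    assume "\<not> k \<le> n"
    then obtain j where j: "k = n + Suc j" using less_imp_Suc_add[of n k] by auto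
    have pj: "\<pi> [^] j \<otimes> d \<in> Q" using d by simp
    have sj: "\<pi> [^] Suc j = \<pi> \<otimes> \<pi> [^] j" by (rule nat_pow_Suc2) simp
    have e: "\<pi> [^] k \<otimes> d = \<pi> [^] n \<otimes> (\<pi> \<otimes> (\<pi> [^] j \<otimes> d))"
    proof -
      have "\<pi> [^] k = \<pi> [^] n \<otimes> \<pi> [^] Suc j" unfolding j by (rule nat_pow_mult[symmetric]) simp
      then show ?thesis unfolding sj using d by (simp add: m_assoc)
    qed
    from dd show False
    proof
      assume "x = \<pi> [^] n \<otimes> y"
      then have "\<pi> [^] n \<otimes> y = \<pi> [^] n \<otimes> (\<pi> \<otimes> (\<pi> [^] j \<otimes> d))" using d(2) e by simp
      then have "y = \<pi> \<otimes> (\<pi> [^] j \<otimes> d)" by (rule \<pi>_cancel[rotated 2]) (use y d in simp_all)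
      then show False using ndiv[OF pj] by blast
    next
      assume "\<pi> [^] n \<otimes> x = y"
      then have "y = \<pi> [^] n \<otimes> (\<pi> [^] k \<otimes> d)" using d(2) by simp
      moreover have "\<pi> [^] k = \<pi> \<otimes> \<pi> [^] (n + j)" using nat_pow_Suc2[of \<pi> "n + j"] by (simp add: j)
      ultimately have "y = \<pi> [^] n \<otimes> (\<pi> \<otimes> (\<pi> [^] (n + j) \<otimes> d))" using d by (simp add: m_assoc)
      also have "\<dots> = (\<pi> [^] n \<otimes> \<pi>) \<otimes> (\<pi> [^] (n + j) \<otimes> d)" using d by (simp add: m_assoc)
      also have "\<pi> [^] n \<otimes> \<pi> = \<pi> \<otimes> \<pi> [^] n" using nat_pow_Suc2[of \<pi> n] by simp
      finally have "y = \<pi> \<otimes> (\<pi> [^] n \<otimes> (\<pi> [^] (n + j) \<otimes> d))" using d by (simp add: m_assoc)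
      moreover have "\<pi> [^] n \<otimes> (\<pi> [^] (n + j) \<otimes> d) \<in> Q" using d by simp
      ultimately show False using ndiv by blast
    qed
  qed
  then show ?thesis by blast
qed

text \<open>Clear denominators, then divide by the highest power of \<open>\<pi>\<close> that divides all
  members; the bound on such powers comes from a nonzero member.\<close>
lemma scale_family:
  assumes A: "finite A" and c: "\<And>i. i \<in> A \<Longrightarrow> c i \<in> Z" and a0: "a0 \<in> A" "c a0 \<noteq> \<zero>"
  shows "\<exists>(n::nat) (k::nat) d. (\<forall>i\<in>A. d i \<in> Q \<and> \<pi> [^] n \<otimes> c i = \<pi> [^] k \<otimes> d i) \<and> (\<exists>i\<in>A. \<exists>w\<in>Q. w \<otimes> d i = \<one>)"
proof -
  have "\<exists>n::nat. \<pi> [^] n \<otimes> c i \<in> Q" if i: "i \<in> A" for i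
  proof (cases "c i = \<zero>")
    case True
    then show ?thesis by simp
  next
    case False
    obtain n :: nat and y where y: "y \<in> Q" "c i = \<pi> [^] n \<otimes> y \<or> \<pi> [^] n \<otimes> c i = y"
      using decomp[OF c[OF i] False] by blast
    from y(2) show ?thesis
    proof
      assume "c i = \<pi> [^] n \<otimes> y"
      then have "\<pi> [^] (0::nat) \<otimes> c i \<in> Q" using y(1) by simp
      then show ?thesis by blast
    qed (use y in blast)
  qed
  then obtain m :: "_ \<Rightarrow> nat" where m: "\<And>i. i \<in> A \<Longrightarrow> \<pi> [^] m i \<otimes> c i \<in> Q" by metis
  define n where "n = sum m A"
  define e where "e i = \<pi> [^] n \<otimes> c i" for i
  have eQ: "e i \<in> Q" if i: "i \<in> A" for i
  proof -
    have "m i \<le> n" unfolding n_def using i A by (simp add: member_le_sum)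
    then have "\<pi> [^] n = \<pi> [^] (n - m i) \<otimes> \<pi> [^] m i" using nat_pow_mult[of \<pi> "n - m i" "m i"] by simp
    then have "e i = \<pi> [^] (n - m i) \<otimes> (\<pi> [^] m i \<otimes> c i)" unfolding e_def using c[OF i] by (simp add: m_assoc)
    then show ?thesis using m[OF i] by simp
  qed
  define T where "T = {k::nat. \<forall>i\<in>A. \<exists>d\<in>Q. e i = \<pi> [^] k \<otimes> d}"
  have "0 \<in> T" unfolding T_def using eQ by auto
  have "e a0 \<noteq> \<zero>"
  proof
    assume "e a0 = \<zero>"
    then have "\<pi> [^] n \<otimes> c a0 = \<pi> [^] n \<otimes> \<zero>" unfolding e_def by simp
    then have "c a0 = \<zero>" by (rule \<pi>_cancel[rotated 2]) (use c a0 in auto)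
    then show False using a0 by simp
  qed
  then obtain b where b: "\<And>k d. d \<in> Q \<Longrightarrow> e a0 = \<pi> [^] (k::nat) \<otimes> d \<Longrightarrow> k \<le> b"
    using divisibility_bounded[OF Q_Z[OF eQ[OF a0(1)]]] by blast
  have Tb: "T \<subseteq> {..b}" unfolding T_def using b a0(1) by blast
  then have fT: "finite T" by (rule finite_subset) simp
  define k where "k = Max T"
  have kT: "k \<in> T" unfolding k_def using fT \<open>0 \<in> T\<close> by (intro Max_in) auto
  have "Suc k \<notin> T" using Max_ge[OF fT, of "Suc k"] by (auto simp: k_def)
  then obtain i0 where i0: "i0 \<in> A" "\<And>d. d \<in> Q \<Longrightarrow> e i0 \<noteq> \<pi> [^] Suc k \<otimes> d" unfolding T_def by blast
  have "\<forall>i. \<exists>d. i \<in> A \<longrightarrow> d \<in> Q \<and> e i = \<pi> [^] k \<otimes> d" using kT unfolding T_def by blast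
  then obtain d where d: "\<And>i. i \<in> A \<Longrightarrow> d i \<in> Q \<and> e i = \<pi> [^] k \<otimes> d i" by metis
  have "\<exists>w\<in>Q. w \<otimes> d i0 = \<one>"
  proof (rule ccontr)
    assume "\<not> ?thesis"
    then obtain y where y: "y \<in> Q" "d i0 = \<pi> \<otimes> y" using Q_unit_or_divisible[of "d i0"] d i0 by blast
    then have "e i0 = \<pi> [^] Suc k \<otimes> y" using d[OF i0(1)] by (simp add: m_assoc)
    then show False using i0(2) y by blast
  qed
  then show ?thesis using d i0(1) unfolding e_def by blast
qed

end

text \<open>A division algebra over a complete field that is a symbol with unit entries and of degree prime to
  the residue characteristic.\<close>
locale symbol_over_dvr = symbol_relations M Z u v \<zeta> \<alpha> \<beta> q + division_over_dvr M Z Q \<pi>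
  for M (structure) and Z u v \<zeta> \<alpha> \<beta> q Q \<pi> +
  assumes spans: "carrier M = combs Z"
    and \<zeta>_Q: "\<zeta> \<in> Q" and \<alpha>_unit: "\<alpha> \<in> Q" "\<exists>a\<in>Q. a \<otimes> \<alpha> = \<one>" and \<beta>_unit: "\<beta> \<in> Q" "\<exists>b\<in>Q. b \<otimes> \<beta> = \<one>"
    and q_unit: "\<exists>c\<in>Q. c \<otimes> [q] \<cdot> \<one> = \<one>"
begin

abbreviation "\<Lambda> \<equiv> combs Q"

lemma \<Lambda>_subring: "subring \<Lambda> M"
  by (rule combs_subring[OF subring_Q Q_sub_Z \<zeta>_Q \<alpha>_unit(1) \<beta>_unit(1)])

lemma Q_sub_\<Lambda>: "Q \<subseteq> \<Lambda>" using combs_scalar[OF subring_Q Q_sub_Z] by blast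

sublocale order_over_dvr M Z Q \<pi> \<Lambda>
  by (rule order_over_dvr.intro[OF division_over_dvr_axioms order_over_dvr_axioms.intro[OF \<Lambda>_subring Q_sub_\<Lambda>]])

lemma Pi_Q_Z: "c \<in> A \<rightarrow> Q \<Longrightarrow> c \<in> A \<rightarrow> Z" using Q_sub_Z by blast

lemma \<pi>_pow_Z [simp]: "\<pi> [^] (n::nat) \<in> Z" using Q_Z Q_pow by simp

subsection \<open>Completeness of the order\<close>

text \<open>Completeness is inherited coefficient by coefficient.\<close>
lemma \<Lambda>_complete:
  fixes f :: "nat \<Rightarrow> 'a"
  assumes f0: "f 0 \<in> \<Lambda>" and f: "\<And>n. \<exists>d\<in>\<Lambda>. f (Suc n) = f n \<oplus> \<pi> [^] n \<otimes> d"
  shows "\<exists>a\<in>\<Lambda>. \<forall>n. \<exists>d\<in>\<Lambda>. a = f n \<oplus> \<pi> [^] n \<otimes> d"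
proof -
  have "\<forall>n. \<exists>e. e \<in> idx \<rightarrow> Q \<and> f (Suc n) = f n \<oplus> \<pi> [^] n \<otimes> comb e" using f unfolding combs_def by blast
  then obtain e where e: "\<And>n. e n \<in> idx \<rightarrow> Q" "\<And>n. f (Suc n) = f n \<oplus> \<pi> [^] n \<otimes> comb (e n)" by metis
  obtain c0 where c0: "c0 \<in> idx \<rightarrow> Q" "f 0 = comb c0" using f0 unfolding combs_def by blast
  define c where "c = rec_nat c0 (\<lambda>n c p. c p \<oplus> \<pi> [^] n \<otimes> e n p)"
  have c_0: "c 0 = c0" and c_Suc: "c (Suc n) = (\<lambda>p. c n p \<oplus> \<pi> [^] n \<otimes> e n p)" for n by (simp_all add: c_def)
  have cf: "c n \<in> idx \<rightarrow> Q \<and> f n = comb (c n)" for n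
  proof (induction n)
    case 0
    then show ?case using c0 c_0 by simp
  next
    case (Suc n)
    then have cQ: "c n \<in> idx \<rightarrow> Q" by blast
    have "c (Suc n) \<in> idx \<rightarrow> Q"
      unfolding c_Suc using funcset_mem[OF cQ] funcset_mem[OF e(1)] by (auto intro!: Q_closed)
    moreover have "f (Suc n) = comb (c (Suc n))"
      unfolding e(2)[of n] c_Suc using Suc comb_linear[OF Pi_Q_Z[OF cQ] Pi_Q_Z[OF e(1)], of "\<pi> [^] n" n] by simp
    ultimately show ?case by blast
  qed
  have "\<exists>a. a \<in> Q \<and> (\<forall>n. \<exists>d\<in>Q. a = c n p \<oplus> \<pi> [^] n \<otimes> d)" if p: "p \<in> idx" for p
  proof -
    have 1: "c n p \<in> Q" for n using cf[of n] p by (simp add: Pi_iff)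
    have "\<exists>d\<in>Q. c (Suc n) p = c n p \<oplus> \<pi> [^] n \<otimes> d" for n
      unfolding c_Suc using funcset_mem[OF e(1) p] by blast
    then show ?thesis using complete[of "\<lambda>n. c n p", OF 1] by blast
  qed
  then have "\<forall>p. \<exists>a. p \<in> idx \<longrightarrow> a \<in> Q \<and> (\<forall>n. \<exists>d\<in>Q. a = c n p \<oplus> \<pi> [^] n \<otimes> d)" by blast
  then obtain a where a: "\<And>p. p \<in> idx \<Longrightarrow> a p \<in> Q" "\<And>p n. p \<in> idx \<Longrightarrow> \<exists>d\<in>Q. a p = c n p \<oplus> \<pi> [^] n \<otimes> d" by metis
  have aQ: "a \<in> idx \<rightarrow> Q" using a(1) by blast
  have "\<exists>d\<in>\<Lambda>. comb a = f n \<oplus> \<pi> [^] n \<otimes> d" for n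
  proof -
    have "\<forall>p. \<exists>d. p \<in> idx \<longrightarrow> d \<in> Q \<and> a p = c n p \<oplus> \<pi> [^] n \<otimes> d" using a(2) by blast
    then obtain t where t: "\<And>p. p \<in> idx \<Longrightarrow> t p \<in> Q \<and> a p = c n p \<oplus> \<pi> [^] n \<otimes> t p" by metis
    have tQ: "t \<in> idx \<rightarrow> Q" using t by blast
    have "comb a = comb (\<lambda>p. c n p \<oplus> \<pi> [^] n \<otimes> t p)" by (rule comb_cong[OF Pi_Q_Z[OF aQ]]) (use t in blast)
    also have "\<dots> = f n \<oplus> \<pi> [^] n \<otimes> comb t"
      using comb_linear[OF Pi_Q_Z Pi_Q_Z[OF tQ], of "c n" "\<pi> [^] n"] cf[of n] by simp
    finally show ?thesis using tQ unfolding combs_def by blast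
  qed
  then show ?thesis using aQ unfolding combs_def by blast
qed

text \<open>No nonzero coefficient is divisible by every power of the uniformizer.\<close>
lemma \<Lambda>_separated:
  assumes x: "x \<in> carrier M" and div: "\<And>n::nat. \<exists>d\<in>\<Lambda>. x = \<pi> [^] n \<otimes> d"
  shows "x = \<zero>"
proof (rule ccontr)
  assume nz: "x \<noteq> \<zero>"
  obtain c where c: "c \<in> idx \<rightarrow> Z" "x = comb c" using x spans unfolding combs_def by blast
  have "\<exists>p\<in>idx. c p \<noteq> \<zero>"
  proof (rule ccontr)
    assume "\<not> ?thesis"
    then have "comb c = (\<Oplus>p\<in>idx. \<zero>)" unfolding comb_def by (intro finsum_cong') auto
    then show False using nz c by simp
  qed
  then obtain p where p: "p \<in> idx" "c p \<noteq> \<zero>" by blast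
  obtain n where n: "\<And>k d. d \<in> Q \<Longrightarrow> c p = \<pi> [^] (k::nat) \<otimes> d \<Longrightarrow> k \<le> n"
    using divisibility_bounded[OF funcset_mem[OF c(1) p(1)] p(2)] by blast
  obtain d where d: "d \<in> idx \<rightarrow> Q" "x = \<pi> [^] Suc n \<otimes> comb d" using div[of "Suc n"] unfolding combs_def by blast
  have "c p = \<pi> [^] Suc n \<otimes> d p"
    by (rule comb_eq_multiple[OF c(1) Pi_Q_Z[OF d(1)] \<pi>_pow_Z _ p(1)]) (use c d in simp)
  then show False using n[of "d p" "Suc n"] funcset_mem[OF d(1) p(1)] by simp
qed

lemma geometric_inverse: "z \<in> carrier M \<Longrightarrow> (\<one> \<ominus> z) \<otimes> (\<Oplus>k\<in>{..<n::nat}. z [^] k) = \<one> \<ominus> z [^] n"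
proof -
  assume z: "z \<in> carrier M"
  let ?S = "\<Oplus>k\<in>{..<n}. z [^] k"
  have S: "?S \<in> carrier M" using z by (intro finsum_closed) auto
  have "?S \<ominus> z \<otimes> ?S = \<one> \<ominus> z [^] n" by (rule diff_eqI[OF _ _ _ _ geometric_sum[OF z]]) (use z S in auto)
  then show ?thesis using z S by (simp add: minus_eq l_distr l_minus)
qed

lemma sum_pow_\<Lambda>: "z \<in> \<Lambda> \<Longrightarrow> (\<Oplus>k\<in>{..<n::nat}. z [^] k) \<in> \<Lambda>"
proof (induction n)
  case 0
  then show ?case using L_closed(1) by simp
next
  case (Suc n)
  have zn: "z [^] k \<in> \<Lambda>" for k :: nat using L_pow Suc by blast
  have "(\<Oplus>k\<in>{..<Suc n}. z [^] k) = z [^] n \<oplus> (\<Oplus>k\<in>{..<n}. z [^] k)"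
    unfolding lessThan_Suc using zn L_carrier by (intro finsum_insert) auto
  then show ?case using L_closed(4)[OF zn] Suc by simp
qed

lemma P_iff: "x \<in> P \<longleftrightarrow> (\<exists>l\<in>\<Lambda>. x = \<pi> \<otimes> l)" unfolding P_def by blast

text \<open>The geometric series converges.\<close>
lemma one_minus_unit:
  assumes "p \<in> P"
  shows "\<exists>w\<in>\<Lambda>. w \<otimes> (\<one> \<ominus> p) = \<one>"
proof -
  obtain l where l: "l \<in> \<Lambda>" "p = \<pi> \<otimes> l" using assms unfolding P_iff by blast
  have lc: "l \<in> carrier M" using L_carrier[OF l(1)] .
  have p: "p \<in> carrier M" unfolding l(2) using lc by simp
  have pn: "p [^] n = \<pi> [^] n \<otimes> l [^] n" for n :: nat
    unfolding l(2) using pow_mult_distrib[of \<pi> l n] central[OF Q_Z[OF \<pi>(1)] lc] lc by simp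
  define f where "f n = (\<Oplus>k\<in>{..<n}. p [^] k)" for n :: nat
  have f_Suc: "f (Suc n) = f n \<oplus> \<pi> [^] n \<otimes> l [^] n" for n
  proof -
    have "f (Suc n) = p [^] n \<oplus> f n" unfolding f_def lessThan_Suc using p by (intro finsum_insert) auto
    moreover have "f n \<in> carrier M" unfolding f_def using p by (intro finsum_closed) auto
    ultimately show ?thesis using p lc pn by (simp add: a_comm)
  qed
  have "f 0 \<in> \<Lambda>" using L_closed(1) by (simp add: f_def)
  moreover have "\<exists>d\<in>\<Lambda>. f (Suc n) = f n \<oplus> \<pi> [^] n \<otimes> d" for n using f_Suc L_pow[OF l(1)] by blast
  ultimately obtain a where a: "a \<in> \<Lambda>" "\<And>n. \<exists>d\<in>\<Lambda>. a = f n \<oplus> \<pi> [^] n \<otimes> d" using \<Lambda>_complete[of f] by blast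
  have ac: "a \<in> carrier M" using L_carrier[OF a(1)] .
  have rearrange: "\<one> \<ominus> x \<otimes> y \<oplus> x \<otimes> z \<ominus> \<one> = x \<otimes> (\<ominus> y \<oplus> z)"
    if "x \<in> carrier M" "y \<in> carrier M" "z \<in> carrier M" for x y z
    using that by algebra
  have "(\<one> \<ominus> p) \<otimes> a \<ominus> \<one> = \<zero>"
  proof (rule \<Lambda>_separated)
    show "(\<one> \<ominus> p) \<otimes> a \<ominus> \<one> \<in> carrier M" using p ac by simp
    fix n :: nat
    obtain d where d: "d \<in> \<Lambda>" "a = f n \<oplus> \<pi> [^] n \<otimes> d" using a(2) by blast
    have dc: "d \<in> carrier M" using L_carrier[OF d(1)] .
    have fc: "f n \<in> carrier M" unfolding f_def using p by (intro finsum_closed) auto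
    have lp: "\<one> \<ominus> p \<in> \<Lambda>" unfolding minus_eq using P_sub assms by (intro L_closed) auto
    have "(\<one> \<ominus> p) \<otimes> a = (\<one> \<ominus> p) \<otimes> f n \<oplus> (\<one> \<ominus> p) \<otimes> (\<pi> [^] n \<otimes> d)"
      unfolding d(2) using p fc dc by (intro r_distr) auto
    also have "(\<one> \<ominus> p) \<otimes> f n = \<one> \<ominus> \<pi> [^] n \<otimes> l [^] n" unfolding f_def geometric_inverse[OF p] pn ..
    also have "(\<one> \<ominus> p) \<otimes> (\<pi> [^] n \<otimes> d) = \<pi> [^] n \<otimes> ((\<one> \<ominus> p) \<otimes> d)" using p dc by (intro left_comm) auto
    finally have "(\<one> \<ominus> p) \<otimes> a = \<one> \<ominus> \<pi> [^] n \<otimes> l [^] n \<oplus> \<pi> [^] n \<otimes> ((\<one> \<ominus> p) \<otimes> d)" .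
    then have "(\<one> \<ominus> p) \<otimes> a \<ominus> \<one> = \<pi> [^] n \<otimes> (\<ominus> (l [^] n) \<oplus> (\<one> \<ominus> p) \<otimes> d)"
      using rearrange[of "\<pi> [^] n" "l [^] n" "(\<one> \<ominus> p) \<otimes> d"] p dc lc by simp
    moreover have "\<ominus> (l [^] n) \<oplus> (\<one> \<ominus> p) \<otimes> d \<in> \<Lambda>"
      by (intro L_closed(3,4,5) L_pow l(1) lp d(1))
    ultimately show "\<exists>d\<in>\<Lambda>. (\<one> \<ominus> p) \<otimes> a \<ominus> \<one> = \<pi> [^] n \<otimes> d" by blast
  qed
  then have "(\<one> \<ominus> p) \<otimes> a = \<one>" using p ac by simp
  then have "a \<otimes> (\<one> \<ominus> p) = \<one>" using inverse_comm p ac by simp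
  then show ?thesis using a(1) by blast
qed

subsection \<open>The order is a local ring\<close>

text \<open>The map \<open>x \<mapsto> 3 x\<^sup>2 - 2 x\<^sup>3\<close> squares the defect \<open>t = x (1 -
  x)\<close> up to the factor \<open>3 + 4 t\<close>, so iterating it converges to an idempotent congruent to
  \<open>e\<close>. A ring without zero divisors has no idempotents but \<open>0\<close> and
  \<open>1\<close>.\<close>
lemma idempotent_lift:
  assumes e: "e \<in> \<Lambda>" "e \<otimes> (\<one> \<ominus> e) \<in> P"
  shows "e \<in> P \<or> \<one> \<ominus> e \<in> P"
proof -
  define I where "I n x \<longleftrightarrow> x \<in> \<Lambda> \<and> (\<exists>l\<in>\<Lambda>. x \<otimes> (\<one> \<ominus> x) = \<pi> [^] Suc n \<otimes> l)" for n :: nat and x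
  have I0: "I 0 e" unfolding I_def using e unfolding P_iff by simp
  have step: "\<exists>y. I (Suc n) y \<and> (\<exists>d\<in>\<Lambda>. y = x \<oplus> \<pi> [^] Suc n \<otimes> d)" if x: "I n x" for n x
  proof -
    obtain l where l: "x \<in> \<Lambda>" "l \<in> \<Lambda>" "x \<otimes> (\<one> \<ominus> x) = \<pi> [^] Suc n \<otimes> l" using x unfolding I_def by blast
    have xc: "x \<in> carrier M" "l \<in> carrier M" using l L_carrier by auto
    define t where "t = x \<otimes> (\<one> \<ominus> x)"
    define y where "y = x \<oplus> t \<otimes> (x \<oplus> x \<ominus> \<one>)"
    have yx: "y \<otimes> (\<one> \<ominus> y) = t \<otimes> t \<otimes> (\<one> \<oplus> \<one> \<oplus> \<one> \<oplus> t \<oplus> t \<oplus> t \<oplus> t)"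
    proof -
      define s where "s = x \<oplus> x \<ominus> \<one>"
      define r where "r = t \<otimes> s"
      have c: "t \<in> carrier M" "s \<in> carrier M" "r \<in> carrier M" unfolding t_def s_def r_def using xc(1) by simp_all
      have one_minus: "z \<otimes> (\<one> \<ominus> z) = z \<ominus> z \<otimes> z" if "z \<in> carrier M" for z
        using that by (simp add: minus_eq r_distr r_minus)
      have t: "t = x \<ominus> x \<otimes> x" unfolding t_def by (rule one_minus[OF xc(1)])
      have xt: "x \<otimes> t = t \<otimes> x" unfolding t using xc(1) by algebra
      have xs: "x \<otimes> s = s \<otimes> x" unfolding s_def using xc(1) by (simp add: minus_eq l_distr r_distr l_minus r_minus)
      have st: "s \<otimes> t = t \<otimes> s"
        unfolding s_def using xt xc(1) c by (simp add: minus_eq l_distr r_distr l_minus r_minus)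
      have "s \<otimes> s = (x \<otimes> s \<oplus> x \<otimes> s) \<ominus> s"
        using xc(1) c by (subst (1) s_def) (simp add: minus_eq l_distr l_minus)
      also have "x \<otimes> s = x \<otimes> x \<oplus> x \<otimes> x \<ominus> x" unfolding s_def using xc(1) by (simp add: minus_eq r_distr r_minus)
      finally have ss: "s \<otimes> s = \<one> \<ominus> (t \<oplus> t \<oplus> t \<oplus> t)" unfolding s_def t using xc(1) by algebra
      have xr: "x \<otimes> r = r \<otimes> x"
        unfolding r_def using xc(1) c m_assoc[of x t s] m_assoc[of t x s] m_assoc[of t s x] xt xs by simp
      have sr: "s \<otimes> r = t \<otimes> (s \<otimes> s)"
        unfolding r_def using c m_assoc[of s t s] m_assoc[of t s s] st by simp
      have rr: "r \<otimes> r = t \<otimes> (t \<otimes> (s \<otimes> s))"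
        using c sr m_assoc[of t s r] unfolding r_def by simp
      have "y \<otimes> (\<one> \<ominus> y) = y \<ominus> y \<otimes> y" by (rule one_minus) (simp add: y_def s_def[symmetric] xc(1) c)
      also have "\<dots> = (x \<ominus> x \<otimes> x) \<oplus> (r \<ominus> x \<otimes> r \<ominus> r \<otimes> x) \<ominus> r \<otimes> r"
        unfolding y_def s_def[symmetric] r_def[symmetric] using xc(1) c by algebra
      also have "r \<ominus> x \<otimes> r \<ominus> r \<otimes> x = \<ominus> (s \<otimes> r)"
        unfolding xr[symmetric] s_def using xc(1) c
        by (simp add: minus_eq l_distr l_minus minus_add a_ac)
      also have "(x \<ominus> x \<otimes> x) \<oplus> \<ominus> (s \<otimes> r) \<ominus> r \<otimes> r = t \<ominus> t \<otimes> (s \<otimes> s) \<ominus> t \<otimes> (t \<otimes> (s \<otimes> s))"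
        unfolding t[symmetric] sr rr by (simp add: minus_eq)
      also have "t \<otimes> (s \<otimes> s) = t \<ominus> (t \<otimes> t \<oplus> t \<otimes> t \<oplus> t \<otimes> t \<oplus> t \<otimes> t)"
        unfolding ss using c by (simp add: minus_eq r_distr r_minus)
      finally have "y \<otimes> (\<one> \<ominus> y) = t \<ominus> (t \<ominus> (t \<otimes> t \<oplus> t \<otimes> t \<oplus> t \<otimes> t \<oplus> t \<otimes> t)) \<ominus>
          t \<otimes> (t \<ominus> (t \<otimes> t \<oplus> t \<otimes> t \<oplus> t \<otimes> t \<oplus> t \<otimes> t))" .
      moreover have "t \<otimes> t \<otimes> (\<one> \<oplus> \<one> \<oplus> \<one> \<oplus> t \<oplus> t \<oplus> t \<oplus> t) =
          t \<otimes> t \<oplus> t \<otimes> t \<oplus> t \<otimes> t \<oplus> t \<otimes> t \<otimes> t \<oplus> t \<otimes> t \<otimes> t \<oplus> t \<otimes> t \<otimes> t \<oplus> t \<otimes> t \<otimes> t"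
        using c by (simp add: r_distr)
      moreover have "t \<ominus> (t \<ominus> (t \<otimes> t \<oplus> t \<otimes> t \<oplus> t \<otimes> t \<oplus> t \<otimes> t)) \<ominus>
          t \<otimes> (t \<ominus> (t \<otimes> t \<oplus> t \<otimes> t \<oplus> t \<otimes> t \<oplus> t \<otimes> t)) =
          t \<otimes> t \<oplus> t \<otimes> t \<oplus> t \<otimes> t \<oplus> t \<otimes> t \<otimes> t \<oplus> t \<otimes> t \<otimes> t \<oplus> t \<otimes> t \<otimes> t \<oplus> t \<otimes> t \<otimes> t"
        using c by algebra
      ultimately show ?thesis by simp
    qed
    define p where "p = \<pi> [^] Suc n"
    have p: "p \<in> Z" "p \<in> carrier M" unfolding p_def using \<pi>_pow_Z[of "Suc n"] Z_carrier[OF \<pi>_pow_Z[of "Suc n"]] by blast+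
    have tp: "t = p \<otimes> l" using l(3) by (simp add: t_def p_def)
    have tL: "t \<in> \<Lambda>" unfolding tp p_def using l(2) Q_sub_L by (intro L_closed(3)) auto
    have "t \<otimes> t = p \<otimes> (p \<otimes> (l \<otimes> l))"
      unfolding tp using p xc left_comm[OF p(1), of l l] by (simp add: m_assoc)
    also have "\<dots> = \<pi> [^] Suc (Suc n) \<otimes> (\<pi> [^] n \<otimes> (l \<otimes> l))"
    proof -
      have "\<pi> [^] Suc n \<otimes> \<pi> [^] Suc n = \<pi> [^] Suc (Suc n) \<otimes> \<pi> [^] n"
        using nat_pow_mult[of \<pi> "Suc n" "Suc n"] nat_pow_mult[of \<pi> "Suc (Suc n)" n] by (simp del: nat_pow_Suc)
      then show ?thesis unfolding p_def using xc by (simp add: m_assoc[symmetric] del: nat_pow_Suc)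
    qed
    finally have "y \<otimes> (\<one> \<ominus> y) = \<pi> [^] Suc (Suc n) \<otimes> (\<pi> [^] n \<otimes> (l \<otimes> l)) \<otimes> (\<one> \<oplus> \<one> \<oplus> \<one> \<oplus> t \<oplus> t \<oplus> t \<oplus> t)"
      unfolding yx by simp
    then have "y \<otimes> (\<one> \<ominus> y) = \<pi> [^] Suc (Suc n) \<otimes> (\<pi> [^] n \<otimes> (l \<otimes> l) \<otimes> (\<one> \<oplus> \<one> \<oplus> \<one> \<oplus> t \<oplus> t \<oplus> t \<oplus> t))"
      using xc L_carrier[OF tL] by (simp add: m_assoc del: nat_pow_Suc)
    moreover have "\<pi> [^] n \<otimes> (l \<otimes> l) \<otimes> (\<one> \<oplus> \<one> \<oplus> \<one> \<oplus> t \<oplus> t \<oplus> t \<oplus> t) \<in> \<Lambda>"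
      using Q_sub_L by (intro L_closed(2,3,4) tL l(2)) auto
    moreover have yL: "y = x \<oplus> \<pi> [^] Suc n \<otimes> (l \<otimes> (x \<oplus> x \<ominus> \<one>))"
      unfolding y_def tp p_def using xc by (simp add: m_assoc del: nat_pow_Suc)
    moreover have dL: "l \<otimes> (x \<oplus> x \<ominus> \<one>) \<in> \<Lambda>" unfolding minus_eq by (intro L_closed(2,3,4,5) l(1,2))
    moreover have "y \<in> \<Lambda>" unfolding yL using Q_sub_L by (intro L_closed(3,4) l(1) dL) auto
    ultimately show ?thesis unfolding I_def by blast
  qed
  obtain f where f: "\<And>n::nat. I n (f n)" "f 0 = e" and fs: "\<And>n::nat. \<exists>d\<in>\<Lambda>. f (Suc n) = f n \<oplus> \<pi> [^] Suc n \<otimes> d"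
  proof -
    have "\<exists>f. f 0 = e \<and> (\<forall>n. I n (f n)) \<and> (\<forall>n. \<exists>d\<in>\<Lambda>. f (Suc n) = f n \<oplus> \<pi> [^] Suc n \<otimes> d)"
    proof -
      define g where "g n x = (SOME y. I (Suc n) y \<and> (\<exists>d\<in>\<Lambda>. y = x \<oplus> \<pi> [^] Suc n \<otimes> d))" for n x
      have g: "I (Suc n) (g n x) \<and> (\<exists>d\<in>\<Lambda>. g n x = x \<oplus> \<pi> [^] Suc n \<otimes> d)" if "I n x" for n x
        unfolding g_def by (rule someI_ex[OF step[OF that]])
      define f where "f = rec_nat e g"
      have "I n (f n)" for n by (induction n) (use I0 g in \<open>auto simp: f_def\<close>)
      then show ?thesis using g by (intro exI[of _ f]) (auto simp: f_def)
    qed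
    then show ?thesis using that by blast
  qed
  have fL: "f n \<in> \<Lambda>" for n using f(1)[of n] unfolding I_def by blast
  have "\<exists>d\<in>\<Lambda>. f (Suc n) = f n \<oplus> \<pi> [^] n \<otimes> d" for n
  proof -
    obtain d where d: "d \<in> \<Lambda>" "f (Suc n) = f n \<oplus> \<pi> [^] Suc n \<otimes> d" using fs by blast
    have "\<pi> \<otimes> d \<in> \<Lambda>" using d Q_sub_L by (intro L_closed(3)) auto
    moreover have "\<pi> [^] Suc n \<otimes> d = \<pi> [^] n \<otimes> (\<pi> \<otimes> d)" using L_carrier[OF d(1)] by (simp add: m_assoc)
    ultimately show ?thesis using d(2) by metis
  qed
  then obtain a where a: "a \<in> \<Lambda>" "\<And>n. \<exists>d\<in>\<Lambda>. a = f n \<oplus> \<pi> [^] n \<otimes> d" using \<Lambda>_complete[of f] fL by blast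
  have ac: "a \<in> carrier M" using L_carrier[OF a(1)] .
  have "a \<otimes> (\<one> \<ominus> a) = \<zero>"
  proof (rule \<Lambda>_separated)
    show "a \<otimes> (\<one> \<ominus> a) \<in> carrier M" using ac by simp
    fix n :: nat
    obtain d where d: "d \<in> \<Lambda>" "a = f n \<oplus> \<pi> [^] n \<otimes> d" using a(2) by blast
    obtain l where l: "l \<in> \<Lambda>" "f n \<otimes> (\<one> \<ominus> f n) = \<pi> [^] Suc n \<otimes> l" using f(1)[of n] unfolding I_def by blast
    define p where "p = \<pi> [^] n"
    have p: "p \<in> Z" "p \<in> carrier M" unfolding p_def by simp_all
    have c: "f n \<in> carrier M" "d \<in> carrier M" "l \<in> carrier M" using fL d l L_carrier by auto
    have "a \<otimes> (\<one> \<ominus> a) = f n \<otimes> (\<one> \<ominus> f n) \<ominus> f n \<otimes> (p \<otimes> d) \<oplus> p \<otimes> d \<otimes> (\<one> \<ominus> a)"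
      unfolding d(2) p_def[symmetric] using p c by algebra
    also have "f n \<otimes> (\<one> \<ominus> f n) = p \<otimes> (\<pi> \<otimes> l)" unfolding l(2) p_def using c by (simp add: m_assoc)
    also have "f n \<otimes> (p \<otimes> d) = p \<otimes> (f n \<otimes> d)" by (rule left_comm[OF p(1) c(1,2)])
    also have "p \<otimes> (\<pi> \<otimes> l) \<ominus> p \<otimes> (f n \<otimes> d) \<oplus> p \<otimes> d \<otimes> (\<one> \<ominus> a) = p \<otimes> (\<pi> \<otimes> l \<ominus> f n \<otimes> d \<oplus> d \<otimes> (\<one> \<ominus> a))"
      using p c ac by (simp add: minus_eq r_distr r_minus m_assoc)
    finally have "a \<otimes> (\<one> \<ominus> a) = \<pi> [^] n \<otimes> (\<pi> \<otimes> l \<ominus> f n \<otimes> d \<oplus> d \<otimes> (\<one> \<ominus> a))" unfolding p_def .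
    moreover have "\<pi> \<otimes> l \<ominus> f n \<otimes> d \<oplus> d \<otimes> (\<one> \<ominus> a) \<in> \<Lambda>"
      unfolding minus_eq using Q_sub_L by (intro L_closed(2,3,4,5) l(1) fL d(1) a(1)) auto
    ultimately show "\<exists>d\<in>\<Lambda>. a \<otimes> (\<one> \<ominus> a) = \<pi> [^] n \<otimes> d" by blast
  qed
  then have a01: "a = \<zero> \<or> a = \<one>" using no_zero_divisors[of a "\<one> \<ominus> a"] ac by auto
  obtain d where d: "d \<in> \<Lambda>" "f (Suc 0) = f 0 \<oplus> \<pi> [^] Suc 0 \<otimes> d" using fs[of 0] by blast
  obtain d' where d': "d' \<in> \<Lambda>" "a = f (Suc 0) \<oplus> \<pi> [^] Suc 0 \<otimes> d'" using a(2) by blast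
  have c: "d \<in> carrier M" "d' \<in> carrier M" "e \<in> carrier M" using d d' e L_carrier by auto
  have ea: "a \<ominus> e = \<pi> \<otimes> (d \<oplus> d')" 
  proof -
    have "a = e \<oplus> \<pi> \<otimes> (d \<oplus> d')" unfolding d'(2) d(2) f(2) using c by (simp add: r_distr a_assoc)
    moreover have "e \<oplus> y \<ominus> e = y" if "y \<in> carrier M" for y using that c by algebra
    ultimately show ?thesis using c by simp
  qed
  have aeP: "a \<ominus> e \<in> P" unfolding ea P_iff using L_closed(4)[OF d(1) d'(1)] by blast
  from a01 show ?thesis
  proof
    assume "a = \<zero>"
    then have "\<ominus> (a \<ominus> e) = e" using c by (simp add: minus_eq)
    then show ?thesis using P_minus[OF aeP] by simp
  qed (use aeP in simp)
qed

text \<open>The powers of \<open>x\<close> are linearly dependent over the field. Scale the coefficients of a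
  relation so that they are integral and one of them is a unit, and let \<open>n\<^sub>0\<close> be the least
  index of a unit coefficient. Modulo the uniformizer the relation reads \<open>x\<^bsup>n0\<^esup> (1 - y) =
  0\<close> with \<open>y = g x\<close> and \<open>g\<close> a polynomial in \<open>x\<close>. Then
  \<open>y\<^bsup>n0\<^esup>\<close> is idempotent modulo the uniformizer, hence congruent to \<open>0\<close>
  or \<open>1\<close>. In the first case \<open>x\<close> is nilpotent modulo the uniformizer and \<open>1 -
  x\<close> is a unit; in the second case \<open>x\<close> has a left inverse modulo the uniformizer and is a
  unit.\<close>
lemma local_\<Lambda>:
  assumes x: "x \<in> \<Lambda>"
  shows "(\<exists>w\<in>\<Lambda>. w \<otimes> x = \<one>) \<or> (\<exists>w\<in>\<Lambda>. w \<otimes> (\<one> \<ominus> x) = \<one>)"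
proof -
  have xc: "x \<in> carrier M" using L_carrier[OF x] .
  let ?D = "Suc (q * q)"
  let ?Us = "map (\<lambda>n. x [^] n) [0..<?D]"
  have dim: "dimension (q * q) Z (carrier M)" using dimension_combs spans by simp
  have Us: "set ?Us \<subseteq> carrier M" using xc by auto
  have dep: "dependent Z ?Us"
    using independent_length_le_dimension[OF symbol_relations.subfield_Z[OF symbol_relations_axioms] dim, of ?Us] xc by auto
  obtain Ks where Ks: "length Ks = length ?Us" "combine Ks ?Us = \<zero>" "set Ks \<subseteq> Z" "set Ks \<noteq> {\<zero>}"
    by (rule dependent_imp_non_trivial_combine[OF symbol_relations.subfield_Z[OF symbol_relations_axioms] Us dep])
  have lK: "length Ks = ?D" using Ks(1) by simp
  have cZ: "Ks ! i \<in> Z" if "i < ?D" for i using that Ks(3) lK nth_mem by (metis subsetD)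
  have "\<exists>i<?D. Ks ! i \<noteq> \<zero>"
  proof (rule ccontr)
    assume "\<not> ?thesis"
    then have "set Ks \<subseteq> {\<zero>}" using lK by (auto simp: set_conv_nth)
    moreover have "set Ks \<noteq> {}" using lK by auto
    ultimately show False using Ks(4) by (metis subset_singletonD)
  qed
  then obtain a0 where a0: "a0 \<in> {..<?D}" "Ks ! a0 \<noteq> \<zero>" by auto
  obtain n k :: nat and d where nd: "\<forall>i\<in>{..<?D}. d i \<in> Q \<and> \<pi> [^] n \<otimes> Ks ! i = \<pi> [^] k \<otimes> d i"
    and un: "\<exists>i\<in>{..<?D}. \<exists>w\<in>Q. w \<otimes> d i = \<one>"
    using scale_family[of "{..<?D}" "(!) Ks" a0] finite_lessThan cZ a0 by (metis lessThan_iff)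
  have dQ: "d i \<in> Q" and dK: "\<pi> [^] n \<otimes> Ks ! i = \<pi> [^] k \<otimes> d i" if "i < ?D" for i using nd that by auto
  have "Ks = map ((!) Ks) [0..<?D]" by (metis lK map_nth)
  then have "combine (map ((!) Ks) [0..<?D]) ?Us = \<zero>" using Ks(2) by simp
  then have K0: "(\<Oplus>i\<in>{..<?D}. Ks ! i \<otimes> x [^] i) = \<zero>"
    using combine_map_upt[of ?D "(!) Ks" "\<lambda>n. x [^] n"] cZ xc by simp
  have "(\<Oplus>i\<in>{..<?D}. \<pi> [^] k \<otimes> (d i \<otimes> x [^] i)) = (\<Oplus>i\<in>{..<?D}. \<pi> [^] n \<otimes> (Ks ! i \<otimes> x [^] i))"
  proof (intro finsum_cong' refl)
    fix i assume "i \<in> {..<?D}"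
    then have i: "i < ?D" by simp
    have "\<pi> [^] k \<otimes> (d i \<otimes> x [^] i) = (\<pi> [^] k \<otimes> d i) \<otimes> x [^] i" using dQ[OF i] xc by (simp add: m_assoc)
    also have "\<dots> = \<pi> [^] n \<otimes> (Ks ! i \<otimes> x [^] i)" unfolding dK[OF i, symmetric] using cZ[OF i] xc by (simp add: m_assoc)
    finally show "\<pi> [^] k \<otimes> (d i \<otimes> x [^] i) = \<pi> [^] n \<otimes> (Ks ! i \<otimes> x [^] i)" .
  qed (use cZ xc in auto)
  also have "\<dots> = \<pi> [^] n \<otimes> (\<Oplus>i\<in>{..<?D}. Ks ! i \<otimes> x [^] i)"
    using cZ xc by (intro finsum_rdistr[symmetric]) auto
  finally have "(\<Oplus>i\<in>{..<?D}. \<pi> [^] k \<otimes> (d i \<otimes> x [^] i)) = \<zero>" unfolding K0 by simp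
  moreover have "(\<Oplus>i\<in>{..<?D}. \<pi> [^] k \<otimes> (d i \<otimes> x [^] i)) = \<pi> [^] k \<otimes> (\<Oplus>i\<in>{..<?D}. d i \<otimes> x [^] i)"
    using dQ xc by (intro finsum_rdistr[symmetric]) auto
  ultimately have "\<pi> [^] k \<otimes> (\<Oplus>i\<in>{..<?D}. d i \<otimes> x [^] i) = \<pi> [^] k \<otimes> \<zero>" by simp
  then have S0: "(\<Oplus>i\<in>{..<?D}. d i \<otimes> x [^] i) = \<zero>"
    by (rule \<pi>_cancel[rotated 2]) (use dQ xc in \<open>auto intro!: finsum_closed\<close>)
  \<comment> \<open>coefficients below \<open>n0\<close> are divisible by \<open>\<pi>\<close>, and
    \<open>x\<^bsup>n0\<^esup>\<close> can be factored out of the rest\<close>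
  define n0 where "n0 = (LEAST i. i < ?D \<and> (\<exists>w\<in>Q. w \<otimes> d i = \<one>))"
  have "n0 < ?D \<and> (\<exists>w\<in>Q. w \<otimes> d n0 = \<one>)"
    unfolding n0_def by (rule LeastI_ex) (use un in blast)
  then have n0: "n0 < ?D" "\<exists>w\<in>Q. w \<otimes> d n0 = \<one>" by blast+
  have below: "\<exists>e\<in>Q. d i = \<pi> \<otimes> e" if i: "i < n0" for i
  proof -
    have iD: "i < ?D" using i n0(1) by (rule less_trans)
    have "\<not> (i < ?D \<and> (\<exists>w\<in>Q. w \<otimes> d i = \<one>))" using i unfolding n0_def by (rule not_less_Least)
    then show ?thesis using iD Q_unit_or_divisible[OF dQ[OF iD]] by blast
  qed
  have xn: "x [^] i \<in> \<Lambda>" for i :: nat by (rule L_pow[OF x])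
  have dL: "d i \<in> \<Lambda>" if "i < ?D" for i using dQ[OF that] Q_sub_L by blast
  have partial: "\<exists>l\<in>\<Lambda>. \<exists>h\<in>\<Lambda>. h \<otimes> x = x \<otimes> h \<and> (\<Oplus>i\<in>{..<m}. d i \<otimes> x [^] i) =
      \<pi> \<otimes> l \<oplus> (if n0 < m then x [^] n0 \<otimes> (d n0 \<oplus> x \<otimes> h) else \<zero>)" if "m \<le> ?D" for m
    using that
  proof (induction m)
    case 0
    then show ?case using L_closed(1) xc by (intro bexI[of _ \<zero>]) auto
  next
    case (Suc m)
    then obtain l h where lh: "l \<in> \<Lambda>" "h \<in> \<Lambda>" "h \<otimes> x = x \<otimes> h" and IH: "(\<Oplus>i\<in>{..<m}. d i \<otimes> x [^] i) =
      \<pi> \<otimes> l \<oplus> (if n0 < m then x [^] n0 \<otimes> (d n0 \<oplus> x \<otimes> h) else \<zero>)" by auto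
    have lc: "l \<in> carrier M" "h \<in> carrier M" using lh L_carrier by auto
    have m: "m < ?D" using Suc by simp
    have dm: "d m \<in> carrier M" "d m \<in> Z" using dQ[OF m] Q_Z by auto
    have d0: "d n0 \<in> carrier M" "d n0 \<in> Z" using dQ[OF n0(1)] Q_Z by auto
    have S: "(\<Oplus>i\<in>{..<Suc m}. d i \<otimes> x [^] i) = d m \<otimes> x [^] m \<oplus> (\<Oplus>i\<in>{..<m}. d i \<otimes> x [^] i)"
      unfolding lessThan_Suc using dQ m xc by (intro finsum_insert) auto
    consider "m < n0" | "m = n0" | "n0 < m" by linarith
    then show ?case
    proof cases
      case 1
      obtain e where e: "e \<in> Q" "d m = \<pi> \<otimes> e" using below[OF 1] by blast
      have "(\<Oplus>i\<in>{..<Suc m}. d i \<otimes> x [^] i) = \<pi> \<otimes> (e \<otimes> x [^] m \<oplus> l)"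
        unfolding S IH e(2) using 1 e(1) lc xc by (simp add: r_distr m_assoc)
      moreover have "e \<otimes> x [^] m \<oplus> l \<in> \<Lambda>" using e(1) Q_sub_L by (intro L_closed(3,4) xn lh) auto
      moreover have "\<pi> \<otimes> (e \<otimes> x [^] m \<oplus> l) \<oplus> \<zero> = \<pi> \<otimes> (e \<otimes> x [^] m \<oplus> l)" using e(1) lc xc by simp
      ultimately show ?thesis using lh(2,3) 1 by (intro bexI[of _ "e \<otimes> x [^] m \<oplus> l"] bexI[of _ h]) auto
    next
      case 2
      have "(\<Oplus>i\<in>{..<Suc m}. d i \<otimes> x [^] i) = \<pi> \<otimes> l \<oplus> x [^] n0 \<otimes> (d n0 \<oplus> x \<otimes> \<zero>)"
        unfolding S IH using 2 lc xc d0 central[OF d0(2), of "x [^] n0"] by (simp add: a_comm)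
      then show ?thesis using lh(1) L_closed(1) xc 2 by (intro bexI[of _ l] bexI[of _ \<zero>]) auto
    next
      case 3
      then obtain j where j: "m = n0 + Suc j" using less_imp_Suc_add by auto
      let ?h = "h \<oplus> d m \<otimes> x [^] j"
      have xj: "x [^] j \<otimes> x = x \<otimes> x [^] j" using nat_pow_Suc2[OF xc, of j] by simp
      have "x [^] m = x [^] n0 \<otimes> (x \<otimes> x [^] j)"
        unfolding j using nat_pow_mult[OF xc, of n0 "Suc j"] nat_pow_Suc2[OF xc, of j] by simp
      then have "d m \<otimes> x [^] m = x [^] n0 \<otimes> (x \<otimes> (d m \<otimes> x [^] j))"
        using xc dm left_comm[OF dm(2), of x "x [^] j"] left_comm[OF dm(2), of "x [^] n0" "x \<otimes> x [^] j"] by simp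
      then have "(\<Oplus>i\<in>{..<Suc m}. d i \<otimes> x [^] i) =
          x [^] n0 \<otimes> (x \<otimes> (d m \<otimes> x [^] j)) \<oplus> (\<pi> \<otimes> l \<oplus> x [^] n0 \<otimes> (d n0 \<oplus> x \<otimes> h))"
        unfolding S IH using 3 by simp
      also have "\<dots> = \<pi> \<otimes> l \<oplus> x [^] n0 \<otimes> (d n0 \<oplus> x \<otimes> ?h)"
        using lc xc dm(1) d0(1) by (simp add: r_distr a_ac)
      finally have "(\<Oplus>i\<in>{..<Suc m}. d i \<otimes> x [^] i) = \<pi> \<otimes> l \<oplus> x [^] n0 \<otimes> (d n0 \<oplus> x \<otimes> ?h)" .
      moreover have "?h \<in> \<Lambda>" by (intro L_closed(3,4) lh dL m xn)
      moreover have "?h \<otimes> x = x \<otimes> ?h"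
        using lc xc dm lh(3) xj left_comm[OF dm(2), of x "x [^] j"] by (simp add: l_distr r_distr m_assoc)
      ultimately show ?thesis using lh(1) 3 by (intro bexI[of _ l] bexI[of _ ?h]) auto
    qed
  qed
  obtain l h where lh: "l \<in> \<Lambda>" "h \<in> \<Lambda>" "h \<otimes> x = x \<otimes> h"
    and eq: "\<zero> = \<pi> \<otimes> l \<oplus> x [^] n0 \<otimes> (d n0 \<oplus> x \<otimes> h)"
    using partial[of ?D] S0 n0(1) by auto
  have lc: "l \<in> carrier M" "h \<in> carrier M" using lh L_carrier by auto
  obtain w where w: "w \<in> Q" "w \<otimes> d n0 = \<one>" using n0(2) by blast
  have wc: "w \<in> carrier M" "w \<in> Z" "d n0 \<in> carrier M" using w Q_Z dQ[OF n0(1)] by auto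
  define g where "g = \<ominus> (w \<otimes> h)"
  have g: "g \<in> \<Lambda>" unfolding g_def using w(1) Q_sub_L by (intro L_closed(3,5) lh) auto
  have gc: "g \<in> carrier M" using L_carrier[OF g] .
  have gx: "g \<otimes> x = x \<otimes> g"
    unfolding g_def using wc lc xc lh(3) left_comm[OF wc(2) xc lc(2)] by (simp add: l_minus r_minus m_assoc)
  define y where "y = g \<otimes> x"
  have y: "y \<in> \<Lambda>" "y \<in> carrier M" unfolding y_def using g x L_closed(3) gc xc by auto
  have "w \<otimes> (d n0 \<oplus> x \<otimes> h) = \<one> \<ominus> y"
    unfolding y_def gx g_def using w(2) wc lc xc left_comm[OF wc(2) xc lc(2)] lh(3) by (simp add: r_distr r_minus l_minus m_assoc minus_eq)
  then have "x [^] n0 \<otimes> (\<one> \<ominus> y) = w \<otimes> (x [^] n0 \<otimes> (d n0 \<oplus> x \<otimes> h))"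
    using left_comm[OF wc(2), of "x [^] n0" "d n0 \<oplus> x \<otimes> h"] xc wc lc by simp
  also have "x [^] n0 \<otimes> (d n0 \<oplus> x \<otimes> h) = \<ominus> (\<pi> \<otimes> l)"
    using eq lc xc wc by (metis \<pi>_Q(2) a_closed a_comm m_closed minus_equality nat_pow_closed)
  finally have e1: "x [^] n0 \<otimes> (\<one> \<ominus> y) = w \<otimes> (\<ominus> (\<pi> \<otimes> l))" .
  have plP: "\<pi> \<otimes> l \<in> P" using lh unfolding P_iff by blast
  have xyP: "x [^] n0 \<otimes> (\<one> \<ominus> y) \<in> P"
    unfolding e1 by (rule P_lmult[OF P_minus[OF plP]]) (use w(1) Q_sub_L in auto)
  have unit_of: "\<exists>w\<in>\<Lambda>. w \<otimes> z = \<one>" if bz: "\<one> \<ominus> b \<otimes> z \<in> P" "b \<in> \<Lambda>" "z \<in> carrier M" for b z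
  proof -
    have bc: "b \<in> carrier M" using L_carrier bz by blast
    obtain w where w: "w \<in> \<Lambda>" "w \<otimes> (\<one> \<ominus> (\<one> \<ominus> b \<otimes> z)) = \<one>" using one_minus_unit[OF bz(1)] by blast
    have "\<one> \<ominus> (\<one> \<ominus> b \<otimes> z) = b \<otimes> z" using bc bz(3) by algebra
    then have "(w \<otimes> b) \<otimes> z = \<one>" using w L_carrier[OF w(1)] bc bz(3) by (simp add: m_assoc)
    then show ?thesis using L_closed(3)[OF w(1) bz(2)] by blast
  qed
  show ?thesis
  proof (cases n0)
    case 0
    then have "\<one> \<ominus> g \<otimes> x \<in> P" using xyP y by (simp add: y_def)
    then show ?thesis using unit_of[of g x] g xc by blast
  next
    case (Suc m)
    \<comment> \<open>\<open>1 - e\<close> is a multiple of \<open>1 - y\<close> and \<open>e\<close> is a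
      multiple of \<open>x\<^bsup>n0\<^esup>\<close>, so \<open>e (1 - e)\<close> lies in \<open>P\<close>\<close>
    define e where "e = y [^] n0"
    have e: "e \<in> \<Lambda>" "e \<in> carrier M" unfolding e_def using L_pow y by auto
    define T where "T = (\<Oplus>k\<in>{..<n0}. y [^] k)"
    have T: "T \<in> \<Lambda>" unfolding T_def by (rule sum_pow_\<Lambda>[OF y(1)])
    have yT: "(\<one> \<ominus> y) \<otimes> T = \<one> \<ominus> e" unfolding T_def e_def by (rule geometric_inverse[OF y(2)])
    have "x [^] n0 \<otimes> (\<one> \<ominus> y) \<otimes> T \<in> P" by (rule P_rmult[OF xyP T])
    then have xe: "x [^] n0 \<otimes> (\<one> \<ominus> e) \<in> P"
      using xc y(2) L_carrier[OF T] yT by (simp add: m_assoc)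
    have "e = g [^] n0 \<otimes> x [^] n0" unfolding e_def y_def by (rule pow_mult_distrib[OF gx gc xc])
    then have "e \<otimes> (\<one> \<ominus> e) = g [^] n0 \<otimes> (x [^] n0 \<otimes> (\<one> \<ominus> e))" using gc xc e by (simp add: m_assoc)
    then have "e \<otimes> (\<one> \<ominus> e) \<in> P" using P_lmult[OF xe L_pow[OF g]] by simp
    from idempotent_lift[OF e(1) this] show ?thesis
    proof
      assume eP: "e \<in> P"
      have "x [^] n0 \<otimes> (\<one> \<ominus> e) \<oplus> x [^] n0 \<otimes> e \<in> P" by (rule P_add[OF xe P_lmult[OF eP xn]])
      moreover have "x [^] n0 \<otimes> (\<one> \<ominus> e) \<oplus> x [^] n0 \<otimes> e = x [^] n0"
        using xc e nat_pow_closed[OF xc, of n0] by (simp add: minus_eq r_distr r_minus a_assoc l_neg)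
      ultimately have xP: "x [^] n0 \<in> P" by simp
      define T' where "T' = (\<Oplus>k\<in>{..<n0}. x [^] k)"
      have T': "T' \<in> \<Lambda>" "T' \<in> carrier M" unfolding T'_def using sum_pow_\<Lambda>[OF x] L_carrier by auto
      have xT: "(\<one> \<ominus> x) \<otimes> T' = \<one> \<ominus> x [^] n0" unfolding T'_def by (rule geometric_inverse[OF xc])
      obtain w where w: "w \<in> \<Lambda>" "w \<otimes> (\<one> \<ominus> x [^] n0) = \<one>" using one_minus_unit[OF xP] by blast
      have wc: "w \<in> carrier M" using L_carrier[OF w(1)] .
      have "(w \<otimes> (\<one> \<ominus> x)) \<otimes> T' = w \<otimes> ((\<one> \<ominus> x) \<otimes> T')" by (rule m_assoc) (use wc xc T' in auto)
      then have "(w \<otimes> (\<one> \<ominus> x)) \<otimes> T' = \<one>" unfolding xT w(2) .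
      then have "T' \<otimes> (w \<otimes> (\<one> \<ominus> x)) = \<one>" by (rule inverse_comm[rotated 2]) (use wc xc T' in auto)
      then have "(T' \<otimes> w) \<otimes> (\<one> \<ominus> x) = \<one>" using wc xc T' by (simp add: m_assoc)
      then show ?thesis using L_closed(3)[OF T'(1) w(1)] by blast
    next
      assume "\<one> \<ominus> e \<in> P"
      moreover have "e = (y [^] m \<otimes> g) \<otimes> x"
        unfolding e_def Suc using y(2) gc xc by (simp add: y_def m_assoc)
      ultimately show ?thesis
        using unit_of[of "y [^] m \<otimes> g" x] L_closed(3)[OF L_pow[OF y(1)] g] xc by auto
    qed
  qed
qed

subsection \<open>The order is a valuation order\<close>

text \<open>The nonunits, where having a left inverse is the same as being a unit since \<open>M\<close> is a
  division ring.\<close>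
definition N :: "'a set" where "N = {x \<in> \<Lambda>. \<not> (\<exists>w\<in>\<Lambda>. w \<otimes> x = \<one>)}"

lemma N_lmult: "x \<in> N \<Longrightarrow> l \<in> \<Lambda> \<Longrightarrow> l \<otimes> x \<in> N"
proof -
  assume x: "x \<in> N" and l: "l \<in> \<Lambda>"
  have "\<not> (w \<otimes> (l \<otimes> x) = \<one>)" if w: "w \<in> \<Lambda>" for w
  proof
    assume "w \<otimes> (l \<otimes> x) = \<one>"
    then have "(w \<otimes> l) \<otimes> x = \<one>" using w l x L_carrier by (simp add: N_def m_assoc)
    then show False using x L_closed(3)[OF w l] by (auto simp: N_def)
  qed
  then show ?thesis using x l L_closed(3) by (auto simp: N_def)
qed

lemma N_rmult: "x \<in> N \<Longrightarrow> l \<in> \<Lambda> \<Longrightarrow> x \<otimes> l \<in> N"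
proof -
  assume x: "x \<in> N" and l: "l \<in> \<Lambda>"
  have xL: "x \<in> \<Lambda>" using x by (simp add: N_def)
  note c = L_carrier[OF xL] L_carrier[OF l]
  have "\<not> (w \<otimes> (x \<otimes> l) = \<one>)" if w: "w \<in> \<Lambda>" for w
  proof
    have wc: "w \<in> carrier M" using L_carrier[OF w] .
    assume "w \<otimes> (x \<otimes> l) = \<one>"
    then have "(w \<otimes> x) \<otimes> l = \<one>" using wc c by (simp add: m_assoc)
    then have "l \<otimes> (w \<otimes> x) = \<one>" by (rule inverse_comm[rotated 2]) (use wc c in auto)
    then have "(l \<otimes> w) \<otimes> x = \<one>" using wc c by (simp add: m_assoc)
    then show False using x L_closed(3)[OF l w] by (auto simp: N_def)
  qed
  then show ?thesis using L_closed(3)[OF xL l] by (auto simp: N_def)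
qed

text \<open>If a sum of two nonunits were a unit, a multiple of one of them would be \<open>1\<close> minus a
  multiple of the other, which contradicts locality.\<close>
lemma N_add: "x \<in> N \<Longrightarrow> y \<in> N \<Longrightarrow> x \<oplus> y \<in> N"
proof -
  assume x: "x \<in> N" and y: "y \<in> N"
  have L: "x \<in> \<Lambda>" "y \<in> \<Lambda>" using x y by (auto simp: N_def)
  note c = L_carrier[OF L(1)] L_carrier[OF L(2)]
  have "\<not> (w \<otimes> (x \<oplus> y) = \<one>)" if w: "w \<in> \<Lambda>" for w
  proof
    have wc: "w \<in> carrier M" using L_carrier[OF w] .
    assume "w \<otimes> (x \<oplus> y) = \<one>"
    then have e: "w \<otimes> x \<oplus> w \<otimes> y = \<one> \<oplus> \<zero>" using wc c by (simp add: r_distr)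
    have "\<one> \<ominus> w \<otimes> x = w \<otimes> y \<ominus> \<zero>" by (rule diff_eqI[OF _ _ _ _ e]) (use wc c in auto)
    then have "\<one> \<ominus> w \<otimes> x = w \<otimes> y" using wc c by (simp add: minus_eq)
    then show False
      using local_\<Lambda>[OF L_closed(3)[OF w L(1)]] N_lmult[OF x w] N_lmult[OF y w] by (auto simp: N_def)
  qed
  then show ?thesis using L_closed(4)[OF L] by (auto simp: N_def)
qed

lemma zero_N: "\<zero> \<in> N"
proof -
  have "w \<otimes> \<zero> \<noteq> \<one>" if "w \<in> \<Lambda>" for w using L_carrier[OF that] one_nonzero by simp
  then show ?thesis using L_closed(1) by (auto simp: N_def)
qed

lemma uv_\<Lambda>: "u \<in> \<Lambda>" "v \<in> \<Lambda>" using combs_uv[OF subring_Q Q_sub_Z \<alpha>_unit(1) \<beta>_unit(1)] by auto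

lemma \<zeta>_pow_\<Lambda>: "\<zeta> [^] (n::nat) \<in> \<Lambda>" using Q_pow[OF \<zeta>_Q] Q_sub_L by blast

lemma ideal_avg:
  assumes A: "A \<subseteq> carrier M" "\<zero> \<in> A" "\<And>x y. x \<in> A \<Longrightarrow> y \<in> A \<Longrightarrow> x \<oplus> y \<in> A"
    "\<And>x l. x \<in> A \<Longrightarrow> l \<in> \<Lambda> \<Longrightarrow> l \<otimes> x \<in> A" "\<And>x l. x \<in> A \<Longrightarrow> l \<in> \<Lambda> \<Longrightarrow> x \<otimes> l \<in> A"
    and w: "w \<in> \<Lambda>" and t: "t \<in> \<Lambda>" and x: "x \<in> A"
  shows "avg w t x \<in> A"
  by (rule avg_mem[OF A(1,2,3) _ _ _ _ _ x]) (use A(4,5) w t L_carrier in auto)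

lemma \<kappa>_unit: "\<exists>k\<in>Q. k \<otimes> \<kappa> = \<one>"
proof -
  obtain a where a: "a \<in> Q" "a \<otimes> \<alpha> = \<one>" using \<alpha>_unit by blast
  obtain b where b: "b \<in> Q" "b \<otimes> \<beta> = \<one>" using \<beta>_unit by blast
  obtain c where c: "c \<in> Q" "c \<otimes> [q] \<cdot> \<one> = \<one>" using q_unit by blast
  define r where "r = [q] \<cdot> \<one>"
  have r: "r \<in> Z" "c \<otimes> r = \<one>" "r \<in> carrier M" using c by (simp_all add: r_def)
  have cancel: "y \<otimes> (z \<otimes> t) = t" if "y \<otimes> z = \<one>" "y \<in> carrier M" "z \<in> carrier M" "t \<in> carrier M" for y z t
    using that m_assoc[of y z t] by simp
  have "(a \<otimes> c \<otimes> b \<otimes> c) \<otimes> (r \<otimes> \<beta> \<otimes> (r \<otimes> \<alpha>)) = a \<otimes> (c \<otimes> (b \<otimes> (c \<otimes> (r \<otimes> (\<beta> \<otimes> (r \<otimes> \<alpha>))))))"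
    using a(1) b(1) c(1) r(3) by (simp add: m_assoc)
  also have "\<dots> = a \<otimes> \<alpha>"
    using cancel[OF r(2)] cancel[OF b(2)] a(1) b(1) c(1) r(3) by simp
  also have "\<dots> = \<one>" by (rule a(2))
  finally have "(a \<otimes> c \<otimes> b \<otimes> c) \<otimes> \<kappa> = \<one>" unfolding \<kappa>_def r_def .
  moreover have "a \<otimes> c \<otimes> b \<otimes> c \<in> Q" using a b c by simp
  ultimately show ?thesis by blast
qed

text \<open>Projecting to the exponents of the unit coefficient stays inside the ideal of nonunits but produces
  a unit times a monomial, which is a unit.\<close>
lemma comb_unit:
  assumes d: "d \<in> idx \<rightarrow> Q" and p: "p \<in> idx" and w: "w \<in> Q" "w \<otimes> d p = \<one>"
  shows "\<exists>w\<in>\<Lambda>. w \<otimes> comb d = \<one>"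
proof (rule ccontr)
  assume no: "\<not> ?thesis"
  have "comb d \<in> \<Lambda>" using d unfolding combs_def by blast
  then have dN: "comb d \<in> N" using no by (simp add: N_def)
  obtain i j where ij: "p = (i, j)" by (cases p)
  have Nc: "N \<subseteq> carrier M" using L_carrier by (auto simp: N_def)
  note avgN = ideal_avg[OF Nc zero_N N_add N_lmult N_rmult]
  have "proj i j (comb d) \<in> N" unfolding proj_def by (intro avgN uv_\<Lambda> \<zeta>_pow_\<Lambda> dN)
  then have kN: "\<kappa> \<otimes> (d p \<otimes> mon i j) \<in> N" using proj_comb[OF Pi_Q_Z[OF d], of i j] p ij by simp
  obtain k where k: "k \<in> Q" "k \<otimes> \<kappa> = \<one>" using \<kappa>_unit by blast
  obtain a where a: "a \<in> Q" "a \<otimes> \<alpha> = \<one>" using \<alpha>_unit by blast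
  obtain b where b: "b \<in> Q" "b \<otimes> \<beta> = \<one>" using \<beta>_unit by blast
  obtain w' where w': "w' \<in> \<Lambda>" "w' \<otimes> mon i j = \<one>"
    using mon_unit[of Q \<Lambda> a b i j] subring_Q Q_sub_Z uv_\<Lambda> Q_sub_L L_closed(3) a b by blast
  have dc: "d p \<in> carrier M" using funcset_mem[OF d p] by simp
  have w'c: "w' \<in> carrier M" using L_carrier[OF w'(1)] .
  have "(w' \<otimes> (w \<otimes> k)) \<otimes> (\<kappa> \<otimes> (d p \<otimes> mon i j)) = w' \<otimes> (w \<otimes> ((k \<otimes> \<kappa>) \<otimes> (d p \<otimes> mon i j)))"
    using k(1) w(1) w'c dc by (simp add: m_assoc)
  also have "\<dots> = w' \<otimes> ((w \<otimes> d p) \<otimes> mon i j)" using k w(1) w'c dc by (simp add: m_assoc)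
  also have "\<dots> = \<one>" using w w' by simp
  finally have "(w' \<otimes> (w \<otimes> k)) \<otimes> (\<kappa> \<otimes> (d p \<otimes> mon i j)) = \<one>" .
  moreover have "w' \<otimes> (w \<otimes> k) \<in> \<Lambda>" using w k Q_sub_L w'(1) by (intro L_closed(3)) auto
  ultimately show False using kN by (auto simp: N_def)
qed

lemma \<pi>_nonunit_\<Lambda>: "w \<in> \<Lambda> \<Longrightarrow> w \<otimes> \<pi> \<noteq> \<one>"
proof
  assume w: "w \<in> \<Lambda>" and e: "w \<otimes> \<pi> = \<one>"
  obtain d where d: "d \<in> idx \<rightarrow> Q" "w = comb d" using w unfolding combs_def by blast
  have 00: "(0, 0) \<in> idx" using q by (simp add: idx_def)
  define c where "c = (\<lambda>p::nat \<times> nat. if p = (0, 0) then \<one> else \<zero>)"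
  have cZ: "c \<in> idx \<rightarrow> Z" by (simp add: c_def)
  have "comb c = \<one>" unfolding c_def using comb_single[OF 00, of \<one>] by (simp add: mon_def)
  then have "comb c = \<pi> \<otimes> comb d" using e d central[OF Q_Z[OF \<pi>(1)], of w] L_carrier[OF w] by simp
  then have "c (0, 0) = \<pi> \<otimes> d (0, 0)"
    by (rule comb_eq_multiple[OF cZ Pi_Q_Z[OF d(1)] Q_Z[OF \<pi>(1)] _ 00])
  then have "\<one> = d (0, 0) \<otimes> \<pi>" unfolding c_def using central[OF Q_Z[OF \<pi>(1)], of "d (0, 0)"] funcset_mem[OF d(1) 00] by simp
  then show False using \<pi>_nonunit[OF funcset_mem[OF d(1) 00]] by simp
qed

text \<open>Scaling the coefficients by a power of the uniformizer makes them integral with one of them a unit;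
  then \<open>comb_unit\<close> applies.\<close>
theorem valuation_order_\<Lambda>: "valuation_order M Z Q \<pi> \<Lambda>"
  unfolding valuation_order_def valuation_order_axioms_def
proof (intro conjI allI impI)
  show "order_over_dvr M Z Q \<pi> \<Lambda>" by (rule order_over_dvr_axioms)
  show "w \<otimes> \<pi> \<noteq> \<one>" if "w \<in> \<Lambda>" for w by (rule \<pi>_nonunit_\<Lambda>[OF that])
  fix x assume x: "x \<in> carrier M" "x \<noteq> \<zero>"
  obtain c where c: "c \<in> idx \<rightarrow> Z" "x = comb c" using x spans unfolding combs_def by blast
  have "\<exists>p\<in>idx. c p \<noteq> \<zero>"
  proof (rule ccontr)
    assume "\<not> ?thesis"
    then have "comb c = (\<Oplus>p\<in>idx. \<zero>)" unfolding comb_def by (intro finsum_cong') auto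
    then show False using x c by simp
  qed
  then obtain p0 where p0: "p0 \<in> idx" "c p0 \<noteq> \<zero>" by blast
  obtain n k :: nat and d where nd: "\<forall>p\<in>idx. d p \<in> Q \<and> \<pi> [^] n \<otimes> c p = \<pi> [^] k \<otimes> d p"
    and un: "\<exists>p\<in>idx. \<exists>w\<in>Q. w \<otimes> d p = \<one>"
    using scale_family[OF idx_finite, of c p0] funcset_mem[OF c(1)] p0 by metis
  have dQ: "d \<in> idx \<rightarrow> Q" using nd by blast
  obtain w where w: "w \<in> \<Lambda>" "w \<otimes> comb d = \<one>" using un comb_unit[OF dQ] by blast
  have yL: "comb d \<in> \<Lambda>" using dQ unfolding combs_def by blast
  have yc: "comb d \<in> carrier M" using L_carrier[OF yL] .
  have z0: "(\<lambda>p. \<zero>) \<in> idx \<rightarrow> Z" by simp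
  have c0: "comb (\<lambda>p. \<zero>) = \<zero>" unfolding comb_def by simp
  have "\<pi> [^] n \<otimes> comb c = comb (\<lambda>p. \<zero> \<oplus> \<pi> [^] n \<otimes> c p)"
    using comb_linear[OF z0 c(1), of "\<pi> [^] n"] c0 c(1) by simp
  also have "\<dots> = comb (\<lambda>p. \<zero> \<oplus> \<pi> [^] k \<otimes> d p)"
    by (rule comb_cong) (use nd c(1) Q_Z[OF funcset_mem[OF dQ]] in auto)
  also have "\<dots> = \<pi> [^] k \<otimes> comb d"
    using comb_linear[OF z0 Pi_Q_Z[OF dQ], of "\<pi> [^] k"] c0 yc by simp
  finally have e: "\<pi> [^] n \<otimes> x = \<pi> [^] k \<otimes> comb d" unfolding c(2) .
  have split: "\<pi> [^] b \<otimes> z = \<pi> [^] a \<otimes> (\<pi> [^] (b - a) \<otimes> z)" if "a \<le> b" "z \<in> carrier M" for a b :: nat and z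
    using that nat_pow_mult[of \<pi> a "b - a"] by (simp add: m_assoc[symmetric])
  have "x = \<pi> [^] (k - n) \<otimes> comb d \<or> \<pi> [^] (n - k) \<otimes> x = comb d"
  proof (cases "n \<le> k")
    case True
    then have "\<pi> [^] n \<otimes> x = \<pi> [^] n \<otimes> (\<pi> [^] (k - n) \<otimes> comb d)" using e split[of n k "comb d"] yc by simp
    then have "x = \<pi> [^] (k - n) \<otimes> comb d" by (rule \<pi>_cancel[rotated 2]) (use x yc in auto)
    then show ?thesis by blast
  next
    case False
    then have "\<pi> [^] k \<otimes> (\<pi> [^] (n - k) \<otimes> x) = \<pi> [^] k \<otimes> comb d" using e split[of k n x] x by simp
    then have "\<pi> [^] (n - k) \<otimes> x = comb d" by (rule \<pi>_cancel[rotated 2]) (use x yc in auto)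
    then show ?thesis by blast
  qed
  then show "\<exists>(n::nat). \<exists>y\<in>\<Lambda>. \<exists>w\<in>\<Lambda>. w \<otimes> y = \<one> \<and> (x = \<pi> [^] n \<otimes> y \<or> \<pi> [^] n \<otimes> x = y)"
    using w yL by blast
qed

subsection \<open>The centre of the residue algebra\<close>

text \<open>Conjugation is trivial modulo \<open>P\<close>, so all \<open>q\<close> summands are congruent to
  \<open>\<gamma> x\<close>.\<close>
lemma avg_central_mod:
  assumes x: "x \<in> \<Lambda>" "\<And>b. b \<in> \<Lambda> \<Longrightarrow> x \<otimes> b \<ominus> b \<otimes> x \<in> P"
    and w: "w \<in> \<Lambda>" "w [^] q = \<gamma>" "\<gamma> \<in> Q"
  shows "avg w \<one> x \<ominus> ([q] \<cdot> \<one> \<otimes> \<gamma>) \<otimes> x \<in> P"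
proof -
  have c: "x \<in> carrier M" "w \<in> carrier M" "\<gamma> \<in> carrier M" using x w L_carrier by auto
  define s where "s a = \<one> [^] a \<otimes> (w [^] a \<otimes> x \<otimes> w [^] (q - a))" for a :: nat
  have sc: "s a \<in> carrier M" for a unfolding s_def using c by simp
  have one: "s a \<ominus> \<gamma> \<otimes> x \<in> P" if a: "a \<le> q" for a
  proof -
    have wa: "w [^] a \<in> carrier M" "w [^] (q - a) \<in> carrier M" using c by auto
    have wg: "w [^] a \<otimes> w [^] (q - a) = \<gamma>" using a w(2) nat_pow_mult[OF c(2), of a "q - a"] by simp
    have "w [^] a \<otimes> (x \<otimes> w [^] (q - a) \<ominus> w [^] (q - a) \<otimes> x) =
        w [^] a \<otimes> x \<otimes> w [^] (q - a) \<ominus> (w [^] a \<otimes> w [^] (q - a)) \<otimes> x"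
      using c(1) wa by algebra
    then have "s a \<ominus> \<gamma> \<otimes> x = w [^] a \<otimes> (x \<otimes> w [^] (q - a) \<ominus> w [^] (q - a) \<otimes> x)"
      unfolding s_def wg using c wa by simp
    then show ?thesis using P_lmult[OF x(2)[OF L_pow[OF w(1)]] L_pow[OF w(1)]] by simp
  qed
  have "(\<Oplus>a\<in>{..<m}. s a) \<ominus> ([m] \<cdot> \<one> \<otimes> \<gamma>) \<otimes> x \<in> P" if "m \<le> q" for m
    using that
  proof (induction m)
    case 0
    then show ?case using P_zero c by (simp add: minus_eq)
  next
    case (Suc m)
    have S: "(\<Oplus>a\<in>{..<Suc m}. s a) = s m \<oplus> (\<Oplus>a\<in>{..<m}. s a)"
      unfolding lessThan_Suc using sc by (intro finsum_insert) auto
    define r where "r = [m] \<cdot> \<one>"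
    have r: "r \<in> carrier M" unfolding r_def by simp
    have rS: "[Suc m] \<cdot> \<one> = r \<oplus> \<one>" unfolding r_def by (rule add.nat_pow_Suc)
    have Sc: "(\<Oplus>a\<in>{..<m}. s a) \<in> carrier M" using sc by (intro finsum_closed) auto
    have "(\<Oplus>a\<in>{..<Suc m}. s a) \<ominus> ([Suc m] \<cdot> \<one> \<otimes> \<gamma>) \<otimes> x =
        (s m \<ominus> \<gamma> \<otimes> x) \<oplus> ((\<Oplus>a\<in>{..<m}. s a) \<ominus> (r \<otimes> \<gamma>) \<otimes> x)"
      unfolding S rS using sc[of m] Sc c r by algebra
    then show ?case using P_add[OF one[of m]] Suc unfolding r_def by simp
  qed
  then show ?thesis unfolding avg_def s_def by blast
qed

text \<open>The two averages with trivial weights multiply \<open>z\<close> by \<open>\<kappa>\<close> modulo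
  \<open>P\<close>, since \<open>z\<close> is central there, but they also extract the constant term multiplied
  by \<open>\<kappa>\<close>. As \<open>\<kappa>\<close> is a unit, \<open>z\<close> is congruent to its
  constant coefficient.\<close>
theorem central_mod_P:
  assumes z: "z \<in> \<Lambda>" "\<And>b. b \<in> \<Lambda> \<Longrightarrow> z \<otimes> b \<ominus> b \<otimes> z \<in> P"
  shows "\<exists>c\<in>Q. z \<ominus> c \<in> P"
proof -
  obtain c where c: "c \<in> idx \<rightarrow> Q" "z = comb c" using z(1) unfolding combs_def by blast
  have 00: "(0, 0) \<in> idx" using q by (simp add: idx_def)
  have zc: "z \<in> carrier M" using L_carrier[OF z(1)] .
  have c00: "c (0, 0) \<in> Q" using funcset_mem[OF c(1) 00] .
  define r where "r = [q] \<cdot> \<one>"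
  have r: "r \<in> Z" "r \<in> carrier M" unfolding r_def by simp_all
  have rQ: "r \<in> Q" unfolding r_def
  proof -
    have "[n] \<cdot> \<one> \<in> Q" for n :: nat by (induction n) (auto simp: add.nat_pow_Suc)
    then show "[q] \<cdot> \<one> \<in> Q" .
  qed
  have ra: "r \<otimes> \<alpha> \<in> Q" using rQ \<alpha>_unit(1) by simp
  let ?x = "(r \<otimes> \<alpha>) \<otimes> z"
  have xL: "?x \<in> \<Lambda>" by (intro L_closed(3) subsetD[OF Q_sub_L ra] z(1))
  define y where "y = avg u \<one> z"
  have yP: "y \<ominus> ?x \<in> P" unfolding y_def r_def by (rule avg_central_mod[OF z uv_\<Lambda>(1) upow \<alpha>_unit(1)])
  have yc: "y \<in> carrier M" unfolding y_def using zc by simp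
  have xc: "?x \<in> carrier M" using L_carrier[OF xL] .
  have xcen: "?x \<otimes> b \<ominus> b \<otimes> ?x \<in> P" if b: "b \<in> \<Lambda>" for b
  proof -
    have bc: "b \<in> carrier M" using L_carrier[OF b] .
    have "?x \<otimes> b \<ominus> b \<otimes> ?x = (r \<otimes> \<alpha>) \<otimes> (z \<otimes> b \<ominus> b \<otimes> z)"
      using left_comm[OF Q_Z[OF ra] bc zc] bc zc Q_carrier[OF ra] by (simp add: m_assoc r_distr r_minus minus_eq)
    then show ?thesis using P_lmult[OF z(2)[OF b]] ra Q_sub_L by auto
  qed
  have "avg v \<one> ?x \<ominus> (r \<otimes> \<beta>) \<otimes> ?x \<in> P"
    unfolding r_def by (rule avg_central_mod[OF xL[unfolded r_def] xcen[unfolded r_def] uv_\<Lambda>(2) vpow \<beta>_unit(1)])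
  moreover have "avg v \<one> (y \<ominus> ?x) \<in> P"
    by (rule ideal_avg[OF _ P_zero P_add P_lmult P_rmult uv_\<Lambda>(2) L_closed(2) yP]) (use P_sub L_carrier in auto)
  ultimately have "avg v \<one> (y \<ominus> ?x) \<oplus> (avg v \<one> ?x \<ominus> (r \<otimes> \<beta>) \<otimes> ?x) \<in> P" by (intro P_add)
  moreover have "avg v \<one> y = avg v \<one> (y \<ominus> ?x) \<oplus> avg v \<one> ?x"
    using avg_add[of v \<one> "y \<ominus> ?x" ?x] yc xc by (simp add: minus_eq a_assoc l_neg)
  ultimately have P1: "avg v \<one> y \<ominus> (r \<otimes> \<beta>) \<otimes> ?x \<in> P" using yc xc r by (simp add: minus_eq a_assoc)
  have "avg v \<one> y = proj 0 0 z" unfolding proj_def y_def by (simp add: \<zeta>q)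
  also have "\<dots> = \<kappa> \<otimes> c (0, 0)"
    using proj_comb[OF Pi_Q_Z[OF c(1)] 00] c(2) c00 by (simp add: mon_def)
  finally have "avg v \<one> y = \<kappa> \<otimes> c (0, 0)" .
  moreover have "(r \<otimes> \<beta>) \<otimes> ?x = \<kappa> \<otimes> z" unfolding \<kappa>_def r_def[symmetric] using r zc by (simp add: m_assoc)
  ultimately have P2: "\<kappa> \<otimes> c (0, 0) \<ominus> \<kappa> \<otimes> z \<in> P" using P1 by simp
  obtain k where k: "k \<in> Q" "k \<otimes> \<kappa> = \<one>" using \<kappa>_unit by blast
  have "k \<otimes> (\<kappa> \<otimes> c (0, 0) \<ominus> \<kappa> \<otimes> z) \<in> P" using k(1) Q_sub_L by (intro P_lmult[OF P2]) auto
  moreover have "k \<otimes> (\<kappa> \<otimes> c (0, 0) \<ominus> \<kappa> \<otimes> z) = (k \<otimes> \<kappa>) \<otimes> c (0, 0) \<ominus> (k \<otimes> \<kappa>) \<otimes> z"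
    using k(1) c00 zc by (simp add: r_distr r_minus minus_eq m_assoc)
  ultimately have "c (0, 0) \<ominus> z \<in> P" using k c00 zc by simp
  then have "\<ominus> (c (0, 0) \<ominus> z) \<in> P" by (rule P_minus)
  moreover have "\<ominus> (c (0, 0) \<ominus> z) = z \<ominus> c (0, 0)" using c00 zc by (simp add: minus_eq minus_add a_comm)
  ultimately show ?thesis using c00 by auto
qed

end

section \<open>The maximal order and its residue algebra\<close>

context valuation_order
begin

lemma coset_eq_iff: "x \<in> L \<Longrightarrow> y \<in> L \<Longrightarrow> P +>\<^bsub>B\<^esub> x = P +>\<^bsub>B\<^esub> y \<longleftrightarrow> x \<ominus> y \<in> P"
proof -
  assume x: "x \<in> L" and y: "y \<in> L"
  interpret B: ring B by (rule B_ring)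
  have "\<ominus>\<^bsub>B\<^esub> y = \<ominus> y"
    by (rule B.minus_equality) (use y L_closed(5)[OF y] in \<open>auto simp: l_neg\<close>)
  then have "x \<ominus>\<^bsub>B\<^esub> y = x \<ominus> y" by (simp add: minus_eq B.minus_eq)
  then show ?thesis
    using B.quotient_eq_iff_same_a_r_cos[OF P_ideal, of x y] x y by simp
qed

text \<open>The scalars are central, and the hypothesis says that nothing else is.\<close>
lemma center_residue_algebra:
  assumes C: "\<And>z. z \<in> L \<Longrightarrow> \<forall>b\<in>L. z \<otimes> b \<ominus> b \<otimes> z \<in> P \<Longrightarrow> \<exists>c\<in>Q. z \<ominus> c \<in> P"
  shows "ring_center (B Quot P) = (\<lambda>c. P +>\<^bsub>B\<^esub> c) ` Q"
proof -
  have carr: "carrier (B Quot P) = (\<lambda>x. P +>\<^bsub>B\<^esub> x) ` L" using carrier_FactRing[of B P] by simp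
  have mult: "(P +>\<^bsub>B\<^esub> x) \<otimes>\<^bsub>B Quot P\<^esub> (P +>\<^bsub>B\<^esub> y) = P +>\<^bsub>B\<^esub> (x \<otimes> y)" if "x \<in> L" "y \<in> L" for x y
    using ideal.rcoset_mult_add[OF P_ideal, of x y] that by (simp add: FactRing_def)
  show ?thesis
  proof
    show "ring_center (B Quot P) \<subseteq> (\<lambda>c. P +>\<^bsub>B\<^esub> c) ` Q"
    proof
      fix W assume W: "W \<in> ring_center (B Quot P)"
      then obtain z where z: "z \<in> L" "W = P +>\<^bsub>B\<^esub> z" unfolding ring_center_def carr by blast
      have "z \<otimes> b \<ominus> b \<otimes> z \<in> P" if b: "b \<in> L" for b
      proof -
        have "W \<otimes>\<^bsub>B Quot P\<^esub> (P +>\<^bsub>B\<^esub> b) = (P +>\<^bsub>B\<^esub> b) \<otimes>\<^bsub>B Quot P\<^esub> W"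
          using W b unfolding ring_center_def carr by blast
        then show ?thesis
          unfolding z(2) mult[OF z(1) b] mult[OF b z(1)] coset_eq_iff[OF L_closed(3)[OF z(1) b] L_closed(3)[OF b z(1)]] .
      qed
      then obtain c where c: "c \<in> Q" "z \<ominus> c \<in> P" using C[OF z(1)] by blast
      then have "W = P +>\<^bsub>B\<^esub> c" unfolding z(2) using coset_eq_iff[OF z(1), of c] Q_sub_L by blast
      then show "W \<in> (\<lambda>c. P +>\<^bsub>B\<^esub> c) ` Q" using c(1) by blast
    qed
    show "(\<lambda>c. P +>\<^bsub>B\<^esub> c) ` Q \<subseteq> ring_center (B Quot P)"
    proof
      fix W assume "W \<in> (\<lambda>c. P +>\<^bsub>B\<^esub> c) ` Q"
      then obtain c where c: "c \<in> Q" "W = P +>\<^bsub>B\<^esub> c" by blast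
      have cL: "c \<in> L" using c Q_sub_L by blast
      have "W \<otimes>\<^bsub>B Quot P\<^esub> T = T \<otimes>\<^bsub>B Quot P\<^esub> W" if T: "T \<in> carrier (B Quot P)" for T
      proof -
        obtain b where b: "b \<in> L" "T = P +>\<^bsub>B\<^esub> b" using T unfolding carr by blast
        show ?thesis
          unfolding c(2) b(2) mult[OF cL b(1)] mult[OF b(1) cL] central[OF Q_Z[OF c(1)] L_carrier[OF b(1)]] ..
      qed
      then show "W \<in> ring_center (B Quot P)" unfolding ring_center_def carr using c(2) cL by blast
    qed
  qed
qed

lemma maximal_order_unique:
  assumes A: "maximal_order F W M \<epsilon> A" and Q: "\<epsilon> ` W = Q" and Z: "\<epsilon> ` carrier F = Z"
    and fg: "set Us \<subseteq> carrier M" "L = Span Q Us" and full: "set Us' \<subseteq> L" "Span Z Us' = carrier M"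
  shows "A = L"
proof -
  have "is_order F W M \<epsilon> A" using A by (simp add: maximal_order_def)
  then obtain Vs where "subring A M" "set Vs \<subseteq> carrier M" "A = Span Q Vs" unfolding is_order_def Q by blast
  then have sub: "A \<subseteq> L" by (rule order_sub_L)
  have "is_order F W M \<epsilon> L"
    unfolding is_order_def Q Z
  proof (intro conjI)
    show "\<exists>Us. set Us \<subseteq> carrier M \<and> L = Span Q Us" using fg by blast
    show "\<exists>Us. set Us \<subseteq> L \<and> Span Z Us = carrier M" using full by blast
  qed (rule L_subring, rule Q_sub_L)
  then show ?thesis using A sub unfolding maximal_order_def by blast
qed

end

lemma (in ring) Span_one:
  assumes "subring Q R"
  shows "Span Q [\<one>] = Q"
proof -
  have Q: "k \<in> carrier R" if "k \<in> Q" for k using that subringE(1)[OF assms] by blast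
  have "x \<in> Span Q [\<one>] \<longleftrightarrow> (\<exists>k\<in>Q. \<exists>y\<in>{\<zero>}. x = k \<otimes> \<one> \<oplus> y)" for x
    using line_extension_mem_iff[of x Q \<one> "{\<zero>}"] by simp
  then show ?thesis using Q by auto
qed

section \<open>Ramification at a point where the first entry is a unit\<close>

context codim1_point
begin

abbreviation "F \<equiv> completion K v"
abbreviation "\<iota> \<equiv> completion_map K v"
abbreviation "VF \<equiv> completed_subring K v V"

lemma valuation_ring_eq: "discretely_valued_field.V K v = V"
proof -
  interpret v: discretely_valued_field K v \<pi> by (rule valuation_discrete)
  have z: "\<zero> \<in> V" using subringE(2)[OF V_subring] .
  have c: "x \<in> V \<Longrightarrow> x \<in> carrier K" for x using subringE(1)[OF V_subring] by blast
  have "x \<in> v.V \<longleftrightarrow> x \<in> V" for x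
    using V_valuation_iff[of x] z c by (cases "x = \<zero>") (auto simp: v.V_def v.ge_def)
  then show ?thesis by blast
qed

lemmas completion_facts =
  discretely_valued_field.F_field[OF valuation_discrete]
  discretely_valued_field.\<iota>_hom[OF valuation_discrete]
  discretely_valued_field.completion_complete_dvr[OF valuation_discrete, unfolded valuation_ring_eq]

lemmas VF_approx = discretely_valued_field.VF_approx[OF valuation_discrete, unfolded valuation_ring_eq]

lemma \<iota>_V: "a \<in> V \<Longrightarrow> \<iota> a \<in> VF"
  using discretely_valued_field.\<iota>_V[OF valuation_discrete] unfolding valuation_ring_eq .

text \<open>The order is \<open>L\<close>, and the centre of its residue algebra consists of the classes of
  \<open>V\<close>. By \<open>VF_approx\<close> these are the classes of elements of the stalk. The map in the
  definition of ramification takes the unique class occurring in the image of a coset.\<close>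
lemma trivial_of_valuation_order:
  fixes E :: "('e, 'n) ring_scheme"
  defines "Z \<equiv> \<lambda>\<epsilon>. \<epsilon> ` carrier F" and "Q \<equiv> \<lambda>\<epsilon>. \<epsilon> ` VF"
  assumes VO: "valuation_order E (Z \<epsilon>) (Q \<epsilon>) (\<epsilon> (\<iota> \<pi>)) L" and \<epsilon>: "\<epsilon> \<in> ring_hom F E"
    and C: "\<And>z. z \<in> L \<Longrightarrow> \<forall>b\<in>L. z \<otimes>\<^bsub>E\<^esub> b \<ominus>\<^bsub>E\<^esub> b \<otimes>\<^bsub>E\<^esub> z \<in> order_over_dvr.P E (\<epsilon> (\<iota> \<pi>)) L \<Longrightarrow>
      \<exists>c\<in>Q \<epsilon>. z \<ominus>\<^bsub>E\<^esub> c \<in> order_over_dvr.P E (\<epsilon> (\<iota> \<pi>)) L"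
    and fg: "set Us \<subseteq> carrier E" "L = ring.Span E (Q \<epsilon>) Us"
    and full: "set Us' \<subseteq> L" "ring.Span E (Z \<epsilon>) Us' = carrier E"
    and T: "maximal_order F VF E \<epsilon> T"
    and J: "J = jacobson_radical (E\<lparr>carrier := T\<rparr>)" and N: "N = E\<lparr>carrier := T\<rparr> Quot J"
  shows "trivial_extension (residue_field K R p) (N\<lparr>carrier := ring_center N\<rparr>)
    (\<lambda>C. the_elem ((\<lambda>a. J +>\<^bsub>E\<lparr>carrier := T\<rparr>\<^esub> \<epsilon> (\<iota> a)) ` C))"
proof -
  interpret L: valuation_order E "Z \<epsilon>" "Q \<epsilon>" "\<epsilon> (\<iota> \<pi>)" L by (rule VO)
  have TL: "T = L" by (rule L.maximal_order_unique[OF T _ _ fg full]) (simp_all add: Q_def Z_def)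
  have JP: "J = L.P" unfolding J TL by (rule L.jacobson_radical_L)
  let ?c = "\<lambda>x. L.P +>\<^bsub>L.B\<^esub> x"
  have center: "ring_center N = ?c ` Q \<epsilon>"
    unfolding N TL JP by (rule L.center_residue_algebra[OF C])
  define h where "h = (\<lambda>a. \<epsilon> (\<iota> a))"
  have h: "h \<in> ring_hom K E" unfolding h_def using ring_hom_trans[OF completion_facts(2) \<epsilon>] by (simp add: comp_def)
  have hQ: "h a \<in> Q \<epsilon>" if "a \<in> V" for a unfolding h_def Q_def using \<iota>_V[OF that] by (rule imageI)
  have hL: "h a \<in> L" if "a \<in> V" for a using hQ[OF that] L.Q_sub_L by blast
  have Vc: "x \<in> V \<Longrightarrow> x \<in> carrier K" for x using subringE(1)[OF V_subring] by blast
  have hc: "h x \<in> carrier E" if "x \<in> carrier K" for x using ring_hom_closed[OF h that] .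
  have \<mm>V: "m \<in> \<mm> \<Longrightarrow> m \<in> V" for m unfolding \<mm>_eq using subringE(6)[OF V_subring] \<pi>(1) by blast
  have coset: "(\<lambda>a. ?c (h a)) ` (\<mm> +>\<^bsub>B\<^esub> x) = {?c (h x)}" if x: "x \<in> V" for x
  proof -
    have mem: "a \<in> \<mm> +>\<^bsub>B\<^esub> x \<longleftrightarrow> (\<exists>m\<in>\<mm>. a = m \<oplus> x)" for a by (auto simp: a_r_coset_def r_coset_def)
    have same: "?c (h a) = ?c (h x)" if a: "a \<in> \<mm> +>\<^bsub>B\<^esub> x" for a
    proof -
      obtain m where m: "m \<in> \<mm>" "a = m \<oplus> x" using a unfolding mem by blast
      obtain r where r: "r \<in> V" "m = r \<otimes> \<pi>" using m(1) unfolding \<mm>_eq by blast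
      have mV: "m \<in> V" by (rule \<mm>V[OF m(1)])
      have aV: "a \<in> V" unfolding m(2) by (rule subringE(7)[OF V_subring mV x])
      have "h a = h m \<oplus>\<^bsub>E\<^esub> h x" unfolding m(2) using ring_hom_add[OF h Vc[OF mV] Vc[OF x]] .
      then have "h a \<ominus>\<^bsub>E\<^esub> h x = h m"
        using hc[OF Vc[OF mV]] hc[OF Vc[OF x]] by (simp add: L.minus_eq L.a_assoc L.r_neg)
      also have "h m = h \<pi> \<otimes>\<^bsub>E\<^esub> h r"
        unfolding r(2) using ring_hom_mult[OF h \<pi>_carrier Vc[OF r(1)]] m_comm[OF \<pi>_carrier Vc[OF r(1)]] by simp
      finally have "h a \<ominus>\<^bsub>E\<^esub> h x \<in> L.P" unfolding L.P_def h_def using hL[OF r(1)] by (simp add: h_def)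
      then show ?thesis using L.coset_eq_iff[OF hL[OF aV] hL[OF x]] by blast
    qed
    have "\<zero> \<in> \<mm>" unfolding \<mm>_eq using subringE(2)[OF V_subring] \<pi>_carrier by (intro bexI[of _ \<zero>]) auto
    then have "x \<in> \<mm> +>\<^bsub>B\<^esub> x" unfolding mem using Vc[OF x] by (intro bexI[of _ \<zero>]) auto
    then show ?thesis using same by blast
  qed
  have "(\<lambda>C. the_elem ((\<lambda>a. ?c (h a)) ` C)) ` carrier (residue_field K R p) = (\<lambda>x. ?c (h x)) ` V"
    unfolding residue_field_def carrier_FactRing image_image using coset by (intro image_cong) auto
  also have "\<dots> = ?c ` Q \<epsilon>"
  proof
    show "(\<lambda>x. ?c (h x)) ` V \<subseteq> ?c ` Q \<epsilon>" using hQ by blast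
    show "?c ` Q \<epsilon> \<subseteq> (\<lambda>x. ?c (h x)) ` V"
    proof
      fix W assume "W \<in> ?c ` Q \<epsilon>"
      then obtain t where t: "t \<in> VF" "W = ?c (\<epsilon> t)" unfolding Q_def by blast
      obtain a d where ad: "a \<in> V" "d \<in> VF" "t = \<iota> a \<oplus>\<^bsub>F\<^esub> \<iota> \<pi> [^]\<^bsub>F\<^esub> (1::nat) \<otimes>\<^bsub>F\<^esub> d"
        using VF_approx[OF t(1), of 1] by blast
      interpret D: complete_dvr F "carrier F" VF "\<iota> \<pi>" by (rule completion_facts(3))
      have Fc: "\<iota> a \<in> carrier F" "\<iota> \<pi> \<in> carrier F" "d \<in> carrier F"
        using ring_hom_closed[OF completion_facts(2)] Vc[OF ad(1)] \<pi>_carrier D.Q_sub_Z ad(2) by auto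
      have dL: "\<epsilon> d \<in> L" using ad(2) L.Q_sub_L unfolding Q_def by blast
      have tL: "\<epsilon> t \<in> L" using t(1) L.Q_sub_L unfolding Q_def by blast
      have "\<epsilon> t = h a \<oplus>\<^bsub>E\<^esub> h \<pi> \<otimes>\<^bsub>E\<^esub> \<epsilon> d"
        unfolding ad(3) h_def using Fc ring_hom_add[OF \<epsilon> Fc(1), of "\<iota> \<pi> \<otimes>\<^bsub>F\<^esub> d"] ring_hom_mult[OF \<epsilon> Fc(2,3)]
        by simp
      moreover have "h a \<oplus>\<^bsub>E\<^esub> y \<ominus>\<^bsub>E\<^esub> h a = y" if "y \<in> carrier E" for y
        using that hc[OF Vc[OF ad(1)]] L.a_comm[of "h a" y] by (simp add: L.minus_eq L.a_assoc L.r_neg)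
      moreover have "h \<pi> \<otimes>\<^bsub>E\<^esub> \<epsilon> d \<in> carrier E" using hc[OF \<pi>_carrier] L.L_carrier[OF dL] by simp
      ultimately have "\<epsilon> t \<ominus>\<^bsub>E\<^esub> h a = h \<pi> \<otimes>\<^bsub>E\<^esub> \<epsilon> d" by simp
      then have "\<epsilon> t \<ominus>\<^bsub>E\<^esub> h a \<in> L.P" unfolding L.P_def h_def using dL by simp
      then have "W = ?c (h a)" unfolding t(2) using L.coset_eq_iff[OF tL hL[OF ad(1)]] by blast
      then show "W \<in> (\<lambda>x. ?c (h x)) ` V" using ad(1) by blast
    qed
  qed
  finally show ?thesis
    unfolding trivial_extension_def by (simp add: center TL JP h_def)
qed

lemma multiple_\<mm>: "r \<in> V \<Longrightarrow> r \<otimes> \<pi> \<in> \<mm>" unfolding \<mm>_eq by blast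

lemma valuation_zero_unit:
  assumes "x \<in> V" "x \<noteq> \<zero>" "v x = 0"
  shows "x \<notin> \<mm>"
proof
  interpret v: discretely_valued_field K v \<pi> by (rule valuation_discrete)
  assume "x \<in> \<mm>"
  then obtain r where r: "r \<in> V" "x = r \<otimes> \<pi>" unfolding \<mm>_eq by blast
  have rc: "r \<in> carrier K" using r(1) subringE(1)[OF V_subring] by blast
  have r0: "r \<noteq> \<zero>" using assms(2) r(2) \<pi>_carrier by auto
  have "v x = v r + 1" unfolding r(2) using v.v_mult[OF rc \<pi>_carrier r0 \<pi>(2)] v.\<pi>(3) by simp
  then show False using V_valuation_iff[OF rc r0] r(1) assms(3) by simp
qed

text \<open>Modulo the uniformizer, which divides \<open>\<beta>\<close>, \<open>\<alpha>\<close> is a power of a unit, and Hensel's lemma lifts the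
  root.\<close>
lemma power_in_completion:
  assumes \<alpha>: "\<alpha> \<in> V" "\<alpha> \<notin> \<mm>" and pm: "power_modulo K R (Suc m) \<alpha> \<beta>"
    and c: "c \<in> V" "c \<otimes> [Suc m] \<cdot> \<one> = \<one>" and nonunit: "\<beta> \<in> \<mm>"
  shows "\<exists>a\<in>carrier F. a [^]\<^bsub>F\<^esub> Suc m = \<iota> \<alpha>"
proof -
  from nonunit obtain r where r: "r \<in> V" "\<beta> = r \<otimes> \<pi>" unfolding \<mm>_eq by blast
  obtain s x where s: "s \<in> R" "x \<in> R" "\<alpha> \<ominus> s [^] Suc m = x \<otimes> \<beta>"
    using pm unfolding power_modulo_def cgenideal_def by auto
  have Vc: "y \<in> V \<Longrightarrow> y \<in> carrier K" for y using subringE(1)[OF V_subring] by blast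
  note mult = subringE(6)[OF V_subring] and add = subringE(7)[OF V_subring]
  have sV: "s \<in> V" "x \<in> V" using s R_sub_V by auto
  have sk: "s [^] k \<in> V" for k :: nat
    by (induction k) (use sV mult subringE(3)[OF V_subring] in auto)
  note cs = Vc[OF \<alpha>(1)] Vc[OF r(1)] Vc[OF sV(1)] Vc[OF sV(2)] \<pi>_carrier Vc[OF sk]
  have \<alpha>_eq: "\<alpha> = s [^] Suc m \<oplus> \<pi> \<otimes> (x \<otimes> r)"
  proof -
    have "\<alpha> = s [^] Suc m \<oplus> (\<alpha> \<ominus> s [^] Suc m)"
      using cs(1) cs(6)[of "Suc m"] a_comm[of "\<alpha> \<ominus> s [^] Suc m" "s [^] Suc m"]
      by (simp add: minus_eq a_assoc l_neg del: nat_pow_Suc)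
    also have "x \<otimes> \<beta> = \<pi> \<otimes> (x \<otimes> r)" unfolding r(2) using cs by (simp add: m_ac)
    ultimately show ?thesis unfolding s(3) by simp
  qed
  have "s \<notin> \<mm>"
  proof
    assume "s \<in> \<mm>"
    then obtain t where t: "t \<in> V" "s = t \<otimes> \<pi>" unfolding \<mm>_eq by blast
    have "s [^] Suc m = s [^] m \<otimes> t \<otimes> \<pi>"
      using cs(6)[of m] Vc[OF t(1)] \<pi>_carrier by (subst nat_pow_Suc) (subst (2) t(2), simp add: m_assoc)
    then have "\<alpha> = (s [^] m \<otimes> t \<oplus> x \<otimes> r) \<otimes> \<pi>"
      using \<alpha>_eq cs(6)[of m] Vc[OF t(1)] cs(2,4,5) m_comm[of \<pi> "x \<otimes> r"] by (simp add: l_distr del: nat_pow_Suc)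
    moreover have "s [^] m \<otimes> t \<oplus> x \<otimes> r \<in> V" by (intro add mult sk t(1) sV(2) r(1))
    ultimately show False using multiple_\<mm> \<alpha>(2) by simp
  qed
  then have inv: "s \<noteq> \<zero>" "inv s \<in> V" "inv s \<otimes> s = \<one>"
    using unit_V[OF sV(1)] Units_l_inv field_Units cs(3) by auto
  interpret F: field F by (rule completion_facts(1))
  note \<iota> = completion_facts(2)
  note \<iota>_mult = ring_hom_mult[OF \<iota>] and \<iota>_add = ring_hom_add[OF \<iota>] and \<iota>_one = ring_hom_one[OF \<iota>]
  have "\<iota> c \<otimes>\<^bsub>F\<^esub> ([Suc m] \<cdot>\<^bsub>F\<^esub> \<one>\<^bsub>F\<^esub>) = \<one>\<^bsub>F\<^esub>"
  proof -
    have "\<iota> ([Suc m] \<cdot> \<one>) = [Suc m] \<cdot>\<^bsub>F\<^esub> \<one>\<^bsub>F\<^esub>"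
      using ring_hom_add_pow[OF \<iota> ring_axioms F.ring_axioms one_closed, of "Suc m"] \<iota>_one by simp
    then show ?thesis using \<iota>_mult[OF Vc[OF c(1)], of "[Suc m] \<cdot> \<one>"] c(2) \<iota>_one by simp
  qed
  moreover have "\<iota> (inv s) \<otimes>\<^bsub>F\<^esub> \<iota> s = \<one>\<^bsub>F\<^esub>"
    using \<iota>_mult[OF Vc[OF inv(2)] cs(3)] inv(3) \<iota>_one by simp
  moreover have "\<iota> \<alpha> = \<iota> s [^]\<^bsub>F\<^esub> Suc m \<oplus>\<^bsub>F\<^esub> \<iota> \<pi> \<otimes>\<^bsub>F\<^esub> \<iota> (x \<otimes> r)"
    unfolding \<alpha>_eq
    using \<iota>_add[OF cs(6)[of "Suc m"], of "\<pi> \<otimes> (x \<otimes> r)"] \<iota>_mult[OF cs(5), of "x \<otimes> r"] cs(2,4,5)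
      ring_hom_nat_pow[OF \<iota> ring_axioms F.ring_axioms cs(3), of "Suc m"] by (simp del: nat_pow_Suc F.nat_pow_Suc)
  ultimately show "\<exists>a\<in>carrier F. a [^]\<^bsub>F\<^esub> Suc m = \<iota> \<alpha>"
    using \<iota>_V c(1) sV(1) inv(2) mult[OF sV(2) r(1)]
    by (intro hensel_root[OF completion_facts(1,3)]) auto
qed

text \<open>In the first case of the dichotomy the order is the completed stalk, in the second it is
  \<open>\<Lambda>\<close>. The second case needs \<open>\<beta>\<close> to be a unit, and
  \<open>power_in_completion\<close> would contradict \<open>not_power\<close> if it were not.\<close>
theorem symbol_ramification_trivial:
  assumes q: "Factorial_Ring.prime q" and \<alpha>: "\<alpha> \<in> R" "\<alpha> \<noteq> \<zero>" and \<beta>: "\<beta> \<in> R" "\<beta> \<noteq> \<zero>"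
    and qR: "nat_invertible A q" and \<zeta>: "primitive_root_of_unity A q \<zeta>"
    and pm: "power_modulo K R q \<alpha> \<beta>" and v0: "v \<alpha> = 0"
    and ram: "is_ramification K R p (symbol_algebra K q \<zeta> \<alpha> \<beta>) (symbol_map K q \<zeta> \<alpha> \<beta>) L \<phi>"
  shows "trivial_extension (residue_field K R p) L \<phi>"
proof -
  have q1: "1 < q" using q prime_gt_1_nat by blast
  have Vc: "y \<in> V \<Longrightarrow> y \<in> carrier K" for y using subringE(1)[OF V_subring] by blast
  have unit: "\<exists>y\<in>V. y \<otimes> x = \<one>" if x: "x \<in> V" "x \<notin> \<mm>" for x
    using unit_V[OF x] Units_l_inv[of x] field_Units Vc[OF x(1)] by (intro bexI[of _ "inv x"]) auto
  have \<alpha>\<mm>: "\<alpha> \<notin> \<mm>" by (rule valuation_zero_unit[OF R_sub_V[OF \<alpha>(1)] \<alpha>(2) v0])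
  have \<zeta>R: "\<zeta> \<in> R" using \<zeta> by (simp add: primitive_root_of_unity_def)
  have \<zeta>K: "primitive_root_of_unity K q \<zeta>"
    using \<zeta> R_carrier unfolding primitive_root_of_unity_def by (simp add: nat_pow_def)
  obtain c where c: "c \<in> R" "c \<otimes> [q] \<cdot> \<one> = \<one>"
    using qR unfolding nat_invertible_def Units_def by (auto simp: add_pow_def nat_pow_def)
  have cV: "c \<in> V" by (rule R_sub_V[OF c(1)])
  have q0: "[q] \<cdot> \<one> \<noteq> \<zero>"
  proof
    assume "[q] \<cdot> \<one> = \<zero>"
    then show False using c Vc[OF cV] by simp
  qed
  from ram obtain D \<delta> and E :: "((letter list \<Rightarrow> 'a) set \<times> (nat \<Rightarrow> 'a) set \<Rightarrow> int) set ring" and \<epsilon> T J N where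
    D: "division_component K (symbol_algebra K q \<zeta> \<alpha> \<beta>) (symbol_map K q \<zeta> \<alpha> \<beta>) (D :: (letter list \<Rightarrow> 'a) set ring) \<delta>"
    and E: "division_component F (tensor_algebra K D \<delta> F \<iota>) (tensor_map K D \<delta> F \<iota>) E \<epsilon>"
    and T: "maximal_order F VF E \<epsilon> T"
    and J: "J = jacobson_radical (E\<lparr>carrier := T\<rparr>)" and N: "N = E\<lparr>carrier := T\<rparr> Quot J"
    and L: "L = N\<lparr>carrier := ring_center N\<rparr>"
    and \<phi>: "\<phi> = (\<lambda>C. the_elem ((\<lambda>a. J +>\<^bsub>E\<lparr>carrier := T\<rparr>\<^esub> \<epsilon> (\<iota> a)) ` C))"
    unfolding is_ramification_def Let_def by blast
  interpret F: field F by (rule completion_facts(1))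
  have cda: "central_division_algebra F E \<epsilon>" using E unfolding division_component_def by simp
  have rE: "ring E" and \<epsilon>: "\<epsilon> \<in> ring_hom F E" using division_component_rings[OF E] by auto
  note center = central_division_algebra_center[OF F.field_axioms cda]
  let ?Z = "\<epsilon> ` carrier F" and ?Q = "\<epsilon> ` VF"
  have dvr: "complete_dvr E ?Z ?Q (\<epsilon> (\<iota> \<pi>))"
    by (rule complete_dvr_image[OF completion_facts(1,3) rE \<epsilon> center(3)])
  have "division_over_dvr E ?Z ?Q (\<epsilon> (\<iota> \<pi>))"
    unfolding division_over_dvr_def division_over_dvr_axioms_def
    using dvr center(2) cda by (auto simp: central_division_algebra_def)
  then interpret E: division_over_dvr E ?Z ?Q "\<epsilon> (\<iota> \<pi>)" .
  have subQ: "subring ?Q E" by (rule E.subring_Q)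
  have subZ: "subring ?Z E" by (rule subfieldE(1)[OF center(1)])
  note trivial = trivial_of_valuation_order[OF _ \<epsilon> _ _ _ _ _ T J N, folded L \<phi>]
  from division_component_dichotomy[OF field_axioms F.field_axioms completion_facts(2) q
      R_carrier[OF \<alpha>(1)] \<alpha>(2) R_carrier[OF \<beta>(1)] \<beta>(2) q0 \<zeta>K D E]
  show ?thesis
  proof
    assume EZ: "carrier E = ?Z"
    show ?thesis
    proof (rule trivial)
      show VO: "valuation_order E ?Z ?Q (\<epsilon> (\<iota> \<pi>)) ?Q" by (rule E.valuation_order_trivial[OF EZ])
      interpret O: valuation_order E ?Z ?Q "\<epsilon> (\<iota> \<pi>)" ?Q by (rule VO)
      show "\<exists>c\<in>?Q. z \<ominus>\<^bsub>E\<^esub> c \<in> O.P" if z: "z \<in> ?Q" for z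
        using z O.P_zero O.L_carrier[OF z] by (intro bexI[of _ z]) (auto simp: E.minus_eq E.r_neg)
      show "set [\<one>\<^bsub>E\<^esub>] \<subseteq> carrier E" by simp
      show "?Q = E.Span ?Q [\<one>\<^bsub>E\<^esub>]" by (rule E.Span_one[OF subQ, symmetric])
      show "set [\<one>\<^bsub>E\<^esub>] \<subseteq> ?Q" using subringE(3)[OF subQ] by simp
      show "E.Span ?Z [\<one>\<^bsub>E\<^esub>] = carrier E" unfolding EZ by (rule E.Span_one[OF subZ])
    qed
  next
    define h where "h = (\<lambda>a. \<epsilon> (\<iota> a))"
    assume "\<exists>u v. symbol_relations E ?Z u v (\<epsilon> (\<iota> \<zeta>)) (\<epsilon> (\<iota> \<alpha>)) (\<epsilon> (\<iota> \<beta>)) q \<and> generated_by E (?Z \<union> {u, v})"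
    then obtain u v where SR: "symbol_relations E ?Z u v (h \<zeta>) (h \<alpha>) (h \<beta>) q" and gen: "generated_by E (?Z \<union> {u, v})"
      unfolding h_def by blast
    interpret S: symbol_relations E ?Z u v "h \<zeta>" "h \<alpha>" "h \<beta>" q by (rule SR)
    have spans: "carrier E = S.combs ?Z" by (rule S.generated_imp_combs[OF gen])
    have h: "h \<in> ring_hom K E" unfolding h_def using ring_hom_trans[OF completion_facts(2) \<epsilon>] by (simp add: comp_def)
    have hQ: "h a \<in> ?Q" if "a \<in> V" for a unfolding h_def using \<iota>_V[OF that] by (rule imageI)
    have h_unit: "\<exists>y\<in>?Q. y \<otimes>\<^bsub>E\<^esub> h x = \<one>\<^bsub>E\<^esub>" if x: "x \<in> V" "y \<in> V" "y \<otimes> x = \<one>" for x y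
      using ring_hom_mult[OF h Vc[OF x(2)] Vc[OF x(1)]] ring_hom_one[OF h] x(3) hQ[OF x(2)]
      by (intro bexI[of _ "h y"]) auto
    have not_power: "a [^]\<^bsub>E\<^esub> q \<noteq> h \<alpha>" if "a \<in> ?Z" for a
      by (rule S.not_power[OF _ q1 that]) (use E.no_zero_divisors in blast)
    have \<beta>\<mm>: "\<beta> \<notin> \<mm>"
    proof
      assume "\<beta> \<in> \<mm>"
      moreover obtain m where m: "q = Suc m" using q1 by (cases q) auto
      ultimately obtain a where a: "a \<in> carrier F" "a [^]\<^bsub>F\<^esub> q = \<iota> \<alpha>"
        using power_in_completion[OF R_sub_V[OF \<alpha>(1)] \<alpha>\<mm>, of m \<beta> c] pm cV c(2) unfolding m by blast
      then show False
        using not_power[of "\<epsilon> a"] ring_hom_nat_pow[OF \<epsilon> F.ring_axioms rE a(1), of q] by (simp add: h_def)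
    qed
    have "symbol_over_dvr E ?Z u v (h \<zeta>) (h \<alpha>) (h \<beta>) q ?Q (h \<pi>)"
      unfolding symbol_over_dvr_def symbol_over_dvr_axioms_def
    proof (intro conjI)
      show "symbol_relations E ?Z u v (h \<zeta>) (h \<alpha>) (h \<beta>) q" by (rule SR)
      show "division_over_dvr E ?Z ?Q (h \<pi>)" unfolding h_def by (rule E.division_over_dvr_axioms)
      show "carrier E = S.combs ?Z" by (rule spans)
      show "h \<zeta> \<in> ?Q" "h \<alpha> \<in> ?Q" "h \<beta> \<in> ?Q" using hQ R_sub_V \<zeta>R \<alpha>(1) \<beta>(1) by auto
      show "\<exists>a\<in>?Q. a \<otimes>\<^bsub>E\<^esub> h \<alpha> = \<one>\<^bsub>E\<^esub>" using unit[OF R_sub_V[OF \<alpha>(1)] \<alpha>\<mm>] h_unit[OF R_sub_V[OF \<alpha>(1)]] by blast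
      show "\<exists>a\<in>?Q. a \<otimes>\<^bsub>E\<^esub> h \<beta> = \<one>\<^bsub>E\<^esub>" using unit[OF R_sub_V[OF \<beta>(1)] \<beta>\<mm>] h_unit[OF R_sub_V[OF \<beta>(1)]] by blast
      have "h ([q] \<cdot> \<one>) = [q] \<cdot>\<^bsub>E\<^esub> \<one>\<^bsub>E\<^esub>"
        using ring_hom_add_pow[OF h ring_axioms rE one_closed, of q] ring_hom_one[OF h] by simp
      then have "h c \<otimes>\<^bsub>E\<^esub> [q] \<cdot>\<^bsub>E\<^esub> \<one>\<^bsub>E\<^esub> = \<one>\<^bsub>E\<^esub>"
        using ring_hom_mult[OF h Vc[OF cV], of "[q] \<cdot> \<one>"] ring_hom_one[OF h] c(2) by simp
      then show "\<exists>c\<in>?Q. c \<otimes>\<^bsub>E\<^esub> [q] \<cdot>\<^bsub>E\<^esub> \<one>\<^bsub>E\<^esub> = \<one>\<^bsub>E\<^esub>" using hQ[OF cV] by blast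
    qed
    then interpret S: symbol_over_dvr E ?Z u v "h \<zeta>" "h \<alpha>" "h \<beta>" q ?Q "h \<pi>" .
    let ?Us = "map (\<lambda>n. S.mon (n div q) (n mod q)) [0..<q * q]"
    show ?thesis
    proof (rule trivial)
      show "valuation_order E ?Z ?Q (\<epsilon> (\<iota> \<pi>)) (S.combs ?Q)" using S.valuation_order_\<Lambda> unfolding h_def .
      show "\<exists>c\<in>?Q. z \<ominus>\<^bsub>E\<^esub> c \<in> order_over_dvr.P E (\<epsilon> (\<iota> \<pi>)) (S.combs ?Q)"
        if z: "z \<in> S.combs ?Q"
          "\<forall>b\<in>S.combs ?Q. z \<otimes>\<^bsub>E\<^esub> b \<ominus>\<^bsub>E\<^esub> b \<otimes>\<^bsub>E\<^esub> z \<in> order_over_dvr.P E (\<epsilon> (\<iota> \<pi>)) (S.combs ?Q)" for z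
        using S.central_mod_P[OF z(1)] z(2) unfolding h_def by blast
      show "set ?Us \<subseteq> carrier E" by auto
      show "S.combs ?Q = E.Span ?Q ?Us" by (rule S.Span_mons[OF subQ E.Q_sub_Z, symmetric])
      have mL: "S.mon i j \<in> S.combs ?Q" for i j
        unfolding S.mon_def by (intro S.L_closed(3) S.L_pow S.uv_\<Lambda>)
      show "set ?Us \<subseteq> S.combs ?Q" using mL by auto
      show "E.Span ?Z ?Us = carrier E" unfolding spans by (rule S.Span_mons[OF subZ order_refl])
    qed
  qed
qed

end

theorem symbol_ramification_divisor:
  assumes K: "is_quotient_field K R" "regular_domain K R"
    and \<alpha>: "\<alpha> \<in> R" "\<alpha> \<noteq> \<zero>\<^bsub>K\<^esub>" and \<beta>: "\<beta> \<in> R" "\<beta> \<noteq> \<zero>\<^bsub>K\<^esub>"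
    and q: "Factorial_Ring.prime q" "nat_invertible (K\<lparr>carrier := R\<rparr>) q"
      "primitive_root_of_unity (K\<lparr>carrier := R\<rparr>) q \<zeta>" "power_modulo K R q \<alpha> \<beta>"
  shows "ramification_divisor K R (symbol_algebra K q \<zeta> \<alpha> \<beta>) (symbol_map K q \<zeta> \<alpha> \<beta>) \<subseteq> divisor K R \<alpha>"
proof
  fix p assume "p \<in> ramification_divisor K R (symbol_algebra K q \<zeta> \<alpha> \<beta>) (symbol_map K q \<zeta> \<alpha> \<beta>)"
  then obtain L \<phi> where p: "p \<in> codim1_points K R"
    and ram: "is_ramification K R p (symbol_algebra K q \<zeta> \<alpha> \<beta>) (symbol_map K q \<zeta> \<alpha> \<beta>) L \<phi>"
    and nontrivial: "\<not> trivial_extension (residue_field K R p) L \<phi>"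
    unfolding ramification_divisor_def by blast
  interpret codim1_point K R p
    unfolding codim1_point_def codim1_point_axioms_def using K p by (simp add: is_quotient_field_def)
  have "v \<alpha> \<noteq> 0" using symbol_ramification_trivial[OF q(1) \<alpha> \<beta> q(2-4) _ ram] nontrivial by blast
  then show "p \<in> divisor K R \<alpha>" using p by (simp add: divisor_def)
qed

lemma (in ring) minus_one_square_root:
  assumes R: "subring S R" and two: "nat_invertible (R\<lparr>carrier := S\<rparr>) 2" and ne: "\<one> \<noteq> \<zero>"
  shows "primitive_root_of_unity (R\<lparr>carrier := S\<rparr>) 2 (\<ominus> \<one>)"
proof -
  obtain c where c: "c \<in> S" "c \<otimes> (\<one> \<oplus> \<one>) = \<one>"
    using two unfolding nat_invertible_def Units_def by (auto simp: add_pow_def nat_pow_def numeral_2_eq_2)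
  have "\<ominus> \<one> \<noteq> \<one>"
  proof
    assume "\<ominus> \<one> = \<one>"
    then have "\<one> \<oplus> \<one> = \<zero>" using r_neg[OF one_closed] by simp
    then show False using c ne subringE(1)[OF R] by auto
  qed
  then show ?thesis
    unfolding primitive_root_of_unity_def using subringE(3,5)[OF R]
    by (auto simp: nat_pow_def numeral_2_eq_2 l_minus less_Suc_eq)
qed

theorem theorem1p1:
  fixes K :: "('a, 'm) ring_scheme" and R :: "'a set" and \<alpha> \<beta> :: 'a
  assumes "is_quotient_field K R"
    and "noetherian_domain (K\<lparr>carrier := R\<rparr>)"
    and "regular_domain K R"
    and "\<alpha> \<in> R" and "\<alpha> \<noteq> \<zero>\<^bsub>K\<^esub>"
    and "\<beta> \<in> R" and "\<beta> \<noteq> \<zero>\<^bsub>K\<^esub>"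
  shows "(nat_invertible (K\<lparr>carrier := R\<rparr>) 2 \<and> power_modulo K R 2 \<alpha> \<beta> \<longrightarrow>
            ramification_divisor K R
              (symbol_algebra K 2 (\<ominus>\<^bsub>K\<^esub> \<one>\<^bsub>K\<^esub>) \<alpha> \<beta>) (symbol_map K 2 (\<ominus>\<^bsub>K\<^esub> \<one>\<^bsub>K\<^esub>) \<alpha> \<beta>)
            \<subseteq> divisor K R \<alpha>) \<and>
         (\<forall>q \<zeta>. Factorial_Ring.prime q \<and> nat_invertible (K\<lparr>carrier := R\<rparr>) q \<and>
            primitive_root_of_unity (K\<lparr>carrier := R\<rparr>) q \<zeta> \<and> power_modulo K R q \<alpha> \<beta> \<longrightarrow>
            ramification_divisor K R (symbol_algebra K q \<zeta> \<alpha> \<beta>) (symbol_map K q \<zeta> \<alpha> \<beta>)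
            \<subseteq> divisor K R \<alpha>)"
proof -
  interpret K: field K using assms(1) by (simp add: is_quotient_field_def)
  note divisor = symbol_ramification_divisor[OF assms(1,3-7)]
  have "primitive_root_of_unity (K\<lparr>carrier := R\<rparr>) 2 (\<ominus>\<^bsub>K\<^esub> \<one>\<^bsub>K\<^esub>)"
    if "nat_invertible (K\<lparr>carrier := R\<rparr>) 2"
    using K.minus_one_square_root[OF _ that] assms(1) K.one_not_zero by (simp add: is_quotient_field_def)
  then show ?thesis using divisor[OF two_is_prime_nat] divisor by blast
qed

end
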